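(* Let $Z$ be a Poisson algebra which is affine and regular over a field $k$, and let $A$ be a Poisson order over $Z$ with Poisson enveloping algebra $A^e$, equipped with its PBW filtration. Then the natural surjection $$A\otimes_Z S_Z(\Omega_{Z/k})\twoheadrightarrow\operatorname{gr}A^e$$ induced by multiplication in $\operatorname{gr}A^e$ is an isomorphism.
   Context: Algebras are unital. "Affine" means semiprime and finitely generated; $Z$ regular means that $\operatorname{Spec}(Z)$ is a smooth affine variety. A Poisson $k$-algebra is a commutative algebra $Z$ with a skew-symmetric $k$-bilinear biderivation $\{\cdot,\cdot\}$ making $Z$ a Lie algebra. A Poisson order over $Z$ is a (not necessarily commutative) $Z$-algebra $A$, finitely generated as a $Z$-module, such that the Poisson bracket on $Z$ extends to a $k$-bilinear map $\{\cdot,\cdot\}:Z\times A\to A$ for which the maps $H(x):=\{x,\cdot\}$ satisfy, for all $x,y\in Z$, $a\in A$: (i) $H(x)\in\operatorname{Der}_k(A)$; (ii) $H(xy)a=xH(y)a+yH(x)a$. The Poisson enveloping algebra $A^e$ is the $k$-algebra generated by symbols $\{\alpha(a):a\in A\}\cup\{\delta(z):z\in Z\}$ subject to: $\alpha:A\to A^e$ is a unital algebra homomorphism; $\delta:Z\to A^e$ is a ($k$-linear) Lie algebra homomorphism; $\alpha(\{x,a\})=[\delta(x),\alpha(a)]$; $\delta(xy)=\alpha(x)\delta(y)+\alpha(y)\delta(x)$, for all $x,y\in Z$, $a\in A$ (where $\alpha(x)$ means $\alpha(x1_A)$). The PBW filtration $A^e=\bigcup_{i\ge0}\mathcal{F}_iA^e$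 is defined by placing the generators $\alpha(a)$ in degree $0$ and $\delta(z)$ in degree $1$; $\operatorname{gr}A^e=\bigoplus_{i\geq 0}\mathcal{F}_iA^e/\mathcal{F}_{i-1}A^e$. $\Omega_{Z/k}$ is the module of Kähler differentials and $S_Z$ the symmetric algebra over $Z$. The natural map sends $a\in A$ to the class of $\alpha(a)$ in degree $0$ and $d(z)\in\Omega_{Z/k}$ to the class of $\delta(z)$ in degree $1$.
   Formalization: The definition of a Poisson order is given the extra condition that Z acts on A as a Lie algebra, {{x,y},a} = {x,{y,a}} − {y,{x,a}}; without it the claim fails (e.g. A = M_2(k[x,y]), zero bracket on Z), and the claim itself forces it. *)

theory Defs
  imports "HOL-Algebra.Module" "HOL-Algebra.QuotRing" "HOL-Library.Multiset"
begin

section \<open>Associative algebras, Poisson algebras and Poisson orders\<close>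

text \<open>The library locale \<^locale>\<open>algebra\<close> only covers commutative algebras.\<close>

locale assoc_algebra = module R A + ring A for R and A (structure) +
  assumes smult_mult_l:
      "\<lbrakk>r \<in> carrier R; x \<in> carrier A; y \<in> carrier A\<rbrakk> \<Longrightarrow> (r \<odot> x) \<otimes> y = r \<odot> (x \<otimes> y)"
    and smult_mult_r:
      "\<lbrakk>r \<in> carrier R; x \<in> carrier A; y \<in> carrier A\<rbrakk> \<Longrightarrow> x \<otimes> (r \<odot> y) = r \<odot> (x \<otimes> y)"

definition alg_hom :: "('r, 'm) ring_scheme \<Rightarrow> ('r, 'a, 'c) module_scheme \<Rightarrow>
    ('r, 'b, 'd) module_scheme \<Rightarrow> ('a \<Rightarrow> 'b) set"
  where "alg_hom R A B = {h \<in> ring_hom A B.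
    \<forall>r\<in>carrier R. \<forall>x\<in>carrier A. h (r \<odot>\<^bsub>A\<^esub> x) = r \<odot>\<^bsub>B\<^esub> h x}"

definition fin_gen_module :: "('r, 'm) ring_scheme \<Rightarrow> ('r, 'a, 'c) module_scheme \<Rightarrow> bool"
  where "fin_gen_module R M \<longleftrightarrow> (\<exists>S. finite S \<and> S \<subseteq> carrier M \<and>
    (\<forall>N. submodule N R M \<and> S \<subseteq> N \<longrightarrow> N = carrier M))"

text \<open>If \<open>A\<close> is a \<open>Z\<close>-algebra and \<open>Z\<close> is a \<open>K\<close>-algebra, this is the induced action of
  \<open>K\<close> on \<open>A\<close>.\<close>

definition base_smult :: "('k, 'z, 'c) module_scheme \<Rightarrow> ('z, 'a, 'd) module_scheme \<Rightarrow>
    'k \<Rightarrow> 'a \<Rightarrow> 'a"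
  where "base_smult Z A c a = (c \<odot>\<^bsub>Z\<^esub> \<one>\<^bsub>Z\<^esub>) \<odot>\<^bsub>A\<^esub> a"

text \<open>The Lie algebra axioms are alternation (rather than mere skew-symmetry, which is weaker in
  characteristic 2) and the Jacobi identity. Linearity and the Leibniz rule in the first argument
  follow by skew-symmetry.\<close>

locale poisson_algebra =
  fixes K :: "('k, 'm) ring_scheme" and Z :: "('k, 'z, 'c) module_scheme" (structure)
    and pb :: "'z \<Rightarrow> 'z \<Rightarrow> 'z"
  assumes field: "field K"
    and algebra: "algebra K Z"
    and pb_closed: "\<lbrakk>x \<in> carrier Z; y \<in> carrier Z\<rbrakk> \<Longrightarrow> pb x y \<in> carrier Z"
    and pb_add: "\<lbrakk>x \<in> carrier Z; y \<in> carrier Z; z \<in> carrier Z\<rbrakk> \<Longrightarrow>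
      pb x (y \<oplus> z) = pb x y \<oplus> pb x z"
    and pb_smult: "\<lbrakk>c \<in> carrier K; x \<in> carrier Z; y \<in> carrier Z\<rbrakk> \<Longrightarrow>
      pb x (c \<odot> y) = c \<odot> pb x y"
    and pb_skew: "\<lbrakk>x \<in> carrier Z; y \<in> carrier Z\<rbrakk> \<Longrightarrow> pb x y = \<ominus> pb y x"
    and pb_alternating: "x \<in> carrier Z \<Longrightarrow> pb x x = \<zero>"
    and pb_leibniz: "\<lbrakk>x \<in> carrier Z; y \<in> carrier Z; z \<in> carrier Z\<rbrakk> \<Longrightarrow>
      pb x (y \<otimes> z) = (pb x y \<otimes> z) \<oplus> (y \<otimes> pb x z)"
    and pb_jacobi: "\<lbrakk>x \<in> carrier Z; y \<in> carrier Z; z \<in> carrier Z\<rbrakk> \<Longrightarrow>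
      pb x (pb y z) \<oplus> pb y (pb z x) \<oplus> pb z (pb x y) = \<zero>"

text \<open>The structure map from \<open>Z\<close> to \<open>A\<close> is not required to be injective; \<open>pa_extends\<close> says that
  \<open>pa\<close> extends the bracket along it. \<open>pa_lie\<close> says that it extends it as a Lie bracket, that is,
  that \<open>pa\<close> is an action of the Lie algebra \<open>Z\<close> on \<open>A\<close>. This is not a consequence of the
  other axioms: take \<open>Z = k[x,y]\<close> with zero bracket, \<open>A\<close> the \<open>2 \<times> 2\<close> matrices over \<open>Z\<close> and
  \<open>{f,a} = f\<^sub>x [E,a] + f\<^sub>y [F,a]\<close> with \<open>E\<close>, \<open>F\<close> the two off-diagonal matrix units. It is
  implied by injectivity of the map from \<open>A\<close> to its enveloping algebra, because there
  \<open>\<alpha>({{x,y},a}) = [[\<delta>(x),\<delta>(y)],\<alpha>(a)]\<close>; in the example the enveloping algebra is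
  zero if the characteristic is not 2.\<close>

locale poisson_order = poisson_algebra K Z pb
  for K :: "('k, 'm) ring_scheme" and Z :: "('k, 'z, 'c) module_scheme" (structure)
    and pb :: "'z \<Rightarrow> 'z \<Rightarrow> 'z" +
  fixes A :: "('z, 'a, 'd) module_scheme" and pa :: "'z \<Rightarrow> 'a \<Rightarrow> 'a"
  assumes assoc_algebra: "assoc_algebra Z A"
    and fin_gen: "fin_gen_module Z A"
    and pa_closed: "\<lbrakk>x \<in> carrier Z; a \<in> carrier A\<rbrakk> \<Longrightarrow> pa x a \<in> carrier A"
    and pa_add_l: "\<lbrakk>x \<in> carrier Z; y \<in> carrier Z; a \<in> carrier A\<rbrakk> \<Longrightarrow>
      pa (x \<oplus> y) a = pa x a \<oplus>\<^bsub>A\<^esub> pa y a"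
    and pa_smult_l: "\<lbrakk>c \<in> carrier K; x \<in> carrier Z; a \<in> carrier A\<rbrakk> \<Longrightarrow>
      pa (c \<odot> x) a = base_smult Z A c (pa x a)"
    and pa_add_r: "\<lbrakk>x \<in> carrier Z; a \<in> carrier A; b \<in> carrier A\<rbrakk> \<Longrightarrow>
      pa x (a \<oplus>\<^bsub>A\<^esub> b) = pa x a \<oplus>\<^bsub>A\<^esub> pa x b"
    and pa_smult_r: "\<lbrakk>c \<in> carrier K; x \<in> carrier Z; a \<in> carrier A\<rbrakk> \<Longrightarrow>
      pa x (base_smult Z A c a) = base_smult Z A c (pa x a)"
    and pa_extends: "\<lbrakk>x \<in> carrier Z; y \<in> carrier Z\<rbrakk> \<Longrightarrow>
      pa x (y \<odot>\<^bsub>A\<^esub> \<one>\<^bsub>A\<^esub>) = pb x y \<odot>\<^bsub>A\<^esub> \<one>\<^bsub>A\<^esub>"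
    and pa_lie: "\<lbrakk>x \<in> carrier Z; y \<in> carrier Z; a \<in> carrier A\<rbrakk> \<Longrightarrow>
      pa (pb x y) a = pa x (pa y a) \<ominus>\<^bsub>A\<^esub> pa y (pa x a)"
    and pa_derivation: "\<lbrakk>x \<in> carrier Z; a \<in> carrier A; b \<in> carrier A\<rbrakk> \<Longrightarrow>
      pa x (a \<otimes>\<^bsub>A\<^esub> b) = (pa x a \<otimes>\<^bsub>A\<^esub> b) \<oplus>\<^bsub>A\<^esub> (a \<otimes>\<^bsub>A\<^esub> pa x b)"
    and pa_leibniz: "\<lbrakk>x \<in> carrier Z; y \<in> carrier Z; a \<in> carrier A\<rbrakk> \<Longrightarrow>
      pa (x \<otimes> y) a = (x \<odot>\<^bsub>A\<^esub> pa y a) \<oplus>\<^bsub>A\<^esub> (y \<odot>\<^bsub>A\<^esub> pa x a)"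

section \<open>Free objects and quotients\<close>

definition free_module :: "('r, 'm) ring_scheme \<Rightarrow> 'x set \<Rightarrow> ('r, 'x \<Rightarrow> 'r) module"
  where "free_module R X =
    \<lparr>carrier = {f. (\<forall>x\<in>X. f x \<in> carrier R) \<and> (\<forall>x. x \<notin> X \<longrightarrow> f x = \<zero>\<^bsub>R\<^esub>) \<and>
       finite {x. f x \<noteq> \<zero>\<^bsub>R\<^esub>}},
     monoid.mult = undefined, one = undefined,
     zero = (\<lambda>x. \<zero>\<^bsub>R\<^esub>), add = (\<lambda>f g x. f x \<oplus>\<^bsub>R\<^esub> g x),
     smult = (\<lambda>r f x. r \<otimes>\<^bsub>R\<^esub> f x)\<rparr>"

definition single :: "('r, 'm) ring_scheme \<Rightarrow> 'x \<Rightarrow> 'x \<Rightarrow> 'r"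
  where "single R x = (\<lambda>y. if y = x then \<one>\<^bsub>R\<^esub> else \<zero>\<^bsub>R\<^esub>)"

definition monoid_algebra :: "('r, 'm) ring_scheme \<Rightarrow> ('x, 'n) monoid_scheme \<Rightarrow>
    ('r, 'x \<Rightarrow> 'r) module"
  where "monoid_algebra R M = (free_module R (carrier M))
    \<lparr>monoid.mult := (\<lambda>f g x. finsum R (\<lambda>(p, q). f p \<otimes>\<^bsub>R\<^esub> g q)
        {(p, q). f p \<noteq> \<zero>\<^bsub>R\<^esub> \<and> g q \<noteq> \<zero>\<^bsub>R\<^esub> \<and> p \<otimes>\<^bsub>M\<^esub> q = x}),
     one := single R \<one>\<^bsub>M\<^esub>\<rparr>"

definition free_monoid :: "'x set \<Rightarrow> 'x list monoid"
  where "free_monoid X = \<lparr>carrier = lists X, monoid.mult = (@), one = []\<rparr>"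

definition free_comm_monoid :: "'x set \<Rightarrow> 'x multiset monoid"
  where "free_comm_monoid X = \<lparr>carrier = {m. set_mset m \<subseteq> X}, monoid.mult = (+), one = {#}\<rparr>"

text \<open>The quotient of an algebra by an ideal. It is also used for the quotient of a module by a
  submodule, in which case the multiplication and unit of the record carry no meaning.\<close>

definition quot_alg :: "('r, 'a, 'c) module_scheme \<Rightarrow> 'a set \<Rightarrow> ('r, 'a set) module"
  where "quot_alg A I =
    \<lparr>carrier = carrier (A Quot I), monoid.mult = monoid.mult (A Quot I), one = one (A Quot I),
     zero = zero (A Quot I), add = add (A Quot I),
     smult = (\<lambda>r X. \<Union>x\<in>X. I +>\<^bsub>A\<^esub> (r \<odot>\<^bsub>A\<^esub> x))\<rparr>"

definition gen_submodule :: "('r, 'm) ring_scheme \<Rightarrow> ('r, 'a, 'c) module_scheme \<Rightarrow>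
    'a set \<Rightarrow> 'a set"
  where "gen_submodule R M S = \<Inter>{N. submodule N R M \<and> S \<subseteq> N}"

section \<open>Smooth affine varieties\<close>

abbreviation polynomials :: "('k, 'm) ring_scheme \<Rightarrow> nat \<Rightarrow> ('k, nat multiset \<Rightarrow> 'k) module"
  where "polynomials K n \<equiv> monoid_algebra K (free_comm_monoid {..<n})"

text \<open>The partial derivative with respect to the variable with index \<open>j\<close>.\<close>

definition partial_deriv :: "('k, 'm) ring_scheme \<Rightarrow> nat \<Rightarrow>
    (nat multiset \<Rightarrow> 'k) \<Rightarrow> nat multiset \<Rightarrow> 'k"
  where "partial_deriv K j f = (\<lambda>m. [Suc (count m j)] \<cdot>\<^bsub>K\<^esub> f (add_mset j m))"

definition semiprime_ring :: "('a, 'm) ring_scheme \<Rightarrow> bool"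
  where "semiprime_ring R \<longleftrightarrow> (\<forall>x\<in>carrier R.
    (\<forall>r\<in>carrier R. x \<otimes>\<^bsub>R\<^esub> r \<otimes>\<^bsub>R\<^esub> x = \<zero>\<^bsub>R\<^esub>) \<longrightarrow> x = \<zero>\<^bsub>R\<^esub>)"

definition presentation :: "('k, 'm) ring_scheme \<Rightarrow> ('k, 'z, 'c) module_scheme \<Rightarrow> nat \<Rightarrow>
    ((nat multiset \<Rightarrow> 'k) \<Rightarrow> 'z) \<Rightarrow> bool"
  where "presentation K Z n \<pi> \<longleftrightarrow>
    \<pi> \<in> alg_hom K (polynomials K n) Z \<and> \<pi> ` carrier (polynomials K n) = carrier Z"

definition affine_algebra :: "('k, 'm) ring_scheme \<Rightarrow> ('k, 'z, 'c) module_scheme \<Rightarrow> bool"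
  where "affine_algebra K Z \<longleftrightarrow> semiprime_ring Z \<and> (\<exists>n \<pi>. presentation K Z n \<pi>)"

text \<open>The Jacobian criterion at the point \<open>P\<close> of the closed subscheme \<open>V(I)\<close> of affine
  \<open>n\<close>-space: the stalk of \<open>I\<close> at \<open>P\<close> is generated by some \<open>f\<^sub>0, \<dots>, f\<^bsub>c-1\<^esub>\<close> in \<open>I\<close> whose
  differentials are linearly independent over the residue field \<open>\<kappa>(P)\<close>. As \<open>\<kappa>(P)\<close> is
  the field of fractions of \<open>K[x]/P\<close>, independence is tested with coefficients in \<open>K[x]\<close>.\<close>

definition jacobian_smooth_at :: "('k, 'm) ring_scheme \<Rightarrow> nat \<Rightarrow> (nat multiset \<Rightarrow> 'k) set \<Rightarrow>
    (nat multiset \<Rightarrow> 'k) set \<Rightarrow> bool"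
  where "jacobian_smooth_at K n I P \<longleftrightarrow> (let Q = polynomials K n in
    \<exists>(c::nat) f. f ` {..<c} \<subseteq> I \<and>
      (\<forall>h\<in>I. \<exists>s\<in>carrier Q - P. s \<otimes>\<^bsub>Q\<^esub> h \<in> Idl\<^bsub>Q\<^esub> (f ` {..<c})) \<and>
      (\<forall>a \<in> {..<c} \<rightarrow> carrier Q.
        (\<forall>j<n. (\<Oplus>\<^bsub>Q\<^esub>i\<in>{..<c}. a i \<otimes>\<^bsub>Q\<^esub> partial_deriv K j (f i)) \<in> P)
          \<longrightarrow> (\<forall>i<c. a i \<in> P)))"

text \<open>The condition does not depend on the presentation chosen.\<close>

definition regular_algebra :: "('k, 'm) ring_scheme \<Rightarrow> ('k, 'z, 'c) module_scheme \<Rightarrow> bool"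
  where "regular_algebra K Z \<longleftrightarrow> (\<exists>n \<pi>. presentation K Z n \<pi> \<and>
    (\<forall>P. primeideal P (polynomials K n) \<and> a_kernel (polynomials K n) Z \<pi> \<subseteq> P \<longrightarrow>
      jacobian_smooth_at K n (a_kernel (polynomials K n) Z \<pi>) P))"

section \<open>Kaehler differentials, symmetric algebras and tensor products\<close>

definition kaehler_relations :: "('k, 'm) ring_scheme \<Rightarrow> ('k, 'z, 'c) module_scheme \<Rightarrow> ('z \<Rightarrow> 'z) set"
  where "kaehler_relations K Z = (let F = free_module Z (carrier Z); d = single Z in
      {d (x \<oplus>\<^bsub>Z\<^esub> y) \<ominus>\<^bsub>F\<^esub> (d x \<oplus>\<^bsub>F\<^esub> d y) | x y. x \<in> carrier Z \<and> y \<in> carrier Z}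
    \<union> {d (c \<odot>\<^bsub>Z\<^esub> x) \<ominus>\<^bsub>F\<^esub> (c \<odot>\<^bsub>Z\<^esub> \<one>\<^bsub>Z\<^esub>) \<odot>\<^bsub>F\<^esub> d x | c x. c \<in> carrier K \<and> x \<in> carrier Z}
    \<union> {d (x \<otimes>\<^bsub>Z\<^esub> y) \<ominus>\<^bsub>F\<^esub> ((x \<odot>\<^bsub>F\<^esub> d y) \<oplus>\<^bsub>F\<^esub> (y \<odot>\<^bsub>F\<^esub> d x)) | x y.
        x \<in> carrier Z \<and> y \<in> carrier Z})"

definition kaehler_submodule :: "('k, 'm) ring_scheme \<Rightarrow> ('k, 'z, 'c) module_scheme \<Rightarrow> ('z \<Rightarrow> 'z) set"
  where "kaehler_submodule K Z =
    gen_submodule Z (free_module Z (carrier Z)) (kaehler_relations K Z)"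

definition kaehler :: "('k, 'm) ring_scheme \<Rightarrow> ('k, 'z, 'c) module_scheme \<Rightarrow>
    ('z, ('z \<Rightarrow> 'z) set) module"
  where "kaehler K Z = quot_alg (free_module Z (carrier Z)) (kaehler_submodule K Z)"

definition kaehler_d :: "('k, 'm) ring_scheme \<Rightarrow> ('k, 'z, 'c) module_scheme \<Rightarrow> 'z \<Rightarrow> ('z \<Rightarrow> 'z) set"
  where "kaehler_d K Z x = kaehler_submodule K Z +>\<^bsub>free_module Z (carrier Z)\<^esub> single Z x"

text \<open>The symmetric algebra of an \<open>R\<close>-module \<open>M\<close>: the polynomial ring over \<open>R\<close> in one variable
  for each element of \<open>M\<close>, modulo the relations making \<open>m\<close> to its variable \<open>R\<close>-linear.\<close>

definition sym_ideal :: "('r, 'm) ring_scheme \<Rightarrow> ('r, 'v, 'c) module_scheme \<Rightarrow>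
    ('v multiset \<Rightarrow> 'r) set"
  where "sym_ideal R M =
    (let P = monoid_algebra R (free_comm_monoid (carrier M)); X = (\<lambda>m. single R {#m#}) in
     Idl\<^bsub>P\<^esub> ({X (m \<oplus>\<^bsub>M\<^esub> m') \<ominus>\<^bsub>P\<^esub> (X m \<oplus>\<^bsub>P\<^esub> X m') | m m'. m \<in> carrier M \<and> m' \<in> carrier M}
       \<union> {X (r \<odot>\<^bsub>M\<^esub> m) \<ominus>\<^bsub>P\<^esub> r \<odot>\<^bsub>P\<^esub> X m | r m. r \<in> carrier R \<and> m \<in> carrier M}))"

definition sym_algebra :: "('r, 'm) ring_scheme \<Rightarrow> ('r, 'v, 'c) module_scheme \<Rightarrow>
    ('r, ('v multiset \<Rightarrow> 'r) set) module"
  where "sym_algebra R M =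
    quot_alg (monoid_algebra R (free_comm_monoid (carrier M))) (sym_ideal R M)"

definition sym_incl :: "('r, 'm) ring_scheme \<Rightarrow> ('r, 'v, 'c) module_scheme \<Rightarrow>
    'v \<Rightarrow> ('v multiset \<Rightarrow> 'r) set"
  where "sym_incl R M m =
    sym_ideal R M +>\<^bsub>monoid_algebra R (free_comm_monoid (carrier M))\<^esub> single R {#m#}"

text \<open>The tensor product of two \<open>R\<close>-algebras: the free \<open>R\<close>-module on \<open>A \<times> B\<close> with the
  componentwise product of its basis elements, modulo bilinearity. The \<open>R\<close>-span of the
  bilinearity relations is already an ideal, so this is the usual tensor product of
  \<open>R\<close>-modules.\<close>

definition tensor_ideal :: "('r, 'm) ring_scheme \<Rightarrow> ('r, 'a, 'c) module_scheme \<Rightarrow>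
    ('r, 'b, 'd) module_scheme \<Rightarrow> ('a \<times> 'b \<Rightarrow> 'r) set"
  where "tensor_ideal R A B =
    (let T = monoid_algebra R (A \<times>\<times> B); t = (\<lambda>a b. single R (a, b)) in
     Idl\<^bsub>T\<^esub> ({t (a \<oplus>\<^bsub>A\<^esub> a') b \<ominus>\<^bsub>T\<^esub> (t a b \<oplus>\<^bsub>T\<^esub> t a' b) | a a' b.
            a \<in> carrier A \<and> a' \<in> carrier A \<and> b \<in> carrier B}
       \<union> {t a (b \<oplus>\<^bsub>B\<^esub> b') \<ominus>\<^bsub>T\<^esub> (t a b \<oplus>\<^bsub>T\<^esub> t a b') | a b b'.
            a \<in> carrier A \<and> b \<in> carrier B \<and> b' \<in> carrier B}
       \<union> {t (r \<odot>\<^bsub>A\<^esub> a) b \<ominus>\<^bsub>T\<^esub> r \<odot>\<^bsub>T\<^esub> t a b | r a b.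
            r \<in> carrier R \<and> a \<in> carrier A \<and> b \<in> carrier B}
       \<union> {t a (r \<odot>\<^bsub>B\<^esub> b) \<ominus>\<^bsub>T\<^esub> r \<odot>\<^bsub>T\<^esub> t a b | r a b.
            r \<in> carrier R \<and> a \<in> carrier A \<and> b \<in> carrier B}))"

definition tensor_algebra :: "('r, 'm) ring_scheme \<Rightarrow> ('r, 'a, 'c) module_scheme \<Rightarrow>
    ('r, 'b, 'd) module_scheme \<Rightarrow> ('r, ('a \<times> 'b \<Rightarrow> 'r) set) module"
  where "tensor_algebra R A B = quot_alg (monoid_algebra R (A \<times>\<times> B)) (tensor_ideal R A B)"

definition tensor_elem :: "('r, 'm) ring_scheme \<Rightarrow> ('r, 'a, 'c) module_scheme \<Rightarrow>
    ('r, 'b, 'd) module_scheme \<Rightarrow> 'a \<Rightarrow> 'b \<Rightarrow> ('a \<times> 'b \<Rightarrow> 'r) set"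
  where "tensor_elem R A B a b =
    tensor_ideal R A B +>\<^bsub>monoid_algebra R (A \<times>\<times> B)\<^esub> single R (a, b)"

section \<open>The associated graded ring of a filtered ring\<close>

text \<open>\<open>Fil i\<close> is the \<open>i\<close>-th filtered piece; the piece of index -1 is zero.\<close>

definition fil_prev :: "('a, 'm) ring_scheme \<Rightarrow> (nat \<Rightarrow> 'a set) \<Rightarrow> nat \<Rightarrow> 'a set"
  where "fil_prev R Fil i = (case i of 0 \<Rightarrow> {\<zero>\<^bsub>R\<^esub>} | Suc j \<Rightarrow> Fil j)"

definition gr_elem :: "('a, 'm) ring_scheme \<Rightarrow> (nat \<Rightarrow> 'a set) \<Rightarrow> nat \<Rightarrow> 'a \<Rightarrow> nat \<Rightarrow> 'a set"
  where "gr_elem R Fil i x =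
    (\<lambda>j. if j = i then fil_prev R Fil i +>\<^bsub>R\<^esub> x else fil_prev R Fil j)"

text \<open>Elements are finitely supported families of cosets. In degree \<open>i\<close> the product of \<open>g\<close> and
  \<open>h\<close> is the class of \<open>\<Sum>\<^bsub>j\<le>i\<^esub> x\<^sub>j y\<^bsub>i-j\<^esub>\<close> for any representatives \<open>x\<^sub>j\<close> of
  \<open>g\<^sub>j\<close> and \<open>y\<^sub>j\<close> of \<open>h\<^sub>j\<close>.\<close>

definition gr_ring :: "('a, 'm) ring_scheme \<Rightarrow> (nat \<Rightarrow> 'a set) \<Rightarrow> (nat \<Rightarrow> 'a set) ring"
  where "gr_ring R Fil =
    \<lparr>carrier = {g. (\<forall>i. \<exists>x\<in>Fil i. g i = fil_prev R Fil i +>\<^bsub>R\<^esub> x) \<and>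
       finite {i. g i \<noteq> fil_prev R Fil i}},
     monoid.mult = (\<lambda>g h i. \<Union>x\<in>Pi UNIV g. \<Union>y\<in>Pi UNIV h.
       fil_prev R Fil i +>\<^bsub>R\<^esub> (\<Oplus>\<^bsub>R\<^esub>j\<in>{..i}. x j \<otimes>\<^bsub>R\<^esub> y (i - j))),
     one = gr_elem R Fil 0 \<one>\<^bsub>R\<^esub>,
     zero = fil_prev R Fil,
     add = (\<lambda>g h i. g i <+>\<^bsub>R\<^esub> h i)\<rparr>"

section \<open>The Poisson enveloping algebra\<close>

datatype ('a, 'z) env_gen = Alpha 'a | is_Delta: Delta 'z

definition env_free :: "('k, 'm) ring_scheme \<Rightarrow> ('k, 'z, 'c) module_scheme \<Rightarrow>
    ('z, 'a, 'd) module_scheme \<Rightarrow> ('k, ('a, 'z) env_gen list \<Rightarrow> 'k) module"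
  where "env_free K Z A =
    monoid_algebra K (free_monoid (Alpha ` carrier A \<union> Delta ` carrier Z))"

definition env_relations :: "('k, 'm) ring_scheme \<Rightarrow> ('k, 'z, 'c) module_scheme \<Rightarrow>
    ('z \<Rightarrow> 'z \<Rightarrow> 'z) \<Rightarrow> ('z, 'a, 'd) module_scheme \<Rightarrow> ('z \<Rightarrow> 'a \<Rightarrow> 'a) \<Rightarrow>
    (('a, 'z) env_gen list \<Rightarrow> 'k) set"
  where "env_relations K Z pb A pa =
    (let F = env_free K Z A; \<alpha> = (\<lambda>a. single K [Alpha a]); \<delta> = (\<lambda>z. single K [Delta z]);
         comm = (\<lambda>u v. u \<otimes>\<^bsub>F\<^esub> v \<ominus>\<^bsub>F\<^esub> v \<otimes>\<^bsub>F\<^esub> u) in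
      \<comment> \<open>\<open>\<alpha>\<close> is a homomorphism of unital \<open>K\<close>-algebras\<close>
      {\<alpha> (a \<oplus>\<^bsub>A\<^esub> b) \<ominus>\<^bsub>F\<^esub> (\<alpha> a \<oplus>\<^bsub>F\<^esub> \<alpha> b) | a b. a \<in> carrier A \<and> b \<in> carrier A}
    \<union> {\<alpha> (base_smult Z A c a) \<ominus>\<^bsub>F\<^esub> c \<odot>\<^bsub>F\<^esub> \<alpha> a | c a. c \<in> carrier K \<and> a \<in> carrier A}
    \<union> {\<alpha> (a \<otimes>\<^bsub>A\<^esub> b) \<ominus>\<^bsub>F\<^esub> \<alpha> a \<otimes>\<^bsub>F\<^esub> \<alpha> b | a b. a \<in> carrier A \<and> b \<in> carrier A}
    \<union> {\<alpha> \<one>\<^bsub>A\<^esub> \<ominus>\<^bsub>F\<^esub> \<one>\<^bsub>F\<^esub>}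
      \<comment> \<open>\<open>\<delta>\<close> is a homomorphism of Lie algebras over \<open>K\<close>\<close>
    \<union> {\<delta> (x \<oplus>\<^bsub>Z\<^esub> y) \<ominus>\<^bsub>F\<^esub> (\<delta> x \<oplus>\<^bsub>F\<^esub> \<delta> y) | x y. x \<in> carrier Z \<and> y \<in> carrier Z}
    \<union> {\<delta> (c \<odot>\<^bsub>Z\<^esub> x) \<ominus>\<^bsub>F\<^esub> c \<odot>\<^bsub>F\<^esub> \<delta> x | c x. c \<in> carrier K \<and> x \<in> carrier Z}
    \<union> {\<delta> (pb x y) \<ominus>\<^bsub>F\<^esub> comm (\<delta> x) (\<delta> y) | x y. x \<in> carrier Z \<and> y \<in> carrier Z}
      \<comment> \<open>compatibility of \<open>\<alpha>\<close> and \<open>\<delta>\<close>\<close>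
    \<union> {\<alpha> (pa x a) \<ominus>\<^bsub>F\<^esub> comm (\<delta> x) (\<alpha> a) | x a. x \<in> carrier Z \<and> a \<in> carrier A}
    \<union> {\<delta> (x \<otimes>\<^bsub>Z\<^esub> y) \<ominus>\<^bsub>F\<^esub> (\<alpha> (x \<odot>\<^bsub>A\<^esub> \<one>\<^bsub>A\<^esub>) \<otimes>\<^bsub>F\<^esub> \<delta> y \<oplus>\<^bsub>F\<^esub> \<alpha> (y \<odot>\<^bsub>A\<^esub> \<one>\<^bsub>A\<^esub>) \<otimes>\<^bsub>F\<^esub> \<delta> x) | x y.
        x \<in> carrier Z \<and> y \<in> carrier Z})"

definition env_ideal :: "('k, 'm) ring_scheme \<Rightarrow> ('k, 'z, 'c) module_scheme \<Rightarrow>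
    ('z \<Rightarrow> 'z \<Rightarrow> 'z) \<Rightarrow> ('z, 'a, 'd) module_scheme \<Rightarrow> ('z \<Rightarrow> 'a \<Rightarrow> 'a) \<Rightarrow>
    (('a, 'z) env_gen list \<Rightarrow> 'k) set"
  where "env_ideal K Z pb A pa = Idl\<^bsub>env_free K Z A\<^esub> (env_relations K Z pb A pa)"

definition env_algebra :: "('k, 'm) ring_scheme \<Rightarrow> ('k, 'z, 'c) module_scheme \<Rightarrow>
    ('z \<Rightarrow> 'z \<Rightarrow> 'z) \<Rightarrow> ('z, 'a, 'd) module_scheme \<Rightarrow> ('z \<Rightarrow> 'a \<Rightarrow> 'a) \<Rightarrow>
    ('k, (('a, 'z) env_gen list \<Rightarrow> 'k) set) module"
  where "env_algebra K Z pb A pa = quot_alg (env_free K Z A) (env_ideal K Z pb A pa)"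

definition env_alpha :: "('k, 'm) ring_scheme \<Rightarrow> ('k, 'z, 'c) module_scheme \<Rightarrow>
    ('z \<Rightarrow> 'z \<Rightarrow> 'z) \<Rightarrow> ('z, 'a, 'd) module_scheme \<Rightarrow> ('z \<Rightarrow> 'a \<Rightarrow> 'a) \<Rightarrow>
    'a \<Rightarrow> (('a, 'z) env_gen list \<Rightarrow> 'k) set"
  where "env_alpha K Z pb A pa a =
    env_ideal K Z pb A pa +>\<^bsub>env_free K Z A\<^esub> single K [Alpha a]"

definition env_delta :: "('k, 'm) ring_scheme \<Rightarrow> ('k, 'z, 'c) module_scheme \<Rightarrow>
    ('z \<Rightarrow> 'z \<Rightarrow> 'z) \<Rightarrow> ('z, 'a, 'd) module_scheme \<Rightarrow> ('z \<Rightarrow> 'a \<Rightarrow> 'a) \<Rightarrow>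
    'z \<Rightarrow> (('a, 'z) env_gen list \<Rightarrow> 'k) set"
  where "env_delta K Z pb A pa z =
    env_ideal K Z pb A pa +>\<^bsub>env_free K Z A\<^esub> single K [Delta z]"

text \<open>The \<open>i\<close>-th piece of the PBW filtration: the classes of the linear combinations of words
  with at most \<open>i\<close> letters \<open>\<delta>(z)\<close>.\<close>

definition pbw_filtration :: "('k, 'm) ring_scheme \<Rightarrow> ('k, 'z, 'c) module_scheme \<Rightarrow>
    ('z \<Rightarrow> 'z \<Rightarrow> 'z) \<Rightarrow> ('z, 'a, 'd) module_scheme \<Rightarrow> ('z \<Rightarrow> 'a \<Rightarrow> 'a) \<Rightarrow>
    nat \<Rightarrow> (('a, 'z) env_gen list \<Rightarrow> 'k) set set"
  where "pbw_filtration K Z pb A pa i =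
    (\<lambda>f. env_ideal K Z pb A pa +>\<^bsub>env_free K Z A\<^esub> f) `
      {f \<in> carrier (env_free K Z A).
        \<forall>w. f w \<noteq> \<zero>\<^bsub>K\<^esub> \<longrightarrow> length (filter is_Delta w) \<le> i}"

definition gr_env :: "('k, 'm) ring_scheme \<Rightarrow> ('k, 'z, 'c) module_scheme \<Rightarrow>
    ('z \<Rightarrow> 'z \<Rightarrow> 'z) \<Rightarrow> ('z, 'a, 'd) module_scheme \<Rightarrow> ('z \<Rightarrow> 'a \<Rightarrow> 'a) \<Rightarrow>
    (nat \<Rightarrow> (('a, 'z) env_gen list \<Rightarrow> 'k) set set) ring"
  where "gr_env K Z pb A pa = gr_ring (env_algebra K Z pb A pa) (pbw_filtration K Z pb A pa)"

definition pbw_source :: "('k, 'm) ring_scheme \<Rightarrow> ('k, 'z, 'c) module_scheme \<Rightarrow>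
    ('z, 'a, 'd) module_scheme \<Rightarrow>
    ('z, ('a \<times> (('z \<Rightarrow> 'z) set multiset \<Rightarrow> 'z) set \<Rightarrow> 'z) set) module"
  where "pbw_source K Z A = tensor_algebra Z A (sym_algebra Z (kaehler K Z))"

text \<open>The natural map is the ring homomorphism with the given values on \<open>a \<otimes> 1\<close> and on
  \<open>1 \<otimes> dz\<close>; as these elements generate the source as a ring, it is unique on the carrier, and it
  sends \<open>a \<otimes> s\<close> to the product of the images of \<open>a\<close> and \<open>s\<close> in the graded ring.\<close>

definition natural_pbw_map :: "('k, 'm) ring_scheme \<Rightarrow> ('k, 'z, 'c) module_scheme \<Rightarrow>
    ('z \<Rightarrow> 'z \<Rightarrow> 'z) \<Rightarrow> ('z, 'a, 'd) module_scheme \<Rightarrow> ('z \<Rightarrow> 'a \<Rightarrow> 'a) \<Rightarrow>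
    (('a \<times> (('z \<Rightarrow> 'z) set multiset \<Rightarrow> 'z) set \<Rightarrow> 'z) set \<Rightarrow>
      nat \<Rightarrow> (('a, 'z) env_gen list \<Rightarrow> 'k) set set) \<Rightarrow> bool"
  where "natural_pbw_map K Z pb A pa \<phi> \<longleftrightarrow>
    (let \<Omega> = kaehler K Z; S = sym_algebra Z \<Omega>;
         cls = gr_elem (env_algebra K Z pb A pa) (pbw_filtration K Z pb A pa) in
      \<phi> \<in> ring_hom (pbw_source K Z A) (gr_env K Z pb A pa) \<and>
      (\<forall>a\<in>carrier A. \<phi> (tensor_elem Z A S a \<one>\<^bsub>S\<^esub>) = cls 0 (env_alpha K Z pb A pa a)) \<and>
      (\<forall>z\<in>carrier Z. \<phi> (tensor_elem Z A S \<one>\<^bsub>A\<^esub> (sym_incl Z \<Omega> (kaehler_d K Z z))) =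
         cls 1 (env_delta K Z pb A pa z)))"

end

theory Submission
  imports Defs
begin

text \<open>Injectivity is local: if the natural map kills the homogeneous element \<open>t\<close> of degree \<open>m\<close> and the
  annihilator of \<open>t\<close> in \<open>Z\<close> is proper, it lies in a prime \<open>\<pp>\<close>. By the Jacobian criterion there
  are coordinates \<open>x\<^sub>j\<close> at \<open>\<pp>\<close> whose differentials form a local basis of the Kaehler differentials, so
  a multiple of \<open>t\<close> by an element outside of \<open>\<pp>\<close> is \<open>\<Sum> a\<^sub>\<beta> dx\<^sup>\<beta>\<close>. Let \<open>B\<close> be the localization of
  \<open>A\<close> at \<open>\<pp>\<close>. The classical PBW recursion yields operators \<open>D\<^sub>j\<close> on the polynomials over \<open>B\<close> in variables
  indexed by \<open>j\<close> which realize \<open>\<delta>(x\<^sub>j)\<close>, and the enveloping algebra acts there by letting \<open>\<alpha>(a)\<close> act by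
  multiplication and \<open>\<delta>(z)\<close> by \<open>\<Sum>\<^sub>j (\<partial>z/\<partial>x\<^sub>j) D\<^sub>j\<close>. As \<open>\<Sum> \<alpha>(a\<^sub>\<beta>) \<delta>(x)\<^sup>\<beta>\<close> has lower filtration degree, its
  value at 1 has degree less than \<open>m\<close>, whereas its leading coefficients are the images of the \<open>a\<^sub>\<beta>\<close> in \<open>B\<close>.
  So these vanish, and some element outside of \<open>\<pp>\<close> kills \<open>t\<close>, a contradiction.\<close>

\<comment> \<open>The Kaehler differentials of a regular algebra are projective but need not be
  free, whereas the PBW recursion needs a basis; this forces the passage to a prime. Two
  difficulties shape the local argument. First, the functions \<open>w j\<close> obtained from the
  Jacobian criterion obey the Leibniz rule only after multiplication by elements outside of
  \<open>\<pp>\<close>. The coefficient ring \<open>B\<close> therefore inverts the single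
  denominator \<open>s\<close>, but is also divided by everything that some element outside of
  \<open>\<pp>\<close> annihilates: identities that hold up to such factors become equalities in
  \<open>B\<close>, and an element of \<open>A\<close> that vanishes in \<open>B\<close> is killed
  by one such factor. Second, the recursion needs structure constants that satisfy the Jacobi
  identity and an action on \<open>B\<close> compatible with them. The constants are the partial
  derivatives of the brackets of coordinates, their Jacobi identity comes from the one in
  \<open>Z\<close>, and the compatibility with \<open>B\<close> comes from \<open>pa_lie\<close>.
  Throughout, a derivation on \<open>Z\<close> is controlled by its values at the coordinates, even
  if it takes values in a noncommutative ring.\<close>
text \<open>A subscript \<open>G\<close> as in \<open>x \<otimes>\<^sub>G y\<close> selects the structure, in the same way as \<open>\<^bsub>G\<^esub>\<close>.\<close>

syntax "_index" :: "logic => index" ("\<^sub>_" [1000] 1000)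

abbreviation (input) mem_carrier (infix "|:" 50) where "x |: R \<equiv> x \<in> carrier R"

section \<open>Additive maps\<close>

text \<open>A bare predicate: the group axioms for \<open>G\<close> and \<open>H\<close> are assumed
  only where a zero, a negative or a sum of maps occurs, so that maps can be composed without
  instantiating locales.\<close>

definition additive :: "('a, 'm) ring_scheme => ('b, 'n) ring_scheme => ('a => 'b) => bool"
  where "additive G H h \<longleftrightarrow> h \<in> carrier G \<rightarrow> carrier H \<and>
    (\<forall>x\<in>carrier G. \<forall>y\<in>carrier G. h (x \<oplus>\<^sub>G y) = h x \<oplus>\<^sub>H h y)"

lemma additiveI:
  assumes "\<And>x. x |: G ==> h x |: H"
    and "\<And>x y. \<lbrakk>x |: G; y |: G\<rbrakk> \<Longrightarrow> h (x \<oplus>\<^sub>G y) = h x \<oplus>\<^sub>H h y"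
  shows "additive G H h"
  using assms by (auto simp: additive_def)

lemma additive_closed: "additive G H h ==> x |: G ==> h x |: H"
  by (auto simp: additive_def)

lemma additive_add:
  "additive G H h ==> x |: G ==> y |: G ==> h (x \<oplus>\<^sub>G y) = h x \<oplus>\<^sub>H h y"
  by (auto simp: additive_def)

lemma additive_abelian_group_hom:
  "additive G H h ==> abelian_group G ==> abelian_group H ==> abelian_group_hom G H h"
  by (intro abelian_group_homI group_hom.intro group_hom_axioms.intro abelian_group.a_group)
    (auto simp: hom_def additive_def)

lemma additive_zero:
  "additive G H h ==> abelian_group G ==> abelian_group H ==> h \<zero>\<^sub>G = \<zero>\<^sub>H"
  by (metis additive_abelian_group_hom abelian_group_hom.hom_zero)

lemma additive_neg:
  "additive G H h ==> abelian_group G ==> abelian_group H ==> x |: G ==>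
    h (\<ominus>\<^sub>G x) = \<ominus>\<^sub>H h x"
  by (metis additive_abelian_group_hom abelian_group_hom.hom_a_inv)

lemma additive_minus:
  assumes "additive G H h" "abelian_group G" "abelian_group H" "x |: G" "y |: G"
  shows "h (x \<ominus>\<^sub>G y) = h x \<ominus>\<^sub>H h y"
  using assms by (simp add: a_minus_def additive_add additive_neg abelian_group.a_inv_closed)

lemma additive_finsum:
  assumes h: "additive G H h" and G: "abelian_group G" and H: "abelian_group H"
    and f: "\<And>i. i \<in> S ==> f i |: G"
  shows "h (finsum G f S) = finsum H (\<lambda>i. h (f i)) S"
proof -
  interpret G: abelian_group G by fact
  interpret H: abelian_group H by fact
  show ?thesis using f
    \<comment> \<open>For infinite \<open>S\<close> both sums are zero by convention, and additive
      maps preserve zero.\<close>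
    by (induction S rule: infinite_finite_induct)
      (auto simp: additive_zero[OF h G H] Pi_def additive_add[OF h] additive_closed[OF h])
qed

lemma additive_comp: "additive G H h ==> additive H L k ==> additive G L (\<lambda>x. k (h x))"
  by (auto simp: additive_def Pi_def)

lemma additive_sum:
  assumes "additive G H h" "additive G H k" "abelian_group H"
  shows "additive G H (\<lambda>x. h x \<oplus>\<^sub>H k x)"
proof -
  interpret H: abelian_group H by fact
  show ?thesis using assms by (auto simp: additive_def Pi_def H.a_ac)
qed

lemma additive_diff:
  assumes "additive G H h" "additive G H k" "abelian_group H"
  shows "additive G H (\<lambda>x. h x \<ominus>\<^sub>H k x)"
proof -
  interpret H: abelian_group H by fact
  show ?thesis using assms by (auto simp: additive_def Pi_def H.a_ac H.minus_add a_minus_def)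
qed

lemma additive_finsum_fun:
  assumes h: "\<And>i. i \<in> S ==> additive G H (h i)" and H: "abelian_group H"
  shows "additive G H (\<lambda>x. finsum H (\<lambda>i. h i x) S)"
proof -
  interpret H: abelian_group H by fact
  note cl = additive_closed[OF h]
  show ?thesis
  proof (rule additiveI)
    fix x y assume xy: "x |: G" "y |: G"
    have "finsum H (\<lambda>i. h i (x \<oplus>\<^sub>G y)) S = finsum H (\<lambda>i. h i x \<oplus>\<^sub>H h i y) S"
      using xy by (intro H.finsum_cong') (auto simp: additive_add[OF h] cl)
    also have "\<dots> = finsum H (\<lambda>i. h i x) S \<oplus>\<^sub>H finsum H (\<lambda>i. h i y) S"
      using xy by (intro H.finsum_addf) (auto simp: cl)
    finally show "finsum H (\<lambda>i. h i (x \<oplus>\<^sub>G y)) S = \<dots>" .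
  qed (auto simp: cl intro!: H.finsum_closed)
qed

lemma ring_hom_additive: "h \<in> ring_hom R S ==> additive R S h"
  by (auto simp: ring_hom_def additive_def)

lemma (in ring) additive_l_mult: "a |: R ==> additive R R (\<lambda>x. a \<otimes> x)"
  by (auto intro!: additiveI simp: r_distr)

lemma (in ring) additive_r_mult: "a |: R ==> additive R R (\<lambda>x. x \<otimes> a)"
  by (auto intro!: additiveI simp: l_distr)

lemma ring_hom_neg:
  "h \<in> ring_hom R S ==> ring R ==> ring S ==> x |: R ==> h (\<ominus>\<^sub>R x) = \<ominus>\<^sub>S h x"
  by (simp add: additive_neg ring_hom_additive ring.is_abelian_group)

lemma ring_hom_minus:
  "h \<in> ring_hom R S ==> ring R ==> ring S ==> x |: R ==> y |: R ==>
    h (x \<ominus>\<^sub>R y) = h x \<ominus>\<^sub>S h y"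
  by (simp add: additive_minus ring_hom_additive ring.is_abelian_group)

inductive_set aspan :: "('a, 'm) ring_scheme => 'a set => 'a set"
  for G :: "('a, 'm) ring_scheme" and S :: "'a set" where
  zero: "\<zero>\<^sub>G \<in> aspan G S"
| add: "x \<in> S ==> y \<in> aspan G S ==> x \<oplus>\<^sub>G y \<in> aspan G S"

lemma aspan_closed:
  assumes "abelian_group G" "S \<subseteq> carrier G" "x \<in> aspan G S" shows "x |: G"
proof -
  interpret abelian_group G by fact
  show ?thesis using assms(3) by induction (use assms(2) in auto)
qed

lemma aspan_base:
  assumes "abelian_group G" "S \<subseteq> carrier G" "x \<in> S" shows "x \<in> aspan G S"
proof -
  interpret abelian_group G by fact
  show ?thesis using aspan.add[OF assms(3) aspan.zero] assms by (metis r_zero subsetD)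
qed

lemma aspan_add:
  assumes "abelian_group G" "S \<subseteq> carrier G" "x \<in> aspan G S" "y \<in> aspan G S"
  shows "x \<oplus>\<^sub>G y \<in> aspan G S"
proof -
  interpret abelian_group G by fact
  show ?thesis using assms(3)
  proof induction
    case zero
    then show ?case using assms(4) aspan_closed[OF assms(1,2)] by simp
  next
    case (add x z)
    then show ?case
      using assms aspan_closed[OF assms(1,2)] by (metis a_assoc aspan.add subsetD)
  qed
qed

lemma aspan_finsum:
  assumes "abelian_group G" "S \<subseteq> carrier G" "\<And>i. i \<in> I ==> f i \<in> aspan G S"
  shows "finsum G f I \<in> aspan G S"
proof -
  interpret abelian_group G by fact
  show ?thesis using assms(3)
    by (induction I rule: infinite_finite_induct)
      (auto simp: aspan.zero aspan_closed[OF assms(1,2)] Pi_def intro!: aspan_add[OF assms(1,2)])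
qed

text \<open>No negatives are needed in the definition of \<open>aspan\<close> for the spanning sets below, which are
  closed under negation.\<close>

lemma aspan_additive_image:
  assumes h: "additive G H h" and G: "abelian_group G" and H: "abelian_group H"
    and S: "S \<subseteq> carrier G" and T: "T \<subseteq> carrier H"
    and ST: "\<And>x. x \<in> S ==> h x \<in> aspan H T" and x: "x \<in> aspan G S"
  shows "h x \<in> aspan H T"
  using x
proof induction
  case zero
  then show ?case by (simp add: additive_zero[OF h G H] aspan.zero)
next
  case (add x y)
  have "h (x \<oplus>\<^sub>G y) = h x \<oplus>\<^sub>H h y"
    using additive_add[OF h] add S aspan_closed[OF G S] by blast
  then show ?case using aspan_add[OF H T ST[OF add(1)] add(3)] by simp
qed

section \<open>Free modules and monoid algebras\<close>

definition mterm :: "('r, 'm) ring_scheme => 'r => 'x => 'x => 'r"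
  where "mterm R r p = (\<lambda>x. if x = p then r else \<zero>\<^sub>R)"

text \<open>Each \<open>h p\<close> is an arbitrary additive function of the coefficient, not just
  multiplication of the coefficient by a fixed element. Hence the same construction yields ring
  homomorphisms and also operators that differentiate coefficients.\<close>

definition lext :: "('r, 'm) ring_scheme => ('g, 'n) ring_scheme => ('x => 'r => 'g) => ('x => 'r) => 'g"
  where "lext R G h f = finsum G (\<lambda>p. h p (f p)) {p. f p \<noteq> \<zero>\<^sub>R}"

lemma single_eq_mterm: "single R p = mterm R \<one>\<^sub>R p"
  by (simp add: single_def mterm_def)

lemma free_module_simps [simp]:
  "zero (free_module R X) = (\<lambda>x. \<zero>\<^sub>R)"
  "add (free_module R X) f g = (\<lambda>x. f x \<oplus>\<^sub>R g x)"
  "smult (free_module R X) r f = (\<lambda>x. r \<otimes>\<^sub>R f x)"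
  by (simp_all add: free_module_def)

lemma free_module_carrier:
  "f \<in> carrier (free_module R X) \<longleftrightarrow>
    (\<forall>x\<in>X. f x |: R) \<and> (\<forall>x. x \<notin> X \<longrightarrow> f x = \<zero>\<^sub>R) \<and> finite {x. f x \<noteq> \<zero>\<^sub>R}"
  by (simp add: free_module_def)

lemma monoid_algebra_simps [simp]:
  "carrier (monoid_algebra R M) = carrier (free_module R (carrier M))"
  "zero (monoid_algebra R M) = (\<lambda>x. \<zero>\<^sub>R)"
  "add (monoid_algebra R M) f g = (\<lambda>x. f x \<oplus>\<^sub>R g x)"
  "smult (monoid_algebra R M) r f = (\<lambda>x. r \<otimes>\<^sub>R f x)"
  "one (monoid_algebra R M) = mterm R \<one>\<^sub>R \<one>\<^sub>M"
  by (simp_all add: monoid_algebra_def free_module_def single_eq_mterm)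

context ring
begin

lemma fm_closed: "f \<in> carrier (free_module R X) ==> f x |: R"
  by (cases "x \<in> X") (auto simp: free_module_carrier)

lemma fm_finite: "f \<in> carrier (free_module R X) ==> finite {x. f x \<noteq> \<zero>}"
  by (auto simp: free_module_carrier)

lemma fm_outside: "f \<in> carrier (free_module R X) ==> x \<notin> X ==> f x = \<zero>"
  by (auto simp: free_module_carrier)

lemma fm_mono_set: "X \<subseteq> Y ==> f \<in> carrier (free_module R X) ==> f \<in> carrier (free_module R Y)"
  unfolding free_module_carrier by (metis subsetD zero_closed)

lemma mterm_closed [intro]: "r |: R ==> p \<in> X ==> mterm R r p \<in> carrier (free_module R X)"
  by (auto simp: free_module_carrier mterm_def intro: finite_subset[of _ "{p}"])

lemma mterm_zero: "mterm R \<zero> p = (\<lambda>x. \<zero>)"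
  by (auto simp: mterm_def)

lemma mterm_add:
  "r |: R ==> s |: R ==>
    mterm R (r \<oplus> s) p = mterm R r p \<oplus>\<^bsub>free_module R X\<^esub> mterm R s p"
  by (auto simp: mterm_def)

lemma fm_abelian_group: "abelian_group (free_module R X)"
proof (rule abelian_groupI)
  fix f g assume fg: "f \<in> carrier (free_module R X)" "g \<in> carrier (free_module R X)"
  have "{x. f x \<oplus> g x \<noteq> \<zero>} \<subseteq> {x. f x \<noteq> \<zero>} \<union> {x. g x \<noteq> \<zero>}" by auto
  with fg show "f \<oplus>\<^bsub>free_module R X\<^esub> g \<in> carrier (free_module R X)"
    by (auto simp: free_module_carrier intro: finite_subset)
next
  fix f assume f: "f \<in> carrier (free_module R X)"
  have "{x. \<ominus> f x \<noteq> \<zero>} \<subseteq> {x. f x \<noteq> \<zero>}" by auto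
  then have "(\<lambda>x. \<ominus> f x) \<in> carrier (free_module R X)"
    using f by (auto simp: free_module_carrier intro: finite_subset)
  moreover have "(\<lambda>x. \<ominus> f x) \<oplus>\<^bsub>free_module R X\<^esub> f = \<zero>\<^bsub>free_module R X\<^esub>"
    using fm_closed[OF f] by (auto simp: l_neg)
  ultimately show "\<exists>g\<in>carrier (free_module R X). g \<oplus>\<^bsub>free_module R X\<^esub> f = \<zero>\<^bsub>free_module R X\<^esub>"
    by blast
qed (simp_all add: fm_closed a_ac, simp add: free_module_carrier)

lemma fm_neg_apply:
  assumes f: "f \<in> carrier (free_module R X)"
  shows "(\<ominus>\<^bsub>free_module R X\<^esub> f) x = \<ominus> f x"
proof -
  interpret V: abelian_group "free_module R X" by (rule fm_abelian_group)
  have "(\<ominus>\<^bsub>free_module R X\<^esub> f) \<oplus>\<^bsub>free_module R X\<^esub> f = \<zero>\<^bsub>free_module R X\<^esub>"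
    using f by (rule V.l_neg)
  then have "(\<ominus>\<^bsub>free_module R X\<^esub> f) x \<oplus> f x = \<zero>" by (auto simp: fun_eq_iff)
  then show ?thesis
    using f by (metis V.a_inv_closed fm_closed minus_equality)
qed

lemma fm_induct [consumes 1, case_names zero add]:
  assumes f: "f \<in> carrier (free_module R X)"
    and zero: "P (\<lambda>x. \<zero>)"
    and add: "\<And>r p f. \<lbrakk>r |: R; p \<in> X; f \<in> carrier (free_module R X); P f\<rbrakk> \<Longrightarrow>
      P (mterm R r p \<oplus>\<^bsub>free_module R X\<^esub> f)"
  shows "P f"
proof -
  have "P f" if "finite S" "{x. f x \<noteq> \<zero>} = S" "f \<in> carrier (free_module R X)" for S f
    using that
  proof (induction S arbitrary: f rule: finite_induct)
    case empty
    then have "f = (\<lambda>x. \<zero>)" by auto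
    then show ?case using zero by simp
  next
    case (insert p S)
    define g where "g = f(p := \<zero>)"
    have "f p \<noteq> \<zero>" using insert.prems(1) by auto
    then have p: "p \<in> X" using fm_outside[OF insert.prems(2)] by blast
    have gS: "{x. g x \<noteq> \<zero>} = S" using insert.prems(1) insert.hyps(2) by (auto simp: g_def)
    have g: "g \<in> carrier (free_module R X)"
      using insert.prems(2) gS insert.hyps(1) by (auto simp: g_def free_module_carrier)
    have "f = mterm R (f p) p \<oplus>\<^bsub>free_module R X\<^esub> g"
      using fm_closed[OF insert.prems(2)] by (auto simp: fun_eq_iff g_def mterm_def)
    then show ?case
      using add[OF fm_closed[OF insert.prems(2)] p g insert.IH[OF gS g]] by metis
  qed
  then show ?thesis using f fm_finite by blast
qed

text \<open>Allows two functions to be summed over a common index set: outside of the support the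
  summand is \<open>h p\<close> at zero, which vanishes.\<close>

lemma lext_superset:
  assumes f: "f \<in> carrier (free_module R X)" and h: "\<And>p. p \<in> X ==> additive R G (h p)"
    and G: "abelian_group G" and S: "finite S" "S \<subseteq> X" "{p. f p \<noteq> \<zero>} \<subseteq> S"
  shows "lext R G h f = finsum G (\<lambda>p. h p (f p)) S"
proof -
  interpret G: abelian_group G by fact
  show ?thesis unfolding lext_def
    using S fm_closed[OF f]
    by (intro G.add.finprod_mono_neutral_cong_left)
      (auto simp: additive_zero[OF h abelian_group_axioms G] subset_iff intro!: additive_closed[OF h])
qed

lemma lext_additive:
  assumes h: "\<And>p. p \<in> X ==> additive R G (h p)" and G: "abelian_group G"
  shows "additive (free_module R X) G (lext R G h)"
proof (rule additiveI)
  interpret G: abelian_group G by fact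
  interpret V: abelian_group "free_module R X" by (rule fm_abelian_group)
  fix f assume f: "f \<in> carrier (free_module R X)"
  show "lext R G h f |: G"
    unfolding lext_def using fm_outside[OF f]
    by (intro G.finsum_closed) (auto intro!: additive_closed[OF h] fm_closed[OF f])
  fix g assume g: "g \<in> carrier (free_module R X)"
  let ?S = "{p. f p \<noteq> \<zero>} \<union> {p. g p \<noteq> \<zero>}"
  have S: "finite ?S" "?S \<subseteq> X" using f g by (auto simp: free_module_carrier)
  have fg: "f \<oplus>\<^bsub>free_module R X\<^esub> g \<in> carrier (free_module R X)"
    using f g by (rule V.a_closed)
  have *: "h p (f p) |: G" "h p (g p) |: G" if "p \<in> ?S" for p
    using S that by (auto intro!: additive_closed[OF h] fm_closed[OF f] fm_closed[OF g])
  have "lext R G h (f \<oplus>\<^bsub>free_module R X\<^esub> g) = finsum G (\<lambda>p. h p (f p \<oplus> g p)) ?S"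
    by (subst lext_superset[OF fg h G S]) auto
  also have "\<dots> = finsum G (\<lambda>p. h p (f p) \<oplus>\<^sub>G h p (g p)) ?S"
    using * S by (intro G.finsum_cong')
     (auto intro!: additive_add[OF h] fm_closed[OF f] fm_closed[OF g] G.a_closed)
  also have "\<dots> = finsum G (\<lambda>p. h p (f p)) ?S \<oplus>\<^sub>G finsum G (\<lambda>p. h p (g p)) ?S"
    by (rule G.finsum_addf) (use * in auto)
  also have "\<dots> = lext R G h f \<oplus>\<^sub>G lext R G h g"
    by (subst (1 2) lext_superset[OF _ h G S]) (use f g in auto)
  finally show "lext R G h (f \<oplus>\<^bsub>free_module R X\<^esub> g) = \<dots>" .
qed

lemma lext_mterm:
  assumes h: "\<And>p. p \<in> X ==> additive R G (h p)" and G: "abelian_group G"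
    and r: "r |: R" and p: "p \<in> X"
  shows "lext R G h (mterm R r p) = h p r"
proof -
  interpret G: abelian_group G by fact
  have "lext R G h (mterm R r p) = finsum G (\<lambda>q. h q (mterm R r p q)) {p}"
    by (rule lext_superset[OF _ h G]) (use r p in \<open>auto simp: mterm_closed, auto simp: mterm_def split: if_splits\<close>)
  then show ?thesis using additive_closed[OF h r] p by (simp add: mterm_def)
qed

text \<open>The main tool for identities in free modules and monoid algebras: if both sides are
  additive in an argument, that argument may be taken to be a single term.\<close>

lemma fm_additive_eqI:
  assumes F: "additive (free_module R X) G F" and F': "additive (free_module R X) G F'"
    and G: "abelian_group G"
    and eq: "\<And>r p. r |: R ==> p \<in> X ==> F (mterm R r p) = F' (mterm R r p)"
    and f: "f \<in> carrier (free_module R X)"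
  shows "F f = F' f"
  using f
proof (induction rule: fm_induct)
  case zero
  show ?case
    using additive_zero[OF F fm_abelian_group G] additive_zero[OF F' fm_abelian_group G]
    unfolding free_module_simps by (rule trans[OF _ sym])
next
  case (add r p f)
  show ?case
    unfolding additive_add[OF F mterm_closed[OF add(1,2)] add(3)]
      additive_add[OF F' mterm_closed[OF add(1,2)] add(3)] eq[OF add(1,2)] add(4) ..
qed

end

lemma add_monoid_monoid_algebra:
  "add_monoid (monoid_algebra R M) = add_monoid (free_module R (carrier M))"
  by (simp add: monoid_algebra_def free_module_def)

lemma additive_monoid_algebra [simp]:
  "additive (monoid_algebra R M) G h \<longleftrightarrow> additive (free_module R (carrier M)) G h"
  "additive G (monoid_algebra R M) h' \<longleftrightarrow> additive G (free_module R (carrier M)) h'"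
  by (simp_all add: additive_def)

lemma a_inv_monoid_algebra:
  "a_inv (monoid_algebra R M) = a_inv (free_module R (carrier M))"
  unfolding a_inv_def add_monoid_monoid_algebra ..

section \<open>Monoid algebras and their universal property\<close>

locale monoid_alg = R?: ring R + M?: monoid M for R (structure) and M (structure)
begin

abbreviation "MA \<equiv> monoid_algebra R M"
abbreviation "FM \<equiv> free_module R (carrier M)"

lemma ma_abelian_group: "abelian_group MA"
  using fm_abelian_group[of "carrier M"]
  unfolding abelian_group_def abelian_monoid_def abelian_group_axioms_def add_monoid_monoid_algebra .

text \<open>The index set of the defining sum varies with the supports of \<open>f\<close> and
  \<open>g\<close> and with \<open>x\<close>. Padding it to a rectangle makes products with
  different factors comparable summand by summand.\<close>

lemma ma_mult_eq:
  assumes f: "f |: FM" and g: "g |: FM"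
    and S: "finite S" "{p. f p \<noteq> \<zero>} \<subseteq> S" and T: "finite T" "{p. g p \<noteq> \<zero>} \<subseteq> T"
  shows "(f \<otimes>\<^bsub>MA\<^esub> g) x =
    finsum R (\<lambda>(p, q). if p \<otimes>\<^sub>M q = x then f p \<otimes> g q else \<zero>) (S \<times> T)"
proof -
  have "(f \<otimes>\<^bsub>MA\<^esub> g) x = finsum R (\<lambda>(p, q). f p \<otimes> g q)
      {(p, q). f p \<noteq> \<zero> \<and> g q \<noteq> \<zero> \<and> p \<otimes>\<^sub>M q = x}"
    by (simp add: monoid_algebra_def)
  also have "\<dots> = finsum R (\<lambda>(p, q). if p \<otimes>\<^sub>M q = x then f p \<otimes> g q else \<zero>) (S \<times> T)"
    using S T fm_closed[OF f] fm_closed[OF g]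
    by (intro R.add.finprod_mono_neutral_cong_left) (auto split: if_splits)
  finally show ?thesis .
qed

lemma ma_mult_closed:
  assumes f: "f |: FM" and g: "g |: FM"
  shows "f \<otimes>\<^bsub>MA\<^esub> g |: FM"
proof -
  let ?S = "{p. f p \<noteq> \<zero>}" and ?T = "{p. g p \<noteq> \<zero>}"
  have ST: "finite ?S" "finite ?T" "?S \<subseteq> carrier M" "?T \<subseteq> carrier M"
    using f g by (auto simp: free_module_carrier)
  note eq = ma_mult_eq[OF f g ST(1) order.refl ST(2) order.refl]
  have 1: "(f \<otimes>\<^bsub>MA\<^esub> g) x |: R" for x
    unfolding eq using fm_closed[OF f] fm_closed[OF g] by (intro R.finsum_closed) auto
  have 2: "(f \<otimes>\<^bsub>MA\<^esub> g) x = \<zero>" if "x \<notin> (\<lambda>(p, q). p \<otimes>\<^sub>M q) ` (?S \<times> ?T)" for x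
  proof -
    have "(f \<otimes>\<^bsub>MA\<^esub> g) x = finsum R (\<lambda>_. \<zero>) (?S \<times> ?T)"
      unfolding eq using that by (intro R.finsum_cong') auto
    then show ?thesis by simp
  qed
  have 3: "(\<lambda>(p, q). p \<otimes>\<^sub>M q) ` (?S \<times> ?T) \<subseteq> carrier M" using ST by auto
  have "{x. (f \<otimes>\<^bsub>MA\<^esub> g) x \<noteq> \<zero>} \<subseteq> (\<lambda>(p, q). p \<otimes>\<^sub>M q) ` (?S \<times> ?T)" using 2 by blast
  then have "finite {x. (f \<otimes>\<^bsub>MA\<^esub> g) x \<noteq> \<zero>}" using ST finite_subset by blast
  then show ?thesis using 1 2 3 by (auto simp: free_module_carrier)
qed

lemma ma_l_distr:
  assumes f: "f |: FM" and f': "f' |: FM" and g: "g |: FM"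
  shows "(f \<oplus>\<^bsub>FM\<^esub> f') \<otimes>\<^bsub>MA\<^esub> g = (f \<otimes>\<^bsub>MA\<^esub> g) \<oplus>\<^bsub>FM\<^esub> (f' \<otimes>\<^bsub>MA\<^esub> g)"
proof
  fix x
  interpret V: abelian_group FM by (rule fm_abelian_group)
  let ?S = "{p. f p \<noteq> \<zero>} \<union> {p. f' p \<noteq> \<zero>}" and ?T = "{p. g p \<noteq> \<zero>}"
  have ST: "finite ?S" "finite ?T" using f f' g by (auto simp: free_module_carrier)
  have ff: "f \<oplus>\<^bsub>FM\<^esub> f' |: FM" using f f' by (rule V.a_closed)
  note cl = fm_closed[OF f] fm_closed[OF f'] fm_closed[OF g]
  have "((f \<oplus>\<^bsub>FM\<^esub> f') \<otimes>\<^bsub>MA\<^esub> g) x =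
    finsum R (\<lambda>(p, q). if p \<otimes>\<^sub>M q = x then (f p \<oplus> f' p) \<otimes> g q else \<zero>) (?S \<times> ?T)"
    by (rule trans[OF ma_mult_eq[OF ff g ST(1) _ ST(2) order.refl]], unfold free_module_simps) auto
  also have "\<dots> = finsum R (\<lambda>z. (case z of (p, q) => if p \<otimes>\<^sub>M q = x then f p \<otimes> g q else \<zero>)
      \<oplus> (case z of (p, q) => if p \<otimes>\<^sub>M q = x then f' p \<otimes> g q else \<zero>)) (?S \<times> ?T)"
    using cl by (intro R.finsum_cong') (auto simp: l_distr)
  also have "\<dots> = ((f \<otimes>\<^bsub>MA\<^esub> g) \<oplus>\<^bsub>FM\<^esub> (f' \<otimes>\<^bsub>MA\<^esub> g)) x"
    unfolding free_module_simps using cl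
    by (subst (1 2) ma_mult_eq[OF _ g ST(1) _ ST(2)], (use f f' in auto)[6], subst R.finsum_addf) auto
  finally show "((f \<oplus>\<^bsub>FM\<^esub> f') \<otimes>\<^bsub>MA\<^esub> g) x = \<dots>" .
qed

lemma ma_r_distr:
  assumes f: "f |: FM" and f': "f' |: FM" and g: "g |: FM"
  shows "g \<otimes>\<^bsub>MA\<^esub> (f \<oplus>\<^bsub>FM\<^esub> f') = (g \<otimes>\<^bsub>MA\<^esub> f) \<oplus>\<^bsub>FM\<^esub> (g \<otimes>\<^bsub>MA\<^esub> f')"
proof
  fix x
  interpret V: abelian_group FM by (rule fm_abelian_group)
  let ?S = "{p. f p \<noteq> \<zero>} \<union> {p. f' p \<noteq> \<zero>}" and ?T = "{p. g p \<noteq> \<zero>}"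
  have ST: "finite ?S" "finite ?T" using f f' g by (auto simp: free_module_carrier)
  have ff: "f \<oplus>\<^bsub>FM\<^esub> f' |: FM" using f f' by (rule V.a_closed)
  note cl = fm_closed[OF f] fm_closed[OF f'] fm_closed[OF g]
  have "(g \<otimes>\<^bsub>MA\<^esub> (f \<oplus>\<^bsub>FM\<^esub> f')) x =
    finsum R (\<lambda>(p, q). if p \<otimes>\<^sub>M q = x then g p \<otimes> (f q \<oplus> f' q) else \<zero>) (?T \<times> ?S)"
    by (rule trans[OF ma_mult_eq[OF g ff ST(2) order.refl ST(1)]], unfold free_module_simps) auto
  also have "\<dots> = finsum R (\<lambda>z. (case z of (p, q) => if p \<otimes>\<^sub>M q = x then g p \<otimes> f q else \<zero>)
      \<oplus> (case z of (p, q) => if p \<otimes>\<^sub>M q = x then g p \<otimes> f' q else \<zero>)) (?T \<times> ?S)"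
    using cl by (intro R.finsum_cong') (auto simp: r_distr)
  also have "\<dots> = ((g \<otimes>\<^bsub>MA\<^esub> f) \<oplus>\<^bsub>FM\<^esub> (g \<otimes>\<^bsub>MA\<^esub> f')) x"
    unfolding free_module_simps using cl
    by (subst (1 2) ma_mult_eq[OF g _ ST(2) _ ST(1)], (use f f' in auto)[6], subst R.finsum_addf) auto
  finally show "(g \<otimes>\<^bsub>MA\<^esub> (f \<oplus>\<^bsub>FM\<^esub> f')) x = \<dots>" .
qed

lemma mterm_mult:
  assumes "r |: R" "s |: R" "p |: M" "q |: M"
  shows "mterm R r p \<otimes>\<^bsub>MA\<^esub> mterm R s q = mterm R (r \<otimes> s) (p \<otimes>\<^sub>M q)"
proof
  fix x
  have "(mterm R r p \<otimes>\<^bsub>MA\<^esub> mterm R s q) x =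
     finsum R (\<lambda>(p', q'). if p' \<otimes>\<^sub>M q' = x then mterm R r p p' \<otimes> mterm R s q q' else \<zero>) ({p} \<times> {q})"
    by (rule ma_mult_eq) (use assms in \<open>auto simp: mterm_closed, auto simp: mterm_def split: if_splits\<close>)
  also have "\<dots> = mterm R (r \<otimes> s) (p \<otimes>\<^sub>M q) x"
    using assms by (auto simp: mterm_def)
  finally show "(mterm R r p \<otimes>\<^bsub>MA\<^esub> mterm R s q) x = \<dots>" .
qed

lemma ma_l_additive: "f |: FM ==> additive FM FM (\<lambda>g. f \<otimes>\<^bsub>MA\<^esub> g)"
  by (intro additiveI ma_mult_closed ma_r_distr)

lemma ma_r_additive: "f |: FM ==> additive FM FM (\<lambda>g. g \<otimes>\<^bsub>MA\<^esub> f)"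
  by (intro additiveI ma_mult_closed ma_l_distr)

text \<open>Both sides are additive in each factor, so the three factors are reduced to terms one
  after the other; for terms the claim is associativity in \<open>R\<close> and in
  \<open>M\<close>.\<close>

lemma ma_assoc:
  assumes f: "f |: FM" and g: "g |: FM" and h: "h |: FM"
  shows "(f \<otimes>\<^bsub>MA\<^esub> g) \<otimes>\<^bsub>MA\<^esub> h = f \<otimes>\<^bsub>MA\<^esub> (g \<otimes>\<^bsub>MA\<^esub> h)"
proof -
  note fa = fm_additive_eqI[where X="carrier M" and G=FM, OF _ _ fm_abelian_group]
  have 1: "(mterm R r p \<otimes>\<^bsub>MA\<^esub> mterm R s q) \<otimes>\<^bsub>MA\<^esub> h = mterm R r p \<otimes>\<^bsub>MA\<^esub> (mterm R s q \<otimes>\<^bsub>MA\<^esub> h)"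
    if "r |: R" "s |: R" "p |: M" "q |: M" "h |: FM" for r s p q h
    by (rule fa[OF _ _ _ that(5)], rule ma_l_additive, use that in \<open>simp add: mterm_mult mterm_closed\<close>,
       rule additive_comp[OF ma_l_additive ma_l_additive])
     (use that in \<open>simp_all add: mterm_mult mterm_closed R.m_assoc M.m_assoc\<close>)
  have 2: "(mterm R r p \<otimes>\<^bsub>MA\<^esub> g) \<otimes>\<^bsub>MA\<^esub> h = mterm R r p \<otimes>\<^bsub>MA\<^esub> (g \<otimes>\<^bsub>MA\<^esub> h)"
    if "r |: R" "p |: M" for r p
    by (rule fa[OF _ _ _ g], rule additive_comp[OF ma_l_additive ma_r_additive], use that h in blast, use h in blast,
       rule additive_comp[OF ma_r_additive ma_l_additive])
      (use that h 1 in \<open>auto\<close>)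
  show ?thesis
    by (rule fa[OF _ _ _ f], rule additive_comp[OF ma_r_additive ma_r_additive], use g in blast, use h in blast,
       rule ma_r_additive)
     (use g h 2 in \<open>auto simp: ma_mult_closed\<close>)
qed

lemma mterm_l_mult_one:
  assumes f: "f |: FM" shows "mterm R \<one> \<one>\<^sub>M \<otimes>\<^bsub>MA\<^esub> f = f"
  by (rule fm_additive_eqI[where F'="\<lambda>f. f", OF ma_l_additive _ fm_abelian_group _ f])
    (auto simp: mterm_mult intro: additiveI)

lemma mterm_r_mult_one:
  assumes f: "f |: FM" shows "f \<otimes>\<^bsub>MA\<^esub> mterm R \<one> \<one>\<^sub>M = f"
  by (rule fm_additive_eqI[where F'="\<lambda>f. f", OF ma_r_additive _ fm_abelian_group _ f])
    (auto simp: mterm_mult intro: additiveI)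

lemma ma_ring: "ring MA"
proof (rule ringI[OF ma_abelian_group])
  show "monoid MA"
    by (rule monoidI) (auto simp: ma_mult_closed ma_assoc mterm_l_mult_one mterm_r_mult_one)
qed (use ma_l_distr ma_r_distr in auto)

text \<open>Turns scalars into ring elements, so that stability of ideals under scalars becomes an
  instance of stability under multiplication.\<close>

lemma smult_eq_mult:
  assumes r: "r |: R" and f: "f |: FM"
  shows "r \<odot>\<^bsub>MA\<^esub> f = mterm R r \<one>\<^sub>M \<otimes>\<^bsub>MA\<^esub> f"
proof -
  have sm: "(\<lambda>x. r \<otimes> f x) |: FM" if "f |: FM" for f
  proof -
    have "{x. r \<otimes> f x \<noteq> \<zero>} \<subseteq> {x. f x \<noteq> \<zero>}" using r by auto
    then show ?thesis using that r by (auto simp: free_module_carrier intro: finite_subset)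
  qed
  have "additive FM FM (\<lambda>f x. r \<otimes> f x)"
    by (rule additiveI) (auto simp: sm fun_eq_iff r_distr r fm_closed)
  then have "(\<lambda>x. r \<otimes> f x) = mterm R r \<one>\<^sub>M \<otimes>\<^bsub>MA\<^esub> f"
    by (rule fm_additive_eqI[OF _ ma_l_additive fm_abelian_group _ f])
      (use r in \<open>auto simp: mterm_mult, auto simp: mterm_def\<close>)
  then show ?thesis by simp
qed

text \<open>The target may be noncommutative. Commutation of the images of coefficients with those
  of monoid elements is what moves \<open>\<eta> s\<close> past \<open>\<mu> p\<close> in the
  product of two terms.\<close>

lemma ma_lift:
  assumes G: "ring G" and eta: "\<eta> \<in> ring_hom R G"
    and mu: "\<And>p. p |: M ==> \<mu> p |: G"
      "\<And>p q. p |: M ==> q |: M ==> \<mu> (p \<otimes>\<^sub>M q) = \<mu> p \<otimes>\<^sub>G \<mu> q"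
      "\<mu> \<one>\<^sub>M = \<one>\<^sub>G"
    and comm: "\<And>r p. r |: R ==> p |: M ==> \<eta> r \<otimes>\<^sub>G \<mu> p = \<mu> p \<otimes>\<^sub>G \<eta> r"
  obtains L where "L \<in> ring_hom MA G"
    "\<And>r p. r |: R ==> p |: M ==> L (mterm R r p) = \<eta> r \<otimes>\<^sub>G \<mu> p"
proof
  interpret G: ring G by fact
  let ?h = "\<lambda>p r. \<eta> r \<otimes>\<^sub>G \<mu> p"
  let ?L = "lext R G ?h"
  note cl = ring_hom_closed[OF eta] mu(1)
  have h: "additive R G (?h p)" if "p |: M" for p
    using that by (auto intro!: additiveI simp: cl ring_hom_add[OF eta] G.l_distr)
  note Ladd = lext_additive[of "carrier M" G ?h, OF h G.abelian_group_axioms]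
  show Lm: "?L (mterm R r p) = ?h p r" if "r |: R" "p |: M" for r p
    using lext_mterm[of "carrier M" G ?h, OF h G.abelian_group_axioms that] by simp
  note Lcl = additive_closed[OF Ladd]
  have mm: "?L (mterm R r p \<otimes>\<^bsub>MA\<^esub> mterm R s q) = ?L (mterm R r p) \<otimes>\<^sub>G ?L (mterm R s q)"
    if "r |: R" "s |: R" "p |: M" "q |: M" for r s p q
  proof -
    have "?L (mterm R r p \<otimes>\<^bsub>MA\<^esub> mterm R s q) = (\<eta> r \<otimes>\<^sub>G \<eta> s) \<otimes>\<^sub>G (\<mu> p \<otimes>\<^sub>G \<mu> q)"
      using that by (simp add: mterm_mult Lm mu ring_hom_mult[OF eta])
    also have "\<dots> = \<eta> r \<otimes>\<^sub>G (\<eta> s \<otimes>\<^sub>G \<mu> p) \<otimes>\<^sub>G \<mu> q"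
      using that by (simp add: cl G.m_assoc)
    also have "\<dots> = \<eta> r \<otimes>\<^sub>G (\<mu> p \<otimes>\<^sub>G \<eta> s) \<otimes>\<^sub>G \<mu> q"
      using that by (simp add: comm)
    also have "\<dots> = ?L (mterm R r p) \<otimes>\<^sub>G ?L (mterm R s q)"
      using that by (simp add: cl G.m_assoc Lm)
    finally show ?thesis .
  qed
  note fa = fm_additive_eqI[where X="carrier M" and G=G, OF _ _ G.abelian_group_axioms]
  have mg: "?L (mterm R r p \<otimes>\<^bsub>MA\<^esub> g) = ?L (mterm R r p) \<otimes>\<^sub>G ?L g"
    if "r |: R" "p |: M" "g |: FM" for r p g
    by (rule fa[where F="\<lambda>g. ?L (mterm R r p \<otimes>\<^bsub>MA\<^esub> g)" and F'="\<lambda>g. ?L (mterm R r p) \<otimes>\<^sub>G ?L g",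
         OF additive_comp[OF ma_l_additive Ladd] additive_comp[OF Ladd G.additive_l_mult] _ that(3)])
      (use that mm in \<open>auto simp: Lcl mterm_closed\<close>)
  have "?L (f \<otimes>\<^bsub>MA\<^esub> g) = ?L f \<otimes>\<^sub>G ?L g" if "f |: FM" "g |: FM" for f g
    by (rule fa[where F="\<lambda>f. ?L (f \<otimes>\<^bsub>MA\<^esub> g)" and F'="\<lambda>f. ?L f \<otimes>\<^sub>G ?L g",
         OF additive_comp[OF ma_r_additive Ladd] additive_comp[OF Ladd G.additive_r_mult] _ that(1)])
      (use that mg in \<open>auto simp: Lcl\<close>)
  moreover have "?L (mterm R \<one> \<one>\<^sub>M) = \<one>\<^sub>G"
    by (simp add: Lm ring_hom_one[OF eta] mu)
  ultimately show "?L \<in> ring_hom MA G"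
    by (intro ring_hom_memI) (simp_all add: Lcl additive_add[OF Ladd, unfolded free_module_simps])
qed

lemma ma_cring:
  assumes "cring R" "comm_monoid M" shows "cring MA"
proof -
  note com = cring.cring_simprules(14)[OF assms(1)] comm_monoid.m_comm[OF assms(2)]
  note fa = fm_additive_eqI[where X="carrier M" and G=FM, OF _ _ fm_abelian_group]
  have 1: "mterm R r p \<otimes>\<^bsub>MA\<^esub> g = g \<otimes>\<^bsub>MA\<^esub> mterm R r p"
    if "r |: R" "p |: M" "g |: FM" for r p g
    by (rule fa[OF ma_l_additive ma_r_additive _ that(3)])
      (use that in \<open>auto simp: mterm_mult com\<close>)
  have "f \<otimes>\<^bsub>MA\<^esub> g = g \<otimes>\<^bsub>MA\<^esub> f" if "f |: FM" "g |: FM" for f g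
    by (rule fa[OF ma_r_additive ma_l_additive _ that(1)]) (use that 1 in auto)
  then have "comm_monoid_axioms MA" by (intro comm_monoid_axioms.intro) simp
  then show ?thesis
    by (intro cring.intro[OF ma_ring] comm_monoid.intro[OF ring.is_monoid[OF ma_ring]])
qed

end

section \<open>Quotients\<close>

text \<open>Here \<open>S\<close> is only a record with operations; its ring axioms are transported
  along \<open>h\<close>. This serves for quotients and for the graded ring, where the operations
  are formulas on cosets.\<close>

lemma ring_image:
  assumes R: "ring R" and carr: "carrier S = h ` carrier R"
    and add: "\<And>x y. \<lbrakk>x |: R; y |: R\<rbrakk> \<Longrightarrow> h (x \<oplus>\<^sub>R y) = h x \<oplus>\<^sub>S h y"
    and mult: "\<And>x y. \<lbrakk>x |: R; y |: R\<rbrakk> \<Longrightarrow> h (x \<otimes>\<^sub>R y) = h x \<otimes>\<^sub>S h y"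
    and one: "h \<one>\<^sub>R = \<one>\<^sub>S" and zero: "h \<zero>\<^sub>R = \<zero>\<^sub>S"
  shows "ring S" "h \<in> ring_hom R S"
proof -
  show h: "h \<in> ring_hom R S"
    using assms by (intro ring_hom_memI) auto
  have "S \<lparr> carrier := h ` carrier R, zero := h \<zero>\<^sub>R \<rparr> = S"
    using carr zero by simp
  then show "ring S" using ring.ring_hom_imp_img_ring[OF R h] by simp
qed

lemma (in abelian_group) minus_eq_zero_iff:
  "x |: G ==> y |: G ==> x \<ominus> y = \<zero> \<longleftrightarrow> x = y"
  unfolding a_minus_def by (metis a_inv_closed minus_equality minus_minus r_neg)

lemma abelian_groupI_ring: "ring R ==> abelian_group R"
  by (rule ring.is_abelian_group)

lemma abelian_subgroupI':
  "abelian_group F ==> additive_subgroup I F ==> abelian_subgroup I F"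
  by (rule abelian_subgroupI3)

lemma quot_alg_simps [simp]:
  "zero (quot_alg F I) = I" "one (quot_alg F I) = I +>\<^sub>F \<one>\<^sub>F"
  "add (quot_alg F I) = set_add F" "monoid.mult (quot_alg F I) = rcoset_mult F I"
  by (simp_all add: quot_alg_def FactRing_def)

lemma quot_alg_carrier: "carrier (quot_alg F I) = (\<lambda>f. I +>\<^sub>F f) ` carrier F"
  by (auto simp: quot_alg_def FactRing_simps)

lemma quot_alg_add:
  assumes "abelian_group F" "additive_subgroup I F" "f |: F" "g |: F"
  shows "(I +>\<^sub>F f) \<oplus>\<^bsub>quot_alg F I\<^esub> (I +>\<^sub>F g) = I +>\<^sub>F (f \<oplus>\<^sub>F g)"
  using abelian_subgroup.a_rcos_sum[OF abelian_subgroupI'] assms by simp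

lemma quot_alg_eq_iff:
  assumes "abelian_group F" "additive_subgroup I F" "f |: F" "g |: F"
  shows "I +>\<^sub>F f = I +>\<^sub>F g \<longleftrightarrow> f \<ominus>\<^sub>F g \<in> I"
proof -
  interpret abelian_subgroup I F by (rule abelian_subgroupI') fact+
  show ?thesis
    using a_rcos_module[OF assms(4,3)] a_repr_independence'[of f g] a_rcos_self[OF assms(3)] assms(4)
    by (auto simp: a_minus_def)
qed

lemma quot_alg_zero_iff:
  assumes "abelian_group F" "additive_subgroup I F" "f |: F"
  shows "I +>\<^sub>F f = I \<longleftrightarrow> f \<in> I"
proof -
  interpret abelian_subgroup I F by (rule abelian_subgroupI') fact+
  show ?thesis
    using assms quot_alg_eq_iff[OF assms(1,2,3) zero_closed] a_rcos_const[of f] a_rcos_self[OF assms(3)]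
    by auto
qed

lemma quot_alg_zero:
  "abelian_group F ==> additive_subgroup I F ==> I +>\<^sub>F \<zero>\<^sub>F = I"
  using quot_alg_zero_iff[of F I "\<zero>\<^sub>F"] additive_subgroup.zero_closed[of I F]
    abelian_monoid.zero_closed[OF abelian_group.axioms(1)] by blast

lemma quot_alg_smult:
  assumes F: "abelian_group F" and I: "additive_subgroup I F"
    and r: "additive F F (\<lambda>x. r \<odot>\<^sub>F x)" "\<And>x. x \<in> I ==> r \<odot>\<^sub>F x \<in> I" and f: "f |: F"
  shows "r \<odot>\<^bsub>quot_alg F I\<^esub> (I +>\<^sub>F f) = I +>\<^sub>F (r \<odot>\<^sub>F f)"
proof -
  interpret I: abelian_subgroup I F by (rule abelian_subgroupI') fact+
  have "I +>\<^sub>F (r \<odot>\<^sub>F x) = I +>\<^sub>F (r \<odot>\<^sub>F f)" if "x \<in> I +>\<^sub>F f" for x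
  proof -
    from that obtain i where i: "i \<in> I" "x = i \<oplus>\<^sub>F f" by (auto simp: a_r_coset_def r_coset_def)
    have "r \<odot>\<^sub>F x = r \<odot>\<^sub>F i \<oplus>\<^sub>F r \<odot>\<^sub>F f"
      using i f additive_add[OF r(1)] by simp
    moreover have "(r \<odot>\<^sub>F i \<oplus>\<^sub>F r \<odot>\<^sub>F f) \<in> I +>\<^sub>F (r \<odot>\<^sub>F f)"
      using r(2)[OF i(1)] by (auto simp: a_r_coset_def r_coset_def)
    ultimately show ?thesis
      using I.a_repr_independence'[of "r \<odot>\<^sub>F x" "r \<odot>\<^sub>F f"] additive_closed[OF r(1) f] F by simp
  qed
  then have "(\<Union>x\<in>I +>\<^sub>F f. I +>\<^sub>F (r \<odot>\<^sub>F x)) = (\<Union>x\<in>I +>\<^sub>F f. I +>\<^sub>F (r \<odot>\<^sub>F f))"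
    by (intro SUP_cong refl)
  also have "\<dots> = I +>\<^sub>F (r \<odot>\<^sub>F f)" using I.a_rcos_self[OF f] by (intro SUP_eq_const) auto
  finally show ?thesis by (simp add: quot_alg_def)
qed

lemma quot_alg_abelian_group:
  assumes F: "abelian_group F" and I: "additive_subgroup I F"
  shows "abelian_group (quot_alg F I)"
proof -
  interpret F: abelian_group F by fact
  interpret I: abelian_subgroup I F by (rule abelian_subgroupI') fact+
  note a = quot_alg_add[OF F I]
  have z: "I = I +>\<^sub>F \<zero>\<^sub>F" by (rule quot_alg_zero[OF F I, symmetric])
  show ?thesis
  proof (rule abelian_groupI)
    fix x assume "x \<in> carrier (quot_alg F I)"
    then obtain f where f: "f |: F" "x = I +>\<^sub>F f" by (auto simp: quot_alg_carrier)
    show "\<exists>y\<in>carrier (quot_alg F I). y \<oplus>\<^bsub>quot_alg F I\<^esub> x = \<zero>\<^bsub>quot_alg F I\<^esub>"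
      using f a[of "\<ominus>\<^sub>F f" f] z
      by (intro bexI[of _ "I +>\<^sub>F (\<ominus>\<^sub>F f)"]) (auto simp: quot_alg_carrier F.l_neg simp del: quot_alg_simps(3))
    show "\<zero>\<^bsub>quot_alg F I\<^esub> \<oplus>\<^bsub>quot_alg F I\<^esub> x = x"
      using f a[of "\<zero>\<^sub>F" f] z by simp
  qed (use z in \<open>auto simp: quot_alg_carrier a F.a_ac simp del: quot_alg_simps(3)\<close>)
qed

lemma quot_alg_factor_additive:
  assumes F: "abelian_group F" and I: "additive_subgroup I F" and G: "abelian_group G"
    and g: "additive F G g" and gI: "\<And>f. f \<in> I ==> g f = \<zero>\<^sub>G"
  obtains g' where "additive (quot_alg F I) G g'" "\<And>f. f |: F ==> g' (I +>\<^sub>F f) = g f"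
proof
  interpret G: abelian_group G by fact
  interpret F: abelian_group F by fact
  \<comment> \<open>An arbitrary representative is chosen; two representatives of a coset differ by
    an element of \<open>I\<close>, on which \<open>g\<close> vanishes.\<close>
  define g' where "g' X = g (SOME f. f |: F \<and> X = I +>\<^sub>F f)" for X
  show eq: "g' (I +>\<^sub>F f) = g f" if f: "f |: F" for f
  proof -
    define f' where "f' = (SOME f'. f' |: F \<and> I +>\<^sub>F f = I +>\<^sub>F f')"
    have f': "f' |: F" "I +>\<^sub>F f' = I +>\<^sub>F f"
      using someI[of "\<lambda>f'. f' |: F \<and> I +>\<^sub>F f = I +>\<^sub>F f'" f] f unfolding f'_def by auto
    then have "g (f' \<ominus>\<^sub>F f) = \<zero>\<^sub>G" using gI f quot_alg_eq_iff[OF F I] by auto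
    then have "g f' \<ominus>\<^sub>G g f = \<zero>\<^sub>G" using additive_minus[OF g F G] f f' by simp
    then have "g f' = g f" using additive_closed[OF g] f f' by (simp add: G.minus_eq_zero_iff)
    then show ?thesis by (simp add: g'_def f'_def)
  qed
  show "additive (quot_alg F I) G g'"
    by (rule additiveI)
      (auto simp: quot_alg_carrier eq additive_closed[OF g] quot_alg_add[OF F I] additive_add[OF g]
        simp del: quot_alg_simps(3))
qed

lemma ideal_additive_subgroup: "ideal I F ==> additive_subgroup I F"
  by (rule ideal.axioms(1))

lemma quot_alg_hom:
  assumes F: "ring F" and I: "ideal I F"
  shows "ring (quot_alg F I)" "(\<lambda>f. I +>\<^sub>F f) \<in> ring_hom F (quot_alg F I)"
proof -
  interpret ideal I F by fact
  note z = quot_alg_zero[OF abelian_groupI_ring[OF F] ideal_additive_subgroup[OF I]]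
  show "ring (quot_alg F I)" "(\<lambda>f. I +>\<^sub>F f) \<in> ring_hom F (quot_alg F I)"
    by (rule ring_image[OF F, of _ "\<lambda>f. I +>\<^sub>F f"];
       simp add: quot_alg_carrier rcoset_mult_add a_rcos_sum z)+
qed

lemma quot_alg_factor:
  assumes F: "ring F" and I: "ideal I F" and G: "ring G"
    and g: "g \<in> ring_hom F G" and gI: "\<And>f. f \<in> I ==> g f = \<zero>\<^sub>G"
  obtains g' where "g' \<in> ring_hom (quot_alg F I) G" "\<And>f. f |: F ==> g' (I +>\<^sub>F f) = g f"
proof -
  interpret ideal I F by fact
  obtain g' where g': "additive (quot_alg F I) G g'"
    and eq: "\<And>f. f |: F ==> g' (I +>\<^sub>F f) = g f"
    using quot_alg_factor_additive[OF abelian_groupI_ring[OF F] ideal_additive_subgroup[OF I]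
        abelian_groupI_ring[OF G] ring_hom_additive[OF g] gI] by metis
  have "g' \<in> ring_hom (quot_alg F I) G"
  proof (rule ring_hom_memI)
    fix x y assume "x \<in> carrier (quot_alg F I)" "y \<in> carrier (quot_alg F I)"
    then obtain a b where "a |: F" "x = I +>\<^sub>F a" "b |: F" "y = I +>\<^sub>F b"
      by (auto simp: quot_alg_carrier)
    then show "g' (x \<otimes>\<^bsub>quot_alg F I\<^esub> y) = g' x \<otimes>\<^sub>G g' y"
      by (simp add: rcoset_mult_add eq ring_hom_mult[OF g])
  qed (use additive_closed[OF g'] additive_add[OF g'] in \<open>auto simp: eq ring_hom_one[OF g]\<close>)
  then show ?thesis using that eq by blast
qed

text \<open>The zeros of \<open>g\<close> form an ideal containing \<open>S\<close>. Together with
  \<open>quot_alg_factor\<close> this yields the universal properties of all algebras given by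
  generators and relations.\<close>

lemma ring_hom_Idl_zero:
  assumes F: "ring F" and G: "ring G" and g: "g \<in> ring_hom F G" and S: "S \<subseteq> carrier F"
    and gS: "\<And>f. f \<in> S ==> g f = \<zero>\<^sub>G" and f: "f \<in> Idl\<^bsub>F\<^esub> S"
  shows "g f = \<zero>\<^sub>G"
proof -
  interpret F: ring F by fact
  interpret G: ring G by fact
  have "ideal {f \<in> carrier F. g f = \<zero>\<^sub>G} F"
  proof (rule idealI[OF F])
    show "subgroup {f \<in> carrier F. g f = \<zero>\<^sub>G} (add_monoid F)"
      by (rule F.add.subgroupI)
        (auto simp: ring_hom_zero[OF g F G] ring_hom_neg[OF g F G] ring_hom_add[OF g])
  qed (auto simp: ring_hom_mult[OF g] ring_hom_closed[OF g])
  then show ?thesis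
    using F.genideal_minimal[of "{f \<in> carrier F. g f = \<zero>\<^sub>G}" S] S gS f by blast
qed

section \<open>The associated graded ring\<close>

lemma (in ring) ring_restrict_carrier:
  assumes H: "H \<subseteq> carrier R" and one: "\<one> \<in> H"
    and neg: "\<And>x. x \<in> H ==> \<ominus> x \<in> H"
    and mult: "\<And>x y. x \<in> H ==> y \<in> H ==> x \<otimes> y \<in> H"
    and add: "\<And>x y. x \<in> H ==> y \<in> H ==> x \<oplus> y \<in> H"
  shows "ring (R\<lparr>carrier := H\<rparr>)"
proof -
  have c: "x \<in> H ==> x |: R" for x using H by blast
  have z: "\<zero> \<in> H" using add[OF neg[OF one] one] by (simp add: l_neg)
  have "\<exists>y\<in>H. y \<oplus> x = \<zero>" if "x \<in> H" for x
    using that neg c by (intro bexI[of _ "\<ominus> x"]) (auto simp: l_neg)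
  then have "abelian_group (R\<lparr>carrier := H\<rparr>)"
    by (intro abelian_groupI) (simp_all add: add z c a_ac)
  moreover have "monoid (R\<lparr>carrier := H\<rparr>)"
    by (intro monoidI) (simp_all add: mult one c m_assoc)
  ultimately show ?thesis
    by (intro ringI) (simp_all add: c l_distr r_distr)
qed

text \<open>The exponents of a polynomial ring in one variable, used for the Rees ring of a
  filtration and for the ring \<open>A[y]\<close> from which the localization is built.\<close>

definition nat_monoid :: "nat monoid"
  where "nat_monoid = \<lparr>carrier = UNIV, monoid.mult = (+), one = 0\<rparr>"

lemma nat_monoid_simps [simp]:
  "carrier nat_monoid = UNIV" "monoid.mult nat_monoid = (+)" "one nat_monoid = 0"
  by (simp_all add: nat_monoid_def)

lemma nat_comm_monoid: "comm_monoid nat_monoid"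
  by (rule comm_monoidI) auto

locale filtered_ring = ring E for E (structure) +
  fixes Fil :: "nat => 'a set"
  assumes Fil_sub: "\<And>i. additive_subgroup (Fil i) E"
    and Fil_Suc: "\<And>i. Fil i \<subseteq> Fil (Suc i)"
    and Fil_mult: "\<And>i j x y. x \<in> Fil i ==> y \<in> Fil j ==> x \<otimes> y \<in> Fil (i + j)"
    and Fil_one: "\<one> \<in> Fil 0"
begin

abbreviation "prev \<equiv> fil_prev E Fil"
abbreviation "cls \<equiv> gr_elem E Fil"
abbreviation "G \<equiv> gr_ring E Fil"

lemma Fil_carrier: "x \<in> Fil i ==> x |: E"
  using additive_subgroup.a_subset[OF Fil_sub] by blast

lemma Fil_zero [simp]: "\<zero> \<in> Fil i"
  using additive_subgroup.zero_closed[OF Fil_sub] .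

lemma Fil_add: "x \<in> Fil i ==> y \<in> Fil i ==> x \<oplus> y \<in> Fil i"
  using additive_subgroup.a_closed[OF Fil_sub] .

lemma Fil_neg: "x \<in> Fil i ==> \<ominus> x \<in> Fil i"
  using additive_subgroup.a_inv_closed[OF Fil_sub] .

lemma Fil_mono: "i \<le> j ==> Fil i \<subseteq> Fil j"
  using lift_Suc_mono_le[of Fil, OF Fil_Suc] by blast

lemma prev_sub: "additive_subgroup (prev i) E"
proof (cases i)
  case 0
  have "additive_subgroup {\<zero>} E"
    using ideal_additive_subgroup zeroideal by blast
  then show ?thesis by (simp add: 0 fil_prev_def)
next
  case (Suc j)
  then show ?thesis using Fil_sub by (simp add: fil_prev_def)
qed

lemma prev_Fil: "x \<in> prev i ==> x \<in> Fil i"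
  using Fil_Suc by (auto simp: fil_prev_def split: nat.splits)

lemma prev_carrier: "x \<in> prev i ==> x |: E"
  using prev_Fil Fil_carrier by blast

lemma prev_add: "x \<in> prev i ==> y \<in> prev i ==> x \<oplus> y \<in> prev i"
  using additive_subgroup.a_closed[OF prev_sub] .

lemma prev_zero [simp]: "\<zero> \<in> prev i"
  using additive_subgroup.zero_closed[OF prev_sub] .

lemma prev_mult_l: "x \<in> prev i ==> y \<in> Fil j ==> x \<otimes> y \<in> prev (i + j)"
  by (cases i) (use Fil_mult prev_zero[of j] Fil_carrier in \<open>auto simp: fil_prev_def split: nat.splits\<close>)

lemma prev_mult_r: "x \<in> Fil i ==> y \<in> prev j ==> x \<otimes> y \<in> prev (i + j)"
  by (cases j) (use Fil_mult prev_zero[of i] Fil_carrier in \<open>auto simp: fil_prev_def split: nat.splits\<close>)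

lemma prev_finsum:
  "(\<And>j. j \<in> S ==> f j \<in> prev i) ==> finsum E f S \<in> prev i"
  by (induction S rule: infinite_finite_induct) (auto simp: Pi_def prev_carrier[of _ i] prev_add)

lemma Fil_finsum:
  "(\<And>j. j \<in> S ==> f j \<in> Fil i) ==> finsum E f S \<in> Fil i"
  by (induction S rule: infinite_finite_induct) (auto simp: Pi_def Fil_carrier[of _ i] Fil_add)

lemma prev_coset_eq_iff:
  "x |: E ==> y |: E ==> prev i +> x = prev i +> y \<longleftrightarrow> x \<ominus> y \<in> prev i"
  by (rule quot_alg_eq_iff[OF is_abelian_group prev_sub])

lemma prev_coset_mem:
  assumes "x \<in> prev i +> y" "y |: E"
  obtains e where "e \<in> prev i" "x = y \<oplus> e"
  using assms prev_carrier by (auto simp: a_r_coset_def r_coset_def a_comm)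

sublocale NA: monoid_alg E nat_monoid
  by (intro monoid_alg.intro ring_axioms comm_monoid.axioms(1)[OF nat_comm_monoid])

text \<open>The Rees ring, a subring of the polynomials over \<open>E\<close>. The graded ring is
  its image under \<open>symb\<close>, so the ring axioms are inherited instead of being verified on
  families of cosets.\<close>

definition rees :: "(nat => 'a) set"
  where "rees = {f \<in> carrier NA.FM. \<forall>i. f i \<in> Fil i}"

definition symb :: "(nat => 'a) => nat => 'a set"
  where "symb f = (\<lambda>i. prev i +> f i)"

lemma nat_mult_eq:
  assumes f: "f |: NA.FM" and g: "g |: NA.FM"
  shows "(f \<otimes>\<^bsub>NA.MA\<^esub> g) i = finsum E (\<lambda>j. f j \<otimes> g (i - j)) {..i}"
proof -
  let ?S = "{p. f p \<noteq> \<zero>} \<union> {..i}" and ?T = "{p. g p \<noteq> \<zero>} \<union> {..i}"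
  have fin: "finite ?S" "finite ?T" using fm_finite[OF f] fm_finite[OF g] by auto
  note cl = fm_closed[OF f] fm_closed[OF g]
  have im: "(p, q) \<in> (\<lambda>j. (j, i - j)) ` {..i} \<longleftrightarrow> p + q = i" for p q :: nat
    by (auto simp: image_iff)
  have "(f \<otimes>\<^bsub>NA.MA\<^esub> g) i = finsum E (\<lambda>(p, q). if p + q = i then f p \<otimes> g q else \<zero>) (?S \<times> ?T)"
    by (subst NA.ma_mult_eq[OF f g fin(1) _ fin(2)]) auto
  also have "\<dots> = finsum E (\<lambda>(p, q). f p \<otimes> g q) ((\<lambda>j. (j, i - j)) ` {..i})"
    using fin cl by (intro add.finprod_mono_neutral_cong_right) (auto simp: im)
  also have "\<dots> = finsum E (\<lambda>j. f j \<otimes> g (i - j)) {..i}"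
    using cl by (subst finsum_reindex) (auto simp: inj_on_def)
  finally show ?thesis .
qed

lemma rees_ring: "ring (NA.MA\<lparr>carrier := rees\<rparr>)"
proof (rule ring.ring_restrict_carrier[OF NA.ma_ring])
  show "rees \<subseteq> carrier NA.MA" by (auto simp: rees_def)
  show "\<one>\<^bsub>NA.MA\<^esub> \<in> rees"
    using Fil_one by (auto simp: rees_def mterm_closed) (auto simp: mterm_def)
next
  fix f assume "f \<in> rees"
  then show "\<ominus>\<^bsub>NA.MA\<^esub> f \<in> rees"
    using abelian_group.a_inv_closed[OF fm_abelian_group]
    by (auto simp: rees_def a_inv_monoid_algebra fm_neg_apply Fil_neg)
next
  fix f g assume "f \<in> rees" "g \<in> rees"
  then have fg: "f |: NA.FM" "g |: NA.FM" "\<And>i. f i \<in> Fil i" "\<And>i. g i \<in> Fil i"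
    by (auto simp: rees_def)
  have "finsum E (\<lambda>j. f j \<otimes> g (i - j)) {..i} \<in> Fil i" for i
  proof (rule Fil_finsum)
    fix j assume "j \<in> {..i}"
    then show "f j \<otimes> g (i - j) \<in> Fil i" using Fil_mult[OF fg(3)[of j] fg(4)[of "i - j"]] by simp
  qed
  then show "f \<otimes>\<^bsub>NA.MA\<^esub> g \<in> rees"
    using fg NA.ma_mult_closed[OF fg(1,2)] by (simp add: rees_def nat_mult_eq[OF fg(1,2)])
  show "f \<oplus>\<^bsub>NA.MA\<^esub> g \<in> rees"
    using fg abelian_monoid.a_closed[OF abelian_group.axioms(1)[OF fm_abelian_group], of f "UNIV::nat set" g]
    by (auto simp: rees_def Fil_add)
qed

text \<open>The product of the graded ring is a union over all choices of representatives, so the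
  point is that the resulting coset does not depend on the choice.\<close>

lemma symb_mult:
  assumes f: "f \<in> rees" and g: "g \<in> rees"
  shows "symb (f \<otimes>\<^bsub>NA.MA\<^esub> g) = symb f \<otimes>\<^sub>G symb g"
proof
  fix i
  have fg: "f |: NA.FM" "g |: NA.FM" "\<And>i. f i \<in> Fil i" "\<And>i. g i \<in> Fil i"
    using assms by (auto simp: rees_def)
  note cl = Fil_carrier[OF fg(3)] Fil_carrier[OF fg(4)]
  let ?c = "\<lambda>x y. prev i +> (\<Oplus>j\<in>{..i}. x j \<otimes> y (i - j))"
  have const: "?c x y = ?c f g" if x: "x \<in> Pi UNIV (symb f)" and y: "y \<in> Pi UNIV (symb g)" for x y
  proof -
    have "\<exists>e\<in>prev j. x j = f j \<oplus> e" for j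
    proof -
      have "x j \<in> prev j +> f j" using x by (auto simp: symb_def Pi_def)
      then show ?thesis using prev_coset_mem cl by blast
    qed
    then obtain e where e: "\<And>j. e j \<in> prev j" "\<And>j. x j = f j \<oplus> e j" by metis
    have "\<exists>e\<in>prev j. y j = g j \<oplus> e" for j
    proof -
      have "y j \<in> prev j +> g j" using y by (auto simp: symb_def Pi_def)
      then show ?thesis using prev_coset_mem cl by blast
    qed
    then obtain e' where e': "\<And>j. e' j \<in> prev j" "\<And>j. y j = g j \<oplus> e' j" by metis
    note cl' = cl prev_carrier[OF e(1)] prev_carrier[OF e'(1)]
    have yF: "y j \<in> Fil j" for j using Fil_add[OF fg(4) prev_Fil[OF e'(1)]] e'(2) by metis
    have *: "x j \<otimes> y (i - j) |: E" "f j \<otimes> g (i - j) |: E" for j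
      using cl' e e' by auto
    \<comment> \<open>With \<open>x = f + e\<close> and \<open>y = g + e'\<close>, the product of
      \<open>x\<close> and \<open>y\<close> differs from that of \<open>f\<close> and
      \<open>g\<close> by \<open>f e' + e y\<close>. Both summands contain a factor of lower
      filtration degree.\<close>
    have "(\<Oplus>j\<in>{..i}. x j \<otimes> y (i - j)) =
        (\<Oplus>j\<in>{..i}. f j \<otimes> g (i - j) \<oplus> (f j \<otimes> e' (i - j) \<oplus> e j \<otimes> y (i - j)))"
    proof (rule finsum_cong')
      fix j
      have "(f j \<oplus> e j) \<otimes> y (i - j) = f j \<otimes> y (i - j) \<oplus> e j \<otimes> y (i - j)"
        using cl' Fil_carrier[OF yF] by (intro l_distr) auto
      also have "f j \<otimes> y (i - j) = f j \<otimes> g (i - j) \<oplus> f j \<otimes> e' (i - j)"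
        unfolding e'(2) using cl' by (intro r_distr) auto
      finally show "x j \<otimes> y (i - j) = f j \<otimes> g (i - j) \<oplus> (f j \<otimes> e' (i - j) \<oplus> e j \<otimes> y (i - j))"
        using cl' Fil_carrier[OF yF] by (simp add: e(2) a_assoc)
    qed (use cl' Fil_carrier[OF yF] in auto)
    also have "\<dots> = (\<Oplus>j\<in>{..i}. f j \<otimes> g (i - j)) \<oplus>
        (\<Oplus>j\<in>{..i}. f j \<otimes> e' (i - j) \<oplus> e j \<otimes> y (i - j))"
      using cl' Fil_carrier[OF yF] by (intro finsum_addf) auto
    finally have eq: "(\<Oplus>j\<in>{..i}. x j \<otimes> y (i - j)) = (\<Oplus>j\<in>{..i}. f j \<otimes> g (i - j)) \<oplus>
        (\<Oplus>j\<in>{..i}. f j \<otimes> e' (i - j) \<oplus> e j \<otimes> y (i - j))" .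
    have p: "(\<Oplus>j\<in>{..i}. f j \<otimes> e' (i - j) \<oplus> e j \<otimes> y (i - j)) \<in> prev i"
    proof (rule prev_finsum)
      fix j assume "j \<in> {..i}"
      then show "f j \<otimes> e' (i - j) \<oplus> e j \<otimes> y (i - j) \<in> prev i"
        using prev_mult_r[OF fg(3)[of j] e'(1)[of "i - j"]] prev_mult_l[OF e(1)[of j] yF[of "i - j"]]
        by (auto intro: prev_add)
    qed
    have c1: "(\<Oplus>j\<in>{..i}. f j \<otimes> g (i - j)) |: E" using * by (intro finsum_closed) auto
    show ?thesis
    proof (subst prev_coset_eq_iff)
      show "(\<Oplus>j\<in>{..i}. x j \<otimes> y (i - j)) \<ominus> (\<Oplus>j\<in>{..i}. f j \<otimes> g (i - j)) \<in> prev i"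
        unfolding eq using c1 p prev_carrier[OF p] by (simp add: a_minus_def a_ac r_neg1 r_neg2)
    qed (use * in \<open>auto intro!: finsum_closed\<close>)
  qed
  have ne: "f \<in> Pi UNIV (symb f)" "g \<in> Pi UNIV (symb g)"
    using abelian_subgroup.a_rcos_self[OF abelian_subgroupI'[OF is_abelian_group prev_sub]] cl
    by (auto simp: symb_def)
  have "(symb f \<otimes>\<^sub>G symb g) i = (\<Union>x\<in>Pi UNIV (symb f). \<Union>y\<in>Pi UNIV (symb g). ?c x y)"
    by (simp add: gr_ring_def)
  also have "\<dots> = (\<Union>x\<in>Pi UNIV (symb f). \<Union>y\<in>Pi UNIV (symb g). ?c f g)"
    using const by (intro SUP_cong refl) auto
  also have "\<dots> = ?c f g" using ne by auto
  finally show "symb (f \<otimes>\<^bsub>NA.MA\<^esub> g) i = (symb f \<otimes>\<^sub>G symb g) i"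
    by (simp add: symb_def nat_mult_eq[OF fg(1,2)])
qed

lemma prev_coset_zero: "prev i +> \<zero> = prev i"
  using quot_alg_zero_iff[OF is_abelian_group prev_sub] by auto

lemma symb_mterm: "symb (mterm E x i) = cls i x"
  by (simp add: symb_def mterm_def gr_elem_def fun_eq_iff prev_coset_zero)

lemma symb_image: "carrier G = symb ` rees"
proof (intro equalityI subsetI)
  fix g assume g: "g |: G"
  \<comment> \<open>The representative zero is chosen wherever the coset is trivial; otherwise the
    chosen family could have infinite support.\<close>
  then have "\<exists>x. x \<in> Fil i \<and> g i = prev i +> x \<and> (g i = prev i \<longrightarrow> x = \<zero>)" for i
    using prev_coset_zero by (cases "g i = prev i") (auto simp: gr_ring_def)
  then obtain x where x: "\<And>i. x i \<in> Fil i" "\<And>i. g i = prev i +> x i"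
    "\<And>i. g i = prev i ==> x i = \<zero>" by metis
  have "{i. x i \<noteq> \<zero>} \<subseteq> {i. g i \<noteq> prev i}" using x by auto
  then have "x \<in> rees" using g x Fil_carrier[OF x(1)]
    by (auto simp: rees_def free_module_carrier gr_ring_def intro: finite_subset)
  moreover have "g = symb x" using x by (auto simp: symb_def)
  ultimately show "g \<in> symb ` rees" by blast
next
  fix g assume "g \<in> symb ` rees"
  then obtain f where f: "f \<in> rees" "g = symb f" by blast
  have "{i. g i \<noteq> prev i} \<subseteq> {i. f i \<noteq> \<zero>}"
    using f prev_coset_zero by (auto simp: symb_def)
  then show "g |: G"
    using f by (auto simp: rees_def gr_ring_def symb_def free_module_carrier intro: finite_subset)
qed

lemma symb_add:
  assumes f: "f \<in> rees" and g: "g \<in> rees"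
  shows "symb (f \<oplus>\<^bsub>NA.MA\<^esub> g) = symb f \<oplus>\<^sub>G symb g"
  using assms abelian_subgroup.a_rcos_sum[OF abelian_subgroupI'[OF is_abelian_group prev_sub]]
  by (auto simp: gr_ring_def symb_def rees_def fm_closed fun_eq_iff)

lemma gr_ring_hom: "ring G" "symb \<in> ring_hom (NA.MA\<lparr>carrier := rees\<rparr>) G"
proof -
  let ?R = "NA.MA\<lparr>carrier := rees\<rparr>"
  have "carrier G = symb ` carrier ?R" by (simp add: symb_image)
  moreover have "symb (x \<oplus>\<^bsub>?R\<^esub> y) = symb x \<oplus>\<^sub>G symb y" if "x \<in> carrier ?R" "y \<in> carrier ?R" for x y
    using symb_add[of x y] that by simp
  moreover have "symb (x \<otimes>\<^bsub>?R\<^esub> y) = symb x \<otimes>\<^sub>G symb y" if "x \<in> carrier ?R" "y \<in> carrier ?R" for x y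
    using symb_mult[of x y] that by simp
  moreover have "symb \<one>\<^bsub>?R\<^esub> = \<one>\<^sub>G" by (simp add: symb_mterm gr_ring_def)
  moreover have "symb \<zero>\<^bsub>?R\<^esub> = \<zero>\<^sub>G" by (simp add: gr_ring_def symb_def prev_coset_zero)
  ultimately show "ring G" "symb \<in> ring_hom ?R G"
    using ring_image[OF rees_ring, of G symb] by blast+
qed

lemma gr_zero: "\<zero>\<^sub>G = prev" by (simp add: gr_ring_def)
lemma gr_one: "\<one>\<^sub>G = cls 0 \<one>" by (simp add: gr_ring_def)

lemma mterm_rees: "x \<in> Fil i ==> mterm E x i \<in> rees"
  using Fil_carrier by (auto simp: rees_def mterm_closed) (auto simp: mterm_def)

lemma cls_closed: "x \<in> Fil i ==> cls i x |: G"
  unfolding symb_image using symb_mterm mterm_rees by (metis imageI)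

lemma cls_mult:
  assumes "x \<in> Fil i" "y \<in> Fil j" shows "cls i x \<otimes>\<^sub>G cls j y = cls (i + j) (x \<otimes> y)"
proof -
  have "cls i x \<otimes>\<^sub>G cls j y = symb (mterm E x i \<otimes>\<^bsub>NA.MA\<^esub> mterm E y j)"
    using assms by (simp add: symb_mult mterm_rees symb_mterm)
  then show ?thesis
    using assms Fil_carrier NA.mterm_mult[of x y i j] by (simp add: symb_mterm)
qed

lemma cls_add:
  assumes "x \<in> Fil i" "y \<in> Fil i" shows "cls i x \<oplus>\<^sub>G cls i y = cls i (x \<oplus> y)"
  using assms abelian_subgroup.a_rcos_sum[OF abelian_subgroupI'[OF is_abelian_group prev_sub]]
    Fil_carrier subgroup_add_id prev_sub
  by (auto simp: gr_ring_def gr_elem_def fun_eq_iff additive_subgroup_def)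

lemma cls_zero_iff:
  assumes "x \<in> Fil i" shows "cls i x = \<zero>\<^sub>G \<longleftrightarrow> x \<in> prev i"
  using quot_alg_zero_iff[OF is_abelian_group prev_sub Fil_carrier[OF assms]]
  by (auto simp: gr_zero gr_elem_def fun_eq_iff)

lemma cls_zero: "cls i \<zero> = \<zero>\<^sub>G"
  using cls_zero_iff[OF Fil_zero] by simp

lemma cls_finsum:
  assumes "\<And>k. k \<in> S ==> x k \<in> Fil i"
  shows "finsum G (\<lambda>k. cls i (x k)) S = cls i (finsum E x S)"
proof -
  interpret G: ring G by (rule gr_ring_hom)
  show ?thesis using assms
    by (induction S rule: infinite_finite_induct)
     (auto simp: Pi_def cls_closed cls_add Fil_finsum Fil_carrier[of _ i] cls_zero)
qed

lemma symb_decomp: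
  assumes f: "f \<in> rees" and S: "finite S" "{i. f i \<noteq> \<zero>} \<subseteq> S"
  shows "symb f = finsum G (\<lambda>i. cls i (f i)) S"
proof -
  interpret G: ring G by (rule gr_ring_hom)
  have cl: "f i \<in> Fil i" for i using f by (auto simp: rees_def)
  have add: "(a \<oplus>\<^sub>G b) j = a j <+> b j" for a b j by (simp add: gr_ring_def)
  have *: "finsum G (\<lambda>i. cls i (f i)) S j = (if j \<in> S then prev j +> f j else prev j)" for j
    using S(1)
  proof induction
    case (insert k S)
    have "finsum G (\<lambda>i. cls i (f i)) (insert k S) j = cls k (f k) j <+> finsum G (\<lambda>i. cls i (f i)) S j"
      using insert(1,2) cls_closed[OF cl] by (simp add: add)
    moreover have "(prev j +> a) <+> (prev j +> b) = prev j +> (a \<oplus> b)"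
      if "a |: E" "b |: E" for a b
      using abelian_subgroup.a_rcos_sum[OF abelian_subgroupI'[OF is_abelian_group prev_sub] that] .
    from this[of "f k" \<zero>] this[of \<zero> "f j"] this[of \<zero> \<zero>]
    have "(prev j +> f k) <+> prev j = prev j +> f k" "prev j <+> (prev j +> f j) = prev j +> f j"
      "prev j <+> prev j = prev j"
      using Fil_carrier[OF cl] by (simp_all add: prev_coset_zero)
    ultimately show ?case
      using insert(2,3) by (cases "k = j") (auto simp: gr_elem_def)
  qed (simp add: gr_zero)
  show ?thesis
  proof
    fix j show "symb f j = finsum G (\<lambda>i. cls i (f i)) S j"
      using S(2) *[of j] prev_coset_zero by (cases "f j = \<zero>") (auto simp: symb_def)
  qed
qed

text \<open>The graded ring is the direct sum of its degrees: at index \<open>i\<close> only the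
  summand of degree \<open>i\<close> differs from the trivial coset.\<close>

lemma gr_finsum_zero:
  assumes S: "finite S" and x: "\<And>i. i \<in> S ==> x i \<in> Fil i"
    and zero: "finsum G (\<lambda>i. cls i (x i)) S = \<zero>\<^sub>G" and i: "i \<in> S"
  shows "x i \<in> prev i"
proof -
  interpret G: ring G by (rule gr_ring_hom)
  define f where "f = (\<lambda>i. if i \<in> S then x i else \<zero>)"
  have f: "f \<in> rees"
    using S x Fil_carrier by (auto simp: f_def rees_def free_module_carrier)
  have "symb f = finsum G (\<lambda>i. cls i (x i)) S"
    by (subst symb_decomp[OF f S])
      (auto simp: f_def intro!: G.finsum_cong' cls_closed x)
  then have "prev i +> f i = prev i" using zero by (simp add: symb_def gr_zero fun_eq_iff)
  then show ?thesis
    using quot_alg_zero_iff[OF is_abelian_group prev_sub Fil_carrier[OF x[OF i]], of i] i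
    by (auto simp: f_def)
qed

lemma gr_decomp:
  assumes "g |: G"
  obtains S x where "finite S" "\<And>i. x i \<in> Fil i" "g = finsum G (\<lambda>i. cls i (x i)) S"
  using assms symb_decomp[OF _ _ order.refl] that
  unfolding symb_image by (auto simp: rees_def free_module_carrier)

end

section \<open>Rings of additive endomorphisms\<close>

text \<open>Endomorphisms are cut off outside of the carrier, so that equality in this ring is
  equality at all elements of \<open>V\<close>.\<close>

definition End_ring :: "('a, 'm) ring_scheme => ('a => 'a) ring"
  where "End_ring V = \<lparr>carrier = {h. additive V V h \<and> h \<in> extensional (carrier V)},
    monoid.mult = (\<lambda>g h. \<lambda>x\<in>carrier V. g (h x)), one = (\<lambda>x\<in>carrier V. x),
    zero = (\<lambda>x\<in>carrier V. \<zero>\<^sub>V), add = (\<lambda>g h. \<lambda>x\<in>carrier V. g x \<oplus>\<^sub>V h x)\<rparr>"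

lemma additive_restrict: "abelian_group V ==> additive V W h ==> additive V W (restrict h (carrier V))"
  using abelian_monoid.a_closed[OF abelian_group.axioms(1)] by (fastforce simp: additive_def)

lemma End_ringI: "abelian_group V ==> additive V V h ==> restrict h (carrier V) \<in> carrier (End_ring V)"
  by (simp add: End_ring_def additive_restrict)

lemma End_ring_simps:
  "x |: V ==> (g \<otimes>\<^bsub>End_ring V\<^esub> h) x = g (h x)"
  "x |: V ==> (g \<oplus>\<^bsub>End_ring V\<^esub> h) x = g x \<oplus>\<^sub>V h x"
  "x |: V ==> \<one>\<^bsub>End_ring V\<^esub> x = x"
  "x |: V ==> \<zero>\<^bsub>End_ring V\<^esub> x = \<zero>\<^sub>V"
  by (simp_all add: End_ring_def)

lemma End_ring_eqI:
  assumes "g \<in> carrier (End_ring V)" "h \<in> carrier (End_ring V)"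
    "\<And>x. x |: V ==> g x = h x"
  shows "g = h"
  using assms by (auto simp: End_ring_def intro: extensionalityI)

lemma End_ring_additive: "h \<in> carrier (End_ring V) ==> additive V V h"
  by (simp add: End_ring_def)

lemma End_ring: assumes V: "abelian_group V" shows "ring (End_ring V)"
proof -
  interpret V: abelian_group V by fact
  note cl = additive_closed[OF End_ring_additive] additive_add[OF End_ring_additive]
  have id: "additive V V (\<lambda>x. x)" by (auto intro: additiveI)
  have z: "additive V V (\<lambda>x. \<zero>\<^sub>V)" by (auto intro: additiveI)
  have neg: "additive V V (\<lambda>x. \<ominus>\<^sub>V h x)" if "additive V V h" for h
    using that by (auto intro!: additiveI simp: additive_closed[OF that] additive_add[OF that] V.minus_add V.a_comm)
  have addc: "g \<oplus>\<^bsub>End_ring V\<^esub> h \<in> carrier (End_ring V)"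
    if "g \<in> carrier (End_ring V)" "h \<in> carrier (End_ring V)" for g h
    using End_ringI[OF V additive_sum[OF End_ring_additive End_ring_additive V]] that
    by (simp add: End_ring_def)
  have multc: "g \<otimes>\<^bsub>End_ring V\<^esub> h \<in> carrier (End_ring V)"
    if "g \<in> carrier (End_ring V)" "h \<in> carrier (End_ring V)" for g h
    using End_ringI[OF V additive_comp[OF End_ring_additive[OF that(2)] End_ring_additive[OF that(1)]]]
    by (simp add: End_ring_def)
  have onec: "\<one>\<^bsub>End_ring V\<^esub> \<in> carrier (End_ring V)" and zeroc: "\<zero>\<^bsub>End_ring V\<^esub> \<in> carrier (End_ring V)"
    using End_ringI[OF V id] End_ringI[OF V z] by (simp_all add: End_ring_def)
  have ag: "abelian_group (End_ring V)"
  proof (rule abelian_groupI)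
    fix h assume h: "h \<in> carrier (End_ring V)"
    have n: "restrict (\<lambda>x. \<ominus>\<^sub>V h x) (carrier V) \<in> carrier (End_ring V)"
      using End_ringI[OF V neg[OF End_ring_additive[OF h]]] .
    show "\<exists>g\<in>carrier (End_ring V). g \<oplus>\<^bsub>End_ring V\<^esub> h = \<zero>\<^bsub>End_ring V\<^esub>"
      by (rule bexI[OF _ n], rule End_ring_eqI[of _ V])
        (use h n addc zeroc in \<open>auto simp: End_ring_simps cl V.l_neg\<close>)
    show "\<zero>\<^bsub>End_ring V\<^esub> \<oplus>\<^bsub>End_ring V\<^esub> h = h"
      by (rule End_ring_eqI[of _ V]) (use h addc zeroc in \<open>auto simp: End_ring_simps cl\<close>)
  next
    fix f g h assume fgh: "f \<in> carrier (End_ring V)" "g \<in> carrier (End_ring V)" "h \<in> carrier (End_ring V)"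
    show "f \<oplus>\<^bsub>End_ring V\<^esub> g \<oplus>\<^bsub>End_ring V\<^esub> h = f \<oplus>\<^bsub>End_ring V\<^esub> (g \<oplus>\<^bsub>End_ring V\<^esub> h)"
      by (rule End_ring_eqI[of _ V]) (use fgh in \<open>auto simp: addc End_ring_simps cl V.a_assoc\<close>)
  next
    fix f g assume fgh: "f \<in> carrier (End_ring V)" "g \<in> carrier (End_ring V)"
    show "f \<oplus>\<^bsub>End_ring V\<^esub> g = g \<oplus>\<^bsub>End_ring V\<^esub> f"
      by (rule End_ring_eqI[of _ V]) (use fgh in \<open>auto simp: addc End_ring_simps cl V.a_comm\<close>)
  qed (auto intro: addc zeroc)
  show ?thesis
  proof (rule ringI[OF ag])
    show "monoid (End_ring V)"
    proof (rule monoidI)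
      fix f g h assume "f \<in> carrier (End_ring V)" "g \<in> carrier (End_ring V)" "h \<in> carrier (End_ring V)"
      then show "f \<otimes>\<^bsub>End_ring V\<^esub> g \<otimes>\<^bsub>End_ring V\<^esub> h = f \<otimes>\<^bsub>End_ring V\<^esub> (g \<otimes>\<^bsub>End_ring V\<^esub> h)"
        by (intro End_ring_eqI[of _ V]) (auto simp: multc End_ring_simps cl)
    next
      fix f assume "f \<in> carrier (End_ring V)"
      then show "\<one>\<^bsub>End_ring V\<^esub> \<otimes>\<^bsub>End_ring V\<^esub> f = f" "f \<otimes>\<^bsub>End_ring V\<^esub> \<one>\<^bsub>End_ring V\<^esub> = f"
        by (intro End_ring_eqI[of _ V]; auto simp: multc onec End_ring_simps cl)+
    qed (auto intro: multc onec)
  next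
    fix f g h assume fgh: "f \<in> carrier (End_ring V)" "g \<in> carrier (End_ring V)" "h \<in> carrier (End_ring V)"
    show "(f \<oplus>\<^bsub>End_ring V\<^esub> g) \<otimes>\<^bsub>End_ring V\<^esub> h = f \<otimes>\<^bsub>End_ring V\<^esub> h \<oplus>\<^bsub>End_ring V\<^esub> g \<otimes>\<^bsub>End_ring V\<^esub> h"
      by (rule End_ring_eqI[of _ V]) (use fgh in \<open>auto simp: addc multc End_ring_simps cl\<close>)
    show "h \<otimes>\<^bsub>End_ring V\<^esub> (f \<oplus>\<^bsub>End_ring V\<^esub> g) = h \<otimes>\<^bsub>End_ring V\<^esub> f \<oplus>\<^bsub>End_ring V\<^esub> h \<otimes>\<^bsub>End_ring V\<^esub> g"
      by (rule End_ring_eqI[of _ V]) (use fgh in \<open>auto simp: addc multc End_ring_simps cl\<close>)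
  qed
qed

section \<open>Free modules, symmetric algebras and tensor products\<close>

lemma (in monoid_alg) ma_mult_support:
  assumes f: "f |: FM" and g: "g |: FM" and x: "(f \<otimes>\<^bsub>MA\<^esub> g) x \<noteq> \<zero>"
  shows "\<exists>p q. f p \<noteq> \<zero> \<and> g q \<noteq> \<zero> \<and> p \<otimes>\<^sub>M q = x"
proof (rule ccontr)
  assume *: "\<not> ?thesis"
  have z: "f p \<otimes> g q = \<zero>" if "p \<otimes>\<^sub>M q = x" for p q
    using that * fm_closed[OF f] fm_closed[OF g] by (cases "f p = \<zero>"; cases "g q = \<zero>") auto
  have fin: "finite {p. f p \<noteq> \<zero>}" "finite {p. g p \<noteq> \<zero>}" using f g by (auto simp: free_module_carrier)
  have "(f \<otimes>\<^bsub>MA\<^esub> g) x = finsum R (\<lambda>_. \<zero>) ({p. f p \<noteq> \<zero>} \<times> {p. g p \<noteq> \<zero>})"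
    unfolding ma_mult_eq[OF f g fin(1) order.refl fin(2) order.refl] using z by (intro R.finsum_cong') auto
  then show False using x by simp
qed

lemma free_comm_monoid: "comm_monoid (free_comm_monoid X)"
  by (rule comm_monoidI) (auto simp: free_comm_monoid_def add_ac)

lemma free_comm_monoid_simps [simp]:
  "carrier (free_comm_monoid X) = {m. set_mset m \<subseteq> X}"
  "monoid.mult (free_comm_monoid X) = (+)" "one (free_comm_monoid X) = {#}"
  by (simp_all add: free_comm_monoid_def)

lemma free_monoid: "monoid (free_monoid X)"
  by (rule monoidI) (auto simp: free_monoid_def)

lemma free_monoid_simps [simp]:
  "carrier (free_monoid X) = lists X"
  "monoid.mult (free_monoid X) = (@)" "one (free_monoid X) = []"
  by (simp_all add: free_monoid_def)

lemma (in ring) smult_fm_closed: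
  assumes r: "r |: R" and f: "f \<in> carrier (free_module R X)"
  shows "(\<lambda>x. r \<otimes> f x) \<in> carrier (free_module R X)"
proof -
  have "{x. r \<otimes> f x \<noteq> \<zero>} \<subseteq> {x. f x \<noteq> \<zero>}" using r by auto
  then show ?thesis using f r by (auto simp: free_module_carrier intro: finite_subset)
qed

lemma (in cring) fm_module: "module R (free_module R X)"
  by (rule moduleI[OF is_cring fm_abelian_group])
    (auto simp: smult_fm_closed fun_eq_iff fm_closed l_distr r_distr m_assoc)

lemma (in module) gen_submodule:
  assumes S: "S \<subseteq> carrier M"
  shows "submodule (gen_submodule R M S) R M" "S \<subseteq> gen_submodule R M S"
proof -
  have ex: "submodule (carrier M) R M \<and> S \<subseteq> carrier M" using carrier_is_submodule S by blast
  show "submodule (gen_submodule R M S) R M"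
  proof (rule submoduleI)
    show "gen_submodule R M S \<subseteq> carrier M" unfolding gen_submodule_def using ex by blast
    show "\<zero>\<^sub>M \<in> gen_submodule R M S"
      unfolding gen_submodule_def using submodule.axioms(1) subgroup.one_closed by fastforce
  qed (use submoduleE in \<open>auto simp: gen_submodule_def\<close>)
  show "S \<subseteq> gen_submodule R M S" by (auto simp: gen_submodule_def)
qed

lemma gen_submodule_minimal:
  "submodule N R M ==> S \<subseteq> N ==> gen_submodule R M S \<subseteq> N"
  by (auto simp: gen_submodule_def)

lemma submodule_additive_subgroup: "submodule N R M ==> additive_subgroup N M"
  by (rule additive_subgroup.intro) (rule submodule.axioms(1))

lemma quot_module:
  assumes M: "module R M" and N: "submodule N R M"
  shows "module R (quot_alg M N)"
    and "\<And>r x. r |: R ==> x |: M ==>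
      r \<odot>\<^bsub>quot_alg M N\<^esub> (N +>\<^sub>M x) = N +>\<^sub>M (r \<odot>\<^sub>M x)"
proof -
  interpret module R M by fact
  note ag = M.abelian_group_axioms submodule_additive_subgroup[OF N]
  show sm: "r \<odot>\<^bsub>quot_alg M N\<^esub> (N +>\<^sub>M x) = N +>\<^sub>M (r \<odot>\<^sub>M x)"
    if "r |: R" "x |: M" for r x
    by (rule quot_alg_smult[OF ag])
      (use that submoduleE[OF N] in \<open>auto intro!: additiveI simp: smult_r_distr\<close>)
  note qa = quot_alg_add[OF ag]
  show "module R (quot_alg M N)"
    by (rule moduleI[OF R.is_cring quot_alg_abelian_group[OF ag]])
      (auto simp: quot_alg_carrier sm qa smult_l_distr smult_r_distr smult_assoc1
        simp del: quot_alg_simps)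
qed

definition mprod :: "('g, 'n) monoid_scheme => ('x => 'g) => 'x multiset => 'g"
  where "mprod G \<gamma> = fold_mset (\<lambda>m y. if \<gamma> m |: G \<and> y |: G \<and>
      (\<forall>m'. \<gamma> m' |: G \<longrightarrow> \<gamma> m \<otimes>\<^sub>G \<gamma> m' = \<gamma> m' \<otimes>\<^sub>G \<gamma> m) then \<gamma> m \<otimes>\<^sub>G y else y) \<one>\<^sub>G"

text \<open>The guard makes the folded operation commute with itself, as folding over a multiset
  requires, whatever the values of \<open>\<gamma>\<close>.\<close>

lemma (in monoid) mprod:
  assumes \<gamma>: "\<And>x. \<gamma> x |: G" and comm: "\<And>x y. \<gamma> x \<otimes> \<gamma> y = \<gamma> y \<otimes> \<gamma> x"
  shows mprod_empty: "mprod G \<gamma> {#} = \<one>"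
    and mprod_add_mset: "mprod G \<gamma> (add_mset x M) = \<gamma> x \<otimes> mprod G \<gamma> M"
    and mprod_closed: "mprod G \<gamma> M |: G"
    and mprod_plus: "mprod G \<gamma> (M + N) = mprod G \<gamma> M \<otimes> mprod G \<gamma> N"
proof -
  let ?f = "\<lambda>m y. if y \<in> carrier G then \<gamma> m \<otimes> y else y"
  have f: "(\<lambda>m y. if \<gamma> m |: G \<and> y |: G \<and>
      (\<forall>m'. \<gamma> m' |: G \<longrightarrow> \<gamma> m \<otimes> \<gamma> m' = \<gamma> m' \<otimes> \<gamma> m) then \<gamma> m \<otimes> y else y) = ?f"
    using assms by (auto simp: fun_eq_iff)
  have "comp_fun_commute ?f"
    by standard (auto simp: fun_eq_iff \<gamma> comm simp flip: m_assoc)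
  then have add: "fold_mset ?f \<one> (add_mset x M) = ?f x (fold_mset ?f \<one> M)" for x M
    by (rule comp_fun_commute.fold_mset_add_mset)
  have cl: "mprod G \<gamma> M |: G" for M
    unfolding mprod_def f by (induction M) (auto simp: add \<gamma>)
  show e: "mprod G \<gamma> {#} = \<one>" by (simp add: mprod_def)
  show a: "mprod G \<gamma> (add_mset x M) = \<gamma> x \<otimes> mprod G \<gamma> M" for x M
    using cl[of M] unfolding mprod_def f add by simp
  show "mprod G \<gamma> M |: G" by (rule cl)
  show "mprod G \<gamma> (M + N) = mprod G \<gamma> M \<otimes> mprod G \<gamma> N"
    by (induction M) (auto simp: e a cl \<gamma> m_assoc)
qed

section \<open>The symmetric algebra of a module\<close>

locale sym_setup = module R M for R :: "('r, 'm) ring_scheme" (structure) and M :: "('r, 'v, 'c) module_scheme" (structure)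
begin

abbreviation "PS \<equiv> monoid_algebra R (free_comm_monoid (carrier M))"
abbreviation "IS \<equiv> sym_ideal R M"
abbreviation "SA \<equiv> sym_algebra R M"
abbreviation "clS f \<equiv> IS +>\<^bsub>PS\<^esub> f"
abbreviation "var m \<equiv> mterm R \<one>\<^sub>R {#m#}"

definition scal :: "'r => ('v multiset => 'r) set"
  where "scal r = clS (mterm R r {#})"

lemma mon_alg: "monoid_alg R (free_comm_monoid (carrier M))"
  by (intro monoid_alg.intro R.ring_axioms comm_monoid.axioms(1) free_comm_monoid)

sublocale PP: monoid_alg R "free_comm_monoid (carrier M)" by (rule mon_alg)

sublocale PSr: ring PS by (rule PP.ma_ring)

lemma PS_cring: "cring PS"
  by (rule PP.ma_cring[OF R.is_cring free_comm_monoid])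

definition sym_rels :: "('v multiset => 'r) set"
  where "sym_rels = {var (m \<oplus>\<^sub>M m') \<ominus>\<^bsub>PS\<^esub> (var m \<oplus>\<^bsub>PS\<^esub> var m') | m m'. m |: M \<and> m' |: M}
       \<union> {var (r \<odot>\<^sub>M m) \<ominus>\<^bsub>PS\<^esub> r \<odot>\<^bsub>PS\<^esub> var m | r m. r |: R \<and> m |: M}"

lemma IS_eq: "IS = Idl\<^bsub>PS\<^esub> sym_rels"
  by (simp only: sym_ideal_def sym_rels_def Let_def single_eq_mterm)

lemma var_closed: "m |: M ==> var m |: PS"
  by (auto intro!: mterm_closed)

lemma smult_PS: "r |: R ==> f |: PS ==> r \<odot>\<^bsub>PS\<^esub> f = mterm R r {#} \<otimes>\<^bsub>PS\<^esub> f"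
  using PP.smult_eq_mult[of r f] by simp

lemma mterm_PS: "r |: R ==> set_mset p \<subseteq> carrier M ==> mterm R r p |: PS"
  by (auto intro!: mterm_closed)

lemma sym_rels_closed: "sym_rels \<subseteq> carrier PS"
proof -
  have "r \<odot>\<^bsub>PS\<^esub> var m |: PS" if "r |: R" "m |: M" for r m
    unfolding smult_PS[OF that(1) var_closed[OF that(2)]]
    using that by (intro PSr.m_closed mterm_PS) auto
  then show ?thesis unfolding sym_rels_def
    by (auto intro!: PSr.minus_closed PSr.a_closed var_closed simp del: monoid_algebra_simps)
qed

lemma IS_ideal: "ideal IS PS"
  unfolding IS_eq by (rule PSr.genideal_ideal[OF sym_rels_closed])

lemma SA_eq: "SA = quot_alg PS IS" by (simp add: sym_algebra_def)

lemma SA_ring: "ring SA" and clS_hom: "clS \<in> ring_hom PS SA"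
  unfolding SA_eq by (rule quot_alg_hom[OF PSr.ring_axioms IS_ideal])+

lemma SA_carrier: "carrier SA = clS ` carrier PS"
  by (simp only: SA_eq quot_alg_carrier)

lemma sym_incl_eq: "sym_incl R M m = clS (var m)"
  by (simp add: sym_incl_def single_eq_mterm)

lemma clS_eqI: "f \<ominus>\<^bsub>PS\<^esub> g \<in> sym_rels ==> f |: PS ==> g |: PS ==> clS f = clS g"
  using quot_alg_eq_iff[OF PSr.is_abelian_group ideal_additive_subgroup[OF IS_ideal]]
    PSr.genideal_self[OF sym_rels_closed] unfolding IS_eq by blast

lemma scal_hom: "scal \<in> ring_hom R SA"
proof -
  have "(\<lambda>r. mterm R r {#}) \<in> ring_hom R PS"
    by (rule ring_hom_memI)
      (auto simp: PP.mterm_mult intro!: mterm_closed simp flip: free_module_simps(2), simp add: mterm_def fun_eq_iff)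
  from ring_hom_trans[OF this clS_hom] show ?thesis by (simp add: scal_def[abs_def] comp_def)
qed

lemma sym_incl_closed: "m |: M ==> sym_incl R M m |: SA"
  unfolding sym_incl_eq by (rule ring_hom_closed[OF clS_hom var_closed])

lemma sym_incl_add:
  assumes "m |: M" "m' |: M"
  shows "sym_incl R M (m \<oplus>\<^sub>M m') = sym_incl R M m \<oplus>\<^bsub>SA\<^esub> sym_incl R M m'"
proof -
  have "sym_incl R M (m \<oplus>\<^sub>M m') = clS (var m \<oplus>\<^bsub>PS\<^esub> var m')"
    unfolding sym_incl_eq using assms
    by (intro clS_eqI var_closed M.a_closed PSr.a_closed) (auto simp: sym_rels_def simp del: monoid_algebra_simps)
  then show ?thesis unfolding sym_incl_eq
    using assms by (simp only: ring_hom_add[OF clS_hom var_closed var_closed])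
qed

lemma sym_incl_smult:
  assumes "r |: R" "m |: M"
  shows "sym_incl R M (r \<odot>\<^sub>M m) = scal r \<otimes>\<^bsub>SA\<^esub> sym_incl R M m"
proof -
  have sm: "r \<odot>\<^bsub>PS\<^esub> var m = mterm R r {#} \<otimes>\<^bsub>PS\<^esub> var m" using assms by (intro smult_PS var_closed)
  have cl: "mterm R r {#} |: PS" using assms by (intro mterm_PS) auto
  have "sym_incl R M (r \<odot>\<^sub>M m) = clS (r \<odot>\<^bsub>PS\<^esub> var m)"
    unfolding sym_incl_eq
  proof (rule clS_eqI)
    show "var (r \<odot>\<^sub>M m) \<ominus>\<^bsub>PS\<^esub> r \<odot>\<^bsub>PS\<^esub> var m \<in> sym_rels" using assms unfolding sym_rels_def by blast
    show "r \<odot>\<^bsub>PS\<^esub> var m |: PS" unfolding sm using cl var_closed[OF assms(2)] by (rule PSr.m_closed)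
  qed (use assms in \<open>intro var_closed smult_closed\<close>)
  then show ?thesis unfolding sym_incl_eq sm scal_def
    by (simp only: ring_hom_mult[OF clS_hom cl var_closed[OF assms(2)]])
qed

lemma smult_SA:
  assumes r: "r |: R" and s: "s |: SA"
  shows "r \<odot>\<^bsub>SA\<^esub> s = scal r \<otimes>\<^bsub>SA\<^esub> s"
proof -
  interpret I: ideal IS PS by (rule IS_ideal)
  have cl: "mterm R r {#} |: PS" using r by (intro mterm_PS) auto
  obtain f where f: "f |: PS" "s = clS f" using s unfolding SA_carrier by blast
  have *: "r \<odot>\<^bsub>quot_alg PS IS\<^esub> (clS f) = clS (r \<odot>\<^bsub>PS\<^esub> f)"
  proof (rule quot_alg_smult[OF PSr.is_abelian_group ideal_additive_subgroup[OF IS_ideal] _ _ f(1)])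
    show "additive PS PS (\<lambda>x. r \<odot>\<^bsub>PS\<^esub> x)"
    proof (rule additiveI)
      fix x y assume xy: "x |: PS" "y |: PS"
      show "r \<odot>\<^bsub>PS\<^esub> x |: PS" unfolding smult_PS[OF r xy(1)] by (rule PSr.m_closed[OF cl xy(1)])
      show "r \<odot>\<^bsub>PS\<^esub> (x \<oplus>\<^bsub>PS\<^esub> y) = r \<odot>\<^bsub>PS\<^esub> x \<oplus>\<^bsub>PS\<^esub> r \<odot>\<^bsub>PS\<^esub> y"
        unfolding smult_PS[OF r xy(1)] smult_PS[OF r xy(2)] smult_PS[OF r PSr.a_closed[OF xy]]
        by (rule PSr.r_distr[OF xy cl])
    qed
    fix x assume x: "x \<in> IS"
    have "x |: PS" using x by (rule I.Icarr)
    show "r \<odot>\<^bsub>PS\<^esub> x \<in> IS" unfolding smult_PS[OF r \<open>x \<in> carrier PS\<close>] by (rule I.I_l_closed[OF x cl])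
  qed
  show ?thesis
    unfolding f(2) SA_eq * smult_PS[OF r f(1)] scal_def
    using ring_hom_mult[OF clS_hom cl f(1)] unfolding SA_eq .
qed

lemma SA_comm:
  assumes "s |: SA" "t |: SA" shows "s \<otimes>\<^bsub>SA\<^esub> t = t \<otimes>\<^bsub>SA\<^esub> s"
proof -
  from assms obtain f g where fg: "f |: PS" "s = clS f" "g |: PS" "t = clS g"
    unfolding SA_carrier by blast
  show ?thesis unfolding fg
    ring_hom_mult[OF clS_hom fg(1,3), symmetric] ring_hom_mult[OF clS_hom fg(3,1), symmetric]
    using cring.cring_simprules(14)[OF PS_cring fg(1,3)] by simp
qed

lemma SA_induct:
  assumes s: "s |: SA"
    and scal: "\<And>r. r |: R ==> P (scal r)"
    and add: "\<And>s t. \<lbrakk>s |: SA; t |: SA; P s; P t\<rbrakk> \<Longrightarrow> P (s \<oplus>\<^bsub>SA\<^esub> t)"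
    and mult: "\<And>m s. \<lbrakk>m |: M; s |: SA; P s\<rbrakk> \<Longrightarrow> P (sym_incl R M m \<otimes>\<^bsub>SA\<^esub> s)"
  shows "P s"
proof -
  have mt: "P (clS (mterm R r p))" if "r |: R" "set_mset p \<subseteq> carrier M" for r p
    using that(2)
  proof (induction p)
    case empty
    then show ?case using scal[OF that(1)] by (simp add: scal_def)
  next
    case (add m p)
    then have m: "m |: M" and p: "set_mset p \<subseteq> carrier M" by auto
    have "mterm R r (add_mset m p) = var m \<otimes>\<^bsub>PS\<^esub> mterm R r p"
      using PP.mterm_mult[of "\<one>\<^sub>R" r "{#m#}" p] that m p by simp
    then have "clS (mterm R r (add_mset m p)) = sym_incl R M m \<otimes>\<^bsub>SA\<^esub> clS (mterm R r p)"
      unfolding sym_incl_eq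
      by (simp only: ring_hom_mult[OF clS_hom var_closed[OF m] mterm_PS[OF that(1) p]])
    then show ?case
      using mult[OF m ring_hom_closed[OF clS_hom mterm_PS[OF that(1) p]] add.IH[OF p]] by simp
  qed
  obtain f where f: "f |: PS" "s = clS f" using s unfolding SA_carrier by blast
  have "f \<in> carrier (free_module R (carrier (free_comm_monoid (carrier M))))" using f by simp
  then have "P (clS f)"
  proof (induction rule: R.fm_induct)
    case zero
    show ?case using mt[of "\<zero>\<^sub>R" "{#}"] by (simp add: R.mterm_zero)
  next
    case (add r p f)
    have f: "f |: PS" using add(3) by simp
    have p: "mterm R r p |: PS" using add(1,2) by (intro mterm_PS) auto
    have "clS (mterm R r p \<oplus>\<^bsub>PS\<^esub> f) = clS (mterm R r p) \<oplus>\<^bsub>SA\<^esub> clS f"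
      by (rule ring_hom_add[OF clS_hom p f])
    moreover have "P (clS (mterm R r p) \<oplus>\<^bsub>SA\<^esub> clS f)"
      using assms(3)[OF ring_hom_closed[OF clS_hom p] ring_hom_closed[OF clS_hom f] mt add(4)] add(1,2) by simp
    ultimately show ?case by simp
  qed
  then show ?thesis using f by simp
qed

text \<open>The target is a possibly noncommutative ring, so it is the images of the generators that
  have to commute, among themselves and with scalars. This generality is used for the graded ring,
  whose commutation relations are only known for particular elements.\<close>

lemma SA_lift:
  assumes G: "ring G" and \<beta>: "\<beta> \<in> ring_hom R G"
    and \<gamma>: "\<And>m. m |: M ==> \<gamma> m |: G"
    and \<gamma>_add: "\<And>m m'. m |: M ==> m' |: M ==> \<gamma> (m \<oplus>\<^sub>M m') = \<gamma> m \<oplus>\<^sub>G \<gamma> m'"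
    and \<gamma>_smult: "\<And>r m. r |: R ==> m |: M ==> \<gamma> (r \<odot>\<^sub>M m) = \<beta> r \<otimes>\<^sub>G \<gamma> m"
    and comm: "\<And>m m'. m |: M ==> m' |: M ==> \<gamma> m \<otimes>\<^sub>G \<gamma> m' = \<gamma> m' \<otimes>\<^sub>G \<gamma> m"
    and comm': "\<And>r m. r |: R ==> m |: M ==> \<beta> r \<otimes>\<^sub>G \<gamma> m = \<gamma> m \<otimes>\<^sub>G \<beta> r"
  obtains \<psi> where "\<psi> \<in> ring_hom SA G" "\<And>r. r |: R ==> \<psi> (scal r) = \<beta> r"
    "\<And>m. m |: M ==> \<psi> (sym_incl R M m) = \<gamma> m"
proof -
  interpret G: ring G by fact
  \<comment> \<open>Extended by one outside of the carrier, \<open>g\<close> satisfies the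
    hypotheses of \<open>mprod\<close>, which are quantified over all elements of the type.\<close>
  define g where "g m = (if m \<in> carrier M then \<gamma> m else \<one>\<^sub>G)" for m
  have g: "\<And>m. g m |: G" "\<And>m m'. g m \<otimes>\<^sub>G g m' = g m' \<otimes>\<^sub>G g m"
    using \<gamma> comm by (auto simp: g_def)
  note mp = G.mprod[of g, OF g]
  have gc: "\<beta> r \<otimes>\<^sub>G g m = g m \<otimes>\<^sub>G \<beta> r" if "r |: R" for r m
    using comm' that ring_hom_closed[OF \<beta> that] by (auto simp: g_def)
  have cm: "\<beta> r \<otimes>\<^sub>G mprod G g p = mprod G g p \<otimes>\<^sub>G \<beta> r" if "r |: R" for r p
  proof (induction p)
    case empty
    then show ?case using ring_hom_closed[OF \<beta> that] by (simp add: mp)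
  next
    case (add m p)
    have "\<beta> r \<otimes>\<^sub>G (g m \<otimes>\<^sub>G mprod G g p) = g m \<otimes>\<^sub>G (\<beta> r \<otimes>\<^sub>G mprod G g p)"
      using ring_hom_closed[OF \<beta> that] g(1) mp(3) gc[OF that] by (simp flip: G.m_assoc)
    then show ?case
      using ring_hom_closed[OF \<beta> that] g(1) mp(3) add by (simp add: mp(2) G.m_assoc)
  qed
  obtain L where L: "L \<in> ring_hom PS G"
    and Lm: "\<And>r p. r |: R ==> p \<in> carrier (free_comm_monoid (carrier M)) ==> L (mterm R r p) = \<beta> r \<otimes>\<^sub>G mprod G g p"
    using PP.ma_lift[OF G \<beta>, of "mprod G g"] mp cm by (metis free_comm_monoid_simps(2,3))
  have Lv: "L (var m) = \<gamma> m" if "m |: M" for m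
  proof -
    have "mprod G g {#m#} = g m" using mp(2)[of m "{#}"] mp(1) g(1) by simp
    then show ?thesis using Lm[of "\<one>\<^sub>R" "{#m#}"] that \<gamma> ring_hom_one[OF \<beta>] by (simp add: g_def)
  qed
  have Ls: "L (mterm R r {#}) = \<beta> r" if "r |: R" for r
    using Lm[of r "{#}"] that ring_hom_closed[OF \<beta> that] mp(1) by simp
  have rel: "L f = \<zero>\<^sub>G" if "f \<in> sym_rels" for f
    using that unfolding sym_rels_def
  proof (elim UnE CollectE exE conjE)
    fix m m' assume m: "f = var (m \<oplus>\<^sub>M m') \<ominus>\<^bsub>PS\<^esub> (var m \<oplus>\<^bsub>PS\<^esub> var m')" "m |: M" "m' |: M"
    have "L f = L (var (m \<oplus>\<^sub>M m')) \<ominus>\<^sub>G L (var m \<oplus>\<^bsub>PS\<^esub> var m')" unfolding m(1)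
      using ring_hom_minus[OF L PSr.ring_axioms G var_closed[OF M.a_closed]
          PSr.a_closed[OF var_closed var_closed]] m(2,3) by blast
    also have "L (var m \<oplus>\<^bsub>PS\<^esub> var m') = L (var m) \<oplus>\<^sub>G L (var m')"
      using ring_hom_add[OF L var_closed var_closed] m(2,3) by blast
    finally show "L f = \<zero>\<^sub>G" using m \<gamma> by (simp add: Lv \<gamma>_add G.minus_eq_zero_iff)
  next
    fix r m assume m: "f = var (r \<odot>\<^sub>M m) \<ominus>\<^bsub>PS\<^esub> r \<odot>\<^bsub>PS\<^esub> var m" "r |: R" "m |: M"
    have c: "mterm R r {#} |: PS" using m by (intro mterm_PS) auto
    have "L f = L (var (r \<odot>\<^sub>M m)) \<ominus>\<^sub>G L (mterm R r {#} \<otimes>\<^bsub>PS\<^esub> var m)"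
      unfolding m(1) smult_PS[OF m(2) var_closed[OF m(3)]]
      using ring_hom_minus[OF L PSr.ring_axioms G var_closed[OF smult_closed]
          PSr.m_closed[OF c var_closed]] m(2,3) by blast
    also have "L (mterm R r {#} \<otimes>\<^bsub>PS\<^esub> var m) = \<beta> r \<otimes>\<^sub>G \<gamma> m"
      using ring_hom_mult[OF L c var_closed[OF m(3)]] m by (simp only: Lv Ls)
    finally show "L f = \<zero>\<^sub>G" using m \<gamma> ring_hom_closed[OF \<beta>] by (simp add: Lv \<gamma>_smult G.minus_eq_zero_iff)
  qed
  obtain \<psi> where \<psi>: "\<psi> \<in> ring_hom (quot_alg PS IS) G" "\<And>f. f |: PS ==> \<psi> (clS f) = L f"
    using quot_alg_factor[OF PSr.ring_axioms IS_ideal G L]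
      ring_hom_Idl_zero[OF PSr.ring_axioms G L sym_rels_closed rel] unfolding IS_eq by metis
  show thesis
  proof
    show "\<psi> \<in> ring_hom SA G" using \<psi>(1) unfolding SA_eq .
    show "\<psi> (scal r) = \<beta> r" if "r |: R" for r
      using \<psi>(2)[OF mterm_PS[OF that, of "{#}"]] Ls[OF that] by (simp add: scal_def)
    show "\<psi> (sym_incl R M m) = \<gamma> m" if "m |: M" for m
      using \<psi>(2)[OF var_closed[OF that]] Lv[OF that] unfolding sym_incl_eq by simp
  qed
qed

end

section \<open>The tensor product of two algebras\<close>

locale tensor_setup = A: assoc_algebra R A + S: assoc_algebra R S
  for R :: "('r, 'm) ring_scheme" and A :: "('r, 'a, 'c) module_scheme" and S :: "('r, 's, 'd) module_scheme"
begin

abbreviation "AS \<equiv> A \<times>\<times> S"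
abbreviation "PT \<equiv> monoid_algebra R AS"
abbreviation "IT \<equiv> tensor_ideal R A S"
abbreviation "TA \<equiv> tensor_algebra R A S"
abbreviation "te a b \<equiv> tensor_elem R A S a b"
abbreviation "clT f \<equiv> IT +>\<^bsub>PT\<^esub> f"
abbreviation "tp a b \<equiv> mterm R \<one>\<^sub>R (a, b)"

lemma AS_monoid: "monoid AS"
  by (rule DirProd_monoid[OF A.is_monoid S.is_monoid])

sublocale PP: monoid_alg R AS
  by (intro monoid_alg.intro A.R.ring_axioms AS_monoid)

sublocale PTr: ring PT by (rule PP.ma_ring)

definition tensor_rels :: "('a \<times> 's => 'r) set"
  where "tensor_rels = {tp (a \<oplus>\<^sub>A a') b \<ominus>\<^bsub>PT\<^esub> (tp a b \<oplus>\<^bsub>PT\<^esub> tp a' b) | a a' b.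
            a |: A \<and> a' |: A \<and> b |: S}
       \<union> {tp a (b \<oplus>\<^sub>S b') \<ominus>\<^bsub>PT\<^esub> (tp a b \<oplus>\<^bsub>PT\<^esub> tp a b') | a b b'.
            a |: A \<and> b |: S \<and> b' |: S}
       \<union> {tp (r \<odot>\<^sub>A a) b \<ominus>\<^bsub>PT\<^esub> r \<odot>\<^bsub>PT\<^esub> tp a b | r a b.
            r |: R \<and> a |: A \<and> b |: S}
       \<union> {tp a (r \<odot>\<^sub>S b) \<ominus>\<^bsub>PT\<^esub> r \<odot>\<^bsub>PT\<^esub> tp a b | r a b.
            r |: R \<and> a |: A \<and> b |: S}"

lemma IT_eq: "IT = Idl\<^bsub>PT\<^esub> tensor_rels"
  by (simp only: tensor_ideal_def tensor_rels_def Let_def single_eq_mterm)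

lemma tp_closed: "a |: A ==> b |: S ==> tp a b |: PT"
  by (auto intro!: A.R.mterm_closed)

lemma mterm_PT: "r |: R ==> a |: A ==> b |: S ==> mterm R r (a, b) |: PT"
  by (auto intro!: A.R.mterm_closed)

lemma smult_tp:
  assumes "r |: R" "a |: A" "b |: S"
  shows "r \<odot>\<^bsub>PT\<^esub> tp a b = mterm R r (a, b)"
  using assms by (auto simp: mterm_def)

lemma tensor_rels_closed: "tensor_rels \<subseteq> carrier PT"
proof -
  have "r \<odot>\<^bsub>PT\<^esub> tp a b |: PT" if "r |: R" "a |: A" "b |: S" for r a b
    unfolding smult_tp[OF that] using that by (rule mterm_PT)
  then show ?thesis unfolding tensor_rels_def
    by (auto intro!: PTr.minus_closed PTr.a_closed tp_closed simp del: monoid_algebra_simps)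
qed

lemma IT_ideal: "ideal IT PT"
  unfolding IT_eq by (rule PTr.genideal_ideal[OF tensor_rels_closed])

lemma TA_eq: "TA = quot_alg PT IT" by (simp add: tensor_algebra_def)

lemma TA_ring: "ring TA" and clT_hom: "clT \<in> ring_hom PT TA"
  unfolding TA_eq by (rule quot_alg_hom[OF PTr.ring_axioms IT_ideal])+

lemma TA_carrier: "carrier TA = clT ` carrier PT"
  by (simp only: TA_eq quot_alg_carrier)

lemma te_eq: "te a b = clT (tp a b)"
  by (simp add: tensor_elem_def single_eq_mterm)

lemma te_closed: "a |: A ==> b |: S ==> te a b |: TA"
  unfolding te_eq by (rule ring_hom_closed[OF clT_hom tp_closed])

lemma clT_eqI: "f \<ominus>\<^bsub>PT\<^esub> g \<in> tensor_rels ==> f |: PT ==> g |: PT ==> clT f = clT g"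
  using quot_alg_eq_iff[OF PTr.is_abelian_group ideal_additive_subgroup[OF IT_ideal]]
    PTr.genideal_self[OF tensor_rels_closed] unfolding IT_eq by blast

lemma te_add_l:
  assumes a: "a |: A" "a' |: A" "b |: S"
  shows "te (a \<oplus>\<^sub>A a') b = te a b \<oplus>\<^bsub>TA\<^esub> te a' b"
proof -
  have "clT (tp (a \<oplus>\<^sub>A a') b) = clT (tp a b \<oplus>\<^bsub>PT\<^esub> tp a' b)"
    by (rule clT_eqI[OF _ tp_closed[OF A.M.a_closed[OF a(1,2)] a(3)]
          PTr.a_closed[OF tp_closed[OF a(1,3)] tp_closed[OF a(2,3)]]])
      (unfold tensor_rels_def, use a in blast)
  then show ?thesis unfolding te_eq
    using ring_hom_add[OF clT_hom tp_closed[OF a(1,3)] tp_closed[OF a(2,3)]] by simp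
qed

lemma te_add_r:
  assumes a: "a |: A" "b |: S" "b' |: S"
  shows "te a (b \<oplus>\<^sub>S b') = te a b \<oplus>\<^bsub>TA\<^esub> te a b'"
proof -
  have "clT (tp a (b \<oplus>\<^sub>S b')) = clT (tp a b \<oplus>\<^bsub>PT\<^esub> tp a b')"
    by (rule clT_eqI[OF _ tp_closed[OF a(1) S.M.a_closed[OF a(2,3)]]
          PTr.a_closed[OF tp_closed[OF a(1,2)] tp_closed[OF a(1,3)]]])
      (unfold tensor_rels_def, use a in blast)
  then show ?thesis unfolding te_eq
    using ring_hom_add[OF clT_hom tp_closed[OF a(1,2)] tp_closed[OF a(1,3)]] by simp
qed

lemma te_smult:
  assumes a: "r |: R" "a |: A" "b |: S"
  shows "te (r \<odot>\<^sub>A a) b = clT (mterm R r (a, b))"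
    and "te a (r \<odot>\<^sub>S b) = clT (mterm R r (a, b))"
proof -
  have sc: "r \<odot>\<^bsub>PT\<^esub> tp a b |: PT" unfolding smult_tp[OF a] using a by (rule mterm_PT)
  have "clT (tp (r \<odot>\<^sub>A a) b) = clT (r \<odot>\<^bsub>PT\<^esub> tp a b)"
    by (rule clT_eqI[OF _ tp_closed[OF A.smult_closed[OF a(1,2)] a(3)] sc])
      (unfold tensor_rels_def, use a in blast)
  then show "te (r \<odot>\<^sub>A a) b = clT (mterm R r (a, b))" unfolding te_eq smult_tp[OF a] .
  have "clT (tp a (r \<odot>\<^sub>S b)) = clT (r \<odot>\<^bsub>PT\<^esub> tp a b)"
    by (rule clT_eqI[OF _ tp_closed[OF a(2) S.smult_closed[OF a(1,3)]] sc])
      (unfold tensor_rels_def, use a in blast)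
  then show "te a (r \<odot>\<^sub>S b) = clT (mterm R r (a, b))" unfolding te_eq smult_tp[OF a] .
qed

lemma te_mult:
  assumes "a |: A" "a' |: A" "b |: S" "b' |: S"
  shows "te a b \<otimes>\<^bsub>TA\<^esub> te a' b' = te (a \<otimes>\<^sub>A a') (b \<otimes>\<^sub>S b')"
  unfolding te_eq ring_hom_mult[OF clT_hom tp_closed[OF assms(1,3)] tp_closed[OF assms(2,4)], symmetric]
  using assms by (simp add: PP.mterm_mult)

lemma te_one: "te \<one>\<^sub>A \<one>\<^sub>S = \<one>\<^bsub>TA\<^esub>"
  unfolding te_eq using ring_hom_one[OF clT_hom] by (simp add: DirProd_def)

definition tau :: "'a => ('a \<times> 's => 'r) set" where "tau a = te a \<one>\<^sub>S"
definition sg :: "'s => ('a \<times> 's => 'r) set" where "sg b = te \<one>\<^sub>A b"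

lemma tau_hom: "tau \<in> ring_hom A TA"
  by (rule ring_hom_memI) (auto simp: tau_def te_closed te_mult te_add_l te_one)

lemma sg_hom: "sg \<in> ring_hom S TA"
  by (rule ring_hom_memI) (auto simp: sg_def te_closed te_mult te_add_r te_one)

lemma te_tau_sg: "a |: A ==> b |: S ==> te a b = tau a \<otimes>\<^bsub>TA\<^esub> sg b"
  by (simp add: tau_def sg_def te_mult)

lemma tau_sg_comm:
  "a |: A ==> b |: S ==> tau a \<otimes>\<^bsub>TA\<^esub> sg b = sg b \<otimes>\<^bsub>TA\<^esub> tau a"
  by (simp add: tau_def sg_def te_mult)

lemma tau_sg_scalar: "r |: R ==> tau (r \<odot>\<^sub>A \<one>\<^sub>A) = sg (r \<odot>\<^sub>S \<one>\<^sub>S)"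
  by (simp add: tau_def sg_def te_smult)

text \<open>Sums of pure tensors suffice, because the scalar of a term can be absorbed into its
  first factor.\<close>

lemma TA_induct:
  assumes t: "t |: TA"
    and te: "\<And>a b. a |: A ==> b |: S ==> P (te a b)"
    and add: "\<And>s t. \<lbrakk>s |: TA; t |: TA; P s; P t\<rbrakk> \<Longrightarrow> P (s \<oplus>\<^bsub>TA\<^esub> t)"
  shows "P t"
proof -
  have mt: "P (clT (mterm R r p))" if "r |: R" "p |: AS" for r p
    using te[of "r \<odot>\<^sub>A fst p" "snd p"] te_smult(1)[of r "fst p" "snd p"] that
    by (auto simp: DirProd_def)
  obtain f where f: "f |: PT" "t = clT f" using t unfolding TA_carrier by blast
  have "f \<in> carrier (free_module R (carrier AS))" using f by simp
  then have "P (clT f)"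
  proof (induction rule: A.R.fm_induct)
    case zero
    show ?case using mt[of "\<zero>\<^sub>R" "(\<zero>\<^sub>A, \<zero>\<^sub>S)"] by (simp add: A.R.mterm_zero)
  next
    case (add r p f)
    have f: "f |: PT" using add(3) by simp
    have p: "mterm R r p |: PT" using add(1,2) by auto
    have "clT (mterm R r p \<oplus>\<^bsub>PT\<^esub> f) = clT (mterm R r p) \<oplus>\<^bsub>TA\<^esub> clT f"
      by (rule ring_hom_add[OF clT_hom p f])
    moreover have "P (clT (mterm R r p) \<oplus>\<^bsub>TA\<^esub> clT f)"
      by (rule assms(3)[OF ring_hom_closed[OF clT_hom p] ring_hom_closed[OF clT_hom f] mt[OF add(1,2)] add(4)])
    ultimately show ?case by simp
  qed
  then show ?thesis using f by simp
qed

lemma TA_lift: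
  assumes G: "ring G" and f: "f \<in> ring_hom A G" and \<psi>: "\<psi> \<in> ring_hom S G"
    and comm: "\<And>a b. a |: A ==> b |: S ==> f a \<otimes>\<^sub>G \<psi> b = \<psi> b \<otimes>\<^sub>G f a"
    and scalar: "\<And>r. r |: R ==> f (r \<odot>\<^sub>A \<one>\<^sub>A) = \<psi> (r \<odot>\<^sub>S \<one>\<^sub>S)"
  obtains \<phi> where "\<phi> \<in> ring_hom TA G"
    "\<And>a b. a |: A ==> b |: S ==> \<phi> (te a b) = f a \<otimes>\<^sub>G \<psi> b"
proof -
  interpret G: ring G by fact
  note cl = ring_hom_closed[OF f] ring_hom_closed[OF \<psi>]
  let ?\<eta> = "\<lambda>r. f (r \<odot>\<^sub>A \<one>\<^sub>A)"
  let ?\<mu> = "\<lambda>p. f (fst p) \<otimes>\<^sub>G \<psi> (snd p)"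
  have asm: "(r \<odot>\<^sub>A \<one>\<^sub>A) \<otimes>\<^sub>A a = r \<odot>\<^sub>A a" "a \<otimes>\<^sub>A (r \<odot>\<^sub>A \<one>\<^sub>A) = r \<odot>\<^sub>A a"
    if "r |: R" "a |: A" for r a
    using that by (simp_all add: A.smult_mult_l A.smult_mult_r)
  have ssm: "(r \<odot>\<^sub>S \<one>\<^sub>S) \<otimes>\<^sub>S b = r \<odot>\<^sub>S b"
    if "r |: R" "b |: S" for r b
    using that by (simp_all add: S.smult_mult_l)
  have eta: "?\<eta> \<in> ring_hom R G"
  proof (rule ring_hom_memI)
    fix r s assume rs: "r |: R" "s |: R"
    show "?\<eta> r |: G" using rs by (simp add: cl)
    have "(r \<otimes>\<^sub>R s) \<odot>\<^sub>A \<one>\<^sub>A = (r \<odot>\<^sub>A \<one>\<^sub>A) \<otimes>\<^sub>A (s \<odot>\<^sub>A \<one>\<^sub>A)"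
      using rs by (simp add: asm(1) A.smult_assoc1)
    then show "?\<eta> (r \<otimes>\<^sub>R s) = ?\<eta> r \<otimes>\<^sub>G ?\<eta> s" using rs by (simp add: ring_hom_mult[OF f])
    show "?\<eta> (r \<oplus>\<^sub>R s) = ?\<eta> r \<oplus>\<^sub>G ?\<eta> s"
      using rs by (simp add: A.smult_l_distr ring_hom_add[OF f])
  qed (simp add: ring_hom_one[OF f])
  \<comment> \<open>The interchange law behind multiplicativity on pairs; only the two inner factors
    have to commute.\<close>
  have mult4: "(x \<otimes>\<^sub>G y) \<otimes>\<^sub>G (x' \<otimes>\<^sub>G y') = (x \<otimes>\<^sub>G x') \<otimes>\<^sub>G (y \<otimes>\<^sub>G y')"
    if "x |: G" "y |: G" "x' |: G" "y' |: G" "y \<otimes>\<^sub>G x' = x' \<otimes>\<^sub>G y" for x y x' y'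
  proof -
    have "y \<otimes>\<^sub>G (x' \<otimes>\<^sub>G y') = x' \<otimes>\<^sub>G (y \<otimes>\<^sub>G y')"
      using that by (simp flip: G.m_assoc)
    then show ?thesis using that by (simp add: G.m_assoc)
  qed
  obtain L where L: "L \<in> ring_hom PT G"
    and Lm: "\<And>r p. r |: R ==> p |: AS ==> L (mterm R r p) = ?\<eta> r \<otimes>\<^sub>G ?\<mu> p"
  proof (rule PP.ma_lift[OF G eta, of ?\<mu>])
    fix p q assume "p |: AS" "q |: AS"
    then obtain a b a' b' where ab: "p = (a, b)" "q = (a', b')" "a |: A" "b |: S"
      "a' |: A" "b' |: S" by auto
    then show "?\<mu> (p \<otimes>\<^bsub>AS\<^esub> q) = ?\<mu> p \<otimes>\<^sub>G ?\<mu> q"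
      using mult4[of "f a" "\<psi> b" "f a'" "\<psi> b'"] comm
      by (simp add: ring_hom_mult[OF f] ring_hom_mult[OF \<psi>] cl)
  next
    fix r p assume r: "r |: R" and "p |: AS"
    then obtain a b where ab: "p = (a, b)" "a |: A" "b |: S" by auto
    have "?\<eta> r \<otimes>\<^sub>G ?\<mu> p = f (r \<odot>\<^sub>A a) \<otimes>\<^sub>G \<psi> b"
      using r ab by (simp add: cl asm ring_hom_mult[OF f, symmetric] flip: G.m_assoc)
    also have "\<dots> = f a \<otimes>\<^sub>G (?\<eta> r \<otimes>\<^sub>G \<psi> b)"
      using r ab by (simp add: cl asm ring_hom_mult[OF f, symmetric] flip: G.m_assoc)
    also have "\<dots> = ?\<mu> p \<otimes>\<^sub>G ?\<eta> r"
      using r ab comm[of "r \<odot>\<^sub>A \<one>\<^sub>A" b] by (simp add: cl G.m_assoc)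
    finally show "?\<eta> r \<otimes>\<^sub>G ?\<mu> p = ?\<mu> p \<otimes>\<^sub>G ?\<eta> r" .
  next
    show "?\<mu> \<one>\<^bsub>AS\<^esub> = \<one>\<^sub>G" by (simp add: ring_hom_one[OF f] ring_hom_one[OF \<psi>])
  qed (auto simp: cl)
  \<comment> \<open>The same value in two forms: the first makes the relations with the scalar in
    \<open>A\<close> vanish, the second, which rests on \<open>scalar\<close>, those with the scalar
    in \<open>S\<close>.\<close>
  have Lr: "L (mterm R r (a, b)) = f (r \<odot>\<^sub>A a) \<otimes>\<^sub>G \<psi> b"
    "L (mterm R r (a, b)) = f a \<otimes>\<^sub>G \<psi> (r \<odot>\<^sub>S b)"
    if "r |: R" "a |: A" "b |: S" for r a b
  proof -
    have "L (mterm R r (a, b)) = ?\<eta> r \<otimes>\<^sub>G (f a \<otimes>\<^sub>G \<psi> b)" using Lm[of r "(a, b)"] that by simp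
    then show 1: "L (mterm R r (a, b)) = f (r \<odot>\<^sub>A a) \<otimes>\<^sub>G \<psi> b"
      using that by (simp add: cl asm ring_hom_mult[OF f, symmetric] flip: G.m_assoc)
    have "f (r \<odot>\<^sub>A a) = f a \<otimes>\<^sub>G ?\<eta> r"
      using that by (simp add: asm ring_hom_mult[OF f, symmetric])
    then show "L (mterm R r (a, b)) = f a \<otimes>\<^sub>G \<psi> (r \<odot>\<^sub>S b)"
      unfolding 1 using that by (simp add: cl scalar ssm G.m_assoc ring_hom_mult[OF \<psi>, symmetric])
  qed
  have Lt: "L (tp a b) = f a \<otimes>\<^sub>G \<psi> b" if "a |: A" "b |: S" for a b
    using Lr(1)[OF A.R.one_closed that] that by simp
  have Ldiff: "L (x \<ominus>\<^bsub>PT\<^esub> y) = \<zero>\<^sub>G" if "L x = L y" "x |: PT" "y |: PT" for x y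
    using ring_hom_minus[OF L PTr.ring_axioms G that(2,3)] that ring_hom_closed[OF L that(3)]
    by (simp add: G.minus_eq_zero_iff)
  note Ladd = ring_hom_add[OF L tp_closed tp_closed]
  have rel: "L x = \<zero>\<^sub>G" if "x \<in> tensor_rels" for x
    using that unfolding tensor_rels_def
  proof (elim UnE CollectE exE conjE)
    fix a a' b assume h: "x = tp (a \<oplus>\<^sub>A a') b \<ominus>\<^bsub>PT\<^esub> (tp a b \<oplus>\<^bsub>PT\<^esub> tp a' b)"
      "a |: A" "a' |: A" "b |: S"
    show "L x = \<zero>\<^sub>G" unfolding h(1)
    proof (rule Ldiff)
      show "L (tp (a \<oplus>\<^sub>A a') b) = L (tp a b \<oplus>\<^bsub>PT\<^esub> tp a' b)"
        unfolding Ladd[OF h(2,4,3,4)] using h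
        by (simp only: Lt A.M.a_closed ring_hom_add[OF f] G.l_distr cl)
    qed (intro tp_closed PTr.a_closed A.M.a_closed h)+
  next
    fix a b b' assume h: "x = tp a (b \<oplus>\<^sub>S b') \<ominus>\<^bsub>PT\<^esub> (tp a b \<oplus>\<^bsub>PT\<^esub> tp a b')"
      "a |: A" "b |: S" "b' |: S"
    show "L x = \<zero>\<^sub>G" unfolding h(1)
    proof (rule Ldiff)
      show "L (tp a (b \<oplus>\<^sub>S b')) = L (tp a b \<oplus>\<^bsub>PT\<^esub> tp a b')"
        unfolding Ladd[OF h(2,3,2,4)] using h
        by (simp only: Lt S.M.a_closed ring_hom_add[OF \<psi>] G.r_distr cl)
    qed (intro tp_closed PTr.a_closed S.M.a_closed h)+
  next
    fix r a b assume h: "x = tp (r \<odot>\<^sub>A a) b \<ominus>\<^bsub>PT\<^esub> r \<odot>\<^bsub>PT\<^esub> tp a b"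
      "r |: R" "a |: A" "b |: S"
    show "L x = \<zero>\<^sub>G" unfolding h(1) smult_tp[OF h(2-4)]
      using h by (intro Ldiff tp_closed mterm_PT A.smult_closed) (simp_all only: Lt Lr(1) A.smult_closed)
  next
    fix r a b assume h: "x = tp a (r \<odot>\<^sub>S b) \<ominus>\<^bsub>PT\<^esub> r \<odot>\<^bsub>PT\<^esub> tp a b"
      "r |: R" "a |: A" "b |: S"
    show "L x = \<zero>\<^sub>G" unfolding h(1) smult_tp[OF h(2-4)]
      using h by (intro Ldiff tp_closed mterm_PT S.smult_closed) (simp_all only: Lt Lr(2) S.smult_closed)
  qed
  obtain \<phi> where \<phi>: "\<phi> \<in> ring_hom (quot_alg PT IT) G" "\<And>f. f |: PT ==> \<phi> (clT f) = L f"
    using quot_alg_factor[OF PTr.ring_axioms IT_ideal G L]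
      ring_hom_Idl_zero[OF PTr.ring_axioms G L tensor_rels_closed rel] unfolding IT_eq by metis
  show thesis
  proof
    show "\<phi> \<in> ring_hom TA G" using \<phi>(1) unfolding TA_eq .
    show "\<phi> (te a b) = f a \<otimes>\<^sub>G \<psi> b" if "a |: A" "b |: S" for a b
      using \<phi>(2)[OF tp_closed[OF that]] Lt[OF that] unfolding te_eq by simp
  qed
qed

end

section \<open>Kaehler differentials\<close>

locale kaehler_setup =
  fixes K :: "('k, 'm) ring_scheme" and Z :: "('k, 'z, 'c) module_scheme"
  assumes K_algebra: "algebra K Z"
begin

sublocale Kr: cring K by (rule algebra.R_cring[OF K_algebra])
sublocale Zc: cring Z by (rule algebra.M_cring[OF K_algebra])
sublocale KZ: module K Z by (rule algebra.module[OF K_algebra])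

abbreviation "FZ \<equiv> free_module Z (carrier Z)"
abbreviation "NZ \<equiv> kaehler_submodule K Z"
abbreviation "\<Omega> \<equiv> kaehler K Z"
abbreviation "dZ \<equiv> kaehler_d K Z"
abbreviation "gen z \<equiv> mterm Z \<one>\<^sub>Z z"

definition kap :: "'k => 'z" where "kap c = c \<odot>\<^sub>Z \<one>\<^sub>Z"

sublocale FZ: module Z FZ by (rule Zc.fm_module)

lemma kap_closed: "c |: K ==> kap c |: Z"
  by (simp add: kap_def)

lemma kap_mult: "c |: K ==> z |: Z ==> kap c \<otimes>\<^sub>Z z = c \<odot>\<^sub>Z z"
  by (simp add: kap_def algebra.smult_assoc2[OF K_algebra])

lemma kap_hom: "kap \<in> ring_hom K Z"
  by (rule ring_hom_memI) (auto simp: kap_def KZ.smult_l_distr KZ.smult_assoc1 algebra.smult_assoc2[OF K_algebra])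

lemma gen_closed: "z |: Z ==> gen z |: FZ"
  by auto

definition der_rels :: "('z => 'z) set"
  where "der_rels = {gen (x \<oplus>\<^sub>Z y) \<ominus>\<^bsub>FZ\<^esub> (gen x \<oplus>\<^bsub>FZ\<^esub> gen y) | x y. x |: Z \<and> y |: Z}
    \<union> {gen (c \<odot>\<^sub>Z x) \<ominus>\<^bsub>FZ\<^esub> kap c \<odot>\<^bsub>FZ\<^esub> gen x | c x. c |: K \<and> x |: Z}
    \<union> {gen (x \<otimes>\<^sub>Z y) \<ominus>\<^bsub>FZ\<^esub> ((x \<odot>\<^bsub>FZ\<^esub> gen y) \<oplus>\<^bsub>FZ\<^esub> (y \<odot>\<^bsub>FZ\<^esub> gen x)) | x y.
        x |: Z \<and> y |: Z}"

lemma kaehler_relations_eq: "kaehler_relations K Z = der_rels"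
  by (simp only: kaehler_relations_def der_rels_def Let_def single_eq_mterm kap_def)

lemma der_rels_closed: "der_rels \<subseteq> carrier FZ"
  unfolding der_rels_def
  by (auto intro!: FZ.M.minus_closed FZ.M.a_closed FZ.smult_closed gen_closed kap_closed
      simp del: free_module_simps)

lemma NZ_submodule: "submodule NZ Z FZ" and NZ_rels: "der_rels \<subseteq> NZ"
  unfolding kaehler_submodule_def kaehler_relations_eq by (rule FZ.gen_submodule[OF der_rels_closed])+

lemma kaehler_module: "module Z \<Omega>"
  unfolding kaehler_def by (rule quot_module(1)[OF FZ.module_axioms NZ_submodule])

sublocale Om: sym_setup Z \<Omega>
  by (rule sym_setup.intro) (rule kaehler_module)

lemma dZ_eq: "dZ z = NZ +>\<^bsub>FZ\<^esub> gen z"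
  by (simp add: kaehler_d_def single_eq_mterm)

lemma dZ_closed: "z |: Z ==> dZ z |: \<Omega>"
  unfolding dZ_eq kaehler_def quot_alg_carrier using gen_closed by blast

lemmas om_add = quot_alg_add[OF FZ.M.abelian_group_axioms submodule_additive_subgroup[OF NZ_submodule], folded kaehler_def]
lemmas om_smult = quot_module(2)[OF FZ.module_axioms NZ_submodule, folded kaehler_def]

lemma om_eqI: "f \<ominus>\<^bsub>FZ\<^esub> g \<in> der_rels ==> f |: FZ ==> g |: FZ ==> NZ +>\<^bsub>FZ\<^esub> f = NZ +>\<^bsub>FZ\<^esub> g"
  using quot_alg_eq_iff[OF FZ.M.abelian_group_axioms submodule_additive_subgroup[OF NZ_submodule]]
    NZ_rels by blast

lemma dZ_add:
  assumes "x |: Z" "y |: Z" shows "dZ (x \<oplus>\<^sub>Z y) = dZ x \<oplus>\<^sub>\<Omega> dZ y"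
proof -
  have "dZ (x \<oplus>\<^sub>Z y) = NZ +>\<^bsub>FZ\<^esub> (gen x \<oplus>\<^bsub>FZ\<^esub> gen y)" unfolding dZ_eq
    by (rule om_eqI[OF _ gen_closed[OF Zc.a_closed[OF assms]]
          FZ.M.a_closed[OF gen_closed[OF assms(1)] gen_closed[OF assms(2)]]])
      (unfold der_rels_def, use assms in blast)
  then show ?thesis using om_add[OF gen_closed gen_closed] assms by (simp only: dZ_eq)
qed

lemma dZ_scalar:
  assumes "c |: K" "x |: Z" shows "dZ (c \<odot>\<^sub>Z x) = kap c \<odot>\<^sub>\<Omega> dZ x"
proof -
  have "dZ (c \<odot>\<^sub>Z x) = NZ +>\<^bsub>FZ\<^esub> (kap c \<odot>\<^bsub>FZ\<^esub> gen x)" unfolding dZ_eq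
    by (rule om_eqI[OF _ gen_closed[OF KZ.smult_closed[OF assms]]
          FZ.smult_closed[OF kap_closed[OF assms(1)] gen_closed[OF assms(2)]]])
      (unfold der_rels_def, use assms in blast)
  then show ?thesis using om_smult[OF kap_closed gen_closed] assms by (simp only: dZ_eq)
qed

lemma dZ_mult:
  assumes "x |: Z" "y |: Z"
  shows "dZ (x \<otimes>\<^sub>Z y) = (x \<odot>\<^sub>\<Omega> dZ y) \<oplus>\<^sub>\<Omega> (y \<odot>\<^sub>\<Omega> dZ x)"
proof -
  note c = FZ.smult_closed[OF assms(1) gen_closed[OF assms(2)]] FZ.smult_closed[OF assms(2) gen_closed[OF assms(1)]]
  have "dZ (x \<otimes>\<^sub>Z y) = NZ +>\<^bsub>FZ\<^esub> ((x \<odot>\<^bsub>FZ\<^esub> gen y) \<oplus>\<^bsub>FZ\<^esub> (y \<odot>\<^bsub>FZ\<^esub> gen x))" unfolding dZ_eq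
    by (rule om_eqI[OF _ gen_closed[OF Zc.m_closed[OF assms]] FZ.M.a_closed[OF c]])
      (unfold der_rels_def, use assms in blast)
  then show ?thesis using om_smult[OF assms(1) gen_closed[OF assms(2)]]
      om_smult[OF assms(2) gen_closed[OF assms(1)]] om_add[OF c] by (simp only: dZ_eq)
qed

lemma om_induct:
  assumes w: "w |: \<Omega>"
    and gen: "\<And>r z. r |: Z ==> z |: Z ==> P (r \<odot>\<^sub>\<Omega> dZ z)"
    and add: "\<And>v w. \<lbrakk>v |: \<Omega>; w |: \<Omega>; P v; P w\<rbrakk> \<Longrightarrow> P (v \<oplus>\<^sub>\<Omega> w)"
  shows "P w"
proof -
  obtain f where f: "f |: FZ" "w = NZ +>\<^bsub>FZ\<^esub> f"
    using w unfolding kaehler_def quot_alg_carrier by blast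
  have carr: "NZ +>\<^bsub>FZ\<^esub> f |: \<Omega>" if "f |: FZ" for f
    using that unfolding kaehler_def quot_alg_carrier by blast
  have m: "P (NZ +>\<^bsub>FZ\<^esub> mterm Z r z)" if "r |: Z" "z |: Z" for r z
  proof -
    have "r \<odot>\<^bsub>FZ\<^esub> gen z = mterm Z r z" using that by (auto simp: mterm_def)
    then show ?thesis using gen[OF that] om_smult[OF that(1) gen_closed[OF that(2)]] by (simp only: dZ_eq)
  qed
  from f(1) have "P (NZ +>\<^bsub>FZ\<^esub> f)"
  proof (induction rule: Zc.fm_induct)
    case zero
    show ?case using m[of "\<zero>\<^sub>Z" "\<zero>\<^sub>Z"] by (simp add: Zc.mterm_zero)
  next
    case (add r p f)
    have p: "mterm Z r p |: FZ" using add(1,2) by auto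
    show ?case unfolding om_add[OF p add(3), symmetric]
      by (rule assms(3)[OF carr[OF p] carr[OF add(3)] m[OF add(1,2)] add(4)])
  qed
  then show ?thesis using f by simp
qed

text \<open>The universal derivation, for derivations into a ring \<open>G\<close> on which
  \<open>Z\<close> acts by left multiplication through \<open>\<beta>\<close>. As \<open>G\<close>
  may be noncommutative, this applies to the graded ring, to the localization of \<open>A\<close>
  and to rings of operators.\<close>

lemma om_lift:
  assumes G: "ring G" and \<beta>: "\<beta> \<in> ring_hom Z G"
    and g: "\<And>x. x |: Z ==> g x |: G"
    and g_add: "\<And>x y. x |: Z ==> y |: Z ==> g (x \<oplus>\<^sub>Z y) = g x \<oplus>\<^sub>G g y"
    and g_scalar: "\<And>c x. c |: K ==> x |: Z ==> g (c \<odot>\<^sub>Z x) = \<beta> (kap c) \<otimes>\<^sub>G g x"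
    and g_mult: "\<And>x y. x |: Z ==> y |: Z ==>
      g (x \<otimes>\<^sub>Z y) = (\<beta> x \<otimes>\<^sub>G g y) \<oplus>\<^sub>G (\<beta> y \<otimes>\<^sub>G g x)"
  obtains \<gamma> where "additive \<Omega> G \<gamma>"
    "\<And>r w. r |: Z ==> w |: \<Omega> ==> \<gamma> (r \<odot>\<^sub>\<Omega> w) = \<beta> r \<otimes>\<^sub>G \<gamma> w"
    "\<And>x. x |: Z ==> \<gamma> (dZ x) = g x"
proof -
  interpret G: ring G by fact
  note \<beta>c = ring_hom_closed[OF \<beta>]
  let ?h = "\<lambda>z r. \<beta> r \<otimes>\<^sub>G g z"
  have h: "additive Z G (?h z)" if "z |: Z" for z
    using that by (auto intro!: additiveI simp: \<beta>c g ring_hom_add[OF \<beta>] G.l_distr)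
  define L where "L = lext Z G ?h"
  have La: "additive FZ G L" unfolding L_def by (rule Zc.lext_additive[OF h G.abelian_group_axioms])
  have Lm: "L (mterm Z r z) = \<beta> r \<otimes>\<^sub>G g z" if "r |: Z" "z |: Z" for r z
    unfolding L_def using Zc.lext_mterm[of "carrier Z" G ?h, OF h G.abelian_group_axioms that] .
  have sa: "additive FZ FZ (\<lambda>f. r \<odot>\<^bsub>FZ\<^esub> f)" if "r |: Z" for r
    using that by (intro additiveI) (auto intro: FZ.smult_closed FZ.smult_r_distr simp del: free_module_simps)
  have Ls: "L (r \<odot>\<^bsub>FZ\<^esub> f) = \<beta> r \<otimes>\<^sub>G L f" if r: "r |: Z" and f: "f |: FZ" for r f
  proof (rule Zc.fm_additive_eqI[where F="\<lambda>f. L (r \<odot>\<^bsub>FZ\<^esub> f)" and F'="\<lambda>f. \<beta> r \<otimes>\<^sub>G L f",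
        OF additive_comp[OF sa[OF r] La] additive_comp[OF La G.additive_l_mult[OF \<beta>c[OF r]]] G.abelian_group_axioms _ f])
    fix s p assume sp: "s |: Z" "p |: Z"
    have "r \<odot>\<^bsub>FZ\<^esub> mterm Z s p = mterm Z (r \<otimes>\<^sub>Z s) p" using r by (auto simp: mterm_def)
    then show "L (r \<odot>\<^bsub>FZ\<^esub> mterm Z s p) = \<beta> r \<otimes>\<^sub>G L (mterm Z s p)"
      using r sp by (simp add: Lm \<beta>c g ring_hom_mult[OF \<beta>] G.m_assoc del: free_module_simps)
  qed
  have Lg: "L (gen z) = g z" if "z |: Z" for z
    using Lm[OF Zc.one_closed that] g[OF that] ring_hom_one[OF \<beta>] by simp
  have Ldiff: "L (x \<ominus>\<^bsub>FZ\<^esub> y) = \<zero>\<^sub>G" if "L x = L y" "x |: FZ" "y |: FZ" for x y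
    using additive_minus[OF La FZ.M.abelian_group_axioms G.abelian_group_axioms that(2,3)] that
      additive_closed[OF La that(3)] by (simp add: G.minus_eq_zero_iff)
  have sub: "submodule {f \<in> carrier FZ. L f = \<zero>\<^sub>G} Z FZ"
    using Ls \<beta>c additive_neg[OF La FZ.M.abelian_group_axioms G.abelian_group_axioms]
      additive_zero[OF La FZ.M.abelian_group_axioms G.abelian_group_axioms]
    by (intro FZ.submoduleI) (auto simp: additive_add[OF La] simp del: free_module_simps)
  have rel: "L f = \<zero>\<^sub>G" if "f \<in> der_rels" for f
    using that unfolding der_rels_def
  proof (elim UnE CollectE exE conjE)
    fix x y assume h: "f = gen (x \<oplus>\<^sub>Z y) \<ominus>\<^bsub>FZ\<^esub> (gen x \<oplus>\<^bsub>FZ\<^esub> gen y)" "x |: Z" "y |: Z"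
    show "L f = \<zero>\<^sub>G" unfolding h(1)
      by (rule Ldiff[OF _ gen_closed FZ.M.a_closed[OF gen_closed gen_closed]])
       (use h additive_add[OF La gen_closed gen_closed] in \<open>simp_all add: Lg g_add del: free_module_simps\<close>)
  next
    fix c x assume h: "f = gen (c \<odot>\<^sub>Z x) \<ominus>\<^bsub>FZ\<^esub> kap c \<odot>\<^bsub>FZ\<^esub> gen x" "c |: K" "x |: Z"
    show "L f = \<zero>\<^sub>G" unfolding h(1)
      by (rule Ldiff[OF _ gen_closed FZ.smult_closed[OF kap_closed gen_closed]])
       (use h Ls[OF kap_closed gen_closed] in \<open>simp_all add: Lg g_scalar del: free_module_simps\<close>)
  next
    fix x y assume h: "f = gen (x \<otimes>\<^sub>Z y) \<ominus>\<^bsub>FZ\<^esub> ((x \<odot>\<^bsub>FZ\<^esub> gen y) \<oplus>\<^bsub>FZ\<^esub> (y \<odot>\<^bsub>FZ\<^esub> gen x))"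
      "x |: Z" "y |: Z"
    note c = FZ.smult_closed[OF h(2) gen_closed[OF h(3)]] FZ.smult_closed[OF h(3) gen_closed[OF h(2)]]
    show "L f = \<zero>\<^sub>G" unfolding h(1)
    proof (rule Ldiff[OF _ gen_closed FZ.M.a_closed[OF c]])
      show "L (gen (x \<otimes>\<^sub>Z y)) = L ((x \<odot>\<^bsub>FZ\<^esub> gen y) \<oplus>\<^bsub>FZ\<^esub> (y \<odot>\<^bsub>FZ\<^esub> gen x))"
        unfolding additive_add[OF La c] Ls[OF h(2) gen_closed[OF h(3)]] Ls[OF h(3) gen_closed[OF h(2)]]
        using h by (simp add: Lg g_mult)
    qed (use h in simp)
  qed
  have LN: "L f = \<zero>\<^sub>G" if "f \<in> NZ" for f
    using gen_submodule_minimal[OF sub, of der_rels] rel der_rels_closed that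
    unfolding kaehler_submodule_def kaehler_relations_eq by blast
  obtain \<gamma> where \<gamma>: "additive \<Omega> G \<gamma>" "\<And>f. f |: FZ ==> \<gamma> (NZ +>\<^bsub>FZ\<^esub> f) = L f"
    using quot_alg_factor_additive[OF FZ.M.abelian_group_axioms submodule_additive_subgroup[OF NZ_submodule]
        G.abelian_group_axioms La LN] unfolding kaehler_def by metis
  show thesis
  proof
    show "additive \<Omega> G \<gamma>" by fact
    show "\<gamma> (dZ x) = g x" if "x |: Z" for x
      unfolding dZ_eq \<gamma>(2)[OF gen_closed[OF that]] by (rule Lg[OF that])
    fix r w assume r: "r |: Z" and "w |: \<Omega>"
    then obtain f where f: "f |: FZ" "w = NZ +>\<^bsub>FZ\<^esub> f"
      unfolding kaehler_def quot_alg_carrier by blast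
    show "\<gamma> (r \<odot>\<^sub>\<Omega> w) = \<beta> r \<otimes>\<^sub>G \<gamma> w"
      unfolding f(2) om_smult[OF r f(1)] \<gamma>(2)[OF f(1)] \<gamma>(2)[OF FZ.smult_closed[OF r f(1)]]
      by (rule Ls[OF r f(1)])
  qed
qed

end

section \<open>The enveloping algebra\<close>

definition lprod :: "('g, 'n) monoid_scheme => ('x => 'g) => 'x list => 'g"
  where "lprod G \<gamma> xs = foldr (\<lambda>x y. \<gamma> x \<otimes>\<^sub>G y) xs \<one>\<^sub>G"

lemma lprod_simps [simp]:
  "lprod G \<gamma> [] = \<one>\<^sub>G" "lprod G \<gamma> (x # xs) = \<gamma> x \<otimes>\<^sub>G lprod G \<gamma> xs"
  by (simp_all add: lprod_def)

lemma (in monoid) lprod_closed: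
  "(\<And>x. x \<in> set xs ==> \<gamma> x |: G) ==> lprod G \<gamma> xs |: G"
  by (induction xs) auto

lemma (in monoid) lprod_append:
  "(\<And>x. x \<in> set xs \<union> set ys ==> \<gamma> x |: G) ==>
    lprod G \<gamma> (xs @ ys) = lprod G \<gamma> xs \<otimes> lprod G \<gamma> ys"
  by (induction xs) (auto simp: lprod_closed m_assoc)

lemma (in monoid) lprod_commute:
  assumes "y |: G" "\<And>x. x \<in> set xs ==> \<gamma> x |: G"
    "\<And>x. x \<in> set xs ==> y \<otimes> \<gamma> x = \<gamma> x \<otimes> y"
  shows "y \<otimes> lprod G \<gamma> xs = lprod G \<gamma> xs \<otimes> y"
  using assms(2,3)
proof (induction xs)
  case (Cons x xs)
  have "y \<otimes> (\<gamma> x \<otimes> lprod G \<gamma> xs) = \<gamma> x \<otimes> (y \<otimes> lprod G \<gamma> xs)"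
    using Cons.prems assms(1) lprod_closed[of xs \<gamma>] by (simp flip: m_assoc)
  then show ?case using Cons assms(1) lprod_closed[of xs \<gamma>] by (simp add: m_assoc)
qed (use assms(1) in simp)

lemma (in ring) fm_restrict:
  "{f \<in> carrier (free_module R L). \<forall>w. f w \<noteq> \<zero> \<longrightarrow> P w} = carrier (free_module R {w \<in> L. P w})"
  by (auto simp: free_module_carrier; metis zero_closed)

context poisson_order
begin

sublocale KS: kaehler_setup K Z
  by (rule kaehler_setup.intro[OF algebra])

sublocale Kf: field K by (rule field)
sublocale Aa: assoc_algebra Z A by (rule assoc_algebra)

abbreviation "kap \<equiv> KS.kap"

definition iota :: "'z => 'a" where "iota z = z \<odot>\<^sub>A \<one>\<^sub>A"

lemma iota_closed [simp]: "z |: Z ==> iota z |: A"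
  by (simp add: iota_def)

lemma iota_mult:
  assumes "z |: Z" "a |: A"
  shows "iota z \<otimes>\<^sub>A a = z \<odot>\<^sub>A a" "a \<otimes>\<^sub>A iota z = z \<odot>\<^sub>A a"
  using assms by (simp_all add: iota_def Aa.smult_mult_l Aa.smult_mult_r)

lemma iota_hom: "iota \<in> ring_hom Z A"
proof (rule ring_hom_memI)
  fix x y assume xy: "x |: Z" "y |: Z"
  have "iota x \<otimes>\<^sub>A iota y = x \<odot>\<^sub>A iota y" by (rule iota_mult(1)) (use xy in auto)
  then show "iota (x \<otimes> y) = iota x \<otimes>\<^sub>A iota y" using xy by (simp add: iota_def Aa.smult_assoc1)
qed (auto simp: iota_def Aa.smult_l_distr)

lemma base_smult_iota:
  "c |: K ==> a |: A ==> base_smult Z A c a = iota (kap c) \<otimes>\<^sub>A a"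
  by (simp add: base_smult_def iota_mult KS.kap_closed) (simp add: KS.kap_def)

lemma pa_additive: "x |: Z ==> additive A A (pa x)"
  by (auto intro!: additiveI simp: pa_closed pa_add_r)

lemma pa_additive_l: "a |: A ==> additive Z A (\<lambda>x. pa x a)"
  by (auto intro!: additiveI simp: pa_closed pa_add_l)

lemma pa_iota: "x |: Z ==> y |: Z ==> pa x (iota y) = iota (pb x y)"
  by (simp add: iota_def pa_extends)

lemma pa_one: assumes x: "x |: Z" shows "pa x \<one>\<^sub>A = \<zero>\<^sub>A"
proof -
  have "pa x \<one>\<^sub>A = pa x \<one>\<^sub>A \<oplus>\<^sub>A pa x \<one>\<^sub>A"
    using pa_derivation[OF x, of "\<one>\<^sub>A" "\<one>\<^sub>A"] pa_closed[OF x, of "\<one>\<^sub>A"] by simp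
  then show ?thesis using pa_closed[OF x, of "\<one>\<^sub>A"] Aa.M.add.l_cancel_one by fastforce
qed

lemma pa_kap:
  assumes "x |: Z" "c |: K" shows "pa x (iota (kap c)) = \<zero>\<^sub>A"
  using pa_smult_r[OF assms(2,1), of "\<one>\<^sub>A"] assms pa_one
  by (simp add: base_smult_iota KS.kap_closed)

lemma pb_zero_l: "y |: Z ==> pb \<zero> y = \<zero>" and pb_add_l:
  "x |: Z ==> x' |: Z ==> y |: Z ==> pb (x \<oplus> x') y = pb x y \<oplus> pb x' y"
proof -
  show add: "pb (x \<oplus> x') y = pb x y \<oplus> pb x' y" if "x |: Z" "x' |: Z" "y |: Z" for x x' y
    using that by (simp add: pb_skew[of _ y] pb_add pb_closed KS.Zc.minus_add)
  show "pb \<zero> y = \<zero>" if "y |: Z" for y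
    using add[OF KS.Zc.zero_closed KS.Zc.zero_closed that] pb_closed[OF KS.Zc.zero_closed that]
     KS.Zc.add.l_cancel_one by fastforce
qed

lemma pb_leibniz_l:
  assumes "x |: Z" "y |: Z" "z |: Z"
  shows "pb (x \<otimes> y) z = (x \<otimes> pb y z) \<oplus> (y \<otimes> pb x z)"
  using assms by (simp add: pb_skew[of _ z] pb_leibniz pb_closed KS.Zc.minus_add KS.Zc.l_minus KS.Zc.r_minus
      KS.Zc.a_comm KS.Zc.m_comm)

abbreviation "X \<equiv> Alpha ` carrier A \<union> Delta ` carrier Z"
abbreviation "F \<equiv> env_free K Z A"
abbreviation "I \<equiv> env_ideal K Z pb A pa"
abbreviation "E \<equiv> env_algebra K Z pb A pa"
abbreviation "clE f \<equiv> I +>\<^sub>F f"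
abbreviation "ltr x \<equiv> mterm K \<one>\<^sub>K [x]"
abbreviation "al \<equiv> env_alpha K Z pb A pa"
abbreviation "de \<equiv> env_delta K Z pb A pa"

lemma F_eq: "F = monoid_algebra K (free_monoid X)"
  by (simp add: env_free_def)

sublocale WA: monoid_alg K "free_monoid X"
  by (intro monoid_alg.intro KS.Kr.ring_axioms free_monoid)

lemma F_ring: "ring F" unfolding F_eq by (rule WA.ma_ring)

sublocale Fr: ring F by (rule F_ring)

lemma F_carrier: "carrier F = carrier (free_module K (lists X))"
  by (simp add: F_eq)

definition env_rels :: "(('a, 'z) env_gen list => 'k) set"
  where "env_rels = {ltr (Alpha (a \<oplus>\<^sub>A b)) \<ominus>\<^sub>F (ltr (Alpha a) \<oplus>\<^sub>F ltr (Alpha b)) | a b. a |: A \<and> b |: A}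
    \<union> {ltr (Alpha (base_smult Z A c a)) \<ominus>\<^sub>F c \<odot>\<^sub>F ltr (Alpha a) | c a. c |: K \<and> a |: A}
    \<union> {ltr (Alpha (a \<otimes>\<^sub>A b)) \<ominus>\<^sub>F ltr (Alpha a) \<otimes>\<^sub>F ltr (Alpha b) | a b. a |: A \<and> b |: A}
    \<union> {ltr (Alpha \<one>\<^sub>A) \<ominus>\<^sub>F \<one>\<^sub>F}
    \<union> {ltr (Delta (x \<oplus> y)) \<ominus>\<^sub>F (ltr (Delta x) \<oplus>\<^sub>F ltr (Delta y)) | x y. x |: Z \<and> y |: Z}
    \<union> {ltr (Delta (c \<odot> x)) \<ominus>\<^sub>F c \<odot>\<^sub>F ltr (Delta x) | c x. c |: K \<and> x |: Z}
    \<union> {ltr (Delta (pb x y)) \<ominus>\<^sub>F (ltr (Delta x) \<otimes>\<^sub>F ltr (Delta y) \<ominus>\<^sub>F ltr (Delta y) \<otimes>\<^sub>F ltr (Delta x)) | x y.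
        x |: Z \<and> y |: Z}
    \<union> {ltr (Alpha (pa x a)) \<ominus>\<^sub>F (ltr (Delta x) \<otimes>\<^sub>F ltr (Alpha a) \<ominus>\<^sub>F ltr (Alpha a) \<otimes>\<^sub>F ltr (Delta x)) | x a.
        x |: Z \<and> a |: A}
    \<union> {ltr (Delta (x \<otimes> y)) \<ominus>\<^sub>F (ltr (Alpha (iota x)) \<otimes>\<^sub>F ltr (Delta y) \<oplus>\<^sub>F ltr (Alpha (iota y)) \<otimes>\<^sub>F ltr (Delta x)) | x y.
        x |: Z \<and> y |: Z}"

lemma env_relations_eq: "env_relations K Z pb A pa = env_rels"
  by (simp only: env_relations_def env_rels_def Let_def single_eq_mterm iota_def)

lemma mterm_F: "c |: K ==> w \<in> lists X ==> mterm K c w |: F"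
  unfolding F_carrier by (rule KS.Kr.mterm_closed)

lemma la: "a |: A ==> ltr (Alpha a) |: F" and ld: "z |: Z ==> ltr (Delta z) |: F"
  by (auto intro!: mterm_F)

lemma mterm_F_mult:
  "c |: K ==> c' |: K ==> w \<in> lists X ==> w' \<in> lists X ==>
    mterm K c w \<otimes>\<^sub>F mterm K c' w' = mterm K (c \<otimes>\<^sub>K c') (w @ w')"
  unfolding F_eq using WA.mterm_mult[of c c' w w'] by simp

lemma F_one: "\<one>\<^sub>F = mterm K \<one>\<^sub>K []" by (simp add: F_eq)

lemma F_smult: "c |: K ==> w \<in> lists X ==> c \<odot>\<^sub>F mterm K \<one>\<^sub>K w = mterm K c w"
  by (auto simp: F_eq mterm_def)

lemma bs_closed: "c |: K ==> a |: A ==> base_smult Z A c a |: A"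
  by (simp add: base_smult_iota KS.kap_closed)

lemma Fs_closed: "c |: K ==> w \<in> lists X ==> c \<odot>\<^sub>F mterm K \<one>\<^sub>K w |: F"
  by (simp only: F_smult mterm_F)

lemma env_rels_closed: "env_rels \<subseteq> carrier F"
  unfolding env_rels_def
  by (auto intro!: Fr.minus_closed Fr.a_closed Fr.m_closed la ld Fs_closed bs_closed pa_closed pb_closed
    KS.Zc.a_closed KS.Zc.m_closed KS.KZ.smult_closed)

lemma I_eq: "I = Idl\<^bsub>F\<^esub> env_rels"
  by (simp add: env_ideal_def env_relations_eq)

lemma I_ideal: "ideal I F"
  unfolding I_eq by (rule Fr.genideal_ideal[OF env_rels_closed])

lemma E_eq: "E = quot_alg F I" by (simp add: env_algebra_def)

lemma E_ring: "ring E" and clE_hom: "clE \<in> ring_hom F E"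
  unfolding E_eq by (rule quot_alg_hom[OF F_ring I_ideal])+

sublocale Er: ring E by (rule E_ring)

lemma al_eq: "al a = clE (ltr (Alpha a))" and de_eq: "de z = clE (ltr (Delta z))"
  by (simp_all add: env_alpha_def env_delta_def single_eq_mterm)

lemma al_closed [simp]: "a |: A ==> al a |: E"
  unfolding al_eq by (rule ring_hom_closed[OF clE_hom la])

lemma de_closed [simp]: "z |: Z ==> de z |: E"
  unfolding de_eq by (rule ring_hom_closed[OF clE_hom ld])

lemma clE_eqI: "f \<ominus>\<^sub>F g \<in> env_rels ==> f |: F ==> g |: F ==> clE f = clE g"
  using quot_alg_eq_iff[OF Fr.is_abelian_group ideal_additive_subgroup[OF I_ideal]]
    Fr.genideal_self[OF env_rels_closed] unfolding I_eq by blast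

lemmas clE_simps = ring_hom_add[OF clE_hom] ring_hom_mult[OF clE_hom] ring_hom_one[OF clE_hom]
  ring_hom_minus[OF clE_hom F_ring E_ring]

lemma al_hom: "al \<in> ring_hom A E"
proof (rule ring_hom_memI)
  fix a b assume ab: "a |: A" "b |: A"
  note c = la[OF ab(1)] la[OF ab(2)]
  have "clE (ltr (Alpha (a \<otimes>\<^sub>A b))) = clE (ltr (Alpha a) \<otimes>\<^sub>F ltr (Alpha b))"
    by (rule clE_eqI[OF _ la[OF Aa.m_closed[OF ab]] Fr.m_closed[OF c]])
      (unfold env_rels_def, use ab in blast)
  then show "al (a \<otimes>\<^sub>A b) = al a \<otimes>\<^sub>E al b" unfolding al_eq clE_simps(2)[OF c] .
  have "clE (ltr (Alpha (a \<oplus>\<^sub>A b))) = clE (ltr (Alpha a) \<oplus>\<^sub>F ltr (Alpha b))"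
    by (rule clE_eqI[OF _ la[OF Aa.M.a_closed[OF ab]] Fr.a_closed[OF c]])
      (unfold env_rels_def, use ab in blast)
  then show "al (a \<oplus>\<^sub>A b) = al a \<oplus>\<^sub>E al b" unfolding al_eq clE_simps(1)[OF c] .
next
  have "clE (ltr (Alpha \<one>\<^sub>A)) = clE \<one>\<^sub>F"
    by (rule clE_eqI[OF _ la[OF Aa.one_closed] Fr.one_closed]) (unfold env_rels_def, blast)
  then show "al \<one>\<^sub>A = \<one>\<^sub>E" unfolding al_eq clE_simps(3) .
qed simp

lemma de_add:
  assumes ab: "x |: Z" "y |: Z" shows "de (x \<oplus> y) = de x \<oplus>\<^sub>E de y"
proof -
  note c = ld[OF ab(1)] ld[OF ab(2)]
  have "clE (ltr (Delta (x \<oplus> y))) = clE (ltr (Delta x) \<oplus>\<^sub>F ltr (Delta y))"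
    by (rule clE_eqI[OF _ ld[OF KS.Zc.a_closed[OF ab]] Fr.a_closed[OF c]])
      (unfold env_rels_def, use ab in blast)
  then show ?thesis unfolding de_eq clE_simps(1)[OF c] .
qed

text \<open>The relations for \<open>c \<odot> \<alpha> 1\<close> and for
  \<open>\<alpha> 1 = 1\<close> identify the scalars of the free algebra with the image of
  \<open>K\<close> under \<open>al\<close>.\<close>

lemma clE_scalar: assumes c: "c |: K" shows "clE (mterm K c []) = al (iota (kap c))"
proof -
  have 1: "base_smult Z A c \<one>\<^sub>A = iota (kap c)" using c by (simp add: base_smult_iota KS.kap_closed)
  have w: "[Alpha \<one>\<^sub>A] \<in> lists X" by auto
  have e: "[] \<in> lists X" by auto
  have "clE (ltr (Alpha (base_smult Z A c \<one>\<^sub>A))) = clE (c \<odot>\<^sub>F ltr (Alpha \<one>\<^sub>A))"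
    by (rule clE_eqI[OF _ la[OF bs_closed[OF c Aa.one_closed]] Fs_closed[OF c w]])
      (unfold env_rels_def, use c in blast)
  then have "al (iota (kap c)) = clE (mterm K c [Alpha \<one>\<^sub>A])"
    unfolding al_eq 1 F_smult[OF c w] .
  also have "mterm K c [Alpha \<one>\<^sub>A] = mterm K c [] \<otimes>\<^sub>F ltr (Alpha \<one>\<^sub>A)"
    using c by (subst mterm_F_mult) auto
  also have "clE \<dots> = clE (mterm K c []) \<otimes>\<^sub>E al \<one>\<^sub>A"
    unfolding al_eq by (rule clE_simps(2)[OF mterm_F[OF c e] la[OF Aa.one_closed]])
  finally show ?thesis
    using ring_hom_one[OF al_hom] ring_hom_closed[OF clE_hom mterm_F[OF c e]] by simp
qed

lemma de_scalar:
  assumes c: "c |: K" and x: "x |: Z"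
  shows "de (c \<odot> x) = al (iota (kap c)) \<otimes>\<^sub>E de x"
proof -
  have w: "[Delta x] \<in> lists X" "[] \<in> lists X" using x by auto
  have "clE (ltr (Delta (c \<odot> x))) = clE (c \<odot>\<^sub>F ltr (Delta x))"
    by (rule clE_eqI[OF _ ld[OF KS.KZ.smult_closed[OF c x]] Fs_closed[OF c w(1)]])
      (unfold env_rels_def, use c x in blast)
  also have "c \<odot>\<^sub>F ltr (Delta x) = mterm K c [] \<otimes>\<^sub>F ltr (Delta x)"
    unfolding F_smult[OF c w(1)] using c x by (subst mterm_F_mult) auto
  also have "clE \<dots> = al (iota (kap c)) \<otimes>\<^sub>E de x"
    unfolding clE_scalar[OF c, symmetric] de_eq by (rule clE_simps(2)[OF mterm_F[OF c w(2)] ld[OF x]])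
  finally show ?thesis by (simp add: de_eq)
qed

lemma de_lie:
  assumes ab: "x |: Z" "y |: Z"
  shows "de (pb x y) = de x \<otimes>\<^sub>E de y \<ominus>\<^sub>E de y \<otimes>\<^sub>E de x"
proof -
  note c = ld[OF ab(1)] ld[OF ab(2)]
  note m = Fr.m_closed[OF c] Fr.m_closed[OF c(2,1)]
  have "clE (ltr (Delta (pb x y))) = clE (ltr (Delta x) \<otimes>\<^sub>F ltr (Delta y) \<ominus>\<^sub>F ltr (Delta y) \<otimes>\<^sub>F ltr (Delta x))"
    by (rule clE_eqI[OF _ ld[OF pb_closed[OF ab]] Fr.minus_closed[OF m]])
      (unfold env_rels_def, use ab in blast)
  then show ?thesis
    unfolding de_eq clE_simps(4)[OF m] clE_simps(2)[OF c] clE_simps(2)[OF c(2,1)] .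
qed

lemma al_pa:
  assumes ab: "x |: Z" "a |: A"
  shows "al (pa x a) = de x \<otimes>\<^sub>E al a \<ominus>\<^sub>E al a \<otimes>\<^sub>E de x"
proof -
  note c = ld[OF ab(1)] la[OF ab(2)]
  note m = Fr.m_closed[OF c] Fr.m_closed[OF c(2,1)]
  have "clE (ltr (Alpha (pa x a))) = clE (ltr (Delta x) \<otimes>\<^sub>F ltr (Alpha a) \<ominus>\<^sub>F ltr (Alpha a) \<otimes>\<^sub>F ltr (Delta x))"
    by (rule clE_eqI[OF _ la[OF pa_closed[OF ab]] Fr.minus_closed[OF m]])
      (unfold env_rels_def, use ab in blast)
  then show ?thesis
    unfolding al_eq de_eq clE_simps(4)[OF m] clE_simps(2)[OF c] clE_simps(2)[OF c(2,1)] .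
qed

lemma de_mult:
  assumes ab: "x |: Z" "y |: Z"
  shows "de (x \<otimes> y) = al (iota x) \<otimes>\<^sub>E de y \<oplus>\<^sub>E al (iota y) \<otimes>\<^sub>E de x"
proof -
  note c = la[OF iota_closed[OF ab(1)]] ld[OF ab(2)] la[OF iota_closed[OF ab(2)]] ld[OF ab(1)]
  note m = Fr.m_closed[OF c(1,2)] Fr.m_closed[OF c(3,4)]
  have "clE (ltr (Delta (x \<otimes> y))) = clE (ltr (Alpha (iota x)) \<otimes>\<^sub>F ltr (Delta y) \<oplus>\<^sub>F ltr (Alpha (iota y)) \<otimes>\<^sub>F ltr (Delta x))"
    by (rule clE_eqI[OF _ ld[OF KS.Zc.m_closed[OF ab]] Fr.a_closed[OF m]])
      (unfold env_rels_def, use ab in blast)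
  then show ?thesis
    unfolding al_eq de_eq clE_simps(1)[OF m] clE_simps(2)[OF c(1,2)] clE_simps(2)[OF c(3,4)] .
qed

section \<open>Evaluation of words, and the universal property of the enveloping algebra\<close>

definition gval :: "('a, 'z) env_gen => (('a, 'z) env_gen list => 'k) set"
  where "gval x = (case x of Alpha a => al a | Delta z => de z)"

lemma gval_closed: "x \<in> X ==> gval x |: E"
  by (auto simp: gval_def)

lemma clE_mterm:
  assumes c: "c |: K" and w: "w \<in> lists X"
  shows "clE (mterm K c w) = al (iota (kap c)) \<otimes>\<^sub>E lprod E gval w"
proof -
  have 1: "clE (mterm K \<one>\<^sub>K w) = lprod E gval w"
    using w
  proof (induction w)
    case Nil
    show ?case using clE_simps(3) by (simp add: F_one)
  next
    case (Cons x w)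
    have x: "ltr x |: F" "mterm K \<one>\<^sub>K w |: F" using Cons by (auto intro!: mterm_F)
    have g: "clE (ltr x) = gval x" by (cases x) (auto simp: gval_def al_eq de_eq)
    have "mterm K \<one>\<^sub>K (x # w) = ltr x \<otimes>\<^sub>F mterm K \<one>\<^sub>K w"
      using Cons by (subst mterm_F_mult) auto
    then show ?case using Cons clE_simps(2)[OF x] g by simp
  qed
  have "mterm K c w = mterm K c [] \<otimes>\<^sub>F mterm K \<one>\<^sub>K w"
    using c w by (subst mterm_F_mult) auto
  moreover have "clE (mterm K c [] \<otimes>\<^sub>F mterm K \<one>\<^sub>K w) = clE (mterm K c []) \<otimes>\<^sub>E clE (mterm K \<one>\<^sub>K w)"
    using c w by (intro clE_simps(2) mterm_F) auto
  ultimately show ?thesis by (simp only: 1 clE_scalar[OF c])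
qed

lemma E_lift:
  assumes G: "ring G" and f: "f \<in> ring_hom A G" and g: "additive Z G g"
    and g_scalar: "\<And>c x. c |: K ==> x |: Z ==> g (c \<odot> x) = f (iota (kap c)) \<otimes>\<^sub>G g x"
    and g_lie: "\<And>x y. x |: Z ==> y |: Z ==>
      g (pb x y) = g x \<otimes>\<^sub>G g y \<ominus>\<^sub>G g y \<otimes>\<^sub>G g x"
    and f_pa: "\<And>x a. x |: Z ==> a |: A ==>
      f (pa x a) = g x \<otimes>\<^sub>G f a \<ominus>\<^sub>G f a \<otimes>\<^sub>G g x"
    and g_mult: "\<And>x y. x |: Z ==> y |: Z ==>
      g (x \<otimes> y) = f (iota x) \<otimes>\<^sub>G g y \<oplus>\<^sub>G f (iota y) \<otimes>\<^sub>G g x"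
  obtains \<phi> where "\<phi> \<in> ring_hom E G" "\<And>a. a |: A ==> \<phi> (al a) = f a"
    "\<And>z. z |: Z ==> \<phi> (de z) = g z"
proof -
  interpret G: ring G by fact
  note fc = ring_hom_closed[OF f] and gc = additive_closed[OF g]
  define v where "v x = (case x of Alpha a => f a | Delta z => g z)" for x
  have v: "v x |: G" if "x \<in> X" for x using that by (auto simp: v_def fc gc)
  have vl: "lprod G v w |: G" if "w \<in> lists X" for w
    using that v by (intro G.lprod_closed) auto
  let ?\<eta> = "\<lambda>c. f (iota (kap c))"
  have eta: "?\<eta> \<in> ring_hom K G"
    using ring_hom_trans[OF ring_hom_trans[OF KS.kap_hom iota_hom] f] by (simp add: comp_def)
  \<comment> \<open>The scalars have to commute with every letter in order to extend to words. For a
    letter \<open>Delta z\<close> this follows from \<open>f_pa\<close>, because \<open>pa z\<close>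
    kills the image of \<open>K\<close>.\<close>
  have comm: "?\<eta> c \<otimes>\<^sub>G v x = v x \<otimes>\<^sub>G ?\<eta> c" if c: "c |: K" and x: "x \<in> X" for c x
  proof (cases x)
    case (Alpha a)
    then have a: "a |: A" using x by auto
    then show ?thesis
      using c ring_hom_mult[OF f, of "iota (kap c)" a] ring_hom_mult[OF f, of a "iota (kap c)"]
      by (simp add: v_def Alpha iota_mult KS.kap_closed)
  next
    case (Delta z)
    then have z: "z |: Z" using x by auto
    have "f (pa z (iota (kap c))) = \<zero>\<^sub>G"
      using pa_kap[OF z c] ring_hom_zero[OF f Aa.ring_axioms G] by simp
    then show ?thesis using f_pa[OF z, of "iota (kap c)"] c z
      by (simp add: v_def Delta KS.kap_closed fc gc G.minus_eq_zero_iff)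
  qed
  obtain L where L: "L \<in> ring_hom F G"
    and Lm: "\<And>c w. c |: K ==> w \<in> lists X ==> L (mterm K c w) = ?\<eta> c \<otimes>\<^sub>G lprod G v w"
  proof (rule WA.ma_lift[OF G eta, of "lprod G v"])
    fix p q assume "p \<in> carrier (free_monoid X)" "q \<in> carrier (free_monoid X)"
    then have "v x |: G" if "x \<in> set p \<union> set q" for x using v that by auto
    then show "lprod G v (p \<otimes>\<^bsub>free_monoid X\<^esub> q) = lprod G v p \<otimes>\<^sub>G lprod G v q"
      using G.lprod_append[of p q v] by simp
  next
    fix c p assume "c |: K" "p \<in> carrier (free_monoid X)"
    then show "?\<eta> c \<otimes>\<^sub>G lprod G v p = lprod G v p \<otimes>\<^sub>G ?\<eta> c"
      using comm v by (intro G.lprod_commute) (auto simp: fc KS.kap_closed)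
  qed (auto simp: vl F_eq)
  have Lx: "L (ltr x) = v x" if "x \<in> X" for x
    using Lm[of "\<one>\<^sub>K" "[x]"] that v ring_hom_one[OF eta] by simp
  have La: "L (ltr (Alpha a)) = f a" if "a |: A" for a
    using Lx[of "Alpha a"] that by (simp add: v_def)
  have Ld: "L (ltr (Delta z)) = g z" if "z |: Z" for z
    using Lx[of "Delta z"] that by (simp add: v_def)
  have Ls: "L (c \<odot>\<^sub>F ltr x) = ?\<eta> c \<otimes>\<^sub>G v x" if "c |: K" "x \<in> X" for c x
    using Lm[of c "[x]"] that v F_smult[of c "[x]"] by simp
  have Ldiff: "L (x \<ominus>\<^sub>F y) = \<zero>\<^sub>G" if "L x = L y" "x |: F" "y |: F" for x y
    using ring_hom_minus[OF L F_ring G that(2,3)] that ring_hom_closed[OF L that(3)]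
    by (simp add: G.minus_eq_zero_iff)
  note Lsimps = ring_hom_add[OF L] ring_hom_mult[OF L] ring_hom_one[OF L] ring_hom_minus[OF L F_ring G]
  note cls = la ld Fr.m_closed Fr.a_closed Fr.minus_closed Fs_closed bs_closed pa_closed pb_closed
    KS.Zc.a_closed KS.Zc.m_closed KS.KZ.smult_closed Aa.M.a_closed Aa.m_closed iota_closed
  have rel: "L x = \<zero>\<^sub>G" if "x \<in> env_rels" for x
    using that unfolding env_rels_def
  proof (elim UnE CollectE exE conjE)
    fix a b assume h: "x = ltr (Alpha (a \<oplus>\<^sub>A b)) \<ominus>\<^sub>F (ltr (Alpha a) \<oplus>\<^sub>F ltr (Alpha b))" "a |: A" "b |: A"
    show "L x = \<zero>\<^sub>G" unfolding h(1)
      by (rule Ldiff) (use h in \<open>simp_all add: cls Lsimps La ring_hom_add[OF f]\<close>)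
  next
    fix c a assume h: "x = ltr (Alpha (base_smult Z A c a)) \<ominus>\<^sub>F c \<odot>\<^sub>F ltr (Alpha a)" "c |: K" "a |: A"
    show "L x = \<zero>\<^sub>G" unfolding h(1)
      by (rule Ldiff) (use h in \<open>simp_all add: cls Ls La v_def base_smult_iota KS.kap_closed ring_hom_mult[OF f]\<close>)
  next
    fix a b assume h: "x = ltr (Alpha (a \<otimes>\<^sub>A b)) \<ominus>\<^sub>F ltr (Alpha a) \<otimes>\<^sub>F ltr (Alpha b)" "a |: A" "b |: A"
    show "L x = \<zero>\<^sub>G" unfolding h(1)
      by (rule Ldiff) (use h in \<open>simp_all add: cls Lsimps La ring_hom_mult[OF f]\<close>)
  next
    assume h: "x \<in> {ltr (Alpha \<one>\<^sub>A) \<ominus>\<^sub>F \<one>\<^sub>F}"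
    show "L x = \<zero>\<^sub>G" unfolding singletonD[OF h]
      by (rule Ldiff) (simp_all add: cls Lsimps La ring_hom_one[OF f])
  next
    fix y z assume h: "x = ltr (Delta (y \<oplus> z)) \<ominus>\<^sub>F (ltr (Delta y) \<oplus>\<^sub>F ltr (Delta z))" "y |: Z" "z |: Z"
    show "L x = \<zero>\<^sub>G" unfolding h(1)
      by (rule Ldiff) (use h in \<open>simp_all add: cls Lsimps Ld additive_add[OF g]\<close>)
  next
    fix c z assume h: "x = ltr (Delta (c \<odot> z)) \<ominus>\<^sub>F c \<odot>\<^sub>F ltr (Delta z)" "c |: K" "z |: Z"
    show "L x = \<zero>\<^sub>G" unfolding h(1)
      by (rule Ldiff) (use h in \<open>simp_all add: cls Ls Ld v_def g_scalar\<close>)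
  next
    fix y z assume h: "x = ltr (Delta (pb y z)) \<ominus>\<^sub>F (ltr (Delta y) \<otimes>\<^sub>F ltr (Delta z) \<ominus>\<^sub>F ltr (Delta z) \<otimes>\<^sub>F ltr (Delta y))"
      "y |: Z" "z |: Z"
    show "L x = \<zero>\<^sub>G" unfolding h(1)
      by (rule Ldiff) (use h in \<open>simp_all add: cls Lsimps Ld g_lie\<close>)
  next
    fix y a assume h: "x = ltr (Alpha (pa y a)) \<ominus>\<^sub>F (ltr (Delta y) \<otimes>\<^sub>F ltr (Alpha a) \<ominus>\<^sub>F ltr (Alpha a) \<otimes>\<^sub>F ltr (Delta y))"
      "y |: Z" "a |: A"
    show "L x = \<zero>\<^sub>G" unfolding h(1)
      by (rule Ldiff) (use h in \<open>simp_all add: cls Lsimps La Ld f_pa\<close>)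
  next
    fix y z assume h: "x = ltr (Delta (y \<otimes> z)) \<ominus>\<^sub>F (ltr (Alpha (iota y)) \<otimes>\<^sub>F ltr (Delta z) \<oplus>\<^sub>F ltr (Alpha (iota z)) \<otimes>\<^sub>F ltr (Delta y))"
      "y |: Z" "z |: Z"
    show "L x = \<zero>\<^sub>G" unfolding h(1)
      by (rule Ldiff) (use h in \<open>simp_all add: cls Lsimps La Ld g_mult\<close>)
  qed
  obtain \<phi> where \<phi>: "\<phi> \<in> ring_hom (quot_alg F I) G" "\<And>f. f |: F ==> \<phi> (clE f) = L f"
    using quot_alg_factor[OF F_ring I_ideal G L]
      ring_hom_Idl_zero[OF F_ring G L env_rels_closed rel] unfolding I_eq by metis
  show thesis
  proof
    show "\<phi> \<in> ring_hom E G" using \<phi>(1) unfolding E_eq .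
    show "\<phi> (al a) = f a" if "a |: A" for a
      unfolding al_eq \<phi>(2)[OF la[OF that]] by (rule La[OF that])
    show "\<phi> (de z) = g z" if "z |: Z" for z
      unfolding de_eq \<phi>(2)[OF ld[OF that]] by (rule Ld[OF that])
  qed
qed

subsection \<open>The filtration\<close>

abbreviation "Fil \<equiv> pbw_filtration K Z pb A pa"
abbreviation "ndelta w \<equiv> length (filter is_Delta w)"
abbreviation "W i \<equiv> {w \<in> lists X. ndelta w \<le> i}"

lemma Fil_eq: "Fil i = clE ` carrier (free_module K (W i))"
proof -
  have "{f \<in> carrier F. \<forall>w. f w \<noteq> \<zero>\<^sub>K \<longrightarrow> ndelta w \<le> i} = carrier (free_module K (W i))"
    unfolding F_carrier by (rule KS.Kr.fm_restrict)
  then show ?thesis by (simp add: pbw_filtration_def)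
qed

lemma WF: "f \<in> carrier (free_module K (W i)) ==> f |: F"
  unfolding F_carrier by (rule KS.Kr.fm_mono_set[rotated]) auto

lemma F_fm: "add F = add (free_module K Y)" "zero F = zero (free_module K Y)"
  by (simp_all add: F_eq fun_eq_iff)

lemma Fil_filtered: "filtered_ring E Fil"
proof (intro filtered_ring.intro E_ring filtered_ring_axioms.intro)
  fix i
  interpret Wm: abelian_group "free_module K (W i)" by (rule KS.Kr.fm_abelian_group)
  have neg: "\<ominus>\<^sub>F f \<in> carrier (free_module K (W i))" if f: "f \<in> carrier (free_module K (W i))" for f
  proof -
    have "\<ominus>\<^sub>F f = \<ominus>\<^bsub>free_module K (W i)\<^esub> f"
      using Wm.l_neg[OF f] WF[OF f] WF[OF Wm.a_inv_closed[OF f]]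
      by (intro Fr.minus_equality) (simp_all only: F_fm[of "W i"])
    then show ?thesis using f by simp
  qed
  show "additive_subgroup (Fil i) E"
  proof (intro additive_subgroup.intro Er.add.subgroupI)
    show "Fil i \<subseteq> carrier E" unfolding Fil_eq using ring_hom_closed[OF clE_hom WF] by blast
    show "Fil i \<noteq> {}" unfolding Fil_eq using Wm.zero_closed by blast
  next
    fix x assume "x \<in> Fil i"
    then obtain f where f: "f \<in> carrier (free_module K (W i))" "x = clE f" unfolding Fil_eq by blast
    show "\<ominus>\<^sub>E x \<in> Fil i"
      unfolding f(2) ring_hom_neg[OF clE_hom F_ring E_ring WF[OF f(1)], symmetric]
      using neg[OF f(1)] unfolding Fil_eq by blast
    fix y assume "y \<in> Fil i"
    then obtain g where g: "g \<in> carrier (free_module K (W i))" "y = clE g" unfolding Fil_eq by blast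
    have "clE (f \<oplus>\<^sub>F g) \<in> Fil i" unfolding Fil_eq F_fm[of "W i"] using Wm.a_closed[OF f(1) g(1)] by blast
    then show "x \<oplus>\<^sub>E y \<in> Fil i"
      unfolding f(2) g(2) by (simp only: ring_hom_add[OF clE_hom WF[OF f(1)] WF[OF g(1)]])
  qed
next
  fix i show "Fil i \<subseteq> Fil (Suc i)"
    unfolding Fil_eq by (rule image_mono) (auto intro: KS.Kr.fm_mono_set[rotated])
next
  fix i j x y assume "x \<in> Fil i" "y \<in> Fil j"
  then obtain f g where f: "f \<in> carrier (free_module K (W i))" "x = clE f"
    and g: "g \<in> carrier (free_module K (W j))" "y = clE g" unfolding Fil_eq by blast
  have fg: "f \<in> carrier (free_module K (carrier (free_monoid X)))" "g \<in> carrier (free_module K (carrier (free_monoid X)))"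
    using WF[OF f(1)] WF[OF g(1)] by (simp_all add: F_carrier)
  have "f \<otimes>\<^sub>F g \<in> carrier (free_module K (W (i + j)))"
  proof -
    \<comment> \<open>A word in the support of a product is a concatenation of words in the supports
      of the factors, and the number of letters \<open>Delta\<close> is additive under
      concatenation.\<close>
    have "ndelta w \<le> i + j" if nz: "(f \<otimes>\<^sub>F g) w \<noteq> \<zero>\<^sub>K" for w
    proof -
      obtain p q where pq: "f p \<noteq> \<zero>\<^sub>K" "g q \<noteq> \<zero>\<^sub>K" "w = p @ q"
        using WA.ma_mult_support[OF fg nz[unfolded F_eq]] by auto
      have "p \<in> W i" "q \<in> W j"
        using KS.Kr.fm_outside[OF f(1)] KS.Kr.fm_outside[OF g(1)] pq by blast+
      then show ?thesis using pq by simp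
    qed
    moreover have "f \<otimes>\<^sub>F g \<in> carrier (free_module K (lists X))"
      using Fr.m_closed[OF WF[OF f(1)] WF[OF g(1)]] by (simp add: F_carrier)
    ultimately show ?thesis unfolding free_module_carrier by blast
  qed
  then have "clE (f \<otimes>\<^sub>F g) \<in> Fil (i + j)" unfolding Fil_eq by blast
  then show "x \<otimes>\<^sub>E y \<in> Fil (i + j)"
    unfolding f(2) g(2) by (simp only: ring_hom_mult[OF clE_hom WF[OF f(1)] WF[OF g(1)]])
next
  have "mterm K \<one>\<^sub>K [] \<in> carrier (free_module K (W 0))" by (rule KS.Kr.mterm_closed) auto
  then show "\<one>\<^sub>E \<in> Fil 0" unfolding Fil_eq ring_hom_one[OF clE_hom, symmetric] F_one by blast
qed

sublocale FE: filtered_ring E Fil by (rule Fil_filtered)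

abbreviation "GE \<equiv> gr_env K Z pb A pa"

lemma GE_eq: "GE = FE.G" by (simp add: gr_env_def)

sublocale GEr: ring GE unfolding GE_eq by (rule FE.gr_ring_hom)

text \<open>Reduces statements about a filtered piece to words with at most \<open>i\<close> letters
  \<open>Delta\<close>, each multiplied by a scalar; these words span the piece by
  definition.\<close>

lemma Fil_induct [consumes 1, case_names zero add]:
  assumes x: "x \<in> Fil i" and zero: "P \<zero>\<^sub>E"
    and add: "\<And>c w y. \<lbrakk>c |: K; w \<in> W i; y \<in> Fil i; P y\<rbrakk> \<Longrightarrow>
      P ((al (iota (kap c)) \<otimes>\<^sub>E lprod E gval w) \<oplus>\<^sub>E y)"
  shows "P x"
proof -
  obtain f where f: "f \<in> carrier (free_module K (W i))" "x = clE f" using x unfolding Fil_eq by blast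
  from f(1) have "P (clE f)"
  proof (induction rule: KS.Kr.fm_induct)
    case zero
    show ?case
      using assms(2) ring_hom_zero[OF clE_hom F_ring E_ring] by (simp add: F_fm[of "{}"])
  next
    case (add c w f)
    have m: "mterm K c w \<in> carrier (free_module K (W i))" using add by auto
    have w: "w \<in> lists X" using add by auto
    have "P (clE (mterm K c w) \<oplus>\<^sub>E clE f)"
      unfolding clE_mterm[OF add(1) w]
      using add by (intro assms(3)) (auto simp: Fil_eq)
    then show ?case unfolding F_fm[of "W i", symmetric] clE_simps(1)[OF WF[OF m] WF[OF add(3)]] .
  qed
  then show ?thesis using f by simp
qed

lemma al_Fil: "a |: A ==> al a \<in> Fil 0"
  and de_Fil: "z |: Z ==> de z \<in> Fil 1"
  unfolding Fil_eq al_eq de_eq by (auto intro!: imageI KS.Kr.mterm_closed)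

lemma lprod_Fil: "w \<in> lists X ==> lprod E gval w \<in> Fil (ndelta w)"
proof (induction w)
  case Nil
  then show ?case by (simp add: FE.Fil_one)
next
  case (Cons x w)
  then have w: "lprod E gval w \<in> Fil (ndelta w)" and x: "x \<in> X" by auto
  show ?case
  proof (cases x)
    case (Alpha a)
    then have "al a \<in> Fil 0" using x by (auto intro: al_Fil)
    from FE.Fil_mult[OF this w] show ?thesis by (simp add: Alpha gval_def[of "Alpha _"])
  next
    case (Delta z)
    then have "de z \<in> Fil 1" using x de_Fil[of z] by auto
    from FE.Fil_mult[OF this w] show ?thesis by (simp add: Delta gval_def[of "Delta _"])
  qed
qed

end

lemma (in sym_setup) SA_assoc_algebra: "assoc_algebra R SA"
proof -
  interpret S: ring SA by (rule SA_ring)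
  note sc = ring_hom_closed[OF scal_hom]
  show ?thesis
  proof (intro assoc_algebra.intro assoc_algebra_axioms.intro SA_ring moduleI R.is_cring S.is_abelian_group)
    fix r x y assume r: "r |: R" and x: "x |: SA" and y: "y |: SA"
    show "(r \<odot>\<^bsub>SA\<^esub> x) \<otimes>\<^bsub>SA\<^esub> y = r \<odot>\<^bsub>SA\<^esub> (x \<otimes>\<^bsub>SA\<^esub> y)"
      using r x y by (simp add: smult_SA sc S.m_assoc)
    show "x \<otimes>\<^bsub>SA\<^esub> (r \<odot>\<^bsub>SA\<^esub> y) = r \<odot>\<^bsub>SA\<^esub> (x \<otimes>\<^bsub>SA\<^esub> y)"
      using r x y SA_comm[OF x sc[OF r]] by (simp add: smult_SA sc flip: S.m_assoc)
  qed (auto simp: smult_SA sc ring_hom_add[OF scal_hom] ring_hom_mult[OF scal_hom] ring_hom_one[OF scal_hom]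
      S.l_distr S.r_distr S.m_assoc)
qed

lemma (in filtered_ring) cls_eqI:
  assumes "x \<in> Fil i" "y \<in> Fil i" "x \<ominus> y \<in> prev i" shows "cls i x = cls i y"
  using assms prev_coset_eq_iff[of x y i] Fil_carrier by (auto simp: gr_elem_def fun_eq_iff)

section \<open>The natural map\<close>

context poisson_order
begin

abbreviation "SO \<equiv> sym_algebra Z (kaehler K Z)"

sublocale TS: tensor_setup Z A SO
  by (rule tensor_setup.intro[OF assoc_algebra KS.Om.SA_assoc_algebra])

abbreviation "T \<equiv> pbw_source K Z A"

lemma T_eq: "T = TS.TA" by (simp add: pbw_source_def)

sublocale Tr: ring T unfolding T_eq by (rule TS.TA_ring)

definition theta :: "'z => ('a \<times> (('z => 'z) set multiset => 'z) set => 'z) set"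
  where "theta z = TS.sg (sym_incl Z (kaehler K Z) (kaehler_d K Z z))"

abbreviation "tau \<equiv> TS.tau"
abbreviation "incl w \<equiv> sym_incl Z (kaehler K Z) w"

lemmas tau_hom = TS.tau_hom[folded T_eq]
lemmas sg_hom = TS.sg_hom[folded T_eq]
lemmas tau_closed = ring_hom_closed[OF tau_hom]

lemma incl_d_closed: "z |: Z ==> incl (KS.dZ z) |: SO"
  by (intro KS.Om.sym_incl_closed KS.dZ_closed)

lemma theta_closed: "z |: Z ==> theta z |: T"
  unfolding theta_def by (rule ring_hom_closed[OF sg_hom incl_d_closed])

lemma theta_tau: "a |: A ==> z |: Z ==> tau a \<otimes>\<^sub>T theta z = theta z \<otimes>\<^sub>T tau a"
  unfolding theta_def T_eq by (rule TS.tau_sg_comm[OF _ incl_d_closed])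

lemma theta_comm: "x |: Z ==> z |: Z ==> theta x \<otimes>\<^sub>T theta z = theta z \<otimes>\<^sub>T theta x"
  unfolding theta_def
  by (simp only: ring_hom_mult[OF sg_hom incl_d_closed incl_d_closed, symmetric]
      KS.Om.SA_comm[OF incl_d_closed incl_d_closed, of x z])

lemma scal_smult: "r |: Z ==> KS.Om.scal r = r \<odot>\<^bsub>SO\<^esub> \<one>\<^bsub>SO\<^esub>"
  using KS.Om.smult_SA[of r "\<one>\<^bsub>SO\<^esub>"] ring_hom_closed[OF KS.Om.scal_hom, of r]
    ring.ring_simprules(6)[OF KS.Om.SA_ring] TS.S.r_one by simp

lemma sg_scal: "r |: Z ==> TS.sg (KS.Om.scal r) = tau (iota r)"
  by (simp add: scal_smult iota_def TS.tau_sg_scalar)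

lemma theta_add:
  assumes "x |: Z" "y |: Z" shows "theta (x \<oplus> y) = theta x \<oplus>\<^sub>T theta y"
  unfolding theta_def KS.dZ_add[OF assms]
    KS.Om.sym_incl_add[OF KS.dZ_closed[OF assms(1)] KS.dZ_closed[OF assms(2)]]
  by (rule ring_hom_add[OF sg_hom incl_d_closed[OF assms(1)] incl_d_closed[OF assms(2)]])

lemma sg_smult:
  assumes r: "r |: Z" and w: "w |: KS.\<Omega>"
  shows "TS.sg (incl (r \<odot>\<^bsub>KS.\<Omega>\<^esub> w)) = tau (iota r) \<otimes>\<^sub>T TS.sg (incl w)"
  unfolding KS.Om.sym_incl_smult[OF r w] sg_scal[OF r, symmetric]
  by (rule ring_hom_mult[OF sg_hom ring_hom_closed[OF KS.Om.scal_hom r] KS.Om.sym_incl_closed[OF w]])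

lemma theta_scalar:
  assumes "c |: K" "x |: Z"
  shows "theta (c \<odot> x) = tau (iota (kap c)) \<otimes>\<^sub>T theta x"
  unfolding theta_def KS.dZ_scalar[OF assms]
  by (rule sg_smult[OF KS.kap_closed[OF assms(1)] KS.dZ_closed[OF assms(2)]])

lemma theta_mult:
  assumes "x |: Z" "y |: Z"
  shows "theta (x \<otimes> y) = (tau (iota x) \<otimes>\<^sub>T theta y) \<oplus>\<^sub>T (tau (iota y) \<otimes>\<^sub>T theta x)"
proof -
  note d = KS.dZ_closed[OF assms(1)] KS.dZ_closed[OF assms(2)]
  note sm = KS.Om.smult_closed[OF assms(1) d(2)] KS.Om.smult_closed[OF assms(2) d(1)]
  show ?thesis
    unfolding theta_def KS.dZ_mult[OF assms] KS.Om.sym_incl_add[OF sm]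
      ring_hom_add[OF sg_hom KS.Om.sym_incl_closed[OF sm(1)] KS.Om.sym_incl_closed[OF sm(2)]]
      sg_smult[OF assms(1) d(2)] sg_smult[OF assms(2) d(1)] ..
qed

section \<open>Monomials in differentials, with coefficients in \<open>A\<close>, that span the
  source\<close>

definition tmon :: "'a => 'z list => ('a \<times> (('z => 'z) set multiset => 'z) set => 'z) set"
  where "tmon a zs = tau a \<otimes>\<^sub>T lprod T theta zs"

definition tmons :: "('a \<times> (('z => 'z) set multiset => 'z) set => 'z) set set"
  where "tmons = {tmon a zs | a zs. a |: A \<and> set zs \<subseteq> carrier Z}"

lemma lprod_theta_closed: "set zs \<subseteq> carrier Z ==> lprod T theta zs |: T"
  by (intro Tr.lprod_closed theta_closed) auto

lemma tmon_closed: "a |: A ==> set zs \<subseteq> carrier Z ==> tmon a zs |: T"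
  by (simp add: tmon_def tau_closed lprod_theta_closed)

lemma tmons_closed: "tmons \<subseteq> carrier T"
  using tmon_closed by (auto simp: tmons_def)

lemmas tspan_add = aspan_add[OF Tr.is_abelian_group tmons_closed]
lemmas tspan_closed = aspan_closed[OF Tr.is_abelian_group tmons_closed]

lemma tspan_tau_mult:
  assumes a: "a |: A" and t: "t \<in> aspan T tmons" shows "tau a \<otimes>\<^sub>T t \<in> aspan T tmons"
proof (rule aspan_additive_image[OF Tr.additive_l_mult[OF tau_closed[OF a]] Tr.is_abelian_group Tr.is_abelian_group
      tmons_closed tmons_closed _ t])
  fix x assume "x \<in> tmons"
  then obtain b zs where x: "x = tmon b zs" "b |: A" "set zs \<subseteq> carrier Z" by (auto simp: tmons_def)
  have "tau a \<otimes>\<^sub>T x = tmon (a \<otimes>\<^sub>A b) zs"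
    using x a by (simp add: tmon_def ring_hom_mult[OF tau_hom] Tr.m_assoc tau_closed lprod_theta_closed)
  then have "tau a \<otimes>\<^sub>T x \<in> tmons" using x a by (auto simp: tmons_def)
  then show "tau a \<otimes>\<^sub>T x \<in> aspan T tmons" by (rule aspan_base[OF Tr.is_abelian_group tmons_closed])
qed

lemma tspan_theta_mult:
  assumes z: "z |: Z" and t: "t \<in> aspan T tmons" shows "theta z \<otimes>\<^sub>T t \<in> aspan T tmons"
proof (rule aspan_additive_image[OF Tr.additive_l_mult[OF theta_closed[OF z]] Tr.is_abelian_group Tr.is_abelian_group
      tmons_closed tmons_closed _ t])
  fix x assume "x \<in> tmons"
  then obtain b zs where x: "x = tmon b zs" "b |: A" "set zs \<subseteq> carrier Z" by (auto simp: tmons_def)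
  have "theta z \<otimes>\<^sub>T x = (theta z \<otimes>\<^sub>T tau b) \<otimes>\<^sub>T lprod T theta zs"
    using x z by (simp add: tmon_def Tr.m_assoc tau_closed theta_closed lprod_theta_closed)
  also have "\<dots> = tmon b (z # zs)"
    using x z by (simp add: tmon_def Tr.m_assoc tau_closed theta_closed lprod_theta_closed flip: theta_tau)
  finally have "theta z \<otimes>\<^sub>T x \<in> tmons" using x z unfolding tmons_def by force
  then show "theta z \<otimes>\<^sub>T x \<in> aspan T tmons" by (rule aspan_base[OF Tr.is_abelian_group tmons_closed])
qed

lemma tspan_tau: "a |: A ==> tau a \<in> aspan T tmons"
  by (rule aspan_base[OF Tr.is_abelian_group tmons_closed])
    (auto simp: tmons_def tmon_def tau_closed intro!: exI[of _ a] exI[of _ "[]"])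

lemma tspan_incl_mult:
  assumes w: "w |: KS.\<Omega>" and t: "t \<in> aspan T tmons" shows "TS.sg (incl w) \<otimes>\<^sub>T t \<in> aspan T tmons"
  using w
proof (induction rule: KS.om_induct[consumes 1, case_names 1 2])
  case (1 r z)
  have "TS.sg (incl (r \<odot>\<^bsub>KS.\<Omega>\<^esub> KS.dZ z)) \<otimes>\<^sub>T t = tau (iota r) \<otimes>\<^sub>T (theta z \<otimes>\<^sub>T t)"
    using 1 tspan_closed[OF t]
    by (simp add: sg_smult KS.dZ_closed theta_closed tau_closed Tr.m_assoc flip: theta_def)
  then show ?case using 1 t by (simp add: tspan_tau_mult tspan_theta_mult)
next
  case (2 v w)
  note c = KS.Om.sym_incl_closed[OF 2(1)] KS.Om.sym_incl_closed[OF 2(2)]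
  note c' = ring_hom_closed[OF sg_hom c(1)] ring_hom_closed[OF sg_hom c(2)]
  have "TS.sg (incl (v \<oplus>\<^bsub>KS.\<Omega>\<^esub> w)) \<otimes>\<^sub>T t = (TS.sg (incl v) \<otimes>\<^sub>T t) \<oplus>\<^sub>T (TS.sg (incl w) \<otimes>\<^sub>T t)"
    unfolding KS.Om.sym_incl_add[OF 2(1,2)] ring_hom_add[OF sg_hom c]
    by (rule Tr.l_distr[OF c' tspan_closed[OF t]])
  then show ?case using tspan_add[OF 2(3,4)] by simp
qed

lemma T_span:
  assumes "t |: T" shows "t \<in> aspan T tmons"
proof -
  have sg: "TS.sg s \<in> aspan T tmons" if "s |: SO" for s
    using that
  proof (induction rule: KS.Om.SA_induct[consumes 1, case_names 1 2 3])
    case (1 r)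
    then show ?case by (simp add: sg_scal tspan_tau)
  next
    case (2 s t)
    then show ?case by (simp add: ring_hom_add[OF sg_hom] tspan_add)
  next
    case (3 m s)
    then show ?case
      by (simp add: ring_hom_mult[OF sg_hom KS.Om.sym_incl_closed] tspan_incl_mult)
  qed
  have "t |: TS.TA" using assms by (simp add: T_eq)
  then show ?thesis
  proof (induction rule: TS.TA_induct[consumes 1, case_names 1 2])
    case (1 a b)
    then show ?case using tspan_tau_mult[OF _ sg] by (simp add: TS.te_tau_sg T_eq)
  next
    case (2 s t)
    then show ?case using tspan_add by (simp add: T_eq)
  qed
qed

abbreviation "cls \<equiv> FE.cls"

abbreviation "natural \<equiv> natural_pbw_map K Z pb A pa"

lemma natural_iff:
  "natural \<phi> \<longleftrightarrow> \<phi> \<in> ring_hom T GE \<and> (\<forall>a\<in>carrier A. \<phi> (tau a) = cls 0 (al a)) \<and>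
     (\<forall>z\<in>carrier Z. \<phi> (theta z) = cls 1 (de z))"
  by (simp add: natural_pbw_map_def Let_def theta_def TS.tau_def TS.sg_def)

lemma fil_prev_Suc: "fil_prev R \<F> (Suc i) = \<F> i" by (simp add: fil_prev_def)

lemma cls_al_hom: "(\<lambda>a. cls 0 (al a)) \<in> ring_hom A GE"
  unfolding GE_eq
  by (rule ring_hom_memI)
    (use FE.cls_mult[of _ 0 _ 0] in \<open>auto simp: FE.cls_closed al_Fil FE.cls_add ring_hom_mult[OF al_hom] ring_hom_add[OF al_hom]
        ring_hom_one[OF al_hom] FE.gr_one\<close>)

text \<open>The commutator of \<open>de z\<close> and \<open>al a\<close> is
  \<open>al (pa z a)\<close>, of degree 0 instead of 1.\<close>

lemma cls_al_de:
  assumes a: "a |: A" and z: "z |: Z"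
  shows "cls 0 (al a) \<otimes>\<^bsub>GE\<^esub> cls 1 (de z) = cls 1 (de z) \<otimes>\<^bsub>GE\<^esub> cls 0 (al a)"
proof -
  have F1: "de z \<otimes>\<^sub>E al a \<in> Fil 1" "al a \<otimes>\<^sub>E de z \<in> Fil 1"
    using FE.Fil_mult[OF de_Fil[OF z] al_Fil[OF a]] FE.Fil_mult[OF al_Fil[OF a] de_Fil[OF z]] by simp_all
  have "cls 1 (de z \<otimes>\<^sub>E al a) = cls 1 (al a \<otimes>\<^sub>E de z)"
    using al_pa[OF z a] al_Fil[OF pa_closed[OF z a]]
    by (intro FE.cls_eqI F1) (simp add: fil_prev_Suc)
  then show ?thesis unfolding GE_eq
    using FE.cls_mult[OF al_Fil[OF a] de_Fil[OF z]] FE.cls_mult[OF de_Fil[OF z] al_Fil[OF a]] by simp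
qed

text \<open>The commutator of \<open>de x\<close> and \<open>de z\<close> is
  \<open>de (pb x z)\<close>, of degree 1 instead of 2.\<close>

lemma cls_de_de:
  assumes x: "x |: Z" and z: "z |: Z"
  shows "cls 1 (de x) \<otimes>\<^bsub>GE\<^esub> cls 1 (de z) = cls 1 (de z) \<otimes>\<^bsub>GE\<^esub> cls 1 (de x)"
proof -
  have "cls (1 + 1) (de x \<otimes>\<^sub>E de z) = cls (1 + 1) (de z \<otimes>\<^sub>E de x)"
    using de_lie[OF x z] de_Fil[OF pb_closed[OF x z]]
    by (intro FE.cls_eqI FE.Fil_mult de_Fil x z) (simp add: fil_prev_Suc)
  then show ?thesis unfolding GE_eq
    using FE.cls_mult[OF de_Fil[OF x] de_Fil[OF z]] FE.cls_mult[OF de_Fil[OF z] de_Fil[OF x]] by simp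
qed

lemma natural_exists: "\<exists>\<phi>. natural \<phi>"
proof -
  let ?f = "\<lambda>a. cls 0 (al a)" and ?g = "\<lambda>z. cls 1 (de z)"
  let ?\<beta> = "\<lambda>z. ?f (iota z)"
  note fc = ring_hom_closed[OF cls_al_hom]
  have beta: "?\<beta> \<in> ring_hom Z GE"
    using ring_hom_trans[OF iota_hom cls_al_hom] by (simp add: comp_def)
  have gc: "?g z |: GE" if "z |: Z" for z
    unfolding GE_eq by (rule FE.cls_closed[OF de_Fil[OF that]])
  have fg: "?f a \<otimes>\<^bsub>GE\<^esub> ?g z = cls 1 (al a \<otimes>\<^sub>E de z)" "al a \<otimes>\<^sub>E de z \<in> Fil 1"
    if "a |: A" "z |: Z" for a z
    unfolding GE_eq using FE.cls_mult[OF al_Fil[OF that(1)] de_Fil[OF that(2)]]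
      FE.Fil_mult[OF al_Fil[OF that(1)] de_Fil[OF that(2)]] by simp_all
  obtain \<gamma> where \<gamma>: "additive KS.\<Omega> GE \<gamma>"
    and \<gamma>s: "\<And>r w. r |: Z ==> w |: KS.\<Omega> ==> \<gamma> (r \<odot>\<^bsub>KS.\<Omega>\<^esub> w) = ?\<beta> r \<otimes>\<^bsub>GE\<^esub> \<gamma> w"
    and \<gamma>d: "\<And>x. x |: Z ==> \<gamma> (KS.dZ x) = ?g x"
  proof (rule KS.om_lift[OF GEr.ring_axioms beta, of ?g])
    fix x y assume xy: "x |: Z" "y |: Z"
    show "?g (x \<oplus> y) = ?g x \<oplus>\<^bsub>GE\<^esub> ?g y"
      unfolding GE_eq using xy by (simp only: de_add FE.cls_add[OF de_Fil de_Fil])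
    show "?g (x \<otimes> y) = ?\<beta> x \<otimes>\<^bsub>GE\<^esub> ?g y \<oplus>\<^bsub>GE\<^esub> ?\<beta> y \<otimes>\<^bsub>GE\<^esub> ?g x"
      unfolding de_mult[OF xy] fg(1)[OF iota_closed[OF xy(1)] xy(2)] fg(1)[OF iota_closed[OF xy(2)] xy(1)]
      unfolding GE_eq FE.cls_add[OF fg(2)[OF iota_closed[OF xy(1)] xy(2)] fg(2)[OF iota_closed[OF xy(2)] xy(1)]] ..
  next
    fix c x assume cx: "c |: K" "x |: Z"
    show "?g (c \<odot> x) = ?\<beta> (KS.kap c) \<otimes>\<^bsub>GE\<^esub> ?g x"
      unfolding de_scalar[OF cx] fg(1)[OF iota_closed[OF KS.kap_closed[OF cx(1)]] cx(2)] ..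
  qed (use gc in auto)
  note \<gamma>c = additive_closed[OF \<gamma>]
  \<comment> \<open>An element that commutes with the classes of \<open>Z\<close> and of all
    \<open>de z\<close> commutes with the image of the differentials, since these are sums of
    multiples of \<open>dZ z\<close>. It is applied to the class of \<open>al a\<close>, to that of
    \<open>de z\<close>, and then to \<open>\<gamma> v\<close> itself.\<close>
  have cen: "y \<otimes>\<^bsub>GE\<^esub> \<gamma> w = \<gamma> w \<otimes>\<^bsub>GE\<^esub> y"
    if w: "w |: KS.\<Omega>" and y: "y |: GE"
      "\<And>r. r |: Z ==> y \<otimes>\<^bsub>GE\<^esub> ?\<beta> r = ?\<beta> r \<otimes>\<^bsub>GE\<^esub> y"
      "\<And>z. z |: Z ==> y \<otimes>\<^bsub>GE\<^esub> ?g z = ?g z \<otimes>\<^bsub>GE\<^esub> y" for w y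
    using w
  proof (induction rule: KS.om_induct[consumes 1, case_names 1 2])
    case (1 r z)
    have b: "?\<beta> r |: GE" "?g z |: GE" using fc gc 1 by auto
    have "y \<otimes>\<^bsub>GE\<^esub> (?\<beta> r \<otimes>\<^bsub>GE\<^esub> ?g z) = ?\<beta> r \<otimes>\<^bsub>GE\<^esub> (y \<otimes>\<^bsub>GE\<^esub> ?g z)"
      using b y(1) y(2)[OF 1(1)] by (simp flip: GEr.m_assoc)
    also have "\<dots> = ?\<beta> r \<otimes>\<^bsub>GE\<^esub> ?g z \<otimes>\<^bsub>GE\<^esub> y" using b y(1) y(3)[OF 1(2)] by (simp add: GEr.m_assoc)
    finally show ?case using 1 by (simp add: \<gamma>s KS.dZ_closed \<gamma>d)
  next
    case (2 v w)
    then show ?case by (simp add: additive_add[OF \<gamma>] GEr.l_distr GEr.r_distr y(1) \<gamma>c)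
  qed
  have f\<gamma>: "?f a \<otimes>\<^bsub>GE\<^esub> \<gamma> w = \<gamma> w \<otimes>\<^bsub>GE\<^esub> ?f a" if "a |: A" "w |: KS.\<Omega>" for a w
  proof (rule cen[OF that(2) fc[OF that(1)]])
    fix r assume r: "r |: Z"
    show "?f a \<otimes>\<^bsub>GE\<^esub> ?\<beta> r = ?\<beta> r \<otimes>\<^bsub>GE\<^esub> ?f a"
      using that(1) r by (simp add: iota_mult flip: ring_hom_mult[OF cls_al_hom])
  qed (use that cls_al_de in auto)
  have g\<gamma>: "?g z \<otimes>\<^bsub>GE\<^esub> \<gamma> w = \<gamma> w \<otimes>\<^bsub>GE\<^esub> ?g z" if "z |: Z" "w |: KS.\<Omega>" for z w
    by (rule cen[OF that(2) gc[OF that(1)]]) (use that cls_al_de cls_de_de in auto)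
  have \<gamma>\<gamma>: "\<gamma> v \<otimes>\<^bsub>GE\<^esub> \<gamma> w = \<gamma> w \<otimes>\<^bsub>GE\<^esub> \<gamma> v" if "v |: KS.\<Omega>" "w |: KS.\<Omega>" for v w
    by (rule cen[OF that(2) \<gamma>c[OF that(1)]]) (use that f\<gamma> g\<gamma> in auto)
  have "\<exists>\<psi>\<in>ring_hom SO GE. (\<forall>r\<in>carrier Z. \<psi> (KS.Om.scal r) = ?\<beta> r) \<and>
      (\<forall>m\<in>carrier KS.\<Omega>. \<psi> (incl m) = \<gamma> m)"
    by (rule KS.Om.SA_lift[OF GEr.ring_axioms beta \<gamma>c additive_add[OF \<gamma>] \<gamma>s \<gamma>\<gamma> f\<gamma>[OF iota_closed]]) blast+
  then obtain \<psi> where \<psi>: "\<psi> \<in> ring_hom SO GE" "\<And>r. r |: Z ==> \<psi> (KS.Om.scal r) = ?\<beta> r"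
    "\<And>m. m |: KS.\<Omega> ==> \<psi> (incl m) = \<gamma> m" by blast
  note \<psi>c = ring_hom_closed[OF \<psi>(1)]
  have f\<psi>: "?f a \<otimes>\<^bsub>GE\<^esub> \<psi> s = \<psi> s \<otimes>\<^bsub>GE\<^esub> ?f a" if a: "a |: A" and s: "s |: SO" for a s
    using s
  proof (induction rule: KS.Om.SA_induct[consumes 1, case_names 1 2 3])
    case (1 r)
    then show ?case using a by (simp add: \<psi>(2) iota_mult flip: ring_hom_mult[OF cls_al_hom])
  next
    case (2 s t)
    then show ?case using a by (simp add: ring_hom_add[OF \<psi>(1)] fc \<psi>c GEr.l_distr GEr.r_distr)
  next
    case (3 m s)
    have c: "\<gamma> m |: GE" "\<psi> s |: GE" "?f a |: GE" using 3 \<gamma>c \<psi>c fc a by auto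
    have "?f a \<otimes>\<^bsub>GE\<^esub> (\<gamma> m \<otimes>\<^bsub>GE\<^esub> \<psi> s) = \<gamma> m \<otimes>\<^bsub>GE\<^esub> (?f a \<otimes>\<^bsub>GE\<^esub> \<psi> s)"
      using c f\<gamma>[OF a 3(1)] by (simp flip: GEr.m_assoc)
    then show ?case using 3 c
      by (simp add: ring_hom_mult[OF \<psi>(1) KS.Om.sym_incl_closed] \<psi>(3) GEr.m_assoc)
  qed
  obtain \<phi> where \<phi>: "\<phi> \<in> ring_hom TS.TA GE"
    "\<And>a b. a |: A ==> b |: SO ==> \<phi> (TS.te a b) = ?f a \<otimes>\<^bsub>GE\<^esub> \<psi> b"
  proof (rule TS.TA_lift[OF GEr.ring_axioms cls_al_hom \<psi>(1) f\<psi>])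
    fix r assume r: "r |: Z"
    show "?f (r \<odot>\<^sub>A \<one>\<^sub>A) = \<psi> (r \<odot>\<^bsub>SO\<^esub> \<one>\<^bsub>SO\<^esub>)"
      using \<psi>(2)[OF r] r by (simp add: scal_smult iota_def)
  qed auto
  have "natural \<phi>" unfolding natural_iff
  proof (intro conjI ballI)
    show "\<phi> \<in> ring_hom T GE" using \<phi>(1) by (simp add: T_eq)
    show "\<phi> (tau a) = ?f a" if "a |: A" for a
      using \<phi>(2)[OF that, of "\<one>\<^bsub>SO\<^esub>"] ring_hom_one[OF \<psi>(1)] fc[OF that] by (simp add: TS.tau_def)
    show "\<phi> (theta z) = ?g z" if "z |: Z" for z
      using \<phi>(2)[OF Aa.one_closed incl_d_closed[OF that]] ring_hom_one[OF cls_al_hom] gc[OF that] that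
      by (simp add: TS.sg_def theta_def \<psi>(3) KS.dZ_closed \<gamma>d)
  qed
  then show ?thesis by (rule exI[of natural \<phi>])
qed

lemma lprod_de_Fil: "set zs \<subseteq> carrier Z ==> lprod E de zs \<in> Fil (length zs)"
proof (induction zs)
  case (Cons z zs)
  then show ?case using FE.Fil_mult[OF de_Fil[of z], of "lprod E de zs" "length zs"] by simp
qed (simp add: FE.Fil_one)

lemma natural_tmon:
  assumes \<phi>: "natural \<phi>" and a: "a |: A" and zs: "set zs \<subseteq> carrier Z"
  shows "\<phi> (tmon a zs) = cls (length zs) (al a \<otimes>\<^sub>E lprod E de zs)"
proof -
  have hom: "\<phi> \<in> ring_hom T GE" using \<phi> by (simp add: natural_iff)
  have "\<phi> (lprod T theta zs) = cls (length zs) (lprod E de zs)"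
    using zs
  proof (induction zs)
    case Nil
    then show ?case by (simp add: ring_hom_one[OF hom] GE_eq FE.gr_one)
  next
    case (Cons z zs)
    then have "\<phi> (lprod T theta (z # zs)) = cls 1 (de z) \<otimes>\<^bsub>GE\<^esub> cls (length zs) (lprod E de zs)"
      using \<phi> by (simp add: ring_hom_mult[OF hom] theta_closed lprod_theta_closed natural_iff)
    also have "\<dots> = cls (1 + length zs) (de z \<otimes>\<^sub>E lprod E de zs)"
      unfolding GE_eq using Cons by (intro FE.cls_mult de_Fil lprod_de_Fil) auto
    finally show ?case by simp
  qed
  then have "\<phi> (tmon a zs) = cls 0 (al a) \<otimes>\<^bsub>GE\<^esub> cls (length zs) (lprod E de zs)"
    unfolding tmon_def using a zs \<phi>
    by (simp add: ring_hom_mult[OF hom] tau_closed lprod_theta_closed natural_iff)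
  also have "\<dots> = cls (0 + length zs) (al a \<otimes>\<^sub>E lprod E de zs)"
    unfolding GE_eq using a zs by (intro FE.cls_mult al_Fil lprod_de_Fil)
  finally show ?thesis by simp
qed

lemma natural_surj:
  assumes \<phi>: "natural \<phi>" shows "\<phi> ` carrier T = carrier GE"
proof (intro equalityI subsetI)
  have hom: "\<phi> \<in> ring_hom T GE" and nat: "\<And>a. a |: A ==> \<phi> (tau a) = cls 0 (al a)"
     "\<And>z. z |: Z ==> \<phi> (theta z) = cls 1 (de z)"
    using \<phi> by (simp_all add: natural_iff)
  show "g |: GE" if "g \<in> \<phi> ` carrier T" for g using that ring_hom_closed[OF hom] by blast
  let ?I = "\<phi> ` carrier T"
  have addI: "g \<oplus>\<^bsub>GE\<^esub> h \<in> ?I" if "g \<in> ?I" "h \<in> ?I" for g h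
    using that by (auto simp flip: ring_hom_add[OF hom])
  have mult: "g \<otimes>\<^bsub>GE\<^esub> h \<in> ?I" if "g \<in> ?I" "h \<in> ?I" for g h
    using that by (auto simp flip: ring_hom_mult[OF hom])
  have zero_im: "\<zero>\<^bsub>GE\<^esub> \<in> ?I" using ring_hom_zero[OF hom Tr.ring_axioms GEr.ring_axioms] Tr.zero_closed by (metis imageI)
  have one: "\<one>\<^bsub>GE\<^esub> \<in> ?I" using ring_hom_one[OF hom] Tr.one_closed by (metis imageI)
  have al: "cls 0 (al a) \<in> ?I" if "a |: A" for a using nat(1)[OF that] tau_closed[OF that] by (metis imageI)
  have de: "cls 1 (de z) \<in> ?I" if "z |: Z" for z using nat(2)[OF that] theta_closed[OF that] by (metis imageI)
  have w: "cls (ndelta w) (lprod E gval w) \<in> ?I" if "w \<in> lists X" for w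
    using that
  proof (induction w)
    case Nil
    then show ?case using one by (simp add: GE_eq FE.gr_one)
  next
    case (Cons x w)
    then have w: "w \<in> lists X" and x: "x \<in> X" and IH: "cls (ndelta w) (lprod E gval w) \<in> ?I" by auto
    show ?case
    proof (cases x)
      case (Alpha a)
      then have "a |: A" using x by auto
      then show ?thesis using mult[OF al IH] FE.cls_mult[OF al_Fil lprod_Fil[OF w]]
        by (simp add: GE_eq Alpha gval_def[of "Alpha _"])
    next
      case (Delta z)
      then have "z |: Z" using x by auto
      then show ?thesis using mult[OF de IH] FE.cls_mult[OF de_Fil lprod_Fil[OF w]]
        by (simp add: GE_eq Delta gval_def[of "Delta _"])
    qed
  qed
  have cls: "cls i x \<in> ?I" if "x \<in> Fil i" for i x
    using that
  proof (induction rule: Fil_induct)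
    case zero
    show ?case using zero_im by (simp add: FE.cls_zero GE_eq)
  next
    case (add c w y)
    have w': "w \<in> lists X" "ndelta w \<le> i" using add by auto
    let ?x = "al (iota (kap c)) \<otimes>\<^sub>E lprod E gval w"
    have a: "iota (kap c) |: A" using add(1) by (simp add: KS.kap_closed)
    have xF: "?x \<in> Fil (ndelta w)" using FE.Fil_mult[OF al_Fil[OF a] lprod_Fil[OF w'(1)]] by simp
    then have xi: "?x \<in> Fil i" using FE.Fil_mono[OF w'(2)] by blast
    have "cls i ?x \<in> ?I"
    proof (cases "ndelta w = i")
      case True
      then show ?thesis
        using mult[OF al[OF a] w[OF w'(1)]] FE.cls_mult[OF al_Fil[OF a] lprod_Fil[OF w'(1)]]
        by (simp add: GE_eq)
    next
      case False
      \<comment> \<open>A word with fewer than \<open>i\<close> letters \<open>Delta\<close> lies in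
        the previous piece, so its class in degree \<open>i\<close> is zero.\<close>
      then obtain j where j: "i = Suc j" "ndelta w \<le> j" using w'(2) by (cases i) auto
      then have "?x \<in> FE.prev i" using FE.Fil_mono[OF j(2)] xF by (auto simp: fil_prev_Suc)
      then have "cls i ?x = \<zero>\<^bsub>GE\<^esub>" using FE.cls_zero_iff[OF xi] by (simp add: GE_eq)
      then show ?thesis using zero_im by simp
    qed
    then show ?case using addI[OF _ add(4), of "cls i ?x"] FE.cls_add[OF xi add(3)] by (simp add: GE_eq)
  qed
  fix g assume "g |: GE"
  then obtain S x where S: "finite S" "\<And>i. x i \<in> Fil i" "g = finsum FE.G (\<lambda>i. cls i (x i)) S"
    using FE.gr_decomp unfolding GE_eq by blast
  have "finsum GE (\<lambda>i. cls i (x i)) S \<in> ?I" using S(1)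
  proof induction
    case (insert i S)
    have "finsum GE (\<lambda>i. cls i (x i)) (insert i S) = cls i (x i) \<oplus>\<^bsub>GE\<^esub> finsum GE (\<lambda>i. cls i (x i)) S"
      using insert(1,2) FE.cls_closed[OF S(2)] by (intro GEr.finsum_insert) (auto simp: GE_eq)
    then show ?case using addI[OF cls[OF S(2)] insert(3)] by simp
  qed (simp add: zero_im)
  then show "g \<in> ?I" unfolding S(3) GE_eq .
qed

end

section \<open>Free Lie-Rinehart algebras\<close>

lemma (in abelian_monoid) finsum_swap:
  assumes "finite S" "\<And>i j. i \<in> S ==> j \<in> T ==> f i j |: G"
  shows "(\<Oplus>i\<in>S. \<Oplus>j\<in>T. f i j) = (\<Oplus>j\<in>T. \<Oplus>i\<in>S. f i j)"
  using assms
proof (induction S rule: finite_induct)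
  case (insert x S)
  have "(\<Oplus>j\<in>T. \<Oplus>i\<in>insert x S. f i j) = (\<Oplus>j\<in>T. f x j \<oplus> (\<Oplus>i\<in>S. f i j))"
    using insert by (intro finsum_cong') (auto intro!: a_closed finsum_closed)
  also have "\<dots> = (\<Oplus>j\<in>T. f x j) \<oplus> (\<Oplus>j\<in>T. \<Oplus>i\<in>S. f i j)"
    using insert by (intro finsum_addf) (auto intro!: finsum_closed)
  finally show ?case using insert by (auto intro!: finsum_closed)
qed simp

text \<open>\<open>B\<close> plays the role of the base, \<open>d\<close> that of the anchor and \<open>c\<close> that of the structure
  constants of a Lie-Rinehart algebra which is free with basis indexed by \<open>J\<close>. The classical
  recursion for the operators of left multiplication by the basis elements on ordered monomials
  is carried out on \<open>V\<close>, the polynomials with coefficients in \<open>B\<close>.\<close>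

locale free_lie_rinehart = ring B for B :: "('b, 'm) ring_scheme" (structure) +
  fixes J :: "nat set" and d :: "nat => 'b => 'b" and c :: "nat => nat => nat => 'b"
  assumes finJ: "finite J"
    and d_add: "i \<in> J ==> additive B B (d i)"
    and d_mult: "\<lbrakk>i \<in> J; x |: B; y |: B\<rbrakk> \<Longrightarrow> d i (x \<otimes> y) = (d i x \<otimes> y) \<oplus> (x \<otimes> d i y)"
    and c_closed: "\<lbrakk>i \<in> J; j \<in> J; k \<in> J\<rbrakk> \<Longrightarrow> c i j k |: B"
    and c_central: "\<lbrakk>i \<in> J; j \<in> J; k \<in> J; x |: B\<rbrakk> \<Longrightarrow> c i j k \<otimes> x = x \<otimes> c i j k"
    and c_diag: "\<lbrakk>i \<in> J; k \<in> J\<rbrakk> \<Longrightarrow> c i i k = \<zero>"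
    and c_skew: "\<lbrakk>i \<in> J; j \<in> J; k \<in> J\<rbrakk> \<Longrightarrow> c j i k = \<ominus> c i j k"
    and d_comm: "\<lbrakk>i \<in> J; j \<in> J; x |: B\<rbrakk> \<Longrightarrow>
      d i (d j x) = d j (d i x) \<oplus> (\<Oplus>k\<in>J. c i j k \<otimes> d k x)"
    and jacobi: "\<lbrakk>i \<in> J; j \<in> J; k \<in> J; m \<in> J\<rbrakk> \<Longrightarrow>
      (d k (c i j m) \<oplus> (\<Oplus>l\<in>J. c i j l \<otimes> c k l m)) \<oplus>
      ((d i (c j k m) \<oplus> (\<Oplus>l\<in>J. c j k l \<otimes> c i l m)) \<oplus>
       (d j (c k i m) \<oplus> (\<Oplus>l\<in>J. c k i l \<otimes> c j l m))) = \<zero>"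
begin

definition mons :: "nat multiset set" where "mons = {\<beta>. set_mset \<beta> \<subseteq> J}"
definition V :: "('b, nat multiset => 'b) module" where "V = free_module B mons"
text \<open>The strict bound makes \<open>Vlt 0\<close> the zero module, so that lower terms can be
  bounded uniformly, including in degree zero.\<close>

definition Vlt :: "nat => ('b, nat multiset => 'b) module" where "Vlt m = free_module B {\<beta> \<in> mons. size \<beta> < m}"
definition sm :: "'b => (nat multiset => 'b) => nat multiset => 'b" where "sm b v = (\<lambda>\<gamma>. b \<otimes> v \<gamma>)"
definition e :: "nat multiset => nat multiset => 'b" where "e \<beta> = mterm B \<one> \<beta>"

sublocale V: abelian_group V unfolding V_def by (rule fm_abelian_group)

lemma Vlt_abelian_group: "abelian_group (Vlt m)" unfolding Vlt_def by (rule fm_abelian_group)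

lemma Vlt_ops: "add (Vlt m) = add V" "zero (Vlt m) = zero V"
  by (simp_all add: Vlt_def V_def fun_eq_iff)

lemma Vlt_sub: "v \<in> carrier (Vlt m) ==> v |: V"
  unfolding Vlt_def V_def by (rule fm_mono_set[rotated]) auto

lemma Vlt_mono: "m \<le> n ==> v \<in> carrier (Vlt m) ==> v \<in> carrier (Vlt n)"
  unfolding Vlt_def by (rule fm_mono_set[rotated]) auto

lemma Vlt_add: "v \<in> carrier (Vlt m) ==> w \<in> carrier (Vlt m) ==> v \<oplus>\<^sub>V w \<in> carrier (Vlt m)"
  using abelian_monoid.a_closed[OF abelian_group.axioms(1)[OF Vlt_abelian_group], of v m w] by (simp add: Vlt_ops)

lemma Vlt_zero: "\<zero>\<^sub>V \<in> carrier (Vlt m)"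
  using abelian_monoid.zero_closed[OF abelian_group.axioms(1)[OF Vlt_abelian_group], of m] by (simp add: Vlt_ops)

lemma Vlt_apply: "v \<in> carrier (Vlt m) ==> m \<le> size \<gamma> ==> v \<gamma> = \<zero>"
  unfolding Vlt_def by (rule fm_outside) auto

lemma Vlt_finsum: "(\<And>k. k \<in> S ==> f k \<in> carrier (Vlt m)) ==> finsum V f S \<in> carrier (Vlt m)"
  by (induction S rule: infinite_finite_induct)
    (auto simp: Vlt_zero Vlt_add Pi_def Vlt_sub[where m=m])

lemma sm_closed: "b |: B ==> v |: V ==> sm b v |: V"
  unfolding V_def sm_def by (rule smult_fm_closed)

lemma sm_Vlt: "b |: B ==> v \<in> carrier (Vlt m) ==> sm b v \<in> carrier (Vlt m)"
  unfolding Vlt_def sm_def by (rule smult_fm_closed)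

lemma V_apply: "v |: V ==> v \<gamma> |: B"
  unfolding V_def by (rule fm_closed)

lemma V_add_apply: "(v \<oplus>\<^sub>V w) \<gamma> = v \<gamma> \<oplus> w \<gamma>" by (simp add: V_def)

lemma sm_add_l: "b |: B ==> b' |: B ==> v |: V ==> sm (b \<oplus> b') v = sm b v \<oplus>\<^sub>V sm b' v"
  by (auto simp: fun_eq_iff V_add_apply sm_def l_distr V_apply)

lemma sm_add_r: "b |: B ==> v |: V ==> w |: V ==> sm b (v \<oplus>\<^sub>V w) = sm b v \<oplus>\<^sub>V sm b w"
  by (auto simp: fun_eq_iff V_add_apply sm_def r_distr V_apply)

lemma sm_mult: "b |: B ==> b' |: B ==> v |: V ==> sm (b \<otimes> b') v = sm b (sm b' v)"
  by (auto simp: fun_eq_iff sm_def m_assoc V_apply)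

lemma sm_one: "v |: V ==> sm \<one> v = v"
  by (auto simp: fun_eq_iff sm_def V_apply)

lemma sm_zero: "v |: V ==> sm \<zero> v = \<zero>\<^sub>V"
  by (auto simp: fun_eq_iff sm_def V_apply) (simp add: V_def)

lemma sm_additive: "b |: B ==> additive V V (sm b)"
  by (auto intro!: additiveI simp: sm_closed sm_add_r)

lemma sm_additive_l: "v |: V ==> additive B V (\<lambda>b. sm b v)"
  by (auto intro!: additiveI simp: sm_closed sm_add_l)

lemma mt_closed: "r |: B ==> \<beta> \<in> mons ==> mterm B r \<beta> |: V"
  unfolding V_def by (rule mterm_closed)

lemma mt_Vlt: "r |: B ==> \<beta> \<in> mons ==> size \<beta> < m ==> mterm B r \<beta> \<in> carrier (Vlt m)"
  unfolding Vlt_def by (rule mterm_closed) auto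

lemma mt_add: "r |: B ==> s |: B ==> mterm B (r \<oplus> s) \<beta> = mterm B r \<beta> \<oplus>\<^sub>V mterm B s \<beta>"
  unfolding V_def by (rule mterm_add)

lemma mt_zero: "mterm B \<zero> \<beta> = \<zero>\<^sub>V" by (simp add: mterm_zero V_def)

lemma mt_sm: "r |: B ==> s |: B ==> sm r (mterm B s \<beta>) = mterm B (r \<otimes> s) \<beta>"
  by (auto simp: sm_def mterm_def)

lemma mt_e: "r |: B ==> mterm B r \<beta> = sm r (e \<beta>)"
  by (simp add: e_def mt_sm)

lemma e_closed: "\<beta> \<in> mons ==> e \<beta> |: V" by (simp add: e_def mt_closed)
lemma e_Vlt: "\<beta> \<in> mons ==> size \<beta> < m ==> e \<beta> \<in> carrier (Vlt m)" by (simp add: e_def mt_Vlt)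

lemma mons_add [simp]: "add_mset i \<beta> \<in> mons \<longleftrightarrow> i \<in> J \<and> \<beta> \<in> mons" "{#} \<in> mons"
  by (auto simp: mons_def)

lemma V_eqI:
  assumes F: "additive V V F" "additive V V F'"
    and eq: "\<And>r \<beta>. r |: B ==> \<beta> \<in> mons ==> F (mterm B r \<beta>) = F' (mterm B r \<beta>)" and v: "v |: V"
  shows "F v = F' v"
proof -
  have *: "additive V V h \<longleftrightarrow> additive (free_module B mons) V h" for h by (simp add: V_def)
  show ?thesis
    by (rule fm_additive_eqI[of mons V F F', OF F(1)[unfolded *] F(2)[unfolded *] V.abelian_group_axioms eq v[unfolded V_def]])
qed

lemma Vlt_eqI:
  assumes F: "additive (Vlt m) V F" "additive (Vlt m) V F'"
    and eq: "\<And>r \<beta>. r |: B ==> \<beta> \<in> mons ==> size \<beta> < m ==> F (mterm B r \<beta>) = F' (mterm B r \<beta>)"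
    and v: "v \<in> carrier (Vlt m)"
  shows "F v = F' v"
  by (rule fm_additive_eqI[of "{\<beta> \<in> mons. size \<beta> < m}" V F F', OF F[unfolded Vlt_def] V.abelian_group_axioms])
    (use eq v in \<open>auto simp: Vlt_def\<close>)

lemma Vlt_induct:
  assumes F: "additive V V F" and v: "v \<in> carrier (Vlt m)"
    and mt: "\<And>r \<beta>. r |: B ==> \<beta> \<in> mons ==> size \<beta> < m ==> F (mterm B r \<beta>) \<in> carrier (Vlt n)"
  shows "F v \<in> carrier (Vlt n)"
proof -
  from v have "v \<in> carrier (free_module B {\<beta> \<in> mons. size \<beta> < m})" by (simp add: Vlt_def)
  then show ?thesis
  proof (induction rule: fm_induct)
    case zero
    show ?case using additive_zero[OF F V.abelian_group_axioms V.abelian_group_axioms] Vlt_zero[of n] by (simp add: V_def)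
  next
    case (add r p f)
    have f: "f |: V" using add(3) Vlt_sub[of f m] by (simp add: Vlt_def)
    have p: "p \<in> mons" "size p < m" using add(2) by auto
    have "F (mterm B r p \<oplus>\<^sub>V f) = F (mterm B r p) \<oplus>\<^sub>V F f"
      by (rule additive_add[OF F mt_closed[OF add(1) p(1)] f])
    then show ?case using Vlt_add[OF mt[OF add(1) p] add(4)] by (simp add: V_def)
  qed
qed

section \<open>The recursion for left multiplication by a basis element\<close>

lemma d_closed: "i \<in> J ==> x |: B ==> d i x |: B"
  using additive_closed[OF d_add] by blast

lemma d_one: assumes i: "i \<in> J" shows "d i \<one> = \<zero>"
proof -
  have "d i \<one> = d i \<one> \<oplus> d i \<one>" using d_mult[OF i one_closed one_closed] d_closed[OF i one_closed] by simp
  then show ?thesis using d_closed[OF i one_closed] add.l_cancel_one by fastforce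
qed

text \<open>The operator with prescribed values \<open>w \<beta>\<close> on monomials that
  differentiates the coefficients by \<open>d i\<close>; on a term it is forced by the Leibniz
  rule.\<close>

definition Ext :: "nat => (nat multiset => nat multiset => 'b) => (nat multiset => 'b) => nat multiset => 'b"
  where "Ext i w = lext B V (\<lambda>\<beta> r. mterm B (d i r) \<beta> \<oplus>\<^sub>V sm r (w \<beta>))"

lemma Ext_summand:
  assumes "i \<in> J" "\<beta> \<in> mons" "w |: V"
  shows "additive B V (\<lambda>r. mterm B (d i r) \<beta> \<oplus>\<^sub>V sm r w)"
proof (rule additive_sum[OF _ sm_additive_l[OF assms(3)] V.abelian_group_axioms])
  show "additive B V (\<lambda>r. mterm B (d i r) \<beta>)"
    using assms by (intro additiveI) (auto simp: mt_closed d_closed additive_add[OF d_add] mt_add)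
qed

lemma Ext_additive:
  assumes "i \<in> J" "\<And>\<beta>. \<beta> \<in> mons ==> w \<beta> |: V" shows "additive V V (Ext i w)"
proof -
  have "additive (free_module B mons) V (Ext i w)"
    unfolding Ext_def using assms by (intro lext_additive Ext_summand V.abelian_group_axioms)
  then show ?thesis by (simp add: V_def)
qed

lemma Ext_additive_Vlt:
  assumes "i \<in> J" "\<And>\<beta>. \<beta> \<in> mons ==> size \<beta> < m ==> w \<beta> |: V" shows "additive (Vlt m) V (Ext i w)"
  unfolding Ext_def Vlt_def using assms by (intro lext_additive Ext_summand V.abelian_group_axioms) auto

lemma Ext_mt:
  assumes "i \<in> J" "w \<beta> |: V" "\<beta> \<in> mons" "r |: B"
  shows "Ext i w (mterm B r \<beta>) = mterm B (d i r) \<beta> \<oplus>\<^sub>V sm r (w \<beta>)"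
  unfolding Ext_def
  by (rule lext_mterm[of "{\<beta>}" V "\<lambda>\<beta> r. mterm B (d i r) \<beta> \<oplus>\<^sub>V sm r (w \<beta>)"])
    (use assms Ext_summand V.abelian_group_axioms in auto)

text \<open>Let \<open>j\<close> be the least variable of \<beta>, with \<open>j < i\<close>, and
  let \<beta>' be the rest. The recursion imposes
  \<open>i (j \<beta>') = j (i \<beta>') + [i,j] \<beta>'\<close>. Here \<open>i \<beta>'\<close>
  has leading monomial \<open>e (add_mset i \<beta>')\<close>, which \<open>j\<close> merely
  multiplies because \<open>j\<close> is minimal; only the difference, which is of lower degree, has
  to be fed back into \<open>W m j\<close>. The first argument bounds the depth of the
  recursion.\<close>

primrec W :: "nat => nat => nat multiset => nat multiset => 'b" where
  "W 0 i \<beta> = e (add_mset i \<beta>)"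
| "W (Suc m) i \<beta> = (if \<forall>x\<in>#\<beta>. i \<le> x then e (add_mset i \<beta>) else
     (let j = Min (set_mset \<beta>); \<beta>' = \<beta> - {#j#} in
       e (add_mset i \<beta>) \<oplus>\<^sub>V
         (Ext j (W m j) (W m i \<beta>' \<oplus>\<^sub>V (\<ominus>\<^sub>V e (add_mset i \<beta>'))) \<oplus>\<^sub>V
         (\<Oplus>\<^sub>V k\<in>J. sm (c i j k) (W m k \<beta>')))))"

lemma split_min:
  assumes "\<not> (\<forall>x\<in>#\<beta>. i \<le> x)" "\<beta> \<in> mons"
  obtains j \<gamma> where "\<beta> = add_mset j \<gamma>" "j < i" "j \<in> J" "\<gamma> \<in> mons" "\<forall>x\<in>#\<gamma>. j \<le> x"
    "Min (set_mset \<beta>) = j"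
proof -
  let ?j = "Min (set_mset \<beta>)"
  have ne: "set_mset \<beta> \<noteq> {}" using assms by auto
  then have j: "?j \<in># \<beta>" by simp
  have le: "\<And>x. x \<in># \<beta> ==> ?j \<le> x" by simp
  have "?j < i" using assms(1) le by (meson not_le_imp_less order.trans)
  moreover have "\<beta> = add_mset ?j (\<beta> - {#?j#})" using j by simp
  moreover have "\<forall>x\<in>#\<beta> - {#?j#}. ?j \<le> x" using le by (meson in_diffD)
  moreover have "?j \<in> J" "\<beta> - {#?j#} \<in> mons" using j assms(2) by (auto simp: mons_def dest: in_diffD)
  ultimately show thesis using that by blast
qed

lemma W_Suc_min:
  assumes "j < i" "\<forall>x\<in>#\<gamma>. j \<le> x"
  shows "W (Suc m) i (add_mset j \<gamma>) = e (add_mset i (add_mset j \<gamma>)) \<oplus>\<^sub>V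
         (Ext j (W m j) (W m i \<gamma> \<oplus>\<^sub>V (\<ominus>\<^sub>V e (add_mset i \<gamma>))) \<oplus>\<^sub>V
         (\<Oplus>\<^sub>V k\<in>J. sm (c i j k) (W m k \<gamma>)))"
proof -
  have "Min (insert j (set_mset \<gamma>)) = j"
    using assms(2) by (intro Min_eqI) auto
  then show ?thesis using assms(1) by (simp add: Let_def)
qed

lemma W_Suc_le: "\<forall>x\<in>#\<beta>. i \<le> x ==> W (Suc m) i \<beta> = e (add_mset i \<beta>)"
  by simp

declare W.simps(2) [simp del]

text \<open>\<open>W m i \<beta>\<close> is the product of the variable \<open>i\<close> and \<open>\<beta>\<close> up to terms of lower degree, and it
  does not depend on \<open>m\<close> as long as \<open>m\<close> is at least the degree of \<open>\<beta>\<close>.\<close>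

lemma W_top:
  "i \<in> J ==> \<beta> \<in> mons ==> size \<beta> \<le> m ==>
    \<exists>u\<in>carrier (Vlt (Suc (size \<beta>))). W m i \<beta> = e (add_mset i \<beta>) \<oplus>\<^sub>V u"
proof (induction m arbitrary: i \<beta>)
  case 0
  then show ?case using Vlt_zero e_closed[of "add_mset i \<beta>"] by (intro bexI[of _ "\<zero>\<^sub>V"]) auto
next
  case (Suc m)
  show ?case
  proof (cases "\<forall>x\<in>#\<beta>. i \<le> x")
    case True
    then show ?thesis using Suc.prems Vlt_zero e_closed[of "add_mset i \<beta>"]
      by (intro bexI[of _ "\<zero>\<^sub>V"]) (auto simp: W_Suc_le)
  next
    case False
    then obtain j \<gamma> where \<beta>: "\<beta> = add_mset j \<gamma>" "j < i" "j \<in> J" "\<gamma> \<in> mons" "\<forall>x\<in>#\<gamma>. j \<le> x"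
      using split_min Suc.prems by metis
    have sz: "size \<gamma> \<le> m" using Suc.prems \<beta> by simp
    have Wc: "W m k \<delta> \<in> carrier (Vlt (Suc (Suc (size \<delta>))))" if "k \<in> J" "\<delta> \<in> mons" "size \<delta> \<le> m" for k \<delta>
    proof -
      note IH = Suc.IH[OF that]
      obtain u where u: "u \<in> carrier (Vlt (Suc (size \<delta>)))" "W m k \<delta> = e (add_mset k \<delta>) \<oplus>\<^sub>V u"
        using IH by blast
      show ?thesis unfolding u(2) using that by (intro Vlt_add e_Vlt Vlt_mono[OF _ u(1)]) auto
    qed
    obtain u where u: "u \<in> carrier (Vlt (Suc (size \<gamma>)))" "W m i \<gamma> = e (add_mset i \<gamma>) \<oplus>\<^sub>V u"
      using Suc.IH[OF Suc.prems(1) \<beta>(4) sz] by blast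
    have eu: "W m i \<gamma> \<oplus>\<^sub>V (\<ominus>\<^sub>V e (add_mset i \<gamma>)) = u"
      unfolding u(2) using e_closed[of "add_mset i \<gamma>"] Vlt_sub[OF u(1)] Suc.prems(1) \<beta>
      by (simp add: V.a_ac V.r_neg V.r_neg1 V.r_neg2)
    \<comment> \<open>The induction hypothesis controls \<open>W m j\<close> only on monomials of
      size at most \<open>m\<close>. Truncation to zero beyond gives an operator that is defined on
      all of \<open>V\<close> and agrees with the original one at \<open>u\<close>.\<close>
    define w where "w \<delta> = (if size \<delta> \<le> m then W m j \<delta> else \<zero>\<^sub>V)" for \<delta>
    have wc: "w \<delta> |: V" if "\<delta> \<in> mons" for \<delta>
      using Vlt_sub[OF Wc[OF \<beta>(3) that]] by (auto simp: w_def)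
    have ext_eq: "Ext j (W m j) u = Ext j w u"
    proof (rule Vlt_eqI[OF _ _ _ u(1)])
      show "additive (Vlt (Suc (size \<gamma>))) V (Ext j (W m j))"
        using sz by (intro Ext_additive_Vlt[OF \<beta>(3)] Vlt_sub[OF Wc] \<beta>(3)) auto
      show "additive (Vlt (Suc (size \<gamma>))) V (Ext j w)"
        by (intro Ext_additive_Vlt[OF \<beta>(3)] wc)
      fix r \<delta> assume "r |: B" "\<delta> \<in> mons" "size \<delta> < Suc (size \<gamma>)"
      then show "Ext j (W m j) (mterm B r \<delta>) = Ext j w (mterm B r \<delta>)"
        using sz wc Vlt_sub[OF Wc[OF \<beta>(3)], of \<delta>] by (simp add: Ext_mt \<beta> w_def)
    qed
    have "Ext j w u \<in> carrier (Vlt (Suc (Suc (size \<gamma>))))"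
    proof (rule Vlt_induct[OF Ext_additive[OF \<beta>(3) wc] u(1)])
      fix r \<delta> assume h: "r |: B" "\<delta> \<in> mons" "size \<delta> < Suc (size \<gamma>)"
      then have "w \<delta> \<in> carrier (Vlt (Suc (Suc (size \<gamma>))))"
        using Vlt_mono[OF _ Wc[OF \<beta>(3) h(2)], of "Suc (Suc (size \<gamma>))"] sz by (simp add: w_def)
      then show "Ext j w (mterm B r \<delta>) \<in> carrier (Vlt (Suc (Suc (size \<gamma>))))"
        using h wc by (auto simp: Ext_mt \<beta> d_closed intro!: Vlt_add mt_Vlt sm_Vlt)
    qed
    moreover have "(\<Oplus>\<^sub>V k\<in>J. sm (c i j k) (W m k \<gamma>)) \<in> carrier (Vlt (Suc (Suc (size \<gamma>))))"
      using Suc.prems(1) \<beta> sz by (intro Vlt_finsum sm_Vlt Wc c_closed) auto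
    ultimately have "Ext j w u \<oplus>\<^sub>V (\<Oplus>\<^sub>V k\<in>J. sm (c i j k) (W m k \<gamma>)) \<in> carrier (Vlt (Suc (size (add_mset j \<gamma>))))"
      using Vlt_add by simp
    then show ?thesis
      unfolding \<beta>(1) W_Suc_min[OF \<beta>(2,5)] eu ext_eq by blast
  qed
qed

lemma W_closed:
  assumes "i \<in> J" "\<beta> \<in> mons" "size \<beta> \<le> m" shows "W m i \<beta> |: V"
  using W_top[OF assms] Vlt_sub e_closed[of "add_mset i \<beta>"] assms by auto

lemma W_stable: "i \<in> J ==> \<beta> \<in> mons ==> size \<beta> \<le> m ==> W (Suc m) i \<beta> = W m i \<beta>"
proof (induction m arbitrary: i \<beta>)
  case 0
  then show ?case by (simp add: W_Suc_le)
next
  case (Suc m)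
  show ?case
  proof (cases "\<forall>x\<in>#\<beta>. i \<le> x")
    case True
    then show ?thesis by (simp add: W_Suc_le)
  next
    case False
    then obtain j \<gamma> where \<beta>: "\<beta> = add_mset j \<gamma>" "j < i" "j \<in> J" "\<gamma> \<in> mons" "\<forall>x\<in>#\<gamma>. j \<le> x"
      using split_min Suc.prems by metis
    have sz: "size \<gamma> \<le> m" using Suc.prems \<beta> by simp
    note st = Suc.IH[OF Suc.prems(1) \<beta>(4) sz]
    obtain u where u: "u \<in> carrier (Vlt (Suc (size \<gamma>)))" "W m i \<gamma> = e (add_mset i \<gamma>) \<oplus>\<^sub>V u"
      using W_top[OF Suc.prems(1) \<beta>(4) sz] by blast
    have eu: "W m i \<gamma> \<oplus>\<^sub>V (\<ominus>\<^sub>V e (add_mset i \<gamma>)) = u"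
      unfolding u(2) using e_closed[of "add_mset i \<gamma>"] Vlt_sub[OF u(1)] Suc.prems(1) \<beta>
      by (simp add: V.a_ac V.r_neg V.r_neg1 V.r_neg2)
    have "Ext j (W (Suc m) j) u = Ext j (W m j) u"
    proof (rule Vlt_eqI[OF _ _ _ u(1)])
      show "additive (Vlt (Suc (size \<gamma>))) V (Ext j (W m j))" "additive (Vlt (Suc (size \<gamma>))) V (Ext j (W (Suc m) j))"
        using sz by (intro Ext_additive_Vlt[OF \<beta>(3)] W_closed \<beta>(3); simp)+
      fix r \<delta> assume "r |: B" "\<delta> \<in> mons" "size \<delta> < Suc (size \<gamma>)"
      then show "Ext j (W (Suc m) j) (mterm B r \<delta>) = Ext j (W m j) (mterm B r \<delta>)"
        using sz Suc.IH[OF \<beta>(3), of \<delta>] W_closed[OF \<beta>(3), of \<delta> m] by (simp add: Ext_mt \<beta>)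
    qed
    moreover have "(\<Oplus>\<^sub>V k\<in>J. sm (c i j k) (W (Suc m) k \<gamma>)) = (\<Oplus>\<^sub>V k\<in>J. sm (c i j k) (W m k \<gamma>))"
      using Suc.prems(1) \<beta> sz Suc.IH[OF _ \<beta>(4) sz]
      by (intro V.finsum_cong') (auto intro!: sm_closed c_closed W_closed)
    ultimately show ?thesis unfolding \<beta>(1) W_Suc_min[OF \<beta>(2,5)] st eu by simp
  qed
qed

section \<open>The operators of left multiplication on polynomials\<close>

definition w :: "nat => nat multiset => nat multiset => 'b" where "w i \<beta> = W (size \<beta>) i \<beta>"

lemma W_w: assumes "i \<in> J" "\<beta> \<in> mons" "size \<beta> \<le> m" shows "W m i \<beta> = w i \<beta>"
proof -
  have "W (size \<beta> + k) i \<beta> = w i \<beta>" for k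
    by (induction k) (use W_stable[OF assms(1,2)] in \<open>auto simp: w_def\<close>)
  from this[of "m - size \<beta>"] show ?thesis using assms by simp
qed

definition D :: "nat => (nat multiset => 'b) => nat multiset => 'b" where "D i = Ext i (w i)"

lemma w_closed: "i \<in> J ==> \<beta> \<in> mons ==> w i \<beta> |: V"
  by (simp add: w_def W_closed)

lemma D_additive: "i \<in> J ==> additive V V (D i)"
  unfolding D_def by (intro Ext_additive w_closed)

lemmas D_closed = additive_closed[OF D_additive]
lemmas D_add = additive_add[OF D_additive]

lemma D_mt:
  "i \<in> J ==> \<beta> \<in> mons ==> r |: B ==> D i (mterm B r \<beta>) = mterm B (d i r) \<beta> \<oplus>\<^sub>V sm r (w i \<beta>)"
  unfolding D_def by (rule Ext_mt) (auto simp: w_closed)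

lemma D_e: "i \<in> J ==> \<beta> \<in> mons ==> D i (e \<beta>) = w i \<beta>"
  by (simp add: e_def D_mt d_one mt_zero sm_one w_closed)

lemma D_e_top:
  assumes "i \<in> J" "\<beta> \<in> mons"
  obtains u where "u \<in> carrier (Vlt (Suc (size \<beta>)))" "D i (e \<beta>) = e (add_mset i \<beta>) \<oplus>\<^sub>V u"
  using W_top[OF assms order.refl] D_e[OF assms] unfolding w_def by metis

lemma D_e_le: "i \<in> J ==> \<beta> \<in> mons ==> \<forall>x\<in>#\<beta>. i \<le> x ==> D i (e \<beta>) = e (add_mset i \<beta>)"
  by (simp add: D_e w_def W_w[symmetric, of i \<beta> "Suc (size \<beta>)"])
    (metis W_stable W_Suc_le order.refl)

lemma D_smult:
  assumes i: "i \<in> J" and b: "b |: B" and v: "v |: V"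
  shows "D i (sm b v) = sm (d i b) v \<oplus>\<^sub>V sm b (D i v)"
proof (rule V_eqI[where F="\<lambda>v. D i (sm b v)" and F'="\<lambda>v. sm (d i b) v \<oplus>\<^sub>V sm b (D i v)", OF _ _ _ v])
  show "additive V V (\<lambda>v. D i (sm b v))"
    by (rule additive_comp[OF sm_additive[OF b] D_additive[OF i]])
  show "additive V V (\<lambda>v. sm (d i b) v \<oplus>\<^sub>V sm b (D i v))"
    by (intro additive_sum additive_comp[OF D_additive[OF i] sm_additive[OF b]] sm_additive d_closed i b
        V.abelian_group_axioms)
  fix r \<beta> assume r: "r |: B" and \<beta>: "\<beta> \<in> mons"
  note cl = r b d_closed[OF i r] d_closed[OF i b] w_closed[OF i \<beta>]
  show "D i (sm b (mterm B r \<beta>)) = sm (d i b) (mterm B r \<beta>) \<oplus>\<^sub>V sm b (D i (mterm B r \<beta>))"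
    using cl i \<beta> by (simp add: mt_sm D_mt d_mult mt_add sm_add_r sm_closed mt_closed sm_mult V.a_assoc)
qed

section \<open>The bracket of two basis elements as an operator, and the commutation
  relations\<close>

definition C :: "nat => nat => (nat multiset => 'b) => nat multiset => 'b"
  where "C i j v = (\<Oplus>\<^sub>V k\<in>J. sm (c i j k) (D k v))"

lemma C_additive: "i \<in> J ==> j \<in> J ==> additive V V (C i j)"
  unfolding C_def
  by (intro additive_finsum_fun V.abelian_group_axioms additive_comp[OF D_additive sm_additive] c_closed)

lemmas C_closed = additive_closed[OF C_additive]

lemma C_smult:
  assumes ij: "i \<in> J" "j \<in> J" and b: "b |: B" and v: "v |: V"
  shows "C i j (sm b v) = sm (\<Oplus>k\<in>J. c i j k \<otimes> d k b) v \<oplus>\<^sub>V sm b (C i j v)"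
proof -
  have 1: "sm (c i j k) (D k (sm b v)) = sm (c i j k \<otimes> d k b) v \<oplus>\<^sub>V sm b (sm (c i j k) (D k v))" if k: "k \<in> J" for k
  proof -
    note cl = c_closed[OF ij k] d_closed[OF k b] D_closed[OF k v] sm_closed
    have "sm (c i j k) (sm b (D k v)) = sm b (sm (c i j k) (D k v))"
      using cl b c_central[OF ij k b] by (simp flip: sm_mult)
    then show ?thesis using cl b v by (simp add: D_smult[OF k] sm_add_r sm_mult)
  qed
  have "C i j (sm b v) = (\<Oplus>\<^sub>V k\<in>J. sm (c i j k \<otimes> d k b) v \<oplus>\<^sub>V sm b (sm (c i j k) (D k v)))"
    unfolding C_def using 1 by (intro V.finsum_cong')
      (auto intro!: V.a_closed sm_closed c_closed ij d_closed D_closed b v m_closed)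
  also have "\<dots> = (\<Oplus>\<^sub>V k\<in>J. sm (c i j k \<otimes> d k b) v) \<oplus>\<^sub>V (\<Oplus>\<^sub>V k\<in>J. sm b (sm (c i j k) (D k v)))"
    by (intro V.finsum_addf) (auto intro!: sm_closed c_closed ij d_closed D_closed b v m_closed)
  also have "\<dots> = sm (\<Oplus>k\<in>J. c i j k \<otimes> d k b) v \<oplus>\<^sub>V sm b (C i j v)"
    unfolding C_def
    by (subst additive_finsum[OF sm_additive_l[OF v] abelian_group_axioms V.abelian_group_axioms],
       use ij b in \<open>auto intro!: c_closed d_closed m_closed\<close>,
       subst additive_finsum[OF sm_additive[OF b] V.abelian_group_axioms V.abelian_group_axioms],
       use ij v in \<open>auto intro!: c_closed D_closed sm_closed\<close>)
  finally show ?thesis .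
qed

definition rel :: "nat => nat => (nat multiset => 'b) => bool"
  where "rel i j v \<longleftrightarrow> D i (D j v) = D j (D i v) \<oplus>\<^sub>V C i j v"

lemma rel_add:
  assumes ij: "i \<in> J" "j \<in> J" and v: "v |: V" "v' |: V" and r: "rel i j v" "rel i j v'"
  shows "rel i j (v \<oplus>\<^sub>V v')"
  using r unfolding rel_def
  by (simp add: D_add D_closed C_closed additive_add[OF C_additive] ij v V.a_ac)

text \<open>On both sides the Leibniz rule produces the same mixed terms, with one operator on the
  scalar and one on \<open>v\<close>; the terms in which both act on the scalar match by
  \<open>d_comm\<close>.\<close>

lemma rel_smult:
  assumes ij: "i \<in> J" "j \<in> J" and b: "b |: B" and v: "v |: V" and r: "rel i j v"
  shows "rel i j (sm b v)"
proof -
  let ?s = "\<Oplus>k\<in>J. c i j k \<otimes> d k b"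
  have s: "?s |: B" using ij b by (intro finsum_closed) (auto intro!: c_closed d_closed)
  have D2: "D i (D j (sm b v)) = sm (d i (d j b)) v \<oplus>\<^sub>V sm (d j b) (D i v) \<oplus>\<^sub>V (sm (d i b) (D j v) \<oplus>\<^sub>V sm b (D i (D j v)))"
    if "i \<in> J" "j \<in> J" for i j
    using that b v by (simp add: D_smult D_add D_closed sm_closed d_closed)
  have "sm (d i (d j b)) v = sm (d j (d i b)) v \<oplus>\<^sub>V sm ?s v"
    using d_comm[OF ij b] s ij b v by (simp add: sm_add_l d_closed)
  moreover have "sm b (D i (D j v)) = sm b (D j (D i v)) \<oplus>\<^sub>V sm b (C i j v)"
    using r ij b v by (simp add: rel_def sm_add_r D_closed C_closed)
  ultimately show ?thesis
    unfolding rel_def D2[OF ij] D2[OF ij(2,1)] C_smult[OF ij b v]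
    using s ij b v by (simp add: sm_closed D_closed d_closed C_closed V.a_ac)
qed

lemma rel_skew:
  assumes ij: "i \<in> J" "j \<in> J" and v: "v |: V" and r: "rel i j v" shows "rel j i v"
proof -
  have "C j i v = (\<Oplus>\<^sub>V k\<in>J. \<ominus>\<^sub>V sm (c i j k) (D k v))"
    unfolding C_def
  proof (rule V.finsum_cong')
    fix k assume k: "k \<in> J"
    show "sm (c j i k) (D k v) = \<ominus>\<^sub>V sm (c i j k) (D k v)"
      unfolding c_skew[OF ij k]
      using additive_neg[OF sm_additive_l[OF D_closed[OF k v]] abelian_group_axioms V.abelian_group_axioms c_closed[OF ij k]] .
  qed (auto intro!: sm_closed c_closed ij D_closed v)
  also have "\<dots> = \<ominus>\<^sub>V C i j v"
    unfolding C_def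
    using additive_finsum[of V V "\<lambda>x. \<ominus>\<^sub>V x" J "\<lambda>k. sm (c i j k) (D k v)", OF _ V.abelian_group_axioms V.abelian_group_axioms]
    by (simp add: additive_def V.minus_add V.a_comm sm_closed c_closed ij D_closed v)
  finally show ?thesis using r ij v unfolding rel_def
    by (simp add: V.a_ac D_closed C_closed V.r_neg1 V.r_neg2 V.r_neg)
qed

lemma rel_diag: assumes i: "i \<in> J" and v: "v |: V" shows "rel i i v"
proof -
  have "C i i v = (\<Oplus>\<^sub>V k\<in>J. \<zero>\<^sub>V)"
    unfolding C_def by (rule V.finsum_cong') (auto simp: c_diag i sm_zero D_closed v)
  then show ?thesis using i v by (simp add: rel_def D_closed)
qed

text \<open>This is the case that the recursion builds in: as \<open>j\<close> is minimal,
  \<open>D j\<close> turns \<open>e \<beta>\<close> into \<open>e (add_mset j \<beta>)\<close>, and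
  the value of \<open>D i\<close> there was defined by the relation.\<close>

lemma rel_easy:
  assumes ij: "i \<in> J" "j \<in> J" "j < i" and \<beta>: "\<beta> \<in> mons" "\<forall>x\<in>#\<beta>. j \<le> x"
  shows "rel i j (e \<beta>)"
proof -
  let ?m = "size \<beta>"
  have eij: "e (add_mset i \<beta>) |: V" "w i \<beta> |: V" using ij \<beta> by (auto intro: e_closed w_closed)
  have ext: "Ext j (W ?m j) = Ext j (W ?m j)" ..
  obtain u where u: "u \<in> carrier (Vlt (Suc ?m))" "W ?m i \<beta> = e (add_mset i \<beta>) \<oplus>\<^sub>V u"
    using W_top[OF ij(1) \<beta>(1) order.refl] by blast
  have uV: "u |: V" by (rule Vlt_sub[OF u(1)])
  have eu: "W ?m i \<beta> \<oplus>\<^sub>V (\<ominus>\<^sub>V e (add_mset i \<beta>)) = u"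
    unfolding u(2) using eij uV by (simp add: V.a_ac V.r_neg V.r_neg1 V.r_neg2)
  have "Ext j (W ?m j) u = D j u"
  proof (rule Vlt_eqI[OF _ _ _ u(1)])
    show "additive (Vlt (Suc ?m)) V (Ext j (W ?m j))" by (intro Ext_additive_Vlt ij W_closed) auto
    show "additive (Vlt (Suc ?m)) V (D j)" unfolding D_def by (intro Ext_additive_Vlt ij w_closed)
    fix r \<delta> assume "r |: B" "\<delta> \<in> mons" "size \<delta> < Suc ?m"
    then show "Ext j (W ?m j) (mterm B r \<delta>) = D j (mterm B r \<delta>)"
      using ij W_w[OF ij(2), of \<delta> ?m] by (simp add: D_mt Ext_mt w_closed)
  qed
  then have "D i (e (add_mset j \<beta>)) = e (add_mset i (add_mset j \<beta>)) \<oplus>\<^sub>V (D j u \<oplus>\<^sub>V (\<Oplus>\<^sub>V k\<in>J. sm (c i j k) (W ?m k \<beta>)))"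
    using D_e[OF ij(1), of "add_mset j \<beta>"] ij \<beta> W_Suc_min[OF ij(3) \<beta>(2), of ?m] eu by (simp add: w_def)
  also have "(\<Oplus>\<^sub>V k\<in>J. sm (c i j k) (W ?m k \<beta>)) = C i j (e \<beta>)"
    unfolding C_def using ij \<beta>
    by (intro V.finsum_cong') (auto simp: D_e W_w intro!: sm_closed c_closed w_closed)
  also have "e (add_mset i (add_mset j \<beta>)) = D j (e (add_mset i \<beta>))"
    using D_e_le[OF ij(2), of "add_mset i \<beta>"] ij \<beta> by (simp add: add_mset_commute)
  also have "D j (e (add_mset i \<beta>)) \<oplus>\<^sub>V (D j u \<oplus>\<^sub>V C i j (e \<beta>)) = D j (w i \<beta>) \<oplus>\<^sub>V C i j (e \<beta>)"
    using u(2) eij uV ij \<beta> by (simp add: w_def D_add V.a_assoc D_closed C_closed e_closed)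
  finally show ?thesis
    unfolding rel_def D_e_le[OF ij(2) \<beta>] D_e[OF ij(1) \<beta>(1)] .
qed

text \<open>The coefficient of the basis element \<open>m\<close> in the iterated bracket
  \<open>[k,[i,j]]\<close>.\<close>

definition Jf :: "nat => nat => nat => nat => 'b"
  where "Jf i j k m = d k (c i j m) \<oplus> (\<Oplus>l\<in>J. c i j l \<otimes> c k l m)"

lemma Jf_closed: "\<lbrakk>i \<in> J; j \<in> J; k \<in> J; m \<in> J\<rbrakk> \<Longrightarrow> Jf i j k m |: B"
  unfolding Jf_def by (intro a_closed d_closed c_closed finsum_closed) (auto intro!: c_closed)

text \<open>Moving \<open>D k\<close> past the operator of \<open>[i,j]\<close> leaves the operator
  of \<open>[k,[i,j]]\<close>. The relation is assumed only at \<open>v\<close> itself, so that it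
  can be used within the induction of \<open>rel_e\<close>.\<close>

lemma D_C:
  assumes ijk: "i \<in> J" "j \<in> J" "k \<in> J" and v: "v |: V" and r: "\<And>l. l \<in> J ==> rel k l v"
  shows "D k (C i j v) = C i j (D k v) \<oplus>\<^sub>V (\<Oplus>\<^sub>V m\<in>J. sm (Jf i j k m) (D m v))"
proof -
  note cl = c_closed[OF ijk(1,2)] D_closed sm_closed d_closed C_closed
  have 1: "D k (sm (c i j l) (D l v)) = sm (c i j l) (D l (D k v)) \<oplus>\<^sub>V
      (sm (d k (c i j l)) (D l v) \<oplus>\<^sub>V sm (c i j l) (C k l v))" if l: "l \<in> J" for l
    using r[OF l] l ijk v by (simp add: D_smult cl rel_def sm_add_r V.a_ac)
  have "D k (C i j v) = (\<Oplus>\<^sub>V l\<in>J. D k (sm (c i j l) (D l v)))"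
    unfolding C_def using ijk v
    by (intro additive_finsum[OF D_additive V.abelian_group_axioms V.abelian_group_axioms] cl) auto
  also have "\<dots> = (\<Oplus>\<^sub>V l\<in>J. sm (c i j l) (D l (D k v)) \<oplus>\<^sub>V
      (sm (d k (c i j l)) (D l v) \<oplus>\<^sub>V sm (c i j l) (C k l v)))"
    using 1 ijk v by (intro V.finsum_cong') (auto intro!: cl V.a_closed)
  also have "\<dots> = C i j (D k v) \<oplus>\<^sub>V ((\<Oplus>\<^sub>V l\<in>J. sm (d k (c i j l)) (D l v)) \<oplus>\<^sub>V (\<Oplus>\<^sub>V l\<in>J. sm (c i j l) (C k l v)))"
    unfolding C_def[of i j "D k v"] using ijk v
    by (subst V.finsum_addf, (auto intro!: cl V.a_closed)[2], subst V.finsum_addf) (auto intro!: cl V.a_closed)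
  also have "(\<Oplus>\<^sub>V l\<in>J. sm (c i j l) (C k l v)) = (\<Oplus>\<^sub>V m\<in>J. sm (\<Oplus>l\<in>J. c i j l \<otimes> c k l m) (D m v))"
  proof -
    have "(\<Oplus>\<^sub>V l\<in>J. sm (c i j l) (C k l v)) = (\<Oplus>\<^sub>V l\<in>J. \<Oplus>\<^sub>V m\<in>J. sm (c i j l \<otimes> c k l m) (D m v))"
    proof (rule V.finsum_cong')
      fix l assume l: "l \<in> J"
      have "sm (c i j l) (C k l v) = (\<Oplus>\<^sub>V m\<in>J. sm (c i j l) (sm (c k l m) (D m v)))"
        unfolding C_def using l ijk v
        by (intro additive_finsum[OF sm_additive V.abelian_group_axioms V.abelian_group_axioms]) (auto intro!: cl c_closed)
      also have "\<dots> = (\<Oplus>\<^sub>V m\<in>J. sm (c i j l \<otimes> c k l m) (D m v))"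
        using l ijk v by (intro V.finsum_cong') (auto simp: sm_mult cl c_closed)
      finally show "sm (c i j l) (C k l v) = \<dots>" .
    qed (use ijk v in \<open>auto intro!: V.finsum_closed cl c_closed m_closed\<close>)
    also have "\<dots> = (\<Oplus>\<^sub>V m\<in>J. \<Oplus>\<^sub>V l\<in>J. sm (c i j l \<otimes> c k l m) (D m v))"
      using finJ ijk v by (intro V.finsum_swap) (auto intro!: cl c_closed m_closed)
    also have "\<dots> = (\<Oplus>\<^sub>V m\<in>J. sm (\<Oplus>l\<in>J. c i j l \<otimes> c k l m) (D m v))"
      using ijk v
      by (intro V.finsum_cong' refl additive_finsum[OF sm_additive_l abelian_group_axioms V.abelian_group_axioms, symmetric])
        (auto intro!: cl c_closed m_closed finsum_closed)
    finally show ?thesis .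
  qed
  also have "(\<Oplus>\<^sub>V l\<in>J. sm (d k (c i j l)) (D l v)) \<oplus>\<^sub>V (\<Oplus>\<^sub>V m\<in>J. sm (\<Oplus>l\<in>J. c i j l \<otimes> c k l m) (D m v))
      = (\<Oplus>\<^sub>V m\<in>J. sm (Jf i j k m) (D m v))"
  proof -
    have fc: "(\<Oplus>l\<in>J. c i j l \<otimes> c k l m) |: B" if "m \<in> J" for m
      using that ijk by (auto intro!: c_closed m_closed finsum_closed)
    show ?thesis unfolding Jf_def using ijk v
      by (subst V.finsum_addf[symmetric], (auto intro!: cl fc)[2], intro V.finsum_cong')
        (auto simp: sm_add_l cl fc)
  qed
  finally show ?thesis .
qed

text \<open>Induction on the degree. If the smaller of the two indices is not minimal, a least
  variable \<open>k\<close> of \<beta> is split off and moved to the front through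
  \<open>D i\<close> and \<open>D j\<close>; the correction terms cancel by the Jacobi
  identity.\<close>

lemma rel_e: "\<beta> \<in> mons ==> i \<in> J ==> j \<in> J ==> rel i j (e \<beta>)"
proof (induction "size \<beta>" arbitrary: \<beta> i j rule: less_induct)
  case less
  note \<beta> = less.prems(1)
  have IH: "rel i j v" if "v \<in> carrier (Vlt (size \<beta>))" "i \<in> J" "j \<in> J" for v i j
  proof -
    from that(1) have "v \<in> carrier (free_module B {\<delta> \<in> mons. size \<delta> < size \<beta>})" by (simp add: Vlt_def)
    then show ?thesis
    proof (induction rule: fm_induct)
      case zero
      have "D l \<zero>\<^sub>V = \<zero>\<^sub>V" "C i j \<zero>\<^sub>V = \<zero>\<^sub>V" if "l \<in> J" for l
        using that additive_zero[OF D_additive V.abelian_group_axioms V.abelian_group_axioms]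
          additive_zero[OF C_additive[OF \<open>i \<in> J\<close> \<open>j \<in> J\<close>] V.abelian_group_axioms V.abelian_group_axioms] by auto
      then have "rel i j \<zero>\<^sub>V" unfolding rel_def using that(2,3) by simp
      then show ?case by (simp add: V_def)
    next
      case (add r p f)
      have p: "p \<in> mons" "size p < size \<beta>" using add(2) by auto
      have f: "f |: V" using add(3) Vlt_sub[of f "size \<beta>"] by (simp add: Vlt_def)
      have "rel i j (sm r (e p) \<oplus>\<^sub>V f)"
        by (intro rel_add rel_smult sm_closed e_closed p f add(1,4) that less.hyps)
      then show ?case using mt_e[OF add(1), of p] by (simp add: V_def)
    qed
  qed
  have main: "rel i j (e \<beta>)" if ij: "i \<in> J" "j \<in> J" "j < i" for i j
  proof (cases "\<forall>x\<in>#\<beta>. j \<le> x")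
    case True
    then show ?thesis by (rule rel_easy[OF ij \<beta>])
  next
    case False
    then obtain k \<gamma> where k: "\<beta> = add_mset k \<gamma>" "k < j" "k \<in> J" "\<gamma> \<in> mons" "\<forall>x\<in>#\<gamma>. k \<le> x"
      using split_min \<beta> by metis
    let ?v = "e \<gamma>"
    have v: "?v \<in> carrier (Vlt (size \<beta>))" using k by (intro e_Vlt) auto
    have vV: "?v |: V" by (rule Vlt_sub[OF v])
    have Dk: "D k ?v = e \<beta>" unfolding k(1) by (rule D_e_le[OF k(3,4,5)])
    \<comment> \<open>The vector \<open>D l' ?v\<close> has the same degree as \<beta>, out of reach
      of the induction hypothesis. Its leading monomial has \<open>k\<close> as least variable, so
      \<open>rel_easy\<close> applies to it, and the remainder \<open>u\<close> is of lower
      degree.\<close>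
    have mixed: "rel l k (D l' ?v)" if "l \<in> J" "l' \<in> J" "k < l" "k < l'" for l l'
    proof -
      note l = that
      obtain u where u: "u \<in> carrier (Vlt (Suc (size \<gamma>)))" "D l' ?v = e (add_mset l' \<gamma>) \<oplus>\<^sub>V u"
        using D_e_top[OF l(2) k(4)] by blast
      have "rel l k u" using u(1) k by (intro IH l(1)) auto
      moreover have "rel l k (e (add_mset l' \<gamma>))" using l k by (intro rel_easy) auto
      ultimately show ?thesis unfolding u(2)
        using l k by (intro rel_add Vlt_sub[OF u(1)] e_closed) auto
    qed
    note cl = D_closed C_closed ij k(3) vV
    have 1: "D j (D k ?v) = D k (D j ?v) \<oplus>\<^sub>V C j k ?v" using IH[OF v ij(2) k(3)] by (simp add: rel_def)
    have 2: "D i (D k (D j ?v)) = D k (D i (D j ?v)) \<oplus>\<^sub>V C i k (D j ?v)"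
      using mixed[OF ij(1,2)] k(2) ij(3) by (simp add: rel_def)
    have 3: "D i (D k ?v) = D k (D i ?v) \<oplus>\<^sub>V C i k ?v" using IH[OF v ij(1) k(3)] by (simp add: rel_def)
    have 4: "D j (D k (D i ?v)) = D k (D j (D i ?v)) \<oplus>\<^sub>V C j k (D i ?v)"
      using mixed[OF ij(2,1)] k(2) ij(3) by (simp add: rel_def)
    have 5: "D i (D j ?v) = D j (D i ?v) \<oplus>\<^sub>V C i j ?v" using IH[OF v ij(1,2)] by (simp add: rel_def)
    let ?S = "\<lambda>i j k. \<Oplus>\<^sub>V m\<in>J. sm (Jf i j k m) (D m ?v)"
    have S: "?S a b l |: V" if "a \<in> J" "b \<in> J" "l \<in> J" for a b l
      using that by (intro V.finsum_closed) (auto intro!: sm_closed Jf_closed D_closed vV)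
    have 6: "D l (C a b ?v) = C a b (D l ?v) \<oplus>\<^sub>V ?S a b l" if "a \<in> J" "b \<in> J" "l \<in> J" for a b l
      by (rule D_C[OF that vV IH[OF v that(3)]])
    \<comment> \<open>Follows from the relation in both orders, so it is available exactly for the
      vectors at which the relation is already known.\<close>
    have Cneg: "C i k u = \<ominus>\<^sub>V C k i u" if "u |: V" "rel i k u" for u
    proof -
      have "rel k i u" by (rule rel_skew[OF ij(1) k(3) that])
      then have "D k (D i u) = D k (D i u) \<oplus>\<^sub>V (C i k u \<oplus>\<^sub>V C k i u)"
        using that(2) that(1) cl by (simp add: rel_def V.a_ac)
      then have "C i k u \<oplus>\<^sub>V C k i u = \<zero>\<^sub>V"
        using V.add.r_cancel_one[of "D k (D i u)" "C i k u \<oplus>\<^sub>V C k i u"] that(1) cl by (simp add: V.a_comm)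
      then show ?thesis using that(1) cl V.minus_equality by metis
    qed
    \<comment> \<open>This is \<open>D_C\<close> for the indices in cyclic order
      \<open>k, i, j\<close>, with the bracket \<open>[k,i]\<close> rewritten as the negative of
      \<open>[i,k]\<close>.\<close>
    have 7: "C i k (D j ?v) = D j (C i k ?v) \<oplus>\<^sub>V ?S k i j"
    proof -
      have "D j (C i k ?v) = \<ominus>\<^sub>V D j (C k i ?v)"
        unfolding Cneg[OF vV IH[OF v ij(1) k(3)]]
        by (rule additive_neg[OF D_additive V.abelian_group_axioms V.abelian_group_axioms]) (use cl in auto)
      also have "\<dots> = \<ominus>\<^sub>V (C k i (D j ?v) \<oplus>\<^sub>V ?S k i j)" using 6[OF k(3) ij(1,2)] by simp
      also have "\<dots> = C i k (D j ?v) \<oplus>\<^sub>V \<ominus>\<^sub>V ?S k i j"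
        using Cneg[OF D_closed[OF ij(2) vV] mixed[OF ij(1,2)]] k(2) ij(3) S[OF k(3) ij(1,2)] cl
        by (simp add: V.minus_add)
      finally show ?thesis using S[OF k(3) ij(1,2)] cl
        by (simp add: V.a_assoc V.l_neg)
    qed
    have S0: "?S i j k \<oplus>\<^sub>V (?S j k i \<oplus>\<^sub>V ?S k i j) = \<zero>\<^sub>V"
    proof -
      have "?S i j k \<oplus>\<^sub>V (?S j k i \<oplus>\<^sub>V ?S k i j) =
        (\<Oplus>\<^sub>V m\<in>J. sm (Jf i j k m) (D m ?v) \<oplus>\<^sub>V (sm (Jf j k i m) (D m ?v) \<oplus>\<^sub>V sm (Jf k i j m) (D m ?v)))"
        by (subst V.finsum_addf, (auto intro!: V.a_closed sm_closed Jf_closed ij k D_closed vV)[2],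
          subst V.finsum_addf) (auto intro!: V.a_closed sm_closed Jf_closed ij k D_closed vV)
      also have "\<dots> = (\<Oplus>\<^sub>V m\<in>J. \<zero>\<^sub>V)"
      proof (rule V.finsum_cong')
        fix m assume m: "m \<in> J"
        have "sm (Jf i j k m) (D m ?v) \<oplus>\<^sub>V (sm (Jf j k i m) (D m ?v) \<oplus>\<^sub>V sm (Jf k i j m) (D m ?v))
            = sm (Jf i j k m \<oplus> (Jf j k i m \<oplus> Jf k i j m)) (D m ?v)"
          using m ij k vV by (simp add: sm_add_l Jf_closed D_closed)
        also have "\<dots> = \<zero>\<^sub>V"
          using jacobi[OF ij(1,2) k(3) m] m vV by (simp add: Jf_def sm_zero D_closed)
        finally show "sm (Jf i j k m) (D m ?v) \<oplus>\<^sub>V (sm (Jf j k i m) (D m ?v) \<oplus>\<^sub>V sm (Jf k i j m) (D m ?v)) = \<zero>\<^sub>V" .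
      qed auto
      finally show ?thesis by simp
    qed
    \<comment> \<open>With \<open>D k ?v\<close> equal to \<open>e \<beta>\<close>, the operator
      \<open>D k\<close> is moved to the left past \<open>D j\<close> and \<open>D i\<close>. After
      \<open>D k\<close> and the bracket operators have been exchanged, the three sums
      \<open>?S\<close> of the cyclic permutations remain and cancel by \<open>S0\<close>.\<close>
    have "D i (D j (D k ?v)) = D k (D j (D i ?v)) \<oplus>\<^sub>V D k (C i j ?v) \<oplus>\<^sub>V C i k (D j ?v) \<oplus>\<^sub>V D i (C j k ?v)"
      unfolding 1 using cl by (simp add: D_add 2 5)
    also have "\<dots> = D k (D j (D i ?v)) \<oplus>\<^sub>V C j k (D i ?v) \<oplus>\<^sub>V D j (C i k ?v) \<oplus>\<^sub>V C i j (D k ?v)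
        \<oplus>\<^sub>V (?S i j k \<oplus>\<^sub>V (?S j k i \<oplus>\<^sub>V ?S k i j))"
      unfolding 7 6[OF ij(1,2) k(3)] 6[OF ij(2) k(3) ij(1)]
      using cl S[OF ij(1,2) k(3)] S[OF ij(2) k(3) ij(1)] S[OF k(3) ij(1,2)] by (simp add: V.a_ac)
    also have "\<dots> = D j (D i (D k ?v)) \<oplus>\<^sub>V C i j (D k ?v)"
      unfolding S0 3 using cl by (simp add: D_add 4)
    finally show ?thesis unfolding rel_def Dk[symmetric] .
  qed
  consider "j < i" | "i = j" | "i < j" by linarith
  then show ?case
  proof cases
    case 3
    show ?thesis by (rule rel_skew[OF less.prems(3,2) e_closed[OF \<beta>] main[OF less.prems(3,2) 3]])
  qed (use main less.prems rel_diag e_closed in auto)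
qed

lemma D_comm:
  assumes "i \<in> J" "j \<in> J" "v |: V"
  shows "D i (D j v) = D j (D i v) \<oplus>\<^sub>V C i j v"
proof (rule V_eqI[where F="\<lambda>v. D i (D j v)" and F'="\<lambda>v. D j (D i v) \<oplus>\<^sub>V C i j v", OF _ _ _ assms(3)])
  fix r \<beta> assume "r |: B" "\<beta> \<in> mons"
  then show "D i (D j (mterm B r \<beta>)) = D j (D i (mterm B r \<beta>)) \<oplus>\<^sub>V C i j (mterm B r \<beta>)"
    using rel_smult[OF assms(1,2) _ e_closed rel_e] assms mt_e unfolding rel_def by metis
qed (intro additive_sum additive_comp[OF D_additive D_additive] C_additive assms V.abelian_group_axioms)+

lemma D_Vlt:
  assumes i: "i \<in> J" and v: "v \<in> carrier (Vlt m)" shows "D i v \<in> carrier (Vlt (Suc m))"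
proof (rule Vlt_induct[OF D_additive[OF i] v])
  fix r \<beta> assume r: "r |: B" "\<beta> \<in> mons" "size \<beta> < m"
  obtain u where u: "u \<in> carrier (Vlt (Suc (size \<beta>)))" "D i (e \<beta>) = e (add_mset i \<beta>) \<oplus>\<^sub>V u"
    using D_e_top[OF i r(2)] by blast
  have "w i \<beta> \<in> carrier (Vlt (Suc m))"
    unfolding D_e[OF i r(2), symmetric] u(2) using r i by (intro Vlt_add e_Vlt Vlt_mono[OF _ u(1)]) auto
  then show "D i (mterm B r \<beta>) \<in> carrier (Vlt (Suc m))"
    using r i by (auto simp: D_mt d_closed intro!: Vlt_add mt_Vlt sm_Vlt)
qed

end

section \<open>Localization at central elements\<close>

definition derivation :: "('a, 'm) ring_scheme => ('a => 'a) => bool"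
  where "derivation R \<delta> \<longleftrightarrow> additive R R \<delta> \<and>
    (\<forall>x\<in>carrier R. \<forall>y\<in>carrier R. \<delta> (x \<otimes>\<^sub>R y) = (\<delta> x \<otimes>\<^sub>R y) \<oplus>\<^sub>R (x \<otimes>\<^sub>R \<delta> y))"

lemma derivation_additive: "derivation R \<delta> ==> additive R R \<delta>"
  and derivation_mult: "derivation R \<delta> ==> x |: R ==> y |: R ==>
    \<delta> (x \<otimes>\<^sub>R y) = (\<delta> x \<otimes>\<^sub>R y) \<oplus>\<^sub>R (x \<otimes>\<^sub>R \<delta> y)"
  by (auto simp: derivation_def)

definition center :: "('a, 'm) ring_scheme => 'a set"
  where "center R = {z \<in> carrier R. \<forall>x\<in>carrier R. z \<otimes>\<^sub>R x = x \<otimes>\<^sub>R z}"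

context ring
begin

lemma center_carrier: "z \<in> center R ==> z |: R" by (simp add: center_def)

lemma center_commute: "z \<in> center R ==> x |: R ==> z \<otimes> x = x \<otimes> z" by (simp add: center_def)

lemma center_one: "\<one> \<in> center R" by (simp add: center_def)
lemma center_zero: "\<zero> \<in> center R" by (simp add: center_def)

lemma center_add: "z \<in> center R ==> w \<in> center R ==> z \<oplus> w \<in> center R"
  by (auto simp: center_def l_distr r_distr)

lemma center_neg: "z \<in> center R ==> \<ominus> z \<in> center R"
  by (auto simp: center_def l_minus r_minus)

lemma center_mult:
  assumes "z \<in> center R" "w \<in> center R" shows "z \<otimes> w \<in> center R"
proof -
  have "z \<otimes> w \<otimes> x = x \<otimes> (z \<otimes> w)" if x: "x |: R" for x
  proof -
    note c = center_carrier[OF assms(1)] center_carrier[OF assms(2)] x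
    have "z \<otimes> w \<otimes> x = z \<otimes> (x \<otimes> w)"
      unfolding m_assoc[OF c] center_commute[OF assms(2) x] ..
    also have "\<dots> = x \<otimes> (z \<otimes> w)"
      unfolding m_assoc[OF c(1,3,2), symmetric] center_commute[OF assms(1) x] m_assoc[OF c(3,1,2)] ..
    finally show ?thesis .
  qed
  moreover have "z \<otimes> w |: R" using assms center_carrier by simp
  ultimately show ?thesis by (simp add: center_def)
qed

lemma center_pow: "z \<in> center R ==> z [^] (k::nat) \<in> center R"
  by (induction k) (auto simp: center_one center_mult)

lemma mult_exchange:
  assumes "x |: R" "z \<in> center R" "y |: R" "w |: R"
  shows "(x \<otimes> z) \<otimes> (y \<otimes> w) = (x \<otimes> y) \<otimes> (z \<otimes> w)"
proof -
  have "(x \<otimes> z) \<otimes> (y \<otimes> w) = x \<otimes> (z \<otimes> y) \<otimes> w" using assms by (simp add: center_carrier m_assoc)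
  then show ?thesis
    unfolding center_commute[OF assms(2,3)] using assms by (simp add: center_carrier m_assoc)
qed

text \<open>In the derivative of \<open>z x = x z\<close>, the terms that contain the derivative of
  \<open>x\<close> agree, which leaves the claim.\<close>

lemma derivation_center:
  assumes \<delta>: "derivation R \<delta>" and z: "z \<in> center R" shows "\<delta> z \<in> center R"
proof -
  note dc = additive_closed[OF derivation_additive[OF \<delta>]]
  have zc: "z |: R" by (rule center_carrier[OF z])
  have "\<delta> z \<otimes> x = x \<otimes> \<delta> z" if x: "x |: R" for x
  proof -
    have "(\<delta> z \<otimes> x) \<oplus> (z \<otimes> \<delta> x) = (\<delta> x \<otimes> z) \<oplus> (x \<otimes> \<delta> z)"
      using derivation_mult[OF \<delta> zc x] derivation_mult[OF \<delta> x zc] center_commute[OF z x] by simp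
    also have "\<dots> = (x \<otimes> \<delta> z) \<oplus> (z \<otimes> \<delta> x)"
      using center_commute[OF z dc[OF x]] dc x zc by (simp add: a_comm)
    finally show ?thesis using dc x zc by (simp add: add.right_cancel)
  qed
  then show ?thesis using dc[OF zc] by (auto simp: center_def)
qed

lemma derivation_zero: "derivation R \<delta> ==> \<delta> \<zero> = \<zero>"
  by (rule additive_zero[OF derivation_additive is_abelian_group is_abelian_group])

lemma derivation_one: assumes "derivation R \<delta>" shows "\<delta> \<one> = \<zero>"
proof -
  have c: "\<delta> \<one> |: R" using additive_closed[OF derivation_additive[OF assms] one_closed] .
  have "\<delta> \<one> = \<delta> \<one> \<oplus> \<delta> \<one>" using derivation_mult[OF assms one_closed one_closed] c by simp
  then show ?thesis using c add.l_cancel_one by fastforce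
qed

end

text \<open>The localization of \<open>A\<close> at \<open>s\<close>, divided by the elements annihilated by some element of \<open>S\<close>. It
  is constructed as a quotient of the polynomial ring \<open>A[y]\<close>.\<close>

locale central_localization = ring A for A :: "('a, 'm) ring_scheme" (structure) +
  fixes S :: "'a set" and s :: 'a
  assumes S_central: "S \<subseteq> center A" and one_S: "\<one> \<in> S"
    and mult_S: "\<And>t r. t \<in> S ==> r \<in> S ==> t \<otimes> r \<in> S" and s_S: "s \<in> S"
begin

sublocale NY: monoid_alg A nat_monoid
  by (intro monoid_alg.intro ring_axioms comm_monoid.axioms(1)[OF nat_comm_monoid])

definition Y :: "('a, nat => 'a) module" where "Y = monoid_algebra A nat_monoid"

sublocale Y: ring Y unfolding Y_def by (rule NY.ma_ring)

abbreviation "yt a k \<equiv> mterm A a (k::nat)"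

lemma yt_closed: "a |: A ==> yt a k |: Y"
  unfolding Y_def by (auto intro: mterm_closed)

lemma yt_mult: "a |: A ==> b |: A ==> yt a k \<otimes>\<^sub>Y yt b l = yt (a \<otimes> b) (k + l)"
  unfolding Y_def using NY.mterm_mult[of a b k l] by simp

lemma yt_add: "a |: A ==> b |: A ==> yt (a \<oplus> b) k = yt a k \<oplus>\<^sub>Y yt b k"
  unfolding Y_def by (simp add: mterm_def fun_eq_iff)

lemma Y_one: "\<one>\<^sub>Y = yt \<one> 0" by (simp add: Y_def)

lemma Y_zero: "\<zero>\<^sub>Y = (\<lambda>k. \<zero>)" by (simp add: Y_def)

lemma Y_add_apply: "(f \<oplus>\<^sub>Y g) k = f k \<oplus> g k" by (simp add: Y_def)

lemma Y_induct [consumes 1, case_names zero add]: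
  assumes f: "f |: Y" and "P \<zero>\<^sub>Y"
    and add: "\<And>a k f. \<lbrakk>a |: A; f |: Y; P f\<rbrakk> \<Longrightarrow> P (yt a k \<oplus>\<^sub>Y f)"
  shows "P f"
proof -
  from f have "f \<in> carrier (free_module A UNIV)" by (simp add: Y_def)
  then show ?thesis
    by (induction rule: fm_induct) (use assms(2) add in \<open>auto simp: Y_def\<close>)
qed

lemma Y_central:
  assumes "z \<in> center A" shows "yt z k \<in> center Y"
proof -
  have zc: "z |: A" using center_carrier assms by blast
  have "yt z k \<otimes>\<^sub>Y f = f \<otimes>\<^sub>Y yt z k" if "f |: Y" for f
    using that
    by (induction rule: Y_induct)
      (auto simp: yt_closed zc Y.l_distr Y.r_distr yt_mult center_commute[OF assms] add.commute)
  then show ?thesis using yt_closed[OF zc] by (auto simp: center_def)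
qed

lemma s_center: "s \<in> center A" and s_closed: "s |: A"
  using s_S S_central center_carrier by auto

lemma S_closed: "t \<in> S ==> t |: A" using S_central center_carrier by blast

definition r0 :: "nat => 'a" where "r0 = yt s (Suc 0) \<ominus>\<^sub>Y \<one>\<^sub>Y"

lemma r0_center: "r0 \<in> center Y"
  unfolding r0_def a_minus_def
  by (intro Y.center_add Y.center_neg Y_central s_center Y.center_one)

lemma r0_closed: "r0 |: Y" by (rule Y.center_carrier[OF r0_center])

text \<open>The ideal generated by \<open>s y - 1\<close>, saturated by \<open>S\<close>. Saturation
  makes every element of \<open>S\<close> a nonzerodivisor on the quotient, while only
  \<open>s\<close> is inverted by construction.\<close>

definition IL :: "(nat => 'a) set"
  where "IL = {f \<in> carrier Y. \<exists>t\<in>S. \<exists>g\<in>carrier Y. yt t 0 \<otimes>\<^sub>Y f = r0 \<otimes>\<^sub>Y g}"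

lemma yS_center: "t \<in> S ==> yt t k \<in> center Y"
  using S_central by (intro Y_central) auto

lemma yS_closed: "t \<in> S ==> yt t k |: Y"
  by (rule Y.center_carrier[OF yS_center])

lemma IL_ideal: "ideal IL Y"
proof (rule idealI[OF Y.ring_axioms])
  show "subgroup IL (add_monoid Y)"
  proof (rule Y.add.subgroupI)
    show "IL \<subseteq> carrier Y" by (auto simp: IL_def)
    have "\<zero>\<^sub>Y \<in> IL" unfolding IL_def
      using one_S by (auto intro!: bexI[of _ \<one>] bexI[of _ "\<zero>\<^sub>Y"] simp: yt_closed r0_closed)
    then show "IL \<noteq> {}" by blast
  next
    fix f assume "f \<in> IL"
    then obtain t g where f: "f |: Y" "t \<in> S" "g |: Y" "yt t 0 \<otimes>\<^sub>Y f = r0 \<otimes>\<^sub>Y g"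
      unfolding IL_def by blast
    then have "yt t 0 \<otimes>\<^sub>Y (\<ominus>\<^sub>Y f) = r0 \<otimes>\<^sub>Y (\<ominus>\<^sub>Y g)"
      by (simp add: Y.r_minus yS_closed r0_closed)
    then show "\<ominus>\<^sub>Y f \<in> IL" unfolding IL_def using f by blast
  next
    fix f f' assume "f \<in> IL" "f' \<in> IL"
    then obtain t g t' g' where f: "f |: Y" "t \<in> S" "g |: Y" "yt t 0 \<otimes>\<^sub>Y f = r0 \<otimes>\<^sub>Y g"
      and f': "f' |: Y" "t' \<in> S" "g' |: Y" "yt t' 0 \<otimes>\<^sub>Y f' = r0 \<otimes>\<^sub>Y g'"
      unfolding IL_def by blast
    note c = yS_closed[OF f(2), of 0] yS_closed[OF f'(2), of 0] f(1,3) f'(1,3) r0_closed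
    have tt: "yt (t \<otimes> t') 0 = yt t 0 \<otimes>\<^sub>Y yt t' 0" "yt (t \<otimes> t') 0 = yt t' 0 \<otimes>\<^sub>Y yt t 0"
      using f f' S_closed center_commute[of t t'] S_central by (auto simp: yt_mult)
    have "yt (t \<otimes> t') 0 \<otimes>\<^sub>Y (f \<oplus>\<^sub>Y f') = yt t' 0 \<otimes>\<^sub>Y (yt t 0 \<otimes>\<^sub>Y f) \<oplus>\<^sub>Y yt t 0 \<otimes>\<^sub>Y (yt t' 0 \<otimes>\<^sub>Y f')"
      using c tt by (simp add: Y.r_distr flip: Y.m_assoc)
    also have "\<dots> = r0 \<otimes>\<^sub>Y (yt t' 0 \<otimes>\<^sub>Y g \<oplus>\<^sub>Y yt t 0 \<otimes>\<^sub>Y g')"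
      unfolding f(4) f'(4) using c Y.center_commute[OF r0_center, of "yt t 0"] Y.center_commute[OF r0_center, of "yt t' 0"]
      by (simp add: Y.r_distr flip: Y.m_assoc)
    finally show "f \<oplus>\<^sub>Y f' \<in> IL" unfolding IL_def using c mult_S[OF f(2) f'(2)] by blast
  qed
next
  fix f x assume "f \<in> IL" and x: "x |: Y"
  then obtain t g where f: "f |: Y" "t \<in> S" "g |: Y" "yt t 0 \<otimes>\<^sub>Y f = r0 \<otimes>\<^sub>Y g"
    unfolding IL_def by blast
  note c = yS_closed[OF f(2), of 0] f(1,3) x r0_closed
  have "yt t 0 \<otimes>\<^sub>Y (x \<otimes>\<^sub>Y f) = x \<otimes>\<^sub>Y (yt t 0 \<otimes>\<^sub>Y f)"
    using c Y.center_commute[OF yS_center[OF f(2)] x] by (simp flip: Y.m_assoc)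
  also have "\<dots> = r0 \<otimes>\<^sub>Y (x \<otimes>\<^sub>Y g)"
    unfolding f(4) using c Y.center_commute[OF r0_center x] by (simp flip: Y.m_assoc)
  finally show "x \<otimes>\<^sub>Y f \<in> IL" unfolding IL_def using c f(2) by blast
  have "yt t 0 \<otimes>\<^sub>Y (f \<otimes>\<^sub>Y x) = r0 \<otimes>\<^sub>Y (g \<otimes>\<^sub>Y x)"
    using c f(4) by (simp flip: Y.m_assoc)
  then show "f \<otimes>\<^sub>Y x \<in> IL" unfolding IL_def using c f(2) by blast
qed

definition L :: "('a, (nat => 'a) set) module" where "L = quot_alg Y IL"
definition cL :: "(nat => 'a) => (nat => 'a) set" where "cL f = IL +>\<^sub>Y f"
definition lo :: "'a => (nat => 'a) set" where "lo a = cL (yt a 0)"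
definition u :: "(nat => 'a) set" where "u = cL (yt \<one> (Suc 0))"

lemma L_ring: "ring L" and cL_hom: "cL \<in> ring_hom Y L"
  unfolding L_def cL_def[abs_def] by (rule quot_alg_hom[OF Y.ring_axioms IL_ideal])+

sublocale L: ring L by (rule L_ring)

lemma L_carrier: "carrier L = cL ` carrier Y"
  by (simp add: L_def quot_alg_carrier cL_def[abs_def])

lemma cL_zero: "f |: Y ==> cL f = \<zero>\<^sub>L \<longleftrightarrow> f \<in> IL"
  using quot_alg_zero_iff[OF Y.is_abelian_group ideal_additive_subgroup[OF IL_ideal], of f]
  by (simp add: L_def cL_def)

lemma lo_hom: "lo \<in> ring_hom A L"
proof -
  have "(\<lambda>a. yt a 0) \<in> ring_hom A Y"
    by (rule ring_hom_memI) (auto simp: yt_closed yt_mult yt_add Y_one)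
  from ring_hom_trans[OF this cL_hom] show ?thesis by (simp add: comp_def lo_def[abs_def])
qed

lemmas lo_closed = ring_hom_closed[OF lo_hom]

lemma u_closed: "u |: L" unfolding u_def by (intro ring_hom_closed[OF cL_hom] yt_closed one_closed)

lemma cL_yt: "a |: A ==> cL (yt a k) = lo a \<otimes>\<^sub>L u [^]\<^sub>L k"
proof (induction k)
  case 0
  then show ?case using lo_closed by (simp add: lo_def)
next
  case (Suc k)
  have "yt a (Suc k) = yt a k \<otimes>\<^sub>Y yt \<one> (Suc 0)" using Suc.prems by (simp add: yt_mult)
  then have "cL (yt a (Suc k)) = cL (yt a k) \<otimes>\<^sub>L u"
    using ring_hom_mult[OF cL_hom yt_closed[OF Suc.prems] yt_closed[OF one_closed]] by (simp add: u_def)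
  then show ?case using Suc lo_closed u_closed by (simp add: L.m_assoc)
qed

lemma L_induct [consumes 1, case_names zero add]:
  assumes x: "x |: L" and "P \<zero>\<^sub>L"
    and add: "\<And>a k x. \<lbrakk>a |: A; x |: L; P x\<rbrakk> \<Longrightarrow> P ((lo a \<otimes>\<^sub>L u [^]\<^sub>L (k::nat)) \<oplus>\<^sub>L x)"
  shows "P x"
proof -
  obtain f where f: "f |: Y" "x = cL f" using x unfolding L_carrier by blast
  from f(1) have "P (cL f)"
  proof (induction rule: Y_induct)
    case zero
    show ?case using assms(2) ring_hom_zero[OF cL_hom Y.ring_axioms L_ring] by simp
  next
    case (add a k f)
    then show ?case
      using assms(3)[OF add(1) ring_hom_closed[OF cL_hom add(2)] add(3), of k]
        ring_hom_add[OF cL_hom yt_closed[OF add(1)] add(2), of k] by (simp add: cL_yt)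
  qed
  then show ?thesis by (simp add: f)
qed

lemma u_center: "u \<in> center L"
proof -
  have "u \<otimes>\<^sub>L x = x \<otimes>\<^sub>L u" if x: "x |: L" for x
  proof -
    obtain f where f: "f |: Y" "x = cL f" using x unfolding L_carrier by blast
    have "yt \<one> (Suc 0) \<otimes>\<^sub>Y f = f \<otimes>\<^sub>Y yt \<one> (Suc 0)" by (rule Y.center_commute[OF Y_central[OF center_one] f(1)])
    then show ?thesis unfolding u_def f(2)
      ring_hom_mult[OF cL_hom yt_closed[OF one_closed] f(1), symmetric]
      ring_hom_mult[OF cL_hom f(1) yt_closed[OF one_closed], symmetric] by simp
  qed
  then show ?thesis using u_closed by (auto simp: center_def)
qed

lemma lo_center: assumes "z \<in> center A" shows "lo z \<in> center L"
proof -
  have zc: "z |: A" using center_carrier assms by blast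
  have "lo z \<otimes>\<^sub>L x = x \<otimes>\<^sub>L lo z" if x: "x |: L" for x
  proof -
    obtain f where f: "f |: Y" "x = cL f" using x unfolding L_carrier by blast
    show ?thesis unfolding lo_def f(2)
      ring_hom_mult[OF cL_hom yt_closed[OF zc] f(1), symmetric]
      ring_hom_mult[OF cL_hom f(1) yt_closed[OF zc], symmetric] Y.center_commute[OF Y_central[OF assms] f(1)] ..
  qed
  then show ?thesis using lo_closed[OF zc] by (auto simp: center_def)
qed

lemma lo_s_u: "lo s \<otimes>\<^sub>L u = \<one>\<^sub>L"
proof -
  have "r0 \<in> IL" unfolding IL_def using one_S r0_closed
    by (auto intro!: bexI[of _ \<one>] bexI[of _ "\<one>\<^sub>Y"] simp flip: Y_one)
  then have "cL (yt s (Suc 0) \<ominus>\<^sub>Y \<one>\<^sub>Y) = \<zero>\<^sub>L" using cL_zero[OF r0_closed] by (simp add: r0_def)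
  then have "cL (yt s (Suc 0)) \<ominus>\<^sub>L \<one>\<^sub>L = \<zero>\<^sub>L"
    using ring_hom_minus[OF cL_hom Y.ring_axioms L_ring yt_closed[OF s_closed] Y.one_closed]
    by (simp add: ring_hom_one[OF cL_hom])
  then show ?thesis
    using L.minus_eq_zero_iff[OF ring_hom_closed[OF cL_hom yt_closed[OF s_closed]] L.one_closed, of "Suc 0"]
      cL_yt[OF s_closed, of "Suc 0"] u_closed by simp
qed

text \<open>The factor \<open>t\<close> is absorbed by the existential quantifier over
  \<open>S\<close> in \<open>IL\<close>.\<close>

lemma lo_S_cancel:
  assumes t: "t \<in> S" and x: "x |: L" and z: "lo t \<otimes>\<^sub>L x = \<zero>\<^sub>L"
  shows "x = \<zero>\<^sub>L"
proof -
  obtain f where f: "f |: Y" "x = cL f" using x unfolding L_carrier by blast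
  have "cL (yt t 0 \<otimes>\<^sub>Y f) = \<zero>\<^sub>L"
    using z ring_hom_mult[OF cL_hom yS_closed[OF t] f(1)] by (simp add: f(2) lo_def)
  then have "yt t 0 \<otimes>\<^sub>Y f \<in> IL" using cL_zero[OF Y.m_closed[OF yS_closed[OF t] f(1)]] by simp
  then obtain r g where r: "r \<in> S" "g |: Y" "yt r 0 \<otimes>\<^sub>Y (yt t 0 \<otimes>\<^sub>Y f) = r0 \<otimes>\<^sub>Y g"
    unfolding IL_def by blast
  then have "yt (r \<otimes> t) 0 \<otimes>\<^sub>Y f = r0 \<otimes>\<^sub>Y g"
    using f t S_closed yS_closed Y.m_assoc[of "yt r 0" "yt t 0" f] by (simp add: yt_mult)
  then have "f \<in> IL" unfolding IL_def using f mult_S[OF r(1) t] r(2) by blast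
  then show ?thesis using cL_zero[OF f(1)] f(2) by simp
qed

lemma yt_s_mult: "f |: Y ==> (yt s (Suc 0) \<otimes>\<^sub>Y f) k = (if k = 0 then \<zero> else s \<otimes> f (k - 1))"
proof (induction arbitrary: k rule: Y_induct)
  case zero
  then show ?case using Y.r_null[OF yt_closed[OF s_closed]] s_closed by (simp add: Y_zero)
next
  case (add a l f)
  have eq: "(yt s (Suc 0) \<otimes>\<^sub>Y (yt a l \<oplus>\<^sub>Y f)) k = (yt (s \<otimes> a) (Suc l)) k \<oplus> (yt s (Suc 0) \<otimes>\<^sub>Y f) k"
    using add(1,2) by (simp add: Y.r_distr yt_closed yt_mult s_closed Y_add_apply)
  have "f (k - 1) |: A" using add(2) fm_closed[of f UNIV] by (simp add: Y_def)
  then show ?case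
    unfolding eq add.IH using add(1) s_closed by (cases k) (auto simp: mterm_def Y_add_apply r_distr)
qed

text \<open>Comparing coefficients in \<open>t a = (s y - 1) g\<close> shows that the coefficients
  of \<open>g\<close> form a geometric progression with ratio \<open>s\<close> and initial term
  \<open>- t a\<close>. As \<open>g\<close> is a polynomial, some power of \<open>s\<close> kills
  that term.\<close>

lemma lo_zero:
  assumes a: "a |: A" and z: "lo a = \<zero>\<^sub>L"
  shows "\<exists>t\<in>S. t \<otimes> a = \<zero>"
proof -
  have "yt a 0 \<in> IL" using z cL_zero[OF yt_closed[OF a]] by (simp add: lo_def)
  then obtain t g where t: "t \<in> S" and g: "g |: Y" and eq: "yt t 0 \<otimes>\<^sub>Y yt a 0 = r0 \<otimes>\<^sub>Y g"
    unfolding IL_def by blast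
  have gc: "g k |: A" for k using g fm_closed[of g UNIV] by (simp add: Y_def)
  have "r0 \<otimes>\<^sub>Y g = (yt s (Suc 0) \<otimes>\<^sub>Y g) \<oplus>\<^sub>Y (\<ominus>\<^sub>Y g)"
    unfolding r0_def a_minus_def using g yt_closed[OF s_closed] by (simp add: Y.l_distr Y.l_minus)
  moreover have "(\<ominus>\<^sub>Y g) k = \<ominus> g k" for k
    using fm_neg_apply[of g UNIV k] g by (simp add: Y_def a_inv_monoid_algebra)
  ultimately have eqk: "yt (t \<otimes> a) 0 k = (if k = 0 then \<zero> else s \<otimes> g (k - 1)) \<oplus> \<ominus> g k" for k
    using fun_cong[OF eq, of k] yt_s_mult[OF g, of k] S_closed[OF t] a by (simp add: yt_mult Y_add_apply)
  have step: "g (Suc k) = s \<otimes> g k" for k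
  proof -
    have "s \<otimes> g k \<ominus> g (Suc k) = \<zero>" using eqk[of "Suc k"] by (simp add: mterm_def a_minus_def)
    then show ?thesis using minus_eq_zero_iff gc s_closed by simp
  qed
  have sp: "s [^] (k::nat) \<in> S" for k by (induction k) (auto simp: one_S mult_S s_S)
  have pow: "g k = s [^] k \<otimes> g 0" for k
  proof (induction k)
    case (Suc k)
    have "g (Suc k) = s \<otimes> s [^] k \<otimes> g 0" using step Suc s_closed gc by (simp add: m_assoc)
    then show ?case using center_commute[OF s_center, of "s [^] k"] s_closed by simp
  qed (simp add: gc)
  have "finite {k. g k \<noteq> \<zero>}" using g by (simp add: Y_def free_module_carrier)
  then obtain k where k: "g k = \<zero>" using ex_new_if_finite[OF infinite_UNIV_nat] by blast
  have g0: "t \<otimes> a = \<ominus> g 0" using eqk[of 0] gc by (simp add: mterm_def)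
  have "(s [^] k \<otimes> t) \<otimes> a = s [^] k \<otimes> (\<ominus> g 0)"
    using S_closed[OF t] a s_closed by (simp add: m_assoc g0)
  also have "\<dots> = \<zero>" using k pow[of k] gc s_closed by (simp add: r_minus)
  finally show ?thesis using mult_S[OF sp t] by blast
qed

text \<open>The quotient rule, defined on polynomials in \<open>y\<close> and then shown to vanish
  on \<open>IL\<close>; saturation causes no harm because elements of \<open>S\<close> can be
  cancelled in \<open>L\<close>.\<close>

lemma derivation_extend:
  assumes \<delta>: "derivation A \<delta>"
  obtains \<Delta> where "derivation L \<Delta>" "\<And>a. a |: A ==> \<Delta> (lo a) = lo (\<delta> a)"
proof -
  note dc = additive_closed[OF derivation_additive[OF \<delta>]]
  \<comment> \<open>The derivative of \<open>u\<close>, as forced by \<open>s u = 1\<close>.\<close>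
  define du1 where "du1 = \<ominus>\<^sub>L (lo (\<delta> s) \<otimes>\<^sub>L (u \<otimes>\<^sub>L u))"
  have du1: "du1 \<in> center L" unfolding du1_def
    by (intro L.center_neg L.center_mult lo_center derivation_center[OF \<delta>] s_center u_center)
  \<comment> \<open>The derivative of the \<open>k\<close>-th power of \<open>u\<close>, by the
    product rule.\<close>
  define du where "du = rec_nat \<zero>\<^sub>L (\<lambda>k x. (x \<otimes>\<^sub>L u) \<oplus>\<^sub>L (u [^]\<^sub>L k \<otimes>\<^sub>L du1))"
  have du_simps: "du 0 = \<zero>\<^sub>L" "\<And>k. du (Suc k) = (du k \<otimes>\<^sub>L u) \<oplus>\<^sub>L (u [^]\<^sub>L k \<otimes>\<^sub>L du1)"
    by (simp_all add: du_def)
  have upc: "u [^]\<^sub>L (k::nat) \<in> center L" for k by (rule L.center_pow[OF u_center])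
  have duc: "du k \<in> center L" for k
    by (induction k) (auto simp: du_simps intro!: L.center_zero L.center_add L.center_mult u_center upc du1)
  note cc = L.center_carrier[OF upc] L.center_carrier[OF duc] L.center_carrier[OF du1] u_closed lo_closed dc
  have du_add: "du (k + l) = (du k \<otimes>\<^sub>L u [^]\<^sub>L l) \<oplus>\<^sub>L (u [^]\<^sub>L k \<otimes>\<^sub>L du l)" for k l
  proof (induction l)
    case 0
    then show ?case using cc by (simp add: du_simps)
  next
    case (Suc l)
    have "du (k + Suc l) = (((du k \<otimes>\<^sub>L u [^]\<^sub>L l) \<oplus>\<^sub>L (u [^]\<^sub>L k \<otimes>\<^sub>L du l)) \<otimes>\<^sub>L u) \<oplus>\<^sub>L (u [^]\<^sub>L (k + l) \<otimes>\<^sub>L du1)"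
      by (simp add: du_simps Suc)
    also have "u [^]\<^sub>L (k + l) = u [^]\<^sub>L k \<otimes>\<^sub>L u [^]\<^sub>L l" using u_closed by (simp add: L.nat_pow_mult)
    finally show ?case using cc by (simp add: du_simps L.l_distr L.r_distr L.m_assoc L.a_assoc)
  qed
  define h where "h k r = (lo (\<delta> r) \<otimes>\<^sub>L u [^]\<^sub>L (k::nat)) \<oplus>\<^sub>L (lo r \<otimes>\<^sub>L du k)" for k r
  have hadd: "additive A L (h k)" for k
    unfolding h_def
    by (intro additive_sum L.is_abelian_group additive_comp[OF ring_hom_additive[OF lo_hom] L.additive_r_mult]
        additive_comp[OF derivation_additive[OF \<delta>] additive_comp[OF ring_hom_additive[OF lo_hom] L.additive_r_mult]] cc)
  \<comment> \<open>A derivation from \<open>Y\<close> to \<open>L\<close> along \<open>cL\<close>: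
    a coefficient is differentiated by \<delta> and a power of \<open>y\<close> as the corresponding
    power of \<open>u\<close>.\<close>
  define E where "E = lext A L h"
  have Eadd: "additive Y L E"
    using lext_additive[of UNIV L h, OF hadd L.is_abelian_group] by (simp add: E_def Y_def)
  have Em: "E (yt a k) = h k a" if "a |: A" for a k
    unfolding E_def using lext_mterm[of UNIV L h, OF hadd L.is_abelian_group that] by simp
  note Ec = additive_closed[OF Eadd] and cLc = ring_hom_closed[OF cL_hom]
  have mm: "E (yt a k \<otimes>\<^sub>Y yt b l) = (E (yt a k) \<otimes>\<^sub>L cL (yt b l)) \<oplus>\<^sub>L (cL (yt a k) \<otimes>\<^sub>L E (yt b l))"
    if ab: "a |: A" "b |: A" for a b k l
  proof -
    note c = cc ab
    note ex = L.mult_exchange[OF _ upc] L.mult_exchange[OF _ duc]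
    have ukl: "u [^]\<^sub>L (k + l) = u [^]\<^sub>L k \<otimes>\<^sub>L u [^]\<^sub>L l" using u_closed by (simp add: L.nat_pow_mult)
    have "E (yt a k \<otimes>\<^sub>Y yt b l) =
      (lo ((\<delta> a \<otimes> b) \<oplus> (a \<otimes> \<delta> b)) \<otimes>\<^sub>L (u [^]\<^sub>L k \<otimes>\<^sub>L u [^]\<^sub>L l)) \<oplus>\<^sub>L
      (lo (a \<otimes> b) \<otimes>\<^sub>L ((du k \<otimes>\<^sub>L u [^]\<^sub>L l) \<oplus>\<^sub>L (u [^]\<^sub>L k \<otimes>\<^sub>L du l)))"
      using ab by (simp add: yt_mult Em h_def derivation_mult[OF \<delta>] du_add ukl)
    also have "\<dots> = (((lo (\<delta> a) \<otimes>\<^sub>L lo b) \<otimes>\<^sub>L (u [^]\<^sub>L k \<otimes>\<^sub>L u [^]\<^sub>L l)) \<oplus>\<^sub>L ((lo a \<otimes>\<^sub>L lo b) \<otimes>\<^sub>L (du k \<otimes>\<^sub>L u [^]\<^sub>L l))) \<oplus>\<^sub>L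
      (((lo a \<otimes>\<^sub>L lo (\<delta> b)) \<otimes>\<^sub>L (u [^]\<^sub>L k \<otimes>\<^sub>L u [^]\<^sub>L l)) \<oplus>\<^sub>L ((lo a \<otimes>\<^sub>L lo b) \<otimes>\<^sub>L (u [^]\<^sub>L k \<otimes>\<^sub>L du l)))"
      using c by (simp add: ring_hom_add[OF lo_hom] ring_hom_mult[OF lo_hom] L.l_distr L.r_distr L.a_ac)
    also have "\<dots> = (E (yt a k) \<otimes>\<^sub>L cL (yt b l)) \<oplus>\<^sub>L (cL (yt a k) \<otimes>\<^sub>L E (yt b l))"
      using c by (simp add: Em h_def cL_yt L.l_distr L.r_distr ex)
    finally show ?thesis .
  qed
  have mg: "E (yt a k \<otimes>\<^sub>Y g) = (E (yt a k) \<otimes>\<^sub>L cL g) \<oplus>\<^sub>L (cL (yt a k) \<otimes>\<^sub>L E g)"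
    if a: "a |: A" and g: "g |: Y" for a k g
    using g
  proof (induction rule: Y_induct)
    case zero
    then show ?case using a yt_closed additive_zero[OF Eadd Y.is_abelian_group L.is_abelian_group]
      ring_hom_zero[OF cL_hom Y.ring_axioms L_ring] Ec cLc by simp
  next
    case (add b l g)
    have "E (yt a k \<otimes>\<^sub>Y (yt b l \<oplus>\<^sub>Y g)) = E (yt a k \<otimes>\<^sub>Y yt b l) \<oplus>\<^sub>L E (yt a k \<otimes>\<^sub>Y g)"
      using a add yt_closed by (simp add: Y.r_distr additive_add[OF Eadd])
    then show ?case using a add yt_closed Ec cLc
      by (simp add: mm additive_add[OF Eadd] ring_hom_add[OF cL_hom] L.r_distr L.a_ac)
  qed
  have fg: "E (f \<otimes>\<^sub>Y g) = (E f \<otimes>\<^sub>L cL g) \<oplus>\<^sub>L (cL f \<otimes>\<^sub>L E g)"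
    if f: "f |: Y" and g: "g |: Y" for f g
    using f
  proof (induction rule: Y_induct)
    case zero
    then show ?case using g additive_zero[OF Eadd Y.is_abelian_group L.is_abelian_group]
      ring_hom_zero[OF cL_hom Y.ring_axioms L_ring] Ec cLc by simp
  next
    case (add b l f)
    have "E ((yt b l \<oplus>\<^sub>Y f) \<otimes>\<^sub>Y g) = E (yt b l \<otimes>\<^sub>Y g) \<oplus>\<^sub>L E (f \<otimes>\<^sub>Y g)"
      using g add yt_closed by (simp add: Y.l_distr additive_add[OF Eadd])
    then show ?case using g add yt_closed Ec cLc
      by (simp add: mg additive_add[OF Eadd] ring_hom_add[OF cL_hom] L.l_distr L.a_ac)
  qed
  have cr0: "cL r0 = \<zero>\<^sub>L"
    using lo_s_u cL_yt[OF s_closed, of "Suc 0"] u_closed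
      ring_hom_minus[OF cL_hom Y.ring_axioms L_ring yt_closed[OF s_closed, of "Suc 0"] Y.one_closed]
    by (simp add: r0_def ring_hom_one[OF cL_hom] L.minus_eq_zero_iff)
  have "E (yt s (Suc 0)) = \<zero>\<^sub>L"
  proof -
    have "lo s \<otimes>\<^sub>L du1 = \<ominus>\<^sub>L ((lo s \<otimes>\<^sub>L u) \<otimes>\<^sub>L (lo (\<delta> s) \<otimes>\<^sub>L u))"
      unfolding du1_def L.mult_exchange[OF lo_closed[OF s_closed] u_center lo_closed[OF dc[OF s_closed]] u_closed]
      using lo_closed s_closed dc u_closed by (simp add: L.r_minus L.m_assoc)
    then show ?thesis
      using s_closed cc lo_s_u by (simp add: Em h_def du_simps L.r_neg)
  qed
  moreover have "E \<one>\<^sub>Y = \<zero>\<^sub>L"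
    using cc(5)[OF one_closed] ring_hom_zero[OF lo_hom ring_axioms L_ring]
    by (simp add: Y_one Em h_def du_simps derivation_one[OF \<delta>])
  ultimately have Er0: "E r0 = \<zero>\<^sub>L"
    unfolding r0_def using additive_minus[OF Eadd Y.is_abelian_group L.is_abelian_group yt_closed[OF s_closed] Y.one_closed]
    by (simp add: L.minus_eq_zero_iff)
  \<comment> \<open>For \<open>f\<close> in \<open>IL\<close> both \<open>cL f\<close> and
    \<open>E\<close> of a multiple of \<open>r0\<close> vanish. The Leibniz rule for
    \<open>t f\<close> then leaves \<open>lo t\<close> times \<open>E f\<close>, and
    \<open>t\<close> cancels.\<close>
  have EI: "E f = \<zero>\<^sub>L" if fI: "f \<in> IL" for f
  proof -
    obtain t g where f: "f |: Y" "t \<in> S" "g |: Y" "yt t 0 \<otimes>\<^sub>Y f = r0 \<otimes>\<^sub>Y g"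
      using fI unfolding IL_def by blast
    have "cL f = \<zero>\<^sub>L" using fI cL_zero[OF f(1)] by simp
    then have "E (yt t 0 \<otimes>\<^sub>Y f) = lo t \<otimes>\<^sub>L E f"
      using fg[OF yS_closed[OF f(2)] f(1)] Ec[OF f(1)] Ec[OF yS_closed[OF f(2)]] lo_closed[OF S_closed[OF f(2)]]
      by (simp add: lo_def)
    moreover have "E (r0 \<otimes>\<^sub>Y g) = \<zero>\<^sub>L"
      using fg[OF r0_closed f(3)] by (simp add: cr0 Er0 cLc Ec f(3))
    ultimately show ?thesis using lo_S_cancel[OF f(2) Ec[OF f(1)]] f(4) by simp
  qed
  obtain \<Delta> where \<Delta>: "additive (quot_alg Y IL) L \<Delta>" "\<And>f. f |: Y ==> \<Delta> (IL +>\<^sub>Y f) = E f"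
    using quot_alg_factor_additive[OF Y.is_abelian_group ideal_additive_subgroup[OF IL_ideal] L.is_abelian_group Eadd EI]
    by metis
  show thesis
  proof
    show "derivation L \<Delta>" unfolding derivation_def
    proof (intro conjI ballI)
      show "additive L L \<Delta>" using \<Delta>(1) by (simp add: L_def)
      fix x y assume "x |: L" "y |: L"
      then obtain f g where f: "f |: Y" "x = cL f" "g |: Y" "y = cL g" unfolding L_carrier by blast
      have cLE: "\<Delta> (cL f) = E f" if "f |: Y" for f using \<Delta>(2)[OF that] by (simp add: cL_def)
      show "\<Delta> (x \<otimes>\<^sub>L y) = (\<Delta> x \<otimes>\<^sub>L y) \<oplus>\<^sub>L (x \<otimes>\<^sub>L \<Delta> y)"
        using f fg by (simp add: cLE flip: ring_hom_mult[OF cL_hom])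
    qed
    show "\<Delta> (lo a) = lo (\<delta> a)" if "a |: A" for a
    proof -
      have "\<Delta> (lo a) = h 0 a" using \<Delta>(2)[OF yt_closed[OF that, of 0]] Em[OF that] by (simp add: lo_def cL_def)
      then show ?thesis using that cc by (simp add: h_def du_simps)
    qed
  qed
qed

text \<open>The value at \<open>u\<close> is killed by \<open>lo s\<close>, by the Leibniz rule for
  \<open>s u = 1\<close>, so it vanishes; and \<open>L\<close> is generated by the image of
  \<open>A\<close> and \<open>u\<close>.\<close>

lemma derivation_zeroI:
  assumes \<Delta>: "derivation L \<Delta>" and z: "\<And>a. a |: A ==> \<Delta> (lo a) = \<zero>\<^sub>L" and x: "x |: L"
  shows "\<Delta> x = \<zero>\<^sub>L"
proof -
  note dc = additive_closed[OF derivation_additive[OF \<Delta>]]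
  have "\<Delta> (lo s \<otimes>\<^sub>L u) = lo s \<otimes>\<^sub>L \<Delta> u"
    using derivation_mult[OF \<Delta> lo_closed[OF s_closed] u_closed] z[OF s_closed] dc[OF u_closed] u_closed lo_closed[OF s_closed]
    by simp
  then have "lo s \<otimes>\<^sub>L \<Delta> u = \<zero>\<^sub>L" by (simp add: lo_s_u L.derivation_one[OF \<Delta>])
  then have u0: "\<Delta> u = \<zero>\<^sub>L" by (rule lo_S_cancel[OF s_S dc[OF u_closed]])
  have up: "\<Delta> (u [^]\<^sub>L (k::nat)) = \<zero>\<^sub>L" for k
    by (induction k) (use u_closed in \<open>auto simp: L.derivation_one[OF \<Delta>] derivation_mult[OF \<Delta>] u0\<close>)
  show ?thesis using x
  proof (induction rule: L_induct)
    case zero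
    then show ?case by (rule L.derivation_zero[OF \<Delta>])
  next
    case (add a k x)
    then show ?case
      using additive_add[OF derivation_additive[OF \<Delta>], of "lo a \<otimes>\<^sub>L u [^]\<^sub>L k" x] u_closed lo_closed
      by (simp add: derivation_mult[OF \<Delta>] z up)
  qed
qed

end

section \<open>Partial derivatives\<close>

text \<open>The action is a parameter, so that \<open>Z\<close> acting on itself and
  \<open>Z\<close> acting on its differentials are instances of the same notion.\<close>

locale left_module = ring R + N: abelian_group N for R :: "('r, 'm) ring_scheme" (structure) and N :: "('n, 'c) ring_scheme" +
  fixes act :: "'r => 'n => 'n"
  assumes act_closed: "r |: R ==> x |: N ==> act r x |: N"
    and act_add_l: "r |: R ==> r' |: R ==> x |: N ==> act (r \<oplus> r') x = act r x \<oplus>\<^sub>N act r' x"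
    and act_add_r: "r |: R ==> x |: N ==> y |: N ==> act r (x \<oplus>\<^sub>N y) = act r x \<oplus>\<^sub>N act r y"
    and act_mult: "r |: R ==> r' |: R ==> x |: N ==> act (r \<otimes> r') x = act r (act r' x)"
    and act_one: "x |: N ==> act \<one> x = x"
begin

lemma act_additive: "r |: R ==> additive N N (act r)"
  by (intro additiveI act_closed act_add_r)

lemma act_additive_l: "x |: N ==> additive R N (\<lambda>r. act r x)"
  by (intro additiveI act_closed act_add_l)

lemma act_zero_l: "x |: N ==> act \<zero> x = \<zero>\<^sub>N"
  using additive_zero[OF act_additive_l is_abelian_group N.abelian_group_axioms] .

lemma act_zero_r: "r |: R ==> act r \<zero>\<^sub>N = \<zero>\<^sub>N"
  using additive_zero[OF act_additive N.abelian_group_axioms N.abelian_group_axioms] .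

end

locale poly_ring = cring K for K :: "('k, 'm) ring_scheme" (structure) + fixes n :: nat
begin

definition Q :: "('k, nat multiset => 'k) module" where "Q = polynomials K n"
definition XM :: "nat multiset set" where "XM = {m. set_mset m \<subseteq> {..<n}}"

lemma Q_carrier: "carrier Q = carrier (free_module K XM)" by (simp add: Q_def XM_def)
lemma Q_add: "add Q = add (free_module K XM)" by (simp add: Q_def XM_def fun_eq_iff)

sublocale QM: monoid_alg K "free_comm_monoid {..<n}"
  by (intro monoid_alg.intro ring_axioms comm_monoid.axioms(1) free_comm_monoid)

lemma Q_cring: "cring Q" unfolding Q_def by (rule QM.ma_cring[OF is_cring free_comm_monoid])

sublocale Q: cring Q by (rule Q_cring)

lemma qt_closed: "r |: K ==> m \<in> XM ==> mterm K r m |: Q"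
  unfolding Q_carrier by (rule mterm_closed)

lemma qt_mult: "r |: K ==> r' |: K ==> m \<in> XM ==> m' \<in> XM ==>
    mterm K r m \<otimes>\<^sub>Q mterm K r' m' = mterm K (r \<otimes> r') (m + m')"
  unfolding Q_def using QM.mterm_mult[of r r' m m'] by (simp add: XM_def)

lemma Q_zero: "\<zero>\<^sub>Q = (\<lambda>m. \<zero>)" by (simp add: Q_def)
lemma Q_add_apply: "(f \<oplus>\<^sub>Q g) m = f m \<oplus> g m" by (simp add: Q_def)
lemma Q_one: "\<one>\<^sub>Q = mterm K \<one> {#}" by (simp add: Q_def)
lemma qt_zero: "mterm K \<zero> m = \<zero>\<^sub>Q" by (simp add: Q_zero mterm_zero)
lemma qt_add: "r |: K ==> r' |: K ==> mterm K (r \<oplus> r') m = mterm K r m \<oplus>\<^sub>Q mterm K r' m"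
  by (auto simp: fun_eq_iff Q_add_apply mterm_def)

lemma Q_eqI:
  assumes F: "additive Q G F" "additive Q G F'" and G: "abelian_group G"
    and eq: "\<And>r m. r |: K ==> m \<in> XM ==> F (mterm K r m) = F' (mterm K r m)" and f: "f |: Q"
  shows "F f = F' f"
proof -
  have *: "additive Q G h \<longleftrightarrow> additive (free_module K XM) G h" for h
    by (simp only: additive_def Q_carrier Q_add)
  show ?thesis
    by (rule fm_additive_eqI[of XM G F F', OF F(1)[unfolded *] F(2)[unfolded *] G eq f[unfolded Q_carrier]])
qed

abbreviation "pd \<equiv> partial_deriv K"
abbreviation "qv i \<equiv> mterm K \<one> {#i#}"

lemma qv_closed: "i < n ==> qv i |: Q"
  by (rule qt_closed) (auto simp: XM_def)

lemma pd_closed: assumes f: "f |: Q" shows "pd i f |: Q"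
proof -
  have ff: "f \<in> carrier (free_module K XM)" using f by (simp add: Q_carrier)
  have z: "pd i f m = \<zero>" if "f (add_mset i m) = \<zero>" for m
    using that by (simp add: partial_deriv_def)
  have "{m. pd i f m \<noteq> \<zero>} \<subseteq> (\<lambda>m. m - {#i#}) ` {m. f m \<noteq> \<zero>}"
  proof
    fix m assume "m \<in> {m. pd i f m \<noteq> \<zero>}"
    then have "f (add_mset i m) \<noteq> \<zero>" using z by auto
    then show "m \<in> (\<lambda>m. m - {#i#}) ` {m. f m \<noteq> \<zero>}" by (auto intro!: image_eqI[of _ _ "add_mset i m"])
  qed
  moreover have "finite {m. f m \<noteq> \<zero>}" using ff by (simp add: free_module_carrier)
  ultimately have "finite {m. pd i f m \<noteq> \<zero>}" by (meson finite_imageI finite_subset)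
  moreover have "pd i f m = \<zero>" if "m \<notin> XM" for m
    using that fm_outside[OF ff, of "add_mset i m"] by (intro z) (auto simp: XM_def)
  moreover have "pd i f m |: K" for m
    using fm_closed[OF ff] by (simp add: partial_deriv_def)
  ultimately show ?thesis unfolding Q_carrier free_module_carrier by blast
qed

lemma pd_additive: "additive Q Q (pd i)"
proof (rule additiveI)
  fix f g assume fg: "f |: Q" "g |: Q"
  then have "f m |: K" "g m |: K" for m
    using fm_closed by (auto simp: Q_carrier)
  then show "pd i (f \<oplus>\<^sub>Q g) = pd i f \<oplus>\<^sub>Q pd i g"
    by (simp add: fun_eq_iff Q_add_apply partial_deriv_def add.nat_pow_distrib a_ac)
qed (rule pd_closed)

text \<open>If the variable \<open>i\<close> does not occur in \<open>m\<close>, the multiset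
  difference leaves \<open>m\<close> unchanged, but the coefficient is then zero.\<close>

lemma pd_qt: "r |: K ==> pd i (mterm K r m) = mterm K ([count m i] \<cdot> r) (m - {#i#})"
  by (auto simp: fun_eq_iff partial_deriv_def mterm_def not_in_iff)
    (metis add_mset_remove_trivial_If diff_single_trivial add.nat_pow_0 count_eq_zero_iff)

lemma pd_mult:
  assumes f: "f |: Q" and g: "g |: Q"
  shows "pd i (f \<otimes>\<^sub>Q g) = (pd i f \<otimes>\<^sub>Q g) \<oplus>\<^sub>Q (f \<otimes>\<^sub>Q pd i g)"
proof -
  have sub: "m - {#i#} \<in> XM" if "m \<in> XM" for m using that by (auto simp: XM_def dest: in_diffD)
  have mm: "pd i (mterm K r m \<otimes>\<^sub>Q mterm K s p) =
      (pd i (mterm K r m) \<otimes>\<^sub>Q mterm K s p) \<oplus>\<^sub>Q (mterm K r m \<otimes>\<^sub>Q pd i (mterm K s p))"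
    if rs: "r |: K" "s |: K" "m \<in> XM" "p \<in> XM" for r s m p
  proof -
    have rsc: "r \<otimes> s |: K" using rs by simp
    have 1: "mterm K (add_pow K (count m i) r \<otimes> s) (m - {#i#} + p) = mterm K (add_pow K (count m i) (r \<otimes> s)) (m + p - {#i#})"
      using rs by (cases "i \<in># m") (simp_all add: add_pow_ldistr not_in_iff mterm_zero)
    have 2: "mterm K (r \<otimes> add_pow K (count p i) s) (m + (p - {#i#})) = mterm K (add_pow K (count p i) (r \<otimes> s)) (m + p - {#i#})"
      using rs by (cases "i \<in># p") (simp_all add: add_pow_rdistr not_in_iff mterm_zero)
    have 3: "add_pow K (count m i + count p i) (r \<otimes> s) = add_pow K (count m i) (r \<otimes> s) \<oplus> add_pow K (count p i) (r \<otimes> s)"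
      using add.nat_pow_mult[OF rsc] by simp
    show ?thesis
      using rs sub by (simp add: qt_mult pd_qt 1 2 3 qt_add)
  qed
  have mg: "pd i (mterm K r m \<otimes>\<^sub>Q g) = (pd i (mterm K r m) \<otimes>\<^sub>Q g) \<oplus>\<^sub>Q (mterm K r m \<otimes>\<^sub>Q pd i g)"
    if r: "r |: K" "m \<in> XM" for r m
  proof (rule Q_eqI[where F="\<lambda>g. pd i (mterm K r m \<otimes>\<^sub>Q g)", OF _ _ Q.is_abelian_group _ g])
    show "additive Q Q (\<lambda>g. pd i (mterm K r m \<otimes>\<^sub>Q g))"
      by (rule additive_comp[OF Q.additive_l_mult[OF qt_closed[OF r]] pd_additive])
    show "additive Q Q (\<lambda>g. (pd i (mterm K r m) \<otimes>\<^sub>Q g) \<oplus>\<^sub>Q (mterm K r m \<otimes>\<^sub>Q pd i g))"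
      by (intro additive_sum Q.is_abelian_group Q.additive_l_mult pd_closed qt_closed r
        additive_comp[OF pd_additive Q.additive_l_mult])
  qed (use mm r in auto)
  show ?thesis
  proof (rule Q_eqI[where F="\<lambda>f. pd i (f \<otimes>\<^sub>Q g)", OF _ _ Q.is_abelian_group _ f])
    show "additive Q Q (\<lambda>f. pd i (f \<otimes>\<^sub>Q g))"
      by (rule additive_comp[OF Q.additive_r_mult[OF g] pd_additive])
    show "additive Q Q (\<lambda>f. (pd i f \<otimes>\<^sub>Q g) \<oplus>\<^sub>Q (f \<otimes>\<^sub>Q pd i g))"
      by (intro additive_sum Q.is_abelian_group Q.additive_r_mult pd_closed g
        additive_comp[OF pd_additive Q.additive_r_mult])
  qed (use mg in auto)
qed

lemma pd_qv: "pd i (qv j) = (if i = j then \<one>\<^sub>Q else \<zero>\<^sub>Q)"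
  by (auto simp: pd_qt Q_one qt_zero)

lemma pd_const: "r |: K ==> pd i (mterm K r {#}) = \<zero>\<^sub>Q"
  by (simp add: pd_qt qt_zero)

text \<open>A derivation that kills constants is determined by its values at the variables. Both
  sides are additive in \<open>f\<close>, so monomials suffice, by induction on their
  degree.\<close>

lemma chain_rule:
  assumes N: "left_module R N act" and \<pi>: "\<pi> \<in> ring_hom Q R" and e: "additive Q N e"
    and e_mult: "\<And>f g. f |: Q ==> g |: Q ==>
      e (f \<otimes>\<^sub>Q g) = act (\<pi> f) (e g) \<oplus>\<^sub>N act (\<pi> g) (e f)"
    and e_const: "\<And>r. r |: K ==> e (mterm K r {#}) = \<zero>\<^sub>N"
    and f: "f |: Q"
  shows "e f = finsum N (\<lambda>i. act (\<pi> (pd i f)) (e (qv i))) {..<n}"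
proof -
  interpret N: left_module R N act by fact
  note \<pi>c = ring_hom_closed[OF \<pi>] and ec = additive_closed[OF e]
  let ?S = "\<lambda>f. finsum N (\<lambda>i. act (\<pi> (pd i f)) (e (qv i))) {..<n}"
  have z: "\<pi> \<zero>\<^sub>Q = \<zero>\<^sub>R" by (rule ring_hom_zero[OF \<pi> Q.ring_axioms N.ring_axioms])
  have S_mt: "e (mterm K r m) = ?S (mterm K r m)" if r: "r |: K" and "m \<in> XM" for r m
    using that(2)
  proof (induction m)
    case empty
    have "?S (mterm K r {#}) = finsum N (\<lambda>i. \<zero>\<^sub>N) {..<n}"
      using r by (intro N.N.finsum_cong') (auto simp: pd_const z N.act_zero_l ec qv_closed)
    then show ?case using e_const[OF r] by simp
  next
    case (add j m)
    then have j: "j < n" and m: "m \<in> XM" by (auto simp: XM_def)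
    let ?M = "mterm K r m"
    have M: "?M |: Q" by (rule qt_closed[OF r m])
    have jM: "{#j#} \<in> XM" using j by (simp add: XM_def)
    have eq: "mterm K r (add_mset j m) = qv j \<otimes>\<^sub>Q ?M"
      using r m jM by (simp add: qt_mult)
    have cl: "\<pi> (pd i ?M) |: R" "e (qv i) |: N" "\<pi> (qv j) |: R" "\<pi> ?M |: R" if "i < n" for i
      using that M j by (auto intro!: \<pi>c ec pd_closed qv_closed)
    have summand: "act (\<pi> (pd i (qv j \<otimes>\<^sub>Q ?M))) (e (qv i)) =
      (if j = i then act (\<pi> ?M) (e (qv i)) else \<zero>\<^sub>N) \<oplus>\<^sub>N act (\<pi> (qv j)) (act (\<pi> (pd i ?M)) (e (qv i)))"
      if i: "i < n" for i
    proof -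
      have "pd i (qv j \<otimes>\<^sub>Q ?M) = (if j = i then ?M else \<zero>\<^sub>Q) \<oplus>\<^sub>Q (qv j \<otimes>\<^sub>Q pd i ?M)"
        using M qv_closed[OF j] by (simp add: pd_mult pd_qv)
      then have "\<pi> (pd i (qv j \<otimes>\<^sub>Q ?M)) = (if j = i then \<pi> ?M else \<zero>\<^sub>R) \<oplus>\<^sub>R (\<pi> (qv j) \<otimes>\<^sub>R \<pi> (pd i ?M))"
        using M qv_closed[OF j] pd_closed[OF M] by (simp add: ring_hom_add[OF \<pi>] ring_hom_mult[OF \<pi>] z)
      then show ?thesis using cl[OF i] by (simp add: N.act_add_l N.act_mult N.act_zero_l)
    qed
    have "?S (qv j \<otimes>\<^sub>Q ?M) = finsum N (\<lambda>i. (if j = i then act (\<pi> ?M) (e (qv i)) else \<zero>\<^sub>N) \<oplus>\<^sub>N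
        act (\<pi> (qv j)) (act (\<pi> (pd i ?M)) (e (qv i)))) {..<n}"
      using cl by (intro N.N.finsum_cong') (auto simp: summand intro!: N.N.a_closed N.act_closed)
    also have "\<dots> = finsum N (\<lambda>i. if j = i then act (\<pi> ?M) (e (qv i)) else \<zero>\<^sub>N) {..<n} \<oplus>\<^sub>N
        finsum N (\<lambda>i. act (\<pi> (qv j)) (act (\<pi> (pd i ?M)) (e (qv i)))) {..<n}"
      using cl by (intro N.N.finsum_addf) (auto intro!: N.act_closed)
    also have "finsum N (\<lambda>i. if j = i then act (\<pi> ?M) (e (qv i)) else \<zero>\<^sub>N) {..<n} = act (\<pi> ?M) (e (qv j))"
      using cl j by (intro N.N.finsum_singleton) (auto intro!: N.act_closed)
    also have "finsum N (\<lambda>i. act (\<pi> (qv j)) (act (\<pi> (pd i ?M)) (e (qv i)))) {..<n} = act (\<pi> (qv j)) (?S ?M)"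
      using cl j by (intro additive_finsum[OF N.act_additive N.N.abelian_group_axioms N.N.abelian_group_axioms, symmetric])
        (auto intro!: N.act_closed)
    finally show ?case
      unfolding eq e_mult[OF qv_closed[OF j] M] add.IH[OF m, symmetric]
      using M j qv_closed[OF j] by (simp add: N.N.a_comm N.act_closed \<pi>c ec)
  qed
  show ?thesis
  proof (rule Q_eqI[OF e _ N.N.abelian_group_axioms S_mt f])
    show "additive Q N ?S"
      by (intro additive_finsum_fun N.N.abelian_group_axioms
        additive_comp[OF additive_comp[OF pd_additive ring_hom_additive[OF \<pi>]] N.act_additive_l] ec qv_closed) auto
  qed
qed

end

section \<open>Elimination in a matrix which is invertible modulo a prime ideal\<close>

text \<open>The linear combinations of the vectors in \<open>G\<close>. Vectors are functions on all
  natural numbers, although only the first \<open>n\<close> entries will carry information.\<close>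

inductive_set vspan :: "('q, 'm) ring_scheme => (nat => 'q) set => (nat => 'q) set"
  for Q :: "('q, 'm) ring_scheme" and G :: "(nat => 'q) set" where
  zero: "(\<lambda>i. \<zero>\<^sub>Q) \<in> vspan Q G"
| add: "a |: Q ==> g \<in> G ==> v \<in> vspan Q G ==> (\<lambda>i. (a \<otimes>\<^sub>Q g i) \<oplus>\<^sub>Q v i) \<in> vspan Q G"

context cring
begin

definition vecs :: "(nat => 'a) set" where "vecs = {g. \<forall>i. g i |: R}"

lemma vspan_vecs: "G \<subseteq> vecs ==> v \<in> vspan R G ==> v \<in> vecs"
proof -
  assume G: "G \<subseteq> vecs" and "v \<in> vspan R G"
  from this(2) show ?thesis
  proof induction
    case (add a g v)
    then have "g \<in> vecs" using G by blast
    then show ?case using add by (simp add: vecs_def)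
  qed (simp add: vecs_def)
qed

lemma vspan_add:
  assumes G: "G \<subseteq> vecs" and v: "v \<in> vspan R G" and w: "w \<in> vspan R G" shows "(\<lambda>i. v i \<oplus> w i) \<in> vspan R G"
proof -
  have wc: "w i |: R" for i using vspan_vecs[OF G w] by (simp add: vecs_def)
  show ?thesis using v
  proof induction
    case zero
    then show ?case using w wc by simp
  next
    case (add a g v)
    have "g i |: R" "v i |: R" for i
      using add G vspan_vecs[OF G add(3)] by (auto simp: vecs_def)
    then have "(\<lambda>i. (a \<otimes> g i \<oplus> v i) \<oplus> w i) = (\<lambda>i. a \<otimes> g i \<oplus> (v i \<oplus> w i))"
      using add wc by (simp add: a_assoc)
    then show ?case using vspan.add[OF add(1,2) add.IH] by simp
  qed
qed

lemma vspan_base: "G \<subseteq> vecs ==> a |: R ==> g \<in> G ==> (\<lambda>i. a \<otimes> g i) \<in> vspan R G"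
proof -
  assume h: "G \<subseteq> vecs" "a |: R" "g \<in> G"
  have "(\<lambda>i. a \<otimes> g i \<oplus> \<zero>) \<in> vspan R G" by (rule vspan.add[OF h(2,3) vspan.zero])
  moreover have "g i |: R" for i using h by (auto simp: vecs_def)
  ultimately show ?thesis using h(2) by simp
qed

lemma vspan_trans:
  assumes G: "G \<subseteq> vecs" and H: "H \<subseteq> vecs" and a: "a |: R"
    and GH: "\<And>g. g \<in> G ==> (\<lambda>i. a \<otimes> g i) \<in> vspan R H" and v: "v \<in> vspan R G"
  shows "(\<lambda>i. a \<otimes> v i) \<in> vspan R H"
proof -
  have sc: "(\<lambda>i. b \<otimes> w i) \<in> vspan R H" if b: "b |: R" and w: "w \<in> vspan R H" for b w
    using w
  proof induction
    case (add c g v)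
    have "g i |: R" "v i |: R" for i
      using add H vspan_vecs[OF H add(3)] by (auto simp: vecs_def)
    then have "(\<lambda>i. b \<otimes> (c \<otimes> g i \<oplus> v i)) = (\<lambda>i. (b \<otimes> c) \<otimes> g i \<oplus> b \<otimes> v i)"
      using add b by (simp add: r_distr m_assoc)
    then show ?case using vspan.add[OF m_closed[OF b add(1)] add(2) add.IH] by simp
  qed (use b vspan.zero in simp)
  show ?thesis using v
  proof induction
    case zero
    then show ?case using a vspan.zero by simp
  next
    case (add c g v)
    have "g i |: R" "v i |: R" for i
      using add G vspan_vecs[OF G add(3)] by (auto simp: vecs_def)
    then have "(\<lambda>i. a \<otimes> (c \<otimes> g i \<oplus> v i)) = (\<lambda>i. c \<otimes> (a \<otimes> g i) \<oplus> a \<otimes> v i)"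
      using add a by (simp add: r_distr m_lcomm)
    then show ?case using vspan_add[OF H sc[OF add(1) GH[OF add(2)]] add.IH] by simp
  qed
qed

lemma vspan_scale:
  "H \<subseteq> vecs ==> a |: R ==> v \<in> vspan R H ==> (\<lambda>i. a \<otimes> v i) \<in> vspan R H"
  using vspan_trans[of H H a v] vspan_base[of H a] by blast

lemma vspan_mono:
  assumes "G \<subseteq> vecs" "H \<subseteq> vecs" "\<And>g. g \<in> G ==> g \<in> vspan R H" "v \<in> vspan R G"
  shows "v \<in> vspan R H"
proof -
  have "(\<lambda>i. \<one> \<otimes> v i) \<in> vspan R H"
    using assms vspan_scale[OF assms(2)] by (intro vspan_trans[OF assms(1,2) _ _ assms(4)]) auto
  moreover have "v i |: R" for i using vspan_vecs[OF assms(1,4)] by (simp add: vecs_def)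
  ultimately show ?thesis by simp
qed

lemma vspan_incl: assumes "G \<subseteq> vecs" "g \<in> G" shows "g \<in> vspan R G"
proof -
  have "g i |: R" for i using assms by (auto simp: vecs_def)
  then show ?thesis using vspan_base[OF assms(1) one_closed assms(2)] by simp
qed

lemma vspan_subset: "G \<subseteq> H ==> H \<subseteq> vecs ==> v \<in> vspan R G ==> v \<in> vspan R H"
  by (rule vspan_mono[of G H]) (auto intro: vspan_incl)

lemma vspan_finsum:
  assumes H: "H \<subseteq> vecs" and f: "\<And>p. p \<in> S ==> f p \<in> vspan R H" and S: "finite S"
  shows "(\<lambda>i. \<Oplus>p\<in>S. f p i) \<in> vspan R H"
  using S f
proof (induction S)
  case empty
  then show ?case using vspan.zero by simp
next
  case (insert p S)
  have c: "f q i |: R" if "q \<in> insert p S" for q i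
    using vspan_vecs[OF H insert(4)[OF that]] by (simp add: vecs_def)
  have "(\<lambda>i. \<Oplus>q\<in>insert p S. f q i) = (\<lambda>i. f p i \<oplus> (\<Oplus>q\<in>S. f q i))"
    using insert(1,2) c by (auto simp: fun_eq_iff)
  then show ?case using vspan_add[OF H insert(4) insert(3)] insert(4) by simp
qed

text \<open>The vectors orthogonal to \<open>y\<close> form a submodule. This serves twice: with
  tangent vectors as \<open>y\<close>, and with the differentials of the variables.\<close>

lemma vspan_annihilate:
  assumes N: "left_module S N act" and \<pi>: "\<pi> \<in> ring_hom R S" and G: "G \<subseteq> vecs"
    and y: "\<And>i. i \<in> X ==> y i |: N" and z: "\<And>g. g \<in> G ==> (\<Oplus>\<^sub>N i\<in>X. act (\<pi> (g i)) (y i)) = \<zero>\<^sub>N"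
    and v: "v \<in> vspan R G"
  shows "(\<Oplus>\<^sub>N i\<in>X. act (\<pi> (v i)) (y i)) = \<zero>\<^sub>N"
  using v
proof induction
  case zero
  interpret N: left_module S N act by fact
  have "(\<Oplus>\<^sub>N i\<in>X. act (\<pi> \<zero>) (y i)) = (\<Oplus>\<^sub>N i\<in>X. \<zero>\<^sub>N)"
    using y by (intro N.N.finsum_cong') (auto simp: ring_hom_zero[OF \<pi> ring_axioms N.ring_axioms] N.act_zero_l)
  then show ?case by simp
next
  case (add a g v)
  interpret N: left_module S N act by fact
  note \<pi>c = ring_hom_closed[OF \<pi>]
  have c: "g i |: R" "v i |: R" for i
    using add G vspan_vecs[OF G add(3)] by (auto simp: vecs_def)
  have "(\<Oplus>\<^sub>N i\<in>X. act (\<pi> (a \<otimes> g i \<oplus> v i)) (y i)) =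
      (\<Oplus>\<^sub>N i\<in>X. act (\<pi> a) (act (\<pi> (g i)) (y i)) \<oplus>\<^sub>N act (\<pi> (v i)) (y i))"
    using c y add(1) by (intro N.N.finsum_cong')
      (auto simp: ring_hom_add[OF \<pi>] ring_hom_mult[OF \<pi>] N.act_add_l N.act_mult \<pi>c N.act_closed)
  also have "\<dots> = (\<Oplus>\<^sub>N i\<in>X. act (\<pi> a) (act (\<pi> (g i)) (y i))) \<oplus>\<^sub>N (\<Oplus>\<^sub>N i\<in>X. act (\<pi> (v i)) (y i))"
    using c y add(1) by (intro N.N.finsum_addf) (auto simp: \<pi>c N.act_closed)
  also have "(\<Oplus>\<^sub>N i\<in>X. act (\<pi> a) (act (\<pi> (g i)) (y i))) = act (\<pi> a) (\<Oplus>\<^sub>N i\<in>X. act (\<pi> (g i)) (y i))"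
    using c y add(1) by (intro additive_finsum[OF N.act_additive N.N.abelian_group_axioms N.N.abelian_group_axioms, symmetric])
      (auto simp: \<pi>c N.act_closed)
  finally show ?case using z[OF add(2)] add.IH add(1) by (simp add: N.act_zero_r \<pi>c)
qed

text \<open>Turns membership in a span into an explicit family of coefficients, the form in which
  the Jacobian criterion states independence. That the family vanishes from \<open>k\<close> on
  keeps the coefficient of the next row free.\<close>

lemma vspan_coefficients:
  assumes g: "\<And>l. g l \<in> vecs" and kc: "k \<le> (c::nat)" and v: "v \<in> vspan R (g ` {..<k})"
  shows "\<exists>a\<in>{..<c} \<rightarrow> carrier R. (\<forall>l\<ge>k. a l = \<zero>) \<and> (\<forall>i. v i = (\<Oplus>l\<in>{..<c}. a l \<otimes> g l i))"
  using v
proof induction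
  case zero
  have "(\<Oplus>l\<in>{..<c}. \<zero> \<otimes> g l i) = (\<Oplus>l\<in>{..<c}. \<zero>)" for i
    using g by (intro finsum_cong') (auto simp: vecs_def)
  then show ?case by (intro bexI[of _ "\<lambda>l. \<zero>"]) auto
next
  case (add b h v)
  obtain l0 where l0: "l0 < k" "h = g l0" using add(2) by auto
  obtain a where a: "a \<in> {..<c} \<rightarrow> carrier R" "\<forall>l\<ge>k. a l = \<zero>" "\<forall>i. v i = (\<Oplus>l\<in>{..<c}. a l \<otimes> g l i)"
    using add.IH by blast
  have gc: "g l i |: R" for l i using g by (simp add: vecs_def)
  have ac: "a l |: R" if "l < c" for l using a(1) that by blast
  define a' where "a' l = (if l0 = l then b else \<zero>) \<oplus> a l" for l
  have "b \<otimes> h i \<oplus> v i = (\<Oplus>l\<in>{..<c}. a' l \<otimes> g l i)" for i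
  proof -
    have "(\<Oplus>l\<in>{..<c}. a' l \<otimes> g l i) = (\<Oplus>l\<in>{..<c}. (if l0 = l then b \<otimes> g l i else \<zero>) \<oplus> a l \<otimes> g l i)"
      using ac gc add(1) by (intro finsum_cong') (auto simp: a'_def l_distr)
    also have "\<dots> = (\<Oplus>l\<in>{..<c}. if l0 = l then b \<otimes> g l i else \<zero>) \<oplus> (\<Oplus>l\<in>{..<c}. a l \<otimes> g l i)"
      using ac gc add(1) by (intro finsum_addf) auto
    also have "(\<Oplus>l\<in>{..<c}. if l0 = l then b \<otimes> g l i else \<zero>) = b \<otimes> g l0 i"
      using gc add(1) l0 kc by (intro finsum_singleton) auto
    finally show ?thesis using a(3) l0 by simp
  qed
  moreover have "a' \<in> {..<c} \<rightarrow> carrier R" using ac add(1) by (auto simp: a'_def)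
  moreover have "\<forall>l\<ge>k. a' l = \<zero>" using a(2) l0 by (auto simp: a'_def)
  ultimately show ?case by blast
qed

end

text \<open>Fraction-free Gauss elimination over the domain \<open>R / I\<close>, with all computations in \<open>R\<close>.\<close>

lemma (in primeideal) gauss_elimination:
  fixes g :: "nat => nat => 'a" and c n :: nat
  assumes g: "\<And>l. l < c ==> g l \<in> vecs"
    and indep: "\<And>k a v. \<lbrakk>k < c; a |: R; v \<in> vspan R (g ` {..<k});
      \<And>i. i < n ==> a \<otimes> g k i \<oplus> v i \<in> I\<rbrakk> \<Longrightarrow> a \<in> I"
  shows "\<exists>s\<in>carrier R - I. \<exists>T\<subseteq>{..<n}. \<exists>h. h ` T \<subseteq> vspan R (g ` {..<c}) \<and>
    (\<forall>p\<in>T. \<forall>q\<in>T. h p q = (if p = q then s else \<zero>)) \<and>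
    (\<exists>\<sigma>\<in>carrier R - I. \<forall>l<c. (\<lambda>i. \<sigma> \<otimes> g l i) \<in> vspan R (h ` T))"
  using assms
proof (induction c)
  case 0
  have "\<one> \<notin> I" using I_notcarr one_imp_carrier by blast
  then have o: "\<one> \<in> carrier R - I" by simp
  show ?case by (rule bexI[OF _ o], rule exI[of _ "{}"]) (use o in auto)
next
  case (Suc c)
  have nI: "x \<otimes> y \<in> carrier R - I" if "x \<in> carrier R - I" "y \<in> carrier R - I" for x y
    using I_prime[of x y] that by auto
  obtain s T h \<sigma> where s: "s \<in> carrier R - I" and T: "T \<subseteq> {..<n}" and h: "h ` T \<subseteq> vspan R (g ` {..<c})"
    and hT: "\<And>p q. p \<in> T ==> q \<in> T ==> h p q = (if p = q then s else \<zero>)"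
    and \<sigma>: "\<sigma> \<in> carrier R - I" "\<And>l. l < c ==> (\<lambda>i. \<sigma> \<otimes> g l i) \<in> vspan R (h ` T)"
  proof -
    have "\<exists>s\<in>carrier R - I. \<exists>T\<subseteq>{..<n}. \<exists>h. h ` T \<subseteq> vspan R (g ` {..<c}) \<and>
      (\<forall>p\<in>T. \<forall>q\<in>T. h p q = (if p = q then s else \<zero>)) \<and>
      (\<exists>\<sigma>\<in>carrier R - I. \<forall>l<c. (\<lambda>i. \<sigma> \<otimes> g l i) \<in> vspan R (h ` T))"
    proof (rule Suc.IH)
      show "g l \<in> vecs" if "l < c" for l using Suc.prems(1) that by simp
      show "a \<in> I" if "k < c" "a |: R" "v \<in> vspan R (g ` {..<k})"
        "\<And>i. i < n ==> a \<otimes> g k i \<oplus> v i \<in> I" for k a v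
        using Suc.prems(2)[OF _ that(2-4)] that(1) by simp
    qed
    then show thesis by (elim bexE exE conjE) (rule that, assumption+, simp, assumption, simp)
  qed
  have sc: "s |: R" "\<sigma> |: R" using s \<sigma> by auto
  have Gv: "g ` {..<c} \<subseteq> vecs" "g ` {..<Suc c} \<subseteq> vecs" using Suc.prems(1) by auto
  have hv: "h p \<in> vecs" if "p \<in> T" for p using vspan_vecs[OF Gv(1)] h that by blast
  have hc: "h p i |: R" if "p \<in> T" for p i using hv[OF that] by (simp add: vecs_def)
  have gc: "g c i |: R" for i using Suc.prems(1)[of c] by (simp add: vecs_def)
  have finT: "finite T" using T finite_subset by blast
  \<comment> \<open>The part of the new row along the old pivot rows. Subtracting it from
    \<open>s\<close> times the new row, as in \<open>g'\<close>, clears all old pivot columns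
    without division.\<close>
  define r where "r i = (\<Oplus>p\<in>T. g c p \<otimes> h p i)" for i
  have rc: "r i |: R" for i unfolding r_def using hc gc by (intro finsum_closed) auto
  have rh: "r \<in> vspan R (h ` T)"
    unfolding r_def using hv gc by (intro vspan_finsum finT vspan_base) auto
  have hG: "v \<in> vspan R (g ` {..<c})" if "v \<in> vspan R (h ` T)" for v
    using hv h by (intro vspan_mono[OF _ Gv(1) _ that]) auto
  define g' where "g' i = s \<otimes> g c i \<oplus> (\<ominus> \<one> \<otimes> r i)" for i
  have g'c: "g' i |: R" for i unfolding g'_def using sc gc rc by simp
  have g'T: "g' q = \<zero>" if q: "q \<in> T" for q
  proof -
    have "r q = (\<Oplus>p\<in>T. if q = p then g c p \<otimes> s else \<zero>)"
      unfolding r_def using hT q gc sc by (intro finsum_cong') auto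
    also have "\<dots> = g c q \<otimes> s" using q finT gc sc by (intro finsum_singleton) auto
    finally show ?thesis unfolding g'_def using sc gc by (simp add: l_minus m_comm r_neg)
  qed
  \<comment> \<open>Otherwise \<open>s\<close> times the row \<open>c\<close>, corrected by a
    combination of the earlier rows, would vanish modulo \<open>I\<close>, and independence would
    place \<open>s\<close> in \<open>I\<close>.\<close>
  have "\<exists>i<n. g' i \<notin> I"
  proof (rule ccontr)
    assume "\<not> (\<exists>i<n. g' i \<notin> I)"
    then have "s \<in> I" using Suc.prems(2)[of c s "\<lambda>i. \<ominus> \<one> \<otimes> r i"] sc
        vspan_scale[OF Gv(1) _ hG[OF rh], of "\<ominus> \<one>"] by (auto simp: g'_def)
    then show False using s by simp
  qed
  then obtain i0 where i0: "i0 < n" "g' i0 \<notin> I" by blast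
  define \<tau> where "\<tau> = g' i0"
  have \<tau>: "\<tau> \<in> carrier R - I" using i0 g'c by (simp add: \<tau>_def)
  then have \<tau>c: "\<tau> |: R" by simp
  have zI: "\<zero> \<in> I" by (rule additive_subgroup.zero_closed[OF additive_subgroup_axioms])
  have i0T: "i0 \<notin> T" using g'T i0(2) zI by auto
  \<comment> \<open>The entry \<tau> of \<open>g'\<close> at the new pivot column clears this column
    from the old rows. All rows are scaled so that the common diagonal entry becomes the product of
    \<open>s\<close> and \<tau>.\<close>
  define h' where "h' p i = (if p = i0 then s \<otimes> g' i else \<tau> \<otimes> h p i \<oplus> (\<ominus> h p i0 \<otimes> g' i))" for p i
  let ?T = "insert i0 T"
  have g'S: "g' \<in> vspan R (g ` {..<Suc c})"
  proof -
    have "r \<in> vspan R (g ` {..<Suc c})"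
      by (rule vspan_subset[OF _ Gv(2) hG[OF rh]]) auto
    then show ?thesis unfolding g'_def[abs_def] using sc
      by (intro vspan_add[OF Gv(2)] vspan_base[OF Gv(2)] vspan_scale[OF Gv(2)]) auto
  qed
  have h'S: "h' p \<in> vspan R (g ` {..<Suc c})" if "p \<in> ?T" for p
  proof (cases "p = i0")
    case True
    then show ?thesis unfolding h'_def[abs_def] using vspan_scale[OF Gv(2) sc(1) g'S] by simp
  next
    case False
    then have p: "p \<in> T" using that by simp
    have "h p \<in> vspan R (g ` {..<Suc c})"
      by (rule vspan_subset[OF _ Gv(2), of "g ` {..<c}"]) (use h p in auto)
    then show ?thesis unfolding h'_def[abs_def] using False hc[OF p] \<tau>c
      by (simp add: vspan_add[OF Gv(2)] vspan_scale[OF Gv(2)] g'S)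
  qed
  have h'v: "h' ` ?T \<subseteq> vecs" using h'S vspan_vecs[OF Gv(2)] by blast
  have h'diag: "h' p q = (if p = q then s \<otimes> \<tau> else \<zero>)" if "p \<in> ?T" "q \<in> ?T" for p q
  proof (cases "p = i0")
    case True
    then show ?thesis using that g'T sc by (auto simp: h'_def \<tau>_def)
  next
    case False
    then have p: "p \<in> T" using that by simp
    show ?thesis
    proof (cases "q = i0")
      case True
      then show ?thesis using False hc[OF p] \<tau>c by (simp add: h'_def \<tau>_def[symmetric] l_minus r_minus m_comm r_neg)
    next
      case False
      then have q: "q \<in> T" using that by simp
      then show ?thesis using \<open>p \<noteq> i0\<close> hT[OF p q] hc[OF p] \<tau>c sc by (simp add: h'_def g'T m_comm)
    qed
  qed
  have sg': "(\<lambda>i. s \<otimes> g' i) \<in> vspan R (h' ` ?T)"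
  proof -
    have "h' i0 \<in> vspan R (h' ` ?T)"
      by (rule vspan_incl[OF h'v]) simp
    then show ?thesis by (simp add: h'_def[abs_def])
  qed
  have sth: "(\<lambda>i. (s \<otimes> \<tau>) \<otimes> h p i) \<in> vspan R (h' ` ?T)" if p: "p \<in> T" for p
  proof -
    have "(s \<otimes> \<tau>) \<otimes> h p i = s \<otimes> h' p i \<oplus> h p i0 \<otimes> (s \<otimes> g' i)" for i
    proof -
      have "p \<noteq> i0" using p i0T by auto
      then have "s \<otimes> h' p i \<oplus> h p i0 \<otimes> (s \<otimes> g' i) = s \<otimes> (\<tau> \<otimes> h p i) \<oplus> (\<ominus> (s \<otimes> (h p i0 \<otimes> g' i)) \<oplus> s \<otimes> (h p i0 \<otimes> g' i))"
        using sc \<tau>c hc[OF p] g'c by (simp add: h'_def r_distr l_minus r_minus m_lcomm a_assoc)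
      then show ?thesis using sc \<tau>c hc[OF p] g'c by (simp add: l_neg m_assoc)
    qed
    then show ?thesis
      using vspan_add[OF h'v vspan_base[OF h'v sc(1), of "h' p"] vspan_scale[OF h'v hc[OF p] sg']] p by simp
  qed
  have strans: "(\<lambda>i. (s \<otimes> \<tau>) \<otimes> v i) \<in> vspan R (h' ` ?T)" if "v \<in> vspan R (h ` T)" for v
    using sth hv sc \<tau>c by (intro vspan_trans[OF _ h'v _ _ that]) auto
  \<comment> \<open>A common multiplier: it absorbs \<sigma> for the earlier rows, the factor
    \<open>s\<close> hidden in \<open>g'\<close>, and the passage from the old pivot rows to the new
    ones.\<close>
  define \<sigma>' where "\<sigma>' = (s \<otimes> \<sigma>) \<otimes> (s \<otimes> \<tau>)"
  have \<sigma>': "\<sigma>' \<in> carrier R - I" unfolding \<sigma>'_def by (intro nI s \<sigma> \<tau>)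
  have "(\<lambda>i. \<sigma>' \<otimes> g l i) \<in> vspan R (h' ` ?T)" if l: "l < Suc c" for l
  proof (cases "l < c")
    case True
    have glc: "g l i |: R" for i using Suc.prems(1)[OF l] by (simp add: vecs_def)
    have "\<sigma>' \<otimes> g l i = s \<otimes> ((s \<otimes> \<tau>) \<otimes> (\<sigma> \<otimes> g l i))" for i
      using sc \<tau>c glc by (simp add: \<sigma>'_def m_ac)
    then show ?thesis using vspan_scale[OF h'v sc(1) strans[OF \<sigma>(2)[OF True]]] by simp
  next
    case False
    then have l: "l = c" using l by simp
    have gcl: "\<sigma>' \<otimes> g l i = (\<sigma> \<otimes> \<tau>) \<otimes> (s \<otimes> g' i) \<oplus> \<sigma> \<otimes> ((s \<otimes> \<tau>) \<otimes> r i)" for i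
    proof -
      have "s \<otimes> g c i = g' i \<oplus> r i"
        using sc gc[of i] rc[of i] by (simp add: g'_def l_minus a_assoc l_neg)
      then have "(\<sigma> \<otimes> (s \<otimes> \<tau>)) \<otimes> (s \<otimes> g c i) = (\<sigma> \<otimes> (s \<otimes> \<tau>)) \<otimes> (g' i \<oplus> r i)" by simp
      then show ?thesis using sc \<tau>c gc[of i] rc[of i] g'c[of i] by (simp add: l \<sigma>'_def r_distr m_ac)
    qed
    show ?thesis unfolding gcl using sc \<tau>c
      by (intro vspan_add[OF h'v] vspan_scale[OF h'v] sg' strans[OF rh]) auto
  qed
  moreover have "s \<otimes> \<tau> \<in> carrier R - I" by (intro nI s \<tau>)
  moreover have "?T \<subseteq> {..<n}" using T i0 by simp
  moreover have "h' ` ?T \<subseteq> vspan R (g ` {..<Suc c})" using h'S by blast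
  ultimately show ?case using h'diag \<sigma>'
    by (intro bexI[of _ "s \<otimes> \<tau>"] exI[of _ ?T] conjI exI[of _ h'] bexI[of _ \<sigma>']) auto
qed

section \<open>Local coordinates on a smooth variety\<close>

text \<open>Local coordinates \<open>x\<close> at the prime \<open>\<pp>\<close>: after inverting \<open>s\<close>, the differentials are a basis
  of the Kaehler differentials, and \<open>w j z / s\<close> are the partial derivatives of \<open>z\<close>. These are
  derivations only up to elements which vanish in the local ring at \<open>\<pp>\<close>.\<close>

locale smooth_chart = kaehler_setup K Z
  for K :: "('k, 'm) ring_scheme" and Z :: "('k, 'z, 'c) module_scheme" (structure) +
  fixes \<pp> :: "'z set" and J :: "nat set" and x :: "nat => 'z" and s :: 'z and w :: "nat => 'z => 'z"
  assumes chart_prime: "primeideal \<pp> Z" and chart_fin: "finite J"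
    and x_closed: "j \<in> J ==> x j |: Z" and s_carr: "s \<in> carrier Z - \<pp>"
    and w_closed: "j \<in> J ==> z |: Z ==> w j z |: Z"
    and d_chart: "z |: Z ==>
      s \<odot>\<^bsub>kaehler K Z\<^esub> kaehler_d K Z z = (\<Oplus>\<^bsub>kaehler K Z\<^esub>j\<in>J. w j z \<odot>\<^bsub>kaehler K Z\<^esub> kaehler_d K Z (x j))"
    and w_add: "j \<in> J ==> y |: Z ==> z |: Z ==>
      \<exists>t\<in>carrier Z - \<pp>. t \<otimes> w j (y \<oplus> z) = t \<otimes> (w j y \<oplus> w j z)"
    and w_mult: "j \<in> J ==> y |: Z ==> z |: Z ==>
      \<exists>t\<in>carrier Z - \<pp>. t \<otimes> w j (y \<otimes> z) = t \<otimes> ((y \<otimes> w j z) \<oplus> (z \<otimes> w j y))"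
    and w_const: "j \<in> J ==> c |: K ==> \<exists>t\<in>carrier Z - \<pp>. t \<otimes> w j (c \<odot> \<one>) = t \<otimes> \<zero>"
    and w_x: "j \<in> J ==> i \<in> J ==> \<exists>t\<in>carrier Z - \<pp>. t \<otimes> w j (x i) = t \<otimes> (if i = j then s else \<zero>)"

text \<open>The outcome of elimination in the Jacobian matrix. The set \<open>I\<close> holds the
  pivot columns, and the rows \<open>h\<close> span, up to factors outside of \<open>\<pp>\<close>
  and modulo the kernel, the gradients of all equations. The remaining variables will be the local
  coordinates.\<close>

locale chart_data = kaehler_setup K Z + PR: poly_ring K n
  for K :: "('k, 'm) ring_scheme" and Z :: "('k, 'z, 'c) module_scheme" (structure) and n :: nat +
  fixes \<pi> :: "(nat multiset => 'k) => 'z" and \<pp> :: "'z set" and I :: "nat set"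
    and h :: "nat => nat => nat multiset => 'k" and s :: "nat multiset => 'k"
  assumes pres: "presentation K Z n \<pi>" and prime: "primeideal \<pp> Z" and I: "I \<subseteq> {..<n}"
    and s: "s |: PR.Q" "\<pi> s \<notin> \<pp>"
    and h_diag: "p \<in> I ==> q \<in> I ==> h p q = (if p = q then s else \<zero>\<^bsub>PR.Q\<^esub>)"
    and h_ker: "p \<in> I ==> h p \<in> vspan PR.Q ((\<lambda>F i. partial_deriv K i F) ` a_kernel PR.Q Z \<pi>)"
    and ker_h: "F \<in> a_kernel PR.Q Z \<pi> ==> \<exists>t\<in>carrier PR.Q. \<pi> t \<notin> \<pp> \<and>
      (\<exists>v\<in>vspan PR.Q (h ` I). \<forall>i<n. \<pi> (t \<otimes>\<^bsub>PR.Q\<^esub> partial_deriv K i F) = \<pi> (v i))"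
begin

abbreviation "Q \<equiv> PR.Q"

lemma \<pi>_hom: "\<pi> \<in> ring_hom Q Z"
  and \<pi>_surj: "\<pi> ` carrier Q = carrier Z"
  and \<pi>_smult: "r |: K ==> f |: Q ==> \<pi> (r \<odot>\<^bsub>polynomials K n\<^esub> f) = r \<odot> \<pi> f"
  using pres by (auto simp: presentation_def alg_hom_def PR.Q_def)

lemmas \<pi>c = ring_hom_closed[OF \<pi>_hom]

lemma \<pi>_zero: "\<pi> \<zero>\<^sub>Q = \<zero>" by (rule ring_hom_zero[OF \<pi>_hom PR.Q.ring_axioms Zc.ring_axioms])

lemma \<pi>_const: "r |: K ==> \<pi> (mterm K r {#}) = r \<odot> \<one>"
proof -
  assume r: "r |: K"
  have "mterm K r {#} = r \<odot>\<^bsub>polynomials K n\<^esub> \<one>\<^sub>Q"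
    using r by (auto simp: PR.Q_one mterm_def fun_eq_iff)
  then show ?thesis using \<pi>_smult[OF r, of "\<one>\<^sub>Q"] ring_hom_one[OF \<pi>_hom] by simp
qed

lemma grads_vecs: "(\<lambda>F i. partial_deriv K i F) ` a_kernel Q Z \<pi> \<subseteq> PR.Q.vecs"
  by (auto simp: PR.Q.vecs_def a_kernel_def' PR.pd_closed)

lemma h_vecs: "h ` I \<subseteq> PR.Q.vecs"
  using PR.Q.vspan_vecs[OF grads_vecs h_ker] by blast

lemma h_closed: "p \<in> I ==> h p i |: Q"
  using h_vecs by (auto simp: PR.Q.vecs_def)

definition J :: "nat set" where "J = {..<n} - I"
text \<open>The tangent vector that belongs to the free variable \<open>j\<close>: it is
  \<open>s\<close> there, zero at the other free variables, and the pivot entries are chosen such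
  that every row of \<open>h\<close> annihilates it.\<close>

definition W :: "nat => nat => nat multiset => 'k"
  where "W j i = (if i = j then s else if i \<in> I then \<ominus>\<^sub>Q h i j else \<zero>\<^sub>Q)"
text \<open>The directional derivative along the tangent vector \<open>W j\<close>; divided by the
  image of \<open>s\<close> it will be the partial derivative by the coordinate
  \<open>j\<close>.\<close>

definition wt :: "nat => (nat multiset => 'k) => 'z"
  where "wt j f = (\<Oplus>i\<in>{..<n}. \<pi> (partial_deriv K i f) \<otimes> \<pi> (W j i))"
text \<open>An arbitrary polynomial representative, chosen without regard to the operations. This is
  why the derivation rules for \<open>wt j (lift z)\<close> hold only up to factors outside of
  \<open>\<pp>\<close>.\<close>

definition lift :: "'z => nat multiset => 'k" where "lift z = (SOME f. f |: Q \<and> \<pi> f = z)"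

lemma W_closed: "W j i |: Q" using s h_closed by (simp add: W_def)

lemma lift: assumes "z |: Z" shows "lift z |: Q" "\<pi> (lift z) = z"
proof -
  have "\<exists>f. f |: Q \<and> \<pi> f = z" using assms by (auto simp flip: \<pi>_surj)
  from someI_ex[OF this] show "lift z |: Q" "\<pi> (lift z) = z" by (simp_all add: lift_def)
qed

lemma Z_module: "left_module Z Z (\<lambda>a b. a \<otimes> b)"
  by unfold_locales (auto simp: Zc.l_distr Zc.r_distr Zc.m_assoc)

lemma Omega_module: "left_module Z \<Omega> (\<lambda>a b. a \<odot>\<^sub>\<Omega> b)"
  by unfold_locales (auto simp: Om.smult_l_distr Om.smult_r_distr Om.smult_assoc1)

sublocale ZM: left_module Z Z "\<lambda>a b. a \<otimes> b" by (rule Z_module)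
sublocale OM: left_module Z \<Omega> "\<lambda>a b. a \<odot>\<^sub>\<Omega> b" by (rule Omega_module)

lemma wt_additive: "additive Q Z (wt j)"
  unfolding wt_def
  by (intro additive_finsum_fun Zc.is_abelian_group ZM.act_additive_l \<pi>c W_closed
    additive_comp[OF additive_comp[OF PR.pd_additive ring_hom_additive[OF \<pi>_hom]] ZM.act_additive_l])

lemmas wt_closed = additive_closed[OF wt_additive]

lemma wt_mult:
  assumes f: "f |: Q" and g: "g |: Q"
  shows "wt j (f \<otimes>\<^sub>Q g) = (\<pi> f \<otimes> wt j g) \<oplus> (\<pi> g \<otimes> wt j f)"
proof -
  note cl = f g \<pi>c PR.pd_closed W_closed
  have "wt j (f \<otimes>\<^sub>Q g) = (\<Oplus>i\<in>{..<n}. \<pi> f \<otimes> (\<pi> (partial_deriv K i g) \<otimes> \<pi> (W j i)) \<oplus>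
      \<pi> g \<otimes> (\<pi> (partial_deriv K i f) \<otimes> \<pi> (W j i)))"
    unfolding wt_def using cl by (intro Zc.finsum_cong')
      (auto simp: PR.pd_mult ring_hom_add[OF \<pi>_hom] ring_hom_mult[OF \<pi>_hom] Zc.l_distr Zc.r_distr Zc.m_ac Zc.a_ac)
  also have "\<dots> = (\<Oplus>i\<in>{..<n}. \<pi> f \<otimes> (\<pi> (partial_deriv K i g) \<otimes> \<pi> (W j i))) \<oplus>
      (\<Oplus>i\<in>{..<n}. \<pi> g \<otimes> (\<pi> (partial_deriv K i f) \<otimes> \<pi> (W j i)))"
    using cl by (intro Zc.finsum_addf) auto
  finally show ?thesis unfolding wt_def using cl by (simp add: Zc.finsum_rdistr[symmetric] Pi_def)
qed

lemma wt_const: "r |: K ==> wt j (mterm K r {#}) = \<zero>"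
proof -
  assume r: "r |: K"
  have "wt j (mterm K r {#}) = (\<Oplus>i\<in>{..<n}. \<zero>)"
    unfolding wt_def using r by (intro Zc.finsum_cong') (auto simp: PR.pd_const \<pi>_zero \<pi>c W_closed)
  then show ?thesis by simp
qed

lemma wt_qv: "i < n ==> wt j (mterm K \<one>\<^sub>K {#i#}) = \<pi> (W j i)"
proof -
  assume i: "i < n"
  have "wt j (mterm K \<one>\<^sub>K {#i#}) = (\<Oplus>k\<in>{..<n}. if i = k then \<pi> (W j k) else \<zero>)"
    unfolding wt_def using i
    by (intro Zc.finsum_cong') (auto simp: PR.pd_qv \<pi>_zero ring_hom_one[OF \<pi>_hom] \<pi>c W_closed)
  also have "\<dots> = \<pi> (W j i)" using i by (intro Zc.finsum_singleton) (auto simp: \<pi>c W_closed)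
  finally show ?thesis .
qed

lemma hW:
  assumes p: "p \<in> I" and j: "j \<in> J" shows "(\<Oplus>i\<in>{..<n}. \<pi> (h p i) \<otimes> \<pi> (W j i)) = \<zero>"
proof -
  have pj: "p < n" "j < n" "j \<noteq> p" "j \<notin> I" using p j I by (auto simp: J_def)
  have cl: "\<pi> (h p i) |: Z" "\<pi> s |: Z" for i using \<pi>c h_closed[OF p] s by auto
  have sum: "\<pi> (h p i) \<otimes> \<pi> (W j i) = (if j = i then \<pi> (h p i) \<otimes> \<pi> s else \<zero>) \<oplus> (if p = i then \<ominus> (\<pi> (h p j) \<otimes> \<pi> s) else \<zero>)" for i
    using p pj h_diag[OF p, of i] h_closed[OF p] cl h_closed[of i]
    by (auto simp: W_def \<pi>_zero ring_hom_neg[OF \<pi>_hom PR.Q.ring_axioms Zc.ring_axioms] Zc.r_minus Zc.m_comm \<pi>c)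
  have "(\<Oplus>i\<in>{..<n}. \<pi> (h p i) \<otimes> \<pi> (W j i)) = (\<Oplus>i\<in>{..<n}. if j = i then \<pi> (h p i) \<otimes> \<pi> s else \<zero>) \<oplus>
      (\<Oplus>i\<in>{..<n}. if p = i then \<ominus> (\<pi> (h p j) \<otimes> \<pi> s) else \<zero>)"
    unfolding sum using cl by (intro Zc.finsum_addf) auto
  also have "(\<Oplus>i\<in>{..<n}. if j = i then \<pi> (h p i) \<otimes> \<pi> s else \<zero>) = \<pi> (h p j) \<otimes> \<pi> s"
    using cl pj by (intro Zc.finsum_singleton) auto
  also have "(\<Oplus>i\<in>{..<n}. if p = i then \<ominus> (\<pi> (h p j) \<otimes> \<pi> s) else \<zero>) = \<ominus> (\<pi> (h p j) \<otimes> \<pi> s)"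
    using cl pj by (intro Zc.finsum_singleton[where f="\<lambda>i. \<ominus> (\<pi> (h p j) \<otimes> \<pi> s)"]) auto
  finally show ?thesis using cl by (simp add: Zc.r_neg)
qed

text \<open>Up to a factor outside of \<open>\<pp>\<close>, the gradient of an equation is a
  combination of the rows of \<open>h\<close>, and the tangent vector is orthogonal to these. Hence
  the directional derivative is almost independent of the representative, as \<open>wt_eq\<close>
  states.\<close>

lemma wt_ker:
  assumes j: "j \<in> J" and F: "F \<in> a_kernel Q Z \<pi>"
  shows "\<exists>t\<in>carrier Z - \<pp>. t \<otimes> wt j F = \<zero>"
proof -
  have Fc: "F |: Q" using F by (simp add: a_kernel_def')
  obtain t v where t: "t |: Q" "\<pi> t \<notin> \<pp>" and v: "v \<in> vspan Q (h ` I)"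
    and tv: "\<And>i. i < n ==> \<pi> (t \<otimes>\<^sub>Q partial_deriv K i F) = \<pi> (v i)"
    using ker_h[OF F] by blast
  have vc: "v i |: Q" for i using PR.Q.vspan_vecs[OF h_vecs v] by (simp add: PR.Q.vecs_def)
  note cl = t Fc \<pi>c PR.pd_closed W_closed vc
  have "\<pi> t \<otimes> wt j F = (\<Oplus>i\<in>{..<n}. \<pi> t \<otimes> (\<pi> (partial_deriv K i F) \<otimes> \<pi> (W j i)))"
    unfolding wt_def using cl by (intro Zc.finsum_rdistr) auto
  also have "\<dots> = (\<Oplus>i\<in>{..<n}. \<pi> (v i) \<otimes> \<pi> (W j i))"
    using cl by (intro Zc.finsum_cong') (auto simp: tv[symmetric] ring_hom_mult[OF \<pi>_hom] Zc.m_assoc)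
  also have "\<dots> = \<zero>"
    by (rule PR.Q.vspan_annihilate[OF Z_module \<pi>_hom h_vecs _ _ v, where y="\<lambda>i. \<pi> (W j i)"])
      (use hW[OF _ j] \<pi>c W_closed in auto)
  finally show ?thesis using t \<pi>c by blast
qed

lemma wt_eq:
  assumes j: "j \<in> J" and f: "f |: Q" "g |: Q" "\<pi> f = \<pi> g"
  shows "\<exists>t\<in>carrier Z - \<pp>. t \<otimes> wt j f = t \<otimes> wt j g"
proof -
  have "\<pi> (f \<ominus>\<^sub>Q g) = \<zero>"
    using ring_hom_minus[OF \<pi>_hom PR.Q.ring_axioms Zc.ring_axioms f(1,2)] f(3) \<pi>c[OF f(2)]
    by (simp add: a_minus_def Zc.r_neg)
  then have "f \<ominus>\<^sub>Q g \<in> a_kernel Q Z \<pi>" using f by (simp add: a_kernel_def')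
  from wt_ker[OF j this] obtain t where t: "t \<in> carrier Z - \<pp>" "t \<otimes> wt j (f \<ominus>\<^sub>Q g) = \<zero>" by blast
  have tc: "t |: Z" using t by simp
  have "t \<otimes> wt j f \<ominus> t \<otimes> wt j g = \<zero>"
    using t(2) additive_minus[OF wt_additive PR.Q.is_abelian_group Zc.is_abelian_group f(1,2)] tc
      wt_closed[OF f(1)] wt_closed[OF f(2)]
    by (simp add: a_minus_def Zc.r_distr Zc.r_minus)
  then have "t \<otimes> wt j f = t \<otimes> wt j g"
    using Zc.minus_eq_zero_iff tc wt_closed[OF f(1)] wt_closed[OF f(2)] by simp
  then show ?thesis using t by blast
qed

abbreviation "xv i \<equiv> \<pi> (mterm K \<one>\<^sub>K {#i#})"

lemma xv_closed: "i < n ==> xv i |: Z"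
  by (rule \<pi>c[OF PR.qv_closed])

lemma dxv: "i < n ==> dZ (xv i) |: \<Omega>" by (rule dZ_closed[OF xv_closed])

lemma dZ_additive: "additive Z \<Omega> dZ" by (rule additiveI[OF dZ_closed dZ_add])

lemma dZ_one: "dZ \<one> = \<zero>\<^sub>\<Omega>"
proof -
  have "dZ \<one> = dZ \<one> \<oplus>\<^sub>\<Omega> dZ \<one>"
    using dZ_mult[OF Zc.one_closed Zc.one_closed] by (simp add: OM.act_one dZ_closed)
  then show ?thesis using Om.M.add.l_cancel_one'[of "dZ \<one>" "dZ \<one>"] by (simp add: dZ_closed)
qed

lemma dZ_chain: "f |: Q ==> dZ (\<pi> f) = (\<Oplus>\<^sub>\<Omega> i\<in>{..<n}. \<pi> (partial_deriv K i f) \<odot>\<^sub>\<Omega> dZ (xv i))"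
  by (rule PR.chain_rule[OF Omega_module \<pi>_hom additive_comp[OF ring_hom_additive[OF \<pi>_hom] dZ_additive]])
    (auto simp: ring_hom_mult[OF \<pi>_hom] dZ_mult \<pi>c \<pi>_const dZ_scalar dZ_one OM.act_zero_r kap_closed)

lemma grad_zero:
  assumes "F \<in> a_kernel Q Z \<pi>" shows "(\<Oplus>\<^sub>\<Omega> i\<in>{..<n}. \<pi> (partial_deriv K i F) \<odot>\<^sub>\<Omega> dZ (xv i)) = \<zero>\<^sub>\<Omega>"
  using assms dZ_chain[of F] additive_zero[OF dZ_additive Zc.is_abelian_group Om.M.abelian_group_axioms]
  by (simp add: a_kernel_def')

lemma finJ: "finite J" by (simp add: J_def)
lemma Jn: "j \<in> J ==> j < n" by (simp add: J_def)

text \<open>For a pivot variable this solves the linear equation given by the row \<open>h i\<close>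
  for the differential of the variable \<open>i\<close>; the coefficient of that differential is
  \<open>s\<close> and the other pivot entries vanish.\<close>

lemma d_qv:
  assumes i: "i < n"
  shows "\<pi> s \<odot>\<^sub>\<Omega> dZ (xv i) = (\<Oplus>\<^sub>\<Omega> j\<in>J. \<pi> (W j i) \<odot>\<^sub>\<Omega> dZ (xv j))"
proof (cases "i \<in> I")
  case False
  then have iJ: "i \<in> J" using i by (simp add: J_def)
  have sc: "\<pi> s |: Z" using s \<pi>c by simp
  have "(\<Oplus>\<^sub>\<Omega> j\<in>J. \<pi> (W j i) \<odot>\<^sub>\<Omega> dZ (xv j)) = (\<Oplus>\<^sub>\<Omega> j\<in>J. if i = j then \<pi> s \<odot>\<^sub>\<Omega> dZ (xv j) else \<zero>\<^sub>\<Omega>)"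
    using False sc dxv by (intro Om.M.finsum_cong') (auto simp: W_def \<pi>_zero Jn OM.act_zero_l OM.act_closed)
  also have "\<dots> = \<pi> s \<odot>\<^sub>\<Omega> dZ (xv i)"
    using iJ finJ sc dxv Jn by (intro Om.M.finsum_singleton) (auto intro!: OM.act_closed)
  finally show ?thesis ..
next
  case True
  note hc = \<pi>c[OF h_closed[OF True]]
  have sc: "\<pi> s |: Z" using s \<pi>c by simp
  have IJ: "{..<n} = I \<union> J" "I \<inter> J = {}" "finite I" using I finite_subset[OF I] by (auto simp: J_def)
  have In: "k \<in> I ==> k < n" for k using I by auto
  let ?t = "\<lambda>k. \<pi> (h i k) \<odot>\<^sub>\<Omega> dZ (xv k)"
  have tc: "?t k |: \<Omega>" if "k < n" for k using OM.act_closed[OF hc dxv[OF that]] .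
  have "(\<Oplus>\<^sub>\<Omega> k\<in>{..<n}. ?t k) = \<zero>\<^sub>\<Omega>"
    by (rule PR.Q.vspan_annihilate[OF Omega_module \<pi>_hom grads_vecs _ _ h_ker[OF True], where y="\<lambda>i. dZ (xv i)"])
      (use grad_zero dxv in auto)
  moreover have "(\<Oplus>\<^sub>\<Omega> k\<in>{..<n}. ?t k) = (\<Oplus>\<^sub>\<Omega> k\<in>I. ?t k) \<oplus>\<^sub>\<Omega> (\<Oplus>\<^sub>\<Omega> k\<in>J. ?t k)"
    unfolding IJ(1) using IJ(2,3) finJ tc In Jn by (intro Om.M.finsum_Un_disjoint) auto
  moreover have "(\<Oplus>\<^sub>\<Omega> k\<in>I. ?t k) = \<pi> s \<odot>\<^sub>\<Omega> dZ (xv i)"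
  proof -
    have "(\<Oplus>\<^sub>\<Omega> k\<in>I. ?t k) = (\<Oplus>\<^sub>\<Omega> k\<in>I. if i = k then \<pi> s \<odot>\<^sub>\<Omega> dZ (xv k) else \<zero>\<^sub>\<Omega>)"
      using sc In dxv h_diag[OF True] by (intro Om.M.finsum_cong') (auto simp: \<pi>_zero OM.act_zero_l OM.act_closed)
    also have "\<dots> = \<pi> s \<odot>\<^sub>\<Omega> dZ (xv i)"
      using True IJ(3) sc In dxv by (intro Om.M.finsum_singleton) (auto intro!: OM.act_closed)
    finally show ?thesis .
  qed
  ultimately have sum: "\<pi> s \<odot>\<^sub>\<Omega> dZ (xv i) \<oplus>\<^sub>\<Omega> (\<Oplus>\<^sub>\<Omega> k\<in>J. ?t k) = \<zero>\<^sub>\<Omega>" by simp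
  have Sc: "(\<Oplus>\<^sub>\<Omega> k\<in>J. ?t k) |: \<Omega>" using tc Jn by (intro Om.M.finsum_closed) auto
  have "(\<Oplus>\<^sub>\<Omega> j\<in>J. \<pi> (W j i) \<odot>\<^sub>\<Omega> dZ (xv j)) = (\<Oplus>\<^sub>\<Omega> j\<in>J. (\<ominus> \<one>) \<odot>\<^sub>\<Omega> ?t j)"
  proof (intro Om.M.finsum_cong')
    show "(\<lambda>j. (\<ominus> \<one>) \<odot>\<^sub>\<Omega> ?t j) \<in> J \<rightarrow> carrier \<Omega>" using tc Jn by (auto intro!: OM.act_closed)
    fix j assume j: "j \<in> J"
    then have "i \<noteq> j" using True by (auto simp: J_def)
    then have "\<pi> (W j i) = \<ominus> \<one> \<otimes> \<pi> (h i j)"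
      using True ring_hom_neg[OF \<pi>_hom PR.Q.ring_axioms Zc.ring_axioms h_closed[OF True]] hc
      by (simp add: W_def Zc.l_minus)
    then show "\<pi> (W j i) \<odot>\<^sub>\<Omega> dZ (xv j) = (\<ominus> \<one>) \<odot>\<^sub>\<Omega> ?t j"
      using hc dxv[OF Jn[OF j]] by (simp add: OM.act_mult)
  qed simp
  also have "\<dots> = (\<ominus> \<one>) \<odot>\<^sub>\<Omega> (\<Oplus>\<^sub>\<Omega> k\<in>J. ?t k)"
    using tc Jn by (intro additive_finsum[OF OM.act_additive Om.M.abelian_group_axioms Om.M.abelian_group_axioms, symmetric]) auto
  also have "\<dots> = \<ominus>\<^sub>\<Omega> (\<Oplus>\<^sub>\<Omega> k\<in>J. ?t k)"
    using Sc Om.smult_l_minus[of \<one>] by (simp add: OM.act_one)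
  also have "\<dots> = \<pi> s \<odot>\<^sub>\<Omega> dZ (xv i)"
    using Om.M.minus_equality[OF sum Sc OM.act_closed[OF sc dxv[OF i]]] .
  finally show ?thesis ..
qed

lemma chart_rule:
  assumes f: "f |: Q"
  shows "\<pi> s \<odot>\<^sub>\<Omega> dZ (\<pi> f) = (\<Oplus>\<^sub>\<Omega> j\<in>J. wt j f \<odot>\<^sub>\<Omega> dZ (xv j))"
proof -
  have cl: "\<pi> s |: Z" "\<pi> (partial_deriv K i f) |: Z" "\<pi> (W j i) |: Z" for i j
    using s f \<pi>c PR.pd_closed W_closed by auto
  note acl = OM.act_closed[OF _ dxv] OM.act_closed[OF _ OM.act_closed[OF _ dxv]]
  have "\<pi> s \<odot>\<^sub>\<Omega> dZ (\<pi> f) = (\<Oplus>\<^sub>\<Omega> i\<in>{..<n}. \<pi> s \<odot>\<^sub>\<Omega> (\<pi> (partial_deriv K i f) \<odot>\<^sub>\<Omega> dZ (xv i)))"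
    unfolding dZ_chain[OF f] using cl acl
    by (intro additive_finsum[OF OM.act_additive Om.M.abelian_group_axioms Om.M.abelian_group_axioms]) auto
  also have "\<dots> = (\<Oplus>\<^sub>\<Omega> i\<in>{..<n}. \<Oplus>\<^sub>\<Omega> j\<in>J. \<pi> (partial_deriv K i f) \<odot>\<^sub>\<Omega> (\<pi> (W j i) \<odot>\<^sub>\<Omega> dZ (xv j)))"
  proof (intro Om.M.finsum_cong')
    show "(\<lambda>i. \<Oplus>\<^sub>\<Omega> j\<in>J. \<pi> (partial_deriv K i f) \<odot>\<^sub>\<Omega> (\<pi> (W j i) \<odot>\<^sub>\<Omega> dZ (xv j))) \<in> {..<n} \<rightarrow> carrier \<Omega>"
      using cl acl Jn by (auto intro!: Om.M.finsum_closed)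
    fix i assume i: "i \<in> {..<n}"
    have "\<pi> s \<odot>\<^sub>\<Omega> (\<pi> (partial_deriv K i f) \<odot>\<^sub>\<Omega> dZ (xv i)) = \<pi> (partial_deriv K i f) \<odot>\<^sub>\<Omega> (\<pi> s \<odot>\<^sub>\<Omega> dZ (xv i))"
      using cl dxv i by (simp add: OM.act_mult[symmetric] Zc.m_comm)
    also have "\<dots> = (\<Oplus>\<^sub>\<Omega> j\<in>J. \<pi> (partial_deriv K i f) \<odot>\<^sub>\<Omega> (\<pi> (W j i) \<odot>\<^sub>\<Omega> dZ (xv j)))"
      using i cl acl Jn by (subst d_qv)
        (auto intro!: additive_finsum[OF OM.act_additive Om.M.abelian_group_axioms Om.M.abelian_group_axioms])
    finally show "\<pi> s \<odot>\<^sub>\<Omega> (\<pi> (partial_deriv K i f) \<odot>\<^sub>\<Omega> dZ (xv i)) = \<dots>" .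
  qed simp
  also have "\<dots> = (\<Oplus>\<^sub>\<Omega> j\<in>J. \<Oplus>\<^sub>\<Omega> i\<in>{..<n}. \<pi> (partial_deriv K i f) \<odot>\<^sub>\<Omega> (\<pi> (W j i) \<odot>\<^sub>\<Omega> dZ (xv j)))"
    using cl acl Jn by (intro Om.M.finsum_swap) auto
  also have "\<dots> = (\<Oplus>\<^sub>\<Omega> j\<in>J. wt j f \<odot>\<^sub>\<Omega> dZ (xv j))"
  proof (intro Om.M.finsum_cong')
    show "(\<lambda>j. wt j f \<odot>\<^sub>\<Omega> dZ (xv j)) \<in> J \<rightarrow> carrier \<Omega>"
      using acl Jn wt_closed[OF f] by auto
    fix j assume j: "j \<in> J"
    have "wt j f \<odot>\<^sub>\<Omega> dZ (xv j) = (\<Oplus>\<^sub>\<Omega> i\<in>{..<n}. (\<pi> (partial_deriv K i f) \<otimes> \<pi> (W j i)) \<odot>\<^sub>\<Omega> dZ (xv j))"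
      unfolding wt_def using cl
      by (intro additive_finsum[OF OM.act_additive_l[OF dxv[OF Jn[OF j]]] Zc.is_abelian_group Om.M.abelian_group_axioms]) auto
    then show "(\<Oplus>\<^sub>\<Omega> i\<in>{..<n}. \<pi> (partial_deriv K i f) \<odot>\<^sub>\<Omega> (\<pi> (W j i) \<odot>\<^sub>\<Omega> dZ (xv j))) = wt j f \<odot>\<^sub>\<Omega> dZ (xv j)"
      using cl dxv[OF Jn[OF j]] by (simp add: OM.act_mult)
  qed simp
  finally show ?thesis .
qed

theorem chart: "smooth_chart K Z \<pp> J xv (\<pi> s) (\<lambda>j z. wt j (lift z))"
proof (intro smooth_chart.intro smooth_chart_axioms.intro)
  show "kaehler_setup K Z" by (rule kaehler_setup_axioms)
  show "primeideal \<pp> Z" "finite J" "\<pi> s \<in> carrier Z - \<pp>" using prime s \<pi>c by (auto simp: J_def)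
  show "xv j |: Z" if "j \<in> J" for j using xv_closed[OF Jn[OF that]] .
  show "wt j (lift z) |: Z" if "z |: Z" for j z by (rule wt_closed[OF lift(1)[OF that]])
  show "\<pi> s \<odot>\<^sub>\<Omega> dZ z = (\<Oplus>\<^sub>\<Omega> j\<in>J. wt j (lift z) \<odot>\<^sub>\<Omega> dZ (xv j))" if "z |: Z" for z
    using chart_rule[OF lift(1)[OF that]] by (simp only: lift(2)[OF that])
  show "\<exists>t\<in>carrier Z - \<pp>. t \<otimes> wt j (lift (y \<oplus> z)) = t \<otimes> (wt j (lift y) \<oplus> wt j (lift z))"
    if "j \<in> J" "y |: Z" "z |: Z" for j y z
    using wt_eq[OF that(1), of "lift (y \<oplus> z)" "lift y \<oplus>\<^sub>Q lift z"] that
    by (simp add: lift ring_hom_add[OF \<pi>_hom] additive_add[OF wt_additive])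
  show "\<exists>t\<in>carrier Z - \<pp>. t \<otimes> wt j (lift (y \<otimes> z)) = t \<otimes> ((y \<otimes> wt j (lift z)) \<oplus> (z \<otimes> wt j (lift y)))"
    if "j \<in> J" "y |: Z" "z |: Z" for j y z
    using wt_eq[OF that(1), of "lift (y \<otimes> z)" "lift y \<otimes>\<^sub>Q lift z"] that
    by (simp add: lift ring_hom_mult[OF \<pi>_hom] wt_mult)
  show "\<exists>t\<in>carrier Z - \<pp>. t \<otimes> wt j (lift (c \<odot> \<one>)) = t \<otimes> \<zero>" if "j \<in> J" "c |: K" for j c
    using wt_eq[OF that(1), of "lift (c \<odot> \<one>)" "mterm K c {#}"] that
    by (simp add: lift \<pi>_const wt_const PR.qt_closed PR.XM_def)
  show "\<exists>t\<in>carrier Z - \<pp>. t \<otimes> wt j (lift (xv i)) = t \<otimes> (if i = j then \<pi> s else \<zero>)" if "j \<in> J" "i \<in> J" for i j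
  proof -
    have "\<pi> (W j i) = (if i = j then \<pi> s else \<zero>)" using that by (auto simp: W_def J_def \<pi>_zero)
    then show ?thesis
      using wt_eq[OF that(1), of "lift (xv i)" "mterm K \<one>\<^sub>K {#i#}"] Jn[OF that(2)]
      by (simp add: lift xv_closed wt_qv PR.qv_closed)
  qed
qed

end

theorem (in kaehler_setup) regular_chart:
  assumes reg: "regular_algebra K Z" and prime: "primeideal \<pp> Z"
  shows "\<exists>J x s w. smooth_chart K Z \<pp> J x s w"
proof -
  obtain n \<pi> where pres: "presentation K Z n \<pi>" and sm: "\<And>P. primeideal P (polynomials K n) ==>
      a_kernel (polynomials K n) Z \<pi> \<subseteq> P ==> jacobian_smooth_at K n (a_kernel (polynomials K n) Z \<pi>) P"
    using reg unfolding regular_algebra_def by blast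
  interpret PR: poly_ring K n by unfold_locales
  have \<pi>_hom: "\<pi> \<in> ring_hom PR.Q Z" using pres by (auto simp: presentation_def alg_hom_def PR.Q_def)
  note \<pi>c = ring_hom_closed[OF \<pi>_hom]
  have \<pi>_zero: "\<pi> \<zero>\<^bsub>PR.Q\<^esub> = \<zero>\<^sub>Z" by (rule ring_hom_zero[OF \<pi>_hom PR.Q.ring_axioms Zc.ring_axioms])
  define P where "P = {f \<in> carrier PR.Q. \<pi> f \<in> \<pp>}"
  let ?ker = "a_kernel PR.Q Z \<pi>"
  have P: "primeideal P PR.Q" unfolding P_def
    by (rule ring_hom_ring.primeideal_vimage[OF _ PR.Q_cring prime])
      (intro ring_hom_ringI2 PR.Q.ring_axioms Zc.ring_axioms \<pi>_hom)
  have kerP: "?ker \<subseteq> P" using additive_subgroup.zero_closed[OF ideal.axioms(1)[OF primeideal.axioms(1)[OF prime]]]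
    by (auto simp: P_def a_kernel_def')
  interpret P: primeideal P PR.Q by (rule P)
  have "jacobian_smooth_at K n ?ker P" using sm[of P] P kerP by (simp add: PR.Q_def)
  then obtain c f where f: "f ` {..<c::nat} \<subseteq> ?ker"
    and gen: "\<And>F. F \<in> ?ker ==> \<exists>t\<in>carrier PR.Q - P. t \<otimes>\<^bsub>PR.Q\<^esub> F \<in> Idl\<^bsub>PR.Q\<^esub> (f ` {..<c})"
    and indep: "\<And>a l. \<lbrakk>a \<in> {..<c} \<rightarrow> carrier PR.Q;
        \<forall>j<n. (\<Oplus>\<^bsub>PR.Q\<^esub>i\<in>{..<c}. a i \<otimes>\<^bsub>PR.Q\<^esub> partial_deriv K j (f i)) \<in> P; l < c\<rbrakk> \<Longrightarrow> a l \<in> P"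
    unfolding jacobian_smooth_at_def Let_def PR.Q_def[symmetric] by (elim exE conjE) (rule that, assumption, erule bspec, simp_all)
  \<comment> \<open>The gradients of the equations, extended by zero from \<open>c\<close> on so
    that every \<open>g l\<close> is a vector over the polynomial ring.\<close>
  define g where "g = (\<lambda>l i. if l < c then partial_deriv K i (f l) else \<zero>\<^bsub>PR.Q\<^esub>)"
  have fc: "f l |: PR.Q" "f l \<in> ?ker" if "l < c" for l using f that by (auto simp: a_kernel_def')
  have gv: "g l \<in> PR.Q.vecs" for l using PR.pd_closed fc by (simp add: g_def PR.Q.vecs_def)
  have gc: "g l i |: PR.Q" for l i using gv by (simp add: PR.Q.vecs_def)
  have gvs: "g ` S \<subseteq> PR.Q.vecs" for S using gv by blast
  have ex: "\<exists>s\<in>carrier PR.Q - P. \<exists>T\<subseteq>{..<n}. \<exists>h. h ` T \<subseteq> vspan PR.Q (g ` {..<c}) \<and>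
    (\<forall>p\<in>T. \<forall>q\<in>T. h p q = (if p = q then s else \<zero>\<^bsub>PR.Q\<^esub>)) \<and>
    (\<exists>\<sigma>\<in>carrier PR.Q - P. \<forall>l<c. (\<lambda>i. \<sigma> \<otimes>\<^bsub>PR.Q\<^esub> g l i) \<in> vspan PR.Q (h ` T))"
  proof (rule P.gauss_elimination)
    fix k a v
    assume k: "k < c" and a: "a |: PR.Q" and v: "v \<in> vspan PR.Q (g ` {..<k})"
      and z: "\<And>i. i < n ==> (a \<otimes>\<^bsub>PR.Q\<^esub> g k i) \<oplus>\<^bsub>PR.Q\<^esub> v i \<in> P"
    obtain b where b: "b \<in> {..<c} \<rightarrow> carrier PR.Q" "\<forall>l\<ge>k. b l = \<zero>\<^bsub>PR.Q\<^esub>"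
      "\<forall>i. v i = (\<Oplus>\<^bsub>PR.Q\<^esub>l\<in>{..<c}. b l \<otimes>\<^bsub>PR.Q\<^esub> g l i)"
      using PR.Q.vspan_coefficients[OF gv less_imp_le[OF k] v] by blast
    have bc: "b l |: PR.Q" if "l < c" for l using b(1) that by blast
    \<comment> \<open>The family \<open>b\<close> vanishes from \<open>k\<close> on, so
      \<open>a' k\<close> is \<open>a\<close> and the Jacobian criterion applied to
      \<open>a'\<close> gives the claim for \<open>a\<close>.\<close>
    define a' where "a' l = (if k = l then a else \<zero>\<^bsub>PR.Q\<^esub>) \<oplus>\<^bsub>PR.Q\<^esub> b l" for l
    have ac': "a' l |: PR.Q" if "l < c" for l using a bc[OF that] by (simp add: a'_def)
    have "(\<Oplus>\<^bsub>PR.Q\<^esub>l\<in>{..<c}. a' l \<otimes>\<^bsub>PR.Q\<^esub> partial_deriv K i (f l)) \<in> P" if i: "i < n" for i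
    proof -
      have "(\<Oplus>\<^bsub>PR.Q\<^esub>l\<in>{..<c}. a' l \<otimes>\<^bsub>PR.Q\<^esub> partial_deriv K i (f l)) =
        (\<Oplus>\<^bsub>PR.Q\<^esub>l\<in>{..<c}. (if k = l then a \<otimes>\<^bsub>PR.Q\<^esub> g l i else \<zero>\<^bsub>PR.Q\<^esub>) \<oplus>\<^bsub>PR.Q\<^esub> (b l \<otimes>\<^bsub>PR.Q\<^esub> g l i))"
        using a bc gc fc PR.pd_closed
        by (intro PR.Q.finsum_cong') (auto simp: a'_def g_def PR.Q.l_distr)
      also have "\<dots> = (\<Oplus>\<^bsub>PR.Q\<^esub>l\<in>{..<c}. if k = l then a \<otimes>\<^bsub>PR.Q\<^esub> g l i else \<zero>\<^bsub>PR.Q\<^esub>) \<oplus>\<^bsub>PR.Q\<^esub> v i"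
        unfolding b(3)[rule_format] using a bc gc by (intro PR.Q.finsum_addf) auto
      also have "(\<Oplus>\<^bsub>PR.Q\<^esub>l\<in>{..<c}. if k = l then a \<otimes>\<^bsub>PR.Q\<^esub> g l i else \<zero>\<^bsub>PR.Q\<^esub>) = a \<otimes>\<^bsub>PR.Q\<^esub> g k i"
        using a gc k by (intro PR.Q.finsum_singleton) auto
      finally show ?thesis using z[OF i] by simp
    qed
    then have "a' k \<in> P" using indep[of a' k] ac' k by auto
    then show "a \<in> P" using b(2) a by (simp add: a'_def)
  qed (rule gv)
  then obtain s where s: "s \<in> carrier PR.Q - P" and exs: "\<exists>T\<subseteq>{..<n}. \<exists>h. h ` T \<subseteq> vspan PR.Q (g ` {..<c}) \<and>
    (\<forall>p\<in>T. \<forall>q\<in>T. h p q = (if p = q then s else \<zero>\<^bsub>PR.Q\<^esub>)) \<and>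
    (\<exists>\<sigma>\<in>carrier PR.Q - P. \<forall>l<c. (\<lambda>i. \<sigma> \<otimes>\<^bsub>PR.Q\<^esub> g l i) \<in> vspan PR.Q (h ` T))" by (rule bexE)
  then obtain T h \<sigma> where T: "T \<subseteq> {..<n}" and h: "h ` T \<subseteq> vspan PR.Q (g ` {..<c})"
    and hd: "\<forall>p\<in>T. \<forall>q\<in>T. h p q = (if p = q then s else \<zero>\<^bsub>PR.Q\<^esub>)"
    and \<sigma>: "\<sigma> \<in> carrier PR.Q - P" and \<sigma>h: "\<forall>l<c. (\<lambda>i. \<sigma> \<otimes>\<^bsub>PR.Q\<^esub> g l i) \<in> vspan PR.Q (h ` T)"
    by (elim exE conjE bexE)
  have hv: "h ` T \<subseteq> PR.Q.vecs" using PR.Q.vspan_vecs[OF gvs] h by blast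
  \<comment> \<open>The equations whose gradient is, modulo the kernel, a combination of the given
    gradients. On the kernel the term of the Leibniz rule that differentiates the multiplier
    vanishes under \<pi>, so this is an ideal; it contains all \<open>f l\<close>.\<close>
  define U where "U = {G \<in> ?ker. \<exists>v\<in>vspan PR.Q (g ` {..<c}). \<forall>i. \<pi> (partial_deriv K i G) = \<pi> (v i)}"
  have Uc: "G |: PR.Q" "\<pi> G = \<zero>\<^sub>Z" if "G \<in> U" for G using that by (auto simp: U_def a_kernel_def')
  have U_mult: "a \<otimes>\<^bsub>PR.Q\<^esub> G \<in> U" if a: "a |: PR.Q" and G: "G \<in> U" for a G
  proof -
    obtain v where v: "v \<in> vspan PR.Q (g ` {..<c})" "\<forall>i. \<pi> (partial_deriv K i G) = \<pi> (v i)" using G by (auto simp: U_def)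
    have vc: "v i |: PR.Q" for i using PR.Q.vspan_vecs[OF gvs v(1)] by (simp add: PR.Q.vecs_def)
    have "\<pi> (partial_deriv K i (a \<otimes>\<^bsub>PR.Q\<^esub> G)) = \<pi> (a \<otimes>\<^bsub>PR.Q\<^esub> v i)" for i
      using a Uc[OF G] v(2) vc PR.pd_closed \<pi>c
      by (simp add: PR.pd_mult ring_hom_add[OF \<pi>_hom] ring_hom_mult[OF \<pi>_hom])
    then show ?thesis using a Uc[OF G] PR.Q.vspan_scale[OF gvs a v(1)] \<pi>c
      by (auto simp: U_def a_kernel_def' ring_hom_mult[OF \<pi>_hom])
  qed
  have U_add: "G \<oplus>\<^bsub>PR.Q\<^esub> H \<in> U" if G: "G \<in> U" and H: "H \<in> U" for G H
  proof -
    obtain v where v: "v \<in> vspan PR.Q (g ` {..<c})" "\<forall>i. \<pi> (partial_deriv K i G) = \<pi> (v i)" using G by (auto simp: U_def)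
    obtain w where w: "w \<in> vspan PR.Q (g ` {..<c})" "\<forall>i. \<pi> (partial_deriv K i H) = \<pi> (w i)" using H by (auto simp: U_def)
    have vc: "v i |: PR.Q" "w i |: PR.Q" for i
      using PR.Q.vspan_vecs[OF gvs v(1)] PR.Q.vspan_vecs[OF gvs w(1)] by (simp_all add: PR.Q.vecs_def)
    have "\<pi> (partial_deriv K i (G \<oplus>\<^bsub>PR.Q\<^esub> H)) = \<pi> (v i \<oplus>\<^bsub>PR.Q\<^esub> w i)" for i
      using Uc[OF G] Uc[OF H] v(2) w(2) vc PR.pd_closed
      by (simp add: additive_add[OF PR.pd_additive] ring_hom_add[OF \<pi>_hom])
    then show ?thesis using Uc[OF G] Uc[OF H] PR.Q.vspan_add[OF gvs v(1) w(1)]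
      by (auto simp: U_def a_kernel_def' ring_hom_add[OF \<pi>_hom])
  qed
  have U_ideal: "ideal U PR.Q"
  proof (rule idealI[OF PR.Q.ring_axioms])
    have z: "\<zero>\<^bsub>PR.Q\<^esub> \<in> U"
      using vspan.zero[of PR.Q "g ` {..<c}"] additive_zero[OF PR.pd_additive PR.Q.is_abelian_group PR.Q.is_abelian_group] \<pi>_zero
      by (auto simp: U_def a_kernel_def' intro!: bexI[of _ "\<lambda>i. \<zero>\<^bsub>PR.Q\<^esub>"])
    show "subgroup U (add_monoid PR.Q)"
    proof (rule PR.Q.add.subgroupI)
      show "\<ominus>\<^bsub>PR.Q\<^esub> a \<in> U" if "a \<in> U" for a
        using U_mult[OF _ that, of "\<ominus>\<^bsub>PR.Q\<^esub> \<one>\<^bsub>PR.Q\<^esub>"] Uc[OF that] by (simp add: PR.Q.l_minus)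
    qed (use z Uc U_add in auto)
    show "a \<otimes>\<^bsub>PR.Q\<^esub> x \<in> U" if "a \<in> U" "x |: PR.Q" for a x
      using U_mult[OF that(2,1)] PR.Q.m_comm[OF Uc(1)[OF that(1)] that(2)] by simp
  qed (rule U_mult)
  have "f l \<in> U" if l: "l < c" for l
    using fc[OF l] l PR.Q.vspan_incl[OF gvs, of "g l" "{..<c}"] by (auto simp: U_def g_def intro!: bexI[of _ "g l"])
  then have "f ` {..<c} \<subseteq> U" by blast
  then have IU: "Idl\<^bsub>PR.Q\<^esub> (f ` {..<c}) \<subseteq> U" by (rule PR.Q.genideal_minimal[OF U_ideal])
  have s': "s |: PR.Q" "\<pi> s \<notin> \<pp>" using s unfolding P_def by blast+
  have hd': "h p q = (if p = q then s else \<zero>\<^bsub>PR.Q\<^esub>)" if "p \<in> T" "q \<in> T" for p q using hd that by simp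
  have gk: "g ` {..<c} \<subseteq> (\<lambda>F i. partial_deriv K i F) ` ?ker" using fc by (auto simp: g_def)
  have kv: "(\<lambda>F i. partial_deriv K i F) ` ?ker \<subseteq> PR.Q.vecs"
      by (auto simp: PR.Q.vecs_def a_kernel_def' PR.pd_closed)
  have hk: "h p \<in> vspan PR.Q ((\<lambda>F i. partial_deriv K i F) ` ?ker)" if "p \<in> T" for p
    by (rule PR.Q.vspan_subset[OF gk kv subsetD[OF h imageI[OF that]]])
  have kh: "\<exists>t\<in>carrier PR.Q. \<pi> t \<notin> \<pp> \<and>
      (\<exists>v\<in>vspan PR.Q (h ` T). \<forall>i<n. \<pi> (t \<otimes>\<^bsub>PR.Q\<^esub> partial_deriv K i F) = \<pi> (v i))"
    if F: "F \<in> ?ker" for F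
  proof -
    have Fc: "F |: PR.Q" "\<pi> F = \<zero>\<^sub>Z" using F by (auto simp: a_kernel_def')
    obtain t where t: "t \<in> carrier PR.Q - P" "t \<otimes>\<^bsub>PR.Q\<^esub> F \<in> U" using gen[OF F] IU by blast
    then obtain v where v: "v \<in> vspan PR.Q (g ` {..<c})" "\<forall>i. \<pi> (partial_deriv K i (t \<otimes>\<^bsub>PR.Q\<^esub> F)) = \<pi> (v i)"
      by (auto simp: U_def)
    have vc: "v i |: PR.Q" for i using PR.Q.vspan_vecs[OF gvs v(1)] by (simp add: PR.Q.vecs_def)
    have tc: "t |: PR.Q" "\<sigma> |: PR.Q" using t \<sigma> by auto
    \<comment> \<open>As \<pi> kills \<open>F\<close>, the derivative of \<open>t F\<close> and
      \<open>t\<close> times the derivative of \<open>F\<close> have the same image; the factor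
      \<sigma> leads from the gradients to the rows of \<open>h\<close>.\<close>
    have 1: "\<pi> ((\<sigma> \<otimes>\<^bsub>PR.Q\<^esub> t) \<otimes>\<^bsub>PR.Q\<^esub> partial_deriv K i F) = \<pi> (\<sigma> \<otimes>\<^bsub>PR.Q\<^esub> v i)" for i
      using v(2)[rule_format, of i, symmetric] tc Fc vc PR.pd_closed \<pi>c
      by (simp add: PR.pd_mult ring_hom_add[OF \<pi>_hom] ring_hom_mult[OF \<pi>_hom] Zc.m_assoc)
    have 2: "(\<lambda>i. \<sigma> \<otimes>\<^bsub>PR.Q\<^esub> v i) \<in> vspan PR.Q (h ` T)"
      using \<sigma>h tc by (intro PR.Q.vspan_trans[OF gvs hv _ _ v(1)]) auto
    have 3: "\<sigma> \<otimes>\<^bsub>PR.Q\<^esub> t \<in> carrier PR.Q - P" using P.I_prime[of \<sigma> t] t(1) \<sigma> tc PR.Q.m_closed[OF tc(2,1)] by blast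
    have 4: "\<sigma> \<otimes>\<^bsub>PR.Q\<^esub> t |: PR.Q" "\<pi> (\<sigma> \<otimes>\<^bsub>PR.Q\<^esub> t) \<notin> \<pp>"
      using 3 unfolding P_def by blast+
    show ?thesis
      by (rule bexI[OF _ 4(1)], rule conjI[OF 4(2)], rule bexI[OF _ 2]) (simp only: 1 simp_thms)
  qed
  have "chart_data K Z n \<pi> \<pp> T h s"
    by (rule chart_data.intro[OF kaehler_setup_axioms PR.poly_ring_axioms chart_data_axioms.intro[OF pres prime T s' hd' hk kh]])
  from chart_data.chart[OF this] show ?thesis by blast
qed

section \<open>The enveloping algebra acts on differential operators in local coordinates\<close>

context ring
begin

text \<open>In \<open>pt_pb\<close>, \<open>p\<close> and \<open>p'\<close> are the mixed terms, in
  which one derivation has been applied to each factor.\<close>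

lemma leibniz_cancel:
  assumes "p |: R" "p' |: R" "b |: R" "b' |: R" "q |: R" "q' |: R"
    "r |: R" "r' |: R"
  shows "((p \<oplus> b \<otimes> q) \<oplus> (b' \<otimes> q' \<oplus> p')) \<ominus> ((p \<oplus> b' \<otimes> r') \<oplus> (p' \<oplus> b \<otimes> r)) =
    b' \<otimes> (q' \<ominus> r') \<oplus> b \<otimes> (q \<ominus> r)"
  using assms by algebra

lemma mult_diff: "a |: R ==> b |: R ==> c |: R ==> a \<otimes> (b \<ominus> c) = a \<otimes> b \<ominus> a \<otimes> c"
  by algebra

lemma add_diff_cancel: "p |: R ==> q |: R ==> p = q \<oplus> (p \<ominus> q)"
  by algebra

lemma derivation_commutator:
  assumes \<delta>: "derivation R \<delta>" and \<epsilon>: "derivation R \<epsilon>"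
  shows "derivation R (\<lambda>x. \<delta> (\<epsilon> x) \<ominus> \<epsilon> (\<delta> x))"
  unfolding derivation_def
proof (intro conjI ballI)
  note c = additive_closed[OF derivation_additive[OF \<delta>]] additive_closed[OF derivation_additive[OF \<epsilon>]]
  show "additive R R (\<lambda>x. \<delta> (\<epsilon> x) \<ominus> \<epsilon> (\<delta> x))"
    by (intro additive_diff additive_comp[OF derivation_additive[OF \<epsilon>] derivation_additive[OF \<delta>]]
      additive_comp[OF derivation_additive[OF \<delta>] derivation_additive[OF \<epsilon>]] is_abelian_group)
  fix x y assume xy: "x |: R" "y |: R"
  have "\<delta> (\<epsilon> (x \<otimes> y)) = (\<delta> (\<epsilon> x) \<otimes> y \<oplus> \<epsilon> x \<otimes> \<delta> y) \<oplus> (\<delta> x \<otimes> \<epsilon> y \<oplus> x \<otimes> \<delta> (\<epsilon> y))"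
    using xy c by (simp add: derivation_mult[OF \<delta>] derivation_mult[OF \<epsilon>] additive_add[OF derivation_additive[OF \<delta>]])
  moreover have "\<epsilon> (\<delta> (x \<otimes> y)) = (\<epsilon> (\<delta> x) \<otimes> y \<oplus> \<delta> x \<otimes> \<epsilon> y) \<oplus> (\<epsilon> x \<otimes> \<delta> y \<oplus> x \<otimes> \<epsilon> (\<delta> y))"
    using xy c by (simp add: derivation_mult[OF \<delta>] derivation_mult[OF \<epsilon>] additive_add[OF derivation_additive[OF \<epsilon>]])
  moreover have "(p \<otimes> y \<oplus> q) \<oplus> (r \<oplus> x \<otimes> p') \<ominus> ((p'' \<otimes> y \<oplus> r) \<oplus> (q \<oplus> x \<otimes> p''')) =
      (p \<ominus> p'') \<otimes> y \<oplus> x \<otimes> (p' \<ominus> p''')"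
    if "p |: R" "p' |: R" "p'' |: R" "p''' |: R" "q |: R" "r |: R" for p p' p'' p''' q r
    using that xy by algebra
  ultimately show "\<delta> (\<epsilon> (x \<otimes> y)) \<ominus> \<epsilon> (\<delta> (x \<otimes> y)) =
      (\<delta> (\<epsilon> x) \<ominus> \<epsilon> (\<delta> x)) \<otimes> y \<oplus> x \<otimes> (\<delta> (\<epsilon> y) \<ominus> \<epsilon> (\<delta> y))"
    using xy c by simp
qed

text \<open>Central coefficients can be moved past \<open>x\<close> in the second term of the
  Leibniz rule.\<close>

lemma derivation_linear_combination:
  assumes c: "\<And>k. k \<in> S ==> c k \<in> center R" and \<delta>: "\<And>k. k \<in> S ==> derivation R (\<delta> k)" and S: "finite S"
  shows "derivation R (\<lambda>x. \<Oplus>k\<in>S. c k \<otimes> \<delta> k x)"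
  unfolding derivation_def
proof (intro conjI ballI)
  note cl = additive_closed[OF derivation_additive[OF \<delta>]] center_carrier[OF c]
  show "additive R R (\<lambda>x. \<Oplus>k\<in>S. c k \<otimes> \<delta> k x)"
    by (intro additive_finsum_fun is_abelian_group additive_comp[OF derivation_additive[OF \<delta>] additive_l_mult] cl)
  fix x y assume xy: "x |: R" "y |: R"
  have "(\<Oplus>k\<in>S. c k \<otimes> \<delta> k (x \<otimes> y)) = (\<Oplus>k\<in>S. (c k \<otimes> \<delta> k x) \<otimes> y \<oplus> x \<otimes> (c k \<otimes> \<delta> k y))"
    using xy cl by (intro finsum_cong')
      (auto simp: derivation_mult[OF \<delta>] r_distr m_assoc center_commute[OF c] simp flip: m_assoc[of _ "c _"])
  also have "\<dots> = (\<Oplus>k\<in>S. (c k \<otimes> \<delta> k x) \<otimes> y) \<oplus> (\<Oplus>k\<in>S. x \<otimes> (c k \<otimes> \<delta> k y))"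
    using xy cl by (intro finsum_addf) auto
  finally show "(\<Oplus>k\<in>S. c k \<otimes> \<delta> k (x \<otimes> y)) = (\<Oplus>k\<in>S. c k \<otimes> \<delta> k x) \<otimes> y \<oplus> x \<otimes> (\<Oplus>k\<in>S. c k \<otimes> \<delta> k y)"
    using xy cl S by (simp add: finsum_ldistr finsum_rdistr Pi_def)
qed

lemma derivation_diff:
  assumes "derivation R \<delta>" "derivation R \<epsilon>" shows "derivation R (\<lambda>x. \<delta> x \<ominus> \<epsilon> x)"
  unfolding derivation_def
proof (intro conjI ballI)
  show "additive R R (\<lambda>x. \<delta> x \<ominus> \<epsilon> x)"
    by (intro additive_diff is_abelian_group assms[THEN derivation_additive])
  fix x y assume xy: "x |: R" "y |: R"
  note c = assms[THEN derivation_additive, THEN additive_closed]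
  have "(p \<otimes> y \<oplus> x \<otimes> q) \<ominus> (p' \<otimes> y \<oplus> x \<otimes> q') = (p \<ominus> p') \<otimes> y \<oplus> x \<otimes> (q \<ominus> q')"
    if "p |: R" "q |: R" "p' |: R" "q' |: R" for p q p' q'
    using that xy by algebra
  then show "\<delta> (x \<otimes> y) \<ominus> \<epsilon> (x \<otimes> y) = (\<delta> x \<ominus> \<epsilon> x) \<otimes> y \<oplus> x \<otimes> (\<delta> y \<ominus> \<epsilon> y)"
    using xy c by (simp add: assms[THEN derivation_mult])
qed

end

section \<open>Derivations along a homomorphism, and their values in local coordinates\<close>

context kaehler_setup
begin

text \<open>Both terms of the Leibniz rule have the coefficient on the left: \<open>G\<close> is
  regarded as a left \<open>Z\<close>-module through \<beta>, which makes the notion meaningful in a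
  noncommutative ring.\<close>

definition der_along :: "('g, 'n) ring_scheme => ('z => 'g) => ('z => 'g) => bool"
  where "der_along G \<beta> g \<longleftrightarrow> additive Z G g \<and> (\<forall>c\<in>carrier K. g (kap c) = \<zero>\<^sub>G) \<and>
    (\<forall>x\<in>carrier Z. \<forall>y\<in>carrier Z. g (x \<otimes>\<^sub>Z y) = (\<beta> x \<otimes>\<^sub>G g y) \<oplus>\<^sub>G (\<beta> y \<otimes>\<^sub>G g x))"

lemma der_alongI:
  assumes "additive Z G g" "\<And>c. c |: K ==> g (kap c) = \<zero>\<^sub>G"
    "\<And>x y. x |: Z ==> y |: Z ==> g (x \<otimes>\<^sub>Z y) = (\<beta> x \<otimes>\<^sub>G g y) \<oplus>\<^sub>G (\<beta> y \<otimes>\<^sub>G g x)"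
  shows "der_along G \<beta> g"
  using assms by (simp add: der_along_def)

lemma der_along_D:
  assumes "der_along G \<beta> g"
  shows "additive Z G g" "\<And>c. c |: K ==> g (kap c) = \<zero>\<^sub>G"
    "\<And>x y. x |: Z ==> y |: Z ==> g (x \<otimes>\<^sub>Z y) = (\<beta> x \<otimes>\<^sub>G g y) \<oplus>\<^sub>G (\<beta> y \<otimes>\<^sub>G g x)"
  using assms by (simp_all add: der_along_def)

lemma der_along_scalar:
  assumes G: "ring G" and \<beta>: "\<beta> \<in> ring_hom Z G" and g: "der_along G \<beta> g" and c: "c |: K" and z: "z |: Z"
  shows "g (c \<odot>\<^sub>Z z) = \<beta> (kap c) \<otimes>\<^sub>G g z"
proof -
  interpret G: ring G by fact
  have "g (kap c \<otimes>\<^sub>Z z) = \<beta> (kap c) \<otimes>\<^sub>G g z"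
    using der_along_D[OF g] c z kap_closed[OF c] ring_hom_closed[OF \<beta>] additive_closed[OF der_along_D(1)[OF g]] by simp
  then show ?thesis using kap_mult[OF c z] by simp
qed

end

text \<open>Such a derivation factors through the differentials, so it can be applied to the chart
  identity for \<open>dZ z\<close>. It will be used with values in the localization, in the
  operators on \<open>V\<close> and in the source of the natural map.\<close>

lemma (in smooth_chart) chart_rule:
  assumes G: "ring G" and \<beta>: "\<beta> \<in> ring_hom Z G" and g: "der_along G \<beta> g" and z: "z |: Z"
  shows "\<beta> s \<otimes>\<^sub>G g z = (\<Oplus>\<^sub>G j\<in>J. \<beta> (w j z) \<otimes>\<^sub>G g (x j))"
proof -
  interpret G: ring G by fact
  note gD = der_along_D[OF g]
  obtain \<gamma> where \<gamma>: "additive \<Omega> G \<gamma>"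
    "\<And>r w. r |: Z ==> w |: \<Omega> ==> \<gamma> (r \<odot>\<^sub>\<Omega> w) = \<beta> r \<otimes>\<^sub>G \<gamma> w"
    "\<And>x. x |: Z ==> \<gamma> (dZ x) = g x"
    by (rule om_lift[OF G \<beta>, of g, OF additive_closed[OF gD(1)] additive_add[OF gD(1)] der_along_scalar[OF G \<beta> g] gD(3)], assumption+, rule that)
  have sc: "s |: Z" using s_carr by simp
  have cl: "w j z \<odot>\<^sub>\<Omega> dZ (x j) |: \<Omega>" if "j \<in> J" for j
    using that w_closed[OF that z] by (simp add: dZ_closed x_closed)
  have "\<beta> s \<otimes>\<^sub>G g z = \<gamma> (\<Oplus>\<^sub>\<Omega> j\<in>J. w j z \<odot>\<^sub>\<Omega> dZ (x j))"
    using \<gamma>(2)[OF sc dZ_closed[OF z]] \<gamma>(3)[OF z] d_chart[OF z] by simp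
  also have "\<dots> = (\<Oplus>\<^sub>G j\<in>J. \<gamma> (w j z \<odot>\<^sub>\<Omega> dZ (x j)))"
    by (rule additive_finsum[OF \<gamma>(1) Om.M.abelian_group_axioms G.is_abelian_group cl])
  also have "\<dots> = (\<Oplus>\<^sub>G j\<in>J. \<beta> (w j z) \<otimes>\<^sub>G g (x j))"
    using z by (intro G.finsum_cong') (auto simp: \<gamma> w_closed x_closed dZ_closed ring_hom_closed[OF \<beta>] additive_closed[OF gD(1)])
  finally show ?thesis .
qed

section \<open>Coefficients, partial derivatives and structure constants in a chart\<close>

locale pbw_chart = poisson_order K Z pb A pa + C: smooth_chart K Z \<pp> J x s w
  for K :: "('k, 'm) ring_scheme" and Z :: "('k, 'z, 'c) module_scheme" (structure) and pb
    and A :: "('z, 'a, 'd) module_scheme" and pa and \<pp> J x s w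
begin

lemma prime_compl:
  "\<one> \<in> carrier Z - \<pp>" "a \<in> carrier Z - \<pp> ==> b \<in> carrier Z - \<pp> ==> a \<otimes> b \<in> carrier Z - \<pp>"
proof -
  interpret P: primeideal \<pp> Z by (rule C.chart_prime)
  show "\<one> \<in> carrier Z - \<pp>" using P.one_imp_carrier P.I_notcarr by auto
  show "a \<otimes> b \<in> carrier Z - \<pp>" if "a \<in> carrier Z - \<pp>" "b \<in> carrier Z - \<pp>"
    using P.I_prime[of a b] that by auto
qed

lemma iota_center: "z |: Z ==> iota z \<in> center A"
  by (simp add: center_def iota_mult)

text \<open>Every element outside of \<open>\<pp>\<close> becomes a nonzerodivisor, while
  \<open>s\<close> alone acquires an inverse; it is the only denominator in the partial
  derivatives.\<close>

sublocale Lo: central_localization A "iota ` (carrier Z - \<pp>)" "iota s"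
proof
  show "iota ` (carrier Z - \<pp>) \<subseteq> center A" using iota_center by blast
  show "\<one>\<^sub>A \<in> iota ` (carrier Z - \<pp>)" using prime_compl(1) ring_hom_one[OF iota_hom] by (metis imageI)
  show "t \<otimes>\<^sub>A r \<in> iota ` (carrier Z - \<pp>)" if tr: "t \<in> iota ` (carrier Z - \<pp>)" "r \<in> iota ` (carrier Z - \<pp>)" for t r
  proof -
    obtain a b where ab: "a \<in> carrier Z - \<pp>" "b \<in> carrier Z - \<pp>" "t = iota a" "r = iota b" using tr by blast
    then have "t \<otimes>\<^sub>A r = iota (a \<otimes> b)" by (simp add: ring_hom_mult[OF iota_hom])
    then show ?thesis using prime_compl(2)[OF ab(1,2)] by blast
  qed
  show "iota s \<in> iota ` (carrier Z - \<pp>)" using C.s_carr by blast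
qed

abbreviation "B \<equiv> Lo.L"
abbreviation "lo \<equiv> Lo.lo"
definition beta :: "'z => (nat => 'a) set" where "beta z = lo (iota z)"
text \<open>The partial derivative of \<open>z\<close> by \<open>x j\<close>, where
  \<open>Lo.u\<close> is the inverse of \<open>s\<close>.\<close>

definition pt :: "nat => 'z => (nat => 'a) set" where "pt j z = Lo.u \<otimes>\<^sub>B beta (w j z)"

lemma sc: "s |: Z" using C.s_carr by simp

lemma beta_hom: "beta \<in> ring_hom Z B"
  unfolding beta_def[abs_def] using ring_hom_trans[OF iota_hom Lo.lo_hom] by (simp add: comp_def)

lemmas beta_closed = ring_hom_closed[OF beta_hom]

lemma beta_center: "z |: Z ==> beta z \<in> center B"
  unfolding beta_def by (rule Lo.lo_center[OF iota_center])

text \<open>The reason for dividing by torsion: the chart identities, which hold up to factors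
  outside of \<open>\<pp>\<close>, become equalities here, and \<open>pt j\<close> becomes a
  derivation in the strict sense.\<close>

lemma beta_eq:
  assumes y: "y |: Z" and z: "z |: Z" and "\<exists>t\<in>carrier Z - \<pp>. t \<otimes> y = t \<otimes> z"
  shows "beta y = beta z"
proof -
  obtain t where t: "t \<in> carrier Z - \<pp>" "t \<otimes> y = t \<otimes> z" using assms by blast
  have bt: "beta t |: B" using t by (simp add: beta_closed)
  have "beta t \<otimes>\<^sub>B beta y = beta t \<otimes>\<^sub>B beta z"
    using t y z ring_hom_mult[OF beta_hom, of t] by (metis DiffD1)
  then have "beta t \<otimes>\<^sub>B (beta y \<ominus>\<^sub>B beta z) = \<zero>\<^sub>B"
    using Lo.L.mult_diff[OF bt beta_closed[OF y] beta_closed[OF z]]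
      Lo.L.minus_eq_zero_iff[OF Lo.L.m_closed[OF bt beta_closed[OF y]] Lo.L.m_closed[OF bt beta_closed[OF z]]] by simp
  then have "beta y \<ominus>\<^sub>B beta z = \<zero>\<^sub>B"
    using t(1) Lo.lo_S_cancel[of "iota t" "beta y \<ominus>\<^sub>B beta z"] Lo.L.minus_closed[OF beta_closed[OF y] beta_closed[OF z]]
    by (simp add: beta_def)
  then show ?thesis using Lo.L.minus_eq_zero_iff[OF beta_closed[OF y] beta_closed[OF z]] by simp
qed

lemma beta_s_u: "beta s \<otimes>\<^sub>B Lo.u = \<one>\<^sub>B" "Lo.u \<otimes>\<^sub>B beta s = \<one>\<^sub>B"
  using Lo.lo_s_u Lo.L.center_commute[OF Lo.u_center beta_closed[OF sc]] by (simp_all add: beta_def)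

lemma u_left: "b |: B ==> q |: B ==> Lo.u \<otimes>\<^sub>B (b \<otimes>\<^sub>B q) = b \<otimes>\<^sub>B (Lo.u \<otimes>\<^sub>B q)"
  using Lo.L.center_commute[OF Lo.u_center, of b] by (simp add: Lo.u_closed flip: Lo.L.m_assoc)

lemma pt_center: "j \<in> J ==> z |: Z ==> pt j z \<in> center B"
  unfolding pt_def by (intro Lo.L.center_mult Lo.u_center beta_center C.w_closed)

lemma pt_closed: "j \<in> J ==> z |: Z ==> pt j z |: B"
  by (rule Lo.L.center_carrier[OF pt_center])

lemma pt_der: assumes j: "j \<in> J" shows "KS.der_along B beta (pt j)"
proof (rule KS.der_alongI)
  note cl = C.w_closed[OF j] beta_closed Lo.u_closed
  show "additive Z B (pt j)"
  proof (rule additiveI[OF pt_closed[OF j]])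
    fix y z assume yz: "y |: Z" "z |: Z"
    have "beta (w j (y \<oplus> z)) = beta (w j y \<oplus> w j z)" using yz cl by (intro beta_eq C.w_add j) auto
    then show "pt j (y \<oplus> z) = pt j y \<oplus>\<^sub>B pt j z"
      using yz cl by (simp add: pt_def ring_hom_add[OF beta_hom] Lo.L.r_distr)
  qed
  show "pt j (kap c) = \<zero>\<^sub>B" if c: "c |: K" for c
  proof -
    have "beta (w j (kap c)) = beta \<zero>"
      using C.w_const[OF j c] KS.kap_closed[OF c] cl by (intro beta_eq) (auto simp: KS.kap_def)
    then show ?thesis using ring_hom_zero[OF beta_hom KS.Zc.ring_axioms Lo.L.ring_axioms] cl by (simp add: pt_def)
  qed
  fix y z assume yz: "y |: Z" "z |: Z"
  have "beta (w j (y \<otimes> z)) = beta ((y \<otimes> w j z) \<oplus> (z \<otimes> w j y))" using yz cl by (intro beta_eq C.w_mult j) auto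
  then show "pt j (y \<otimes> z) = (beta y \<otimes>\<^sub>B pt j z) \<oplus>\<^sub>B (beta z \<otimes>\<^sub>B pt j y)"
    using yz cl by (simp add: pt_def ring_hom_add[OF beta_hom] ring_hom_mult[OF beta_hom] Lo.L.r_distr u_left)
qed

lemma pt_x: assumes "i \<in> J" "j \<in> J" shows "pt j (x i) = (if i = j then \<one>\<^sub>B else \<zero>\<^sub>B)"
proof -
  have "beta (w j (x i)) = beta (if i = j then s else \<zero>)"
    using assms C.w_closed C.x_closed sc by (intro beta_eq C.w_x) auto
  then show ?thesis
    using ring_hom_zero[OF beta_hom KS.Zc.ring_axioms Lo.L.ring_axioms] by (simp add: pt_def beta_s_u Lo.u_closed)
qed

lemma pt_rule:
  assumes g: "KS.der_along B beta g" and z: "z |: Z"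
  shows "g z = (\<Oplus>\<^sub>B j\<in>J. pt j z \<otimes>\<^sub>B g (x j))"
proof -
  note gc = additive_closed[OF KS.der_along_D(1)[OF g]]
  note cl = gc[OF z] gc[OF C.x_closed] beta_closed[OF C.w_closed[OF _ z]] Lo.u_closed beta_closed[OF sc]
  have "g z = Lo.u \<otimes>\<^sub>B (beta s \<otimes>\<^sub>B g z)" using cl by (simp add: beta_s_u flip: Lo.L.m_assoc)
  also have "\<dots> = Lo.u \<otimes>\<^sub>B (\<Oplus>\<^sub>B j\<in>J. beta (w j z) \<otimes>\<^sub>B g (x j))"
    by (simp only: C.chart_rule[OF Lo.L.ring_axioms beta_hom g z])
  also have "\<dots> = (\<Oplus>\<^sub>B j\<in>J. Lo.u \<otimes>\<^sub>B (beta (w j z) \<otimes>\<^sub>B g (x j)))"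
    using cl C.chart_fin by (intro Lo.L.finsum_rdistr) auto
  also have "\<dots> = (\<Oplus>\<^sub>B j\<in>J. pt j z \<otimes>\<^sub>B g (x j))"
    using cl by (intro Lo.L.finsum_cong') (auto simp: pt_def Lo.L.m_assoc)
  finally show ?thesis .
qed

text \<open>The bracket with the coordinate \<open>x k\<close>, extended to the localization; only
  existence of the extension and its values on \<open>A\<close> matter.\<close>

definition dv :: "nat => (nat => 'a) set => (nat => 'a) set"
  where "dv k = (SOME \<Delta>. derivation B \<Delta> \<and> (\<forall>a\<in>carrier A. \<Delta> (lo a) = lo (pa (x k) a)))"

lemma dv:
  assumes k: "k \<in> J"
  shows dv_derivation: "derivation B (dv k)" and dv_lo: "\<And>a. a |: A ==> dv k (lo a) = lo (pa (x k) a)"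
proof -
  have "derivation A (pa (x k))" unfolding derivation_def
    using pa_additive pa_derivation C.x_closed[OF k] by blast
  from Lo.derivation_extend[OF this] obtain \<Delta> where "derivation B \<Delta>" "\<And>a. a |: A ==> \<Delta> (lo a) = lo (pa (x k) a)"
    by blast
  then have "\<exists>\<Delta>. derivation B \<Delta> \<and> (\<forall>a\<in>carrier A. \<Delta> (lo a) = lo (pa (x k) a))" by blast
  from someI_ex[OF this] show "derivation B (dv k)" "\<And>a. a |: A ==> dv k (lo a) = lo (pa (x k) a)"
    by (simp_all add: dv_def)
qed

lemmas dv_additive = derivation_additive[OF dv_derivation]
lemmas dv_closed = additive_closed[OF dv_additive]

lemma dv_beta: "k \<in> J ==> z |: Z ==> dv k (beta z) = beta (pb (x k) z)"
  by (simp add: beta_def dv_lo pa_iota C.x_closed)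

text \<open>The structure constants: the bracket of the differentials of \<open>x i\<close> and
  \<open>x j\<close> is the differential of their Poisson bracket, expanded in the
  coordinates.\<close>

definition st :: "nat => nat => nat => (nat => 'a) set" where "st i j k = pt k (pb (x i) (x j))"

lemma pa_kap_l: assumes c: "c |: K" and a: "a |: A" shows "pa (kap c) a = \<zero>\<^sub>A"
proof -
  have "pa \<one> a = pa \<one> a \<oplus>\<^sub>A pa \<one> a"
    using pa_leibniz[OF KS.Zc.one_closed KS.Zc.one_closed a] pa_closed[OF KS.Zc.one_closed a] by simp
  then have "pa \<one> a = \<zero>\<^sub>A" using pa_closed[OF KS.Zc.one_closed a] Aa.M.add.l_cancel_one by fastforce
  then show ?thesis using pa_smult_l[OF c KS.Zc.one_closed a] c
    by (simp add: KS.kap_def[symmetric] base_smult_iota KS.kap_closed)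
qed

text \<open>For fixed \<open>a\<close>, bracketing with \<open>a\<close> is a derivation in
  \<open>z\<close>, so it is determined by its values at the coordinates.\<close>

lemma lo_pa:
  assumes a: "a |: A" and z: "z |: Z"
  shows "lo (pa z a) = (\<Oplus>\<^sub>B j\<in>J. pt j z \<otimes>\<^sub>B dv j (lo a))"
proof -
  have "KS.der_along B beta (\<lambda>z. lo (pa z a))"
  proof (rule KS.der_alongI)
    show "additive Z B (\<lambda>z. lo (pa z a))"
      by (rule additive_comp[OF pa_additive_l[OF a] ring_hom_additive[OF Lo.lo_hom]])
    show "lo (pa (kap c) a) = \<zero>\<^sub>B" if "c |: K" for c
      using ring_hom_zero[OF Lo.lo_hom Aa.ring_axioms Lo.L.ring_axioms] by (simp add: pa_kap_l[OF that a])
    show "lo (pa (y \<otimes> z) a) = (beta y \<otimes>\<^sub>B lo (pa z a)) \<oplus>\<^sub>B (beta z \<otimes>\<^sub>B lo (pa y a))"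
      if "y |: Z" "z |: Z" for y z
      using that a by (simp add: pa_leibniz beta_def pa_closed ring_hom_add[OF Lo.lo_hom]
          flip: iota_mult(1) ring_hom_mult[OF Lo.lo_hom])
  qed
  from pt_rule[OF this z] have "lo (pa z a) = (\<Oplus>\<^sub>B j\<in>J. pt j z \<otimes>\<^sub>B lo (pa (x j) a))" .
  also have "\<dots> = (\<Oplus>\<^sub>B j\<in>J. pt j z \<otimes>\<^sub>B dv j (lo a))"
    using a z by (intro Lo.L.finsum_cong') (auto simp: dv_lo pt_closed pa_closed C.x_closed Lo.lo_closed)
  finally show ?thesis .
qed

text \<open>The difference of \<open>pt m (pb (x k) f)\<close> and \<open>dv k (pt m f)\<close> is a
  derivation in \<open>f\<close>, hence given by its values at the coordinates. For
  \<open>f = pb (x i) (x j)\<close> this expresses the coefficients of an iterated bracket, the form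
  in which the Jacobi identity is required.\<close>

lemma pt_pb:
  assumes k: "k \<in> J" and m: "m \<in> J" and f: "f |: Z"
  shows "pt m (pb (x k) f) = dv k (pt m f) \<oplus>\<^sub>B (\<Oplus>\<^sub>B l\<in>J. pt l f \<otimes>\<^sub>B st k l m)"
proof -
  note pD = KS.der_along_D[OF pt_der[OF m]] and xk = C.x_closed[OF k]
  let ?h = "\<lambda>f. pt m (pb (x k) f) \<ominus>\<^sub>B dv k (pt m f)"
  have pbk: "additive Z Z (pb (x k))" using xk by (auto intro!: additiveI simp: pb_closed pb_add)
  have d0: "dv k \<zero>\<^sub>B = \<zero>\<^sub>B" "dv k \<one>\<^sub>B = \<zero>\<^sub>B"
    using Lo.L.derivation_zero[OF dv_derivation[OF k]] Lo.L.derivation_one[OF dv_derivation[OF k]] .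
  have h: "KS.der_along B beta ?h"
  proof (rule KS.der_alongI)
    show "additive Z B ?h"
      by (intro additive_diff additive_comp[OF pbk pD(1)] additive_comp[OF pD(1) dv_additive[OF k]] Lo.L.is_abelian_group)
    show "?h (kap c) = \<zero>\<^sub>B" if c: "c |: K" for c
    proof -
      have "pb (x k) \<one> = pb (x k) \<one> \<oplus> pb (x k) \<one>"
        using pb_leibniz[OF xk KS.Zc.one_closed KS.Zc.one_closed] pb_closed[OF xk KS.Zc.one_closed] by simp
      then have "pb (x k) \<one> = \<zero>" using pb_closed[OF xk KS.Zc.one_closed] KS.Zc.add.l_cancel_one by fastforce
      then have "pb (x k) (kap c) = \<zero>" using pb_smult[OF c xk KS.Zc.one_closed] c by (simp add: KS.kap_def)
      then show ?thesis
        using additive_zero[OF pD(1) KS.Zc.is_abelian_group Lo.L.is_abelian_group] d0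
        by (simp add: pD(2)[OF c] a_minus_def)
    qed
    fix y z assume yz: "y |: Z" "z |: Z"
    note cl = yz xk pb_closed[OF xk] beta_closed pt_closed[OF m] dv_closed[OF k]
    have 1: "pt m (pb (x k) (y \<otimes> z)) =
       (beta (pb (x k) y) \<otimes>\<^sub>B pt m z \<oplus>\<^sub>B beta z \<otimes>\<^sub>B pt m (pb (x k) y)) \<oplus>\<^sub>B
       (beta y \<otimes>\<^sub>B pt m (pb (x k) z) \<oplus>\<^sub>B beta (pb (x k) z) \<otimes>\<^sub>B pt m y)"
      using cl by (simp add: pb_leibniz pD(3) additive_add[OF pD(1)])
    have 2: "dv k (pt m (y \<otimes> z)) =
       (beta (pb (x k) y) \<otimes>\<^sub>B pt m z \<oplus>\<^sub>B beta y \<otimes>\<^sub>B dv k (pt m z)) \<oplus>\<^sub>B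
       (beta (pb (x k) z) \<otimes>\<^sub>B pt m y \<oplus>\<^sub>B beta z \<otimes>\<^sub>B dv k (pt m y))"
      using cl by (simp add: pD(3) additive_add[OF dv_additive[OF k]] derivation_mult[OF dv_derivation[OF k]] dv_beta[OF k])
    show "?h (y \<otimes> z) = (beta y \<otimes>\<^sub>B ?h z) \<oplus>\<^sub>B (beta z \<otimes>\<^sub>B ?h y)"
      unfolding 1 2 using cl by (intro Lo.L.leibniz_cancel) auto
  qed
  have "?h f = (\<Oplus>\<^sub>B l\<in>J. pt l f \<otimes>\<^sub>B st k l m)"
    unfolding pt_rule[OF h f]
  proof (intro Lo.L.finsum_cong')
    show "(\<lambda>l. pt l f \<otimes>\<^sub>B st k l m) \<in> J \<rightarrow> carrier B"
      using f m xk C.x_closed by (auto simp: st_def pt_closed pb_closed)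
    \<comment> \<open>At a coordinate, \<open>pt m\<close> is constant and therefore killed by
      \<open>dv k\<close>, so only the structure constant remains.\<close>
    fix l assume l: "l \<in> J"
    have "pt m (pb (x k) (x l)) |: B" using m l xk C.x_closed by (simp add: pt_closed pb_closed)
    then show "pt l f \<otimes>\<^sub>B ?h (x l) = pt l f \<otimes>\<^sub>B st k l m"
      using d0 l m by (cases "l = m") (simp_all add: pt_x st_def a_minus_def)
  qed simp
  moreover have "pt m (pb (x k) f) = dv k (pt m f) \<oplus>\<^sub>B ?h f"
    using f xk m k by (intro Lo.L.add_diff_cancel) (auto simp: pt_closed pb_closed dv_closed)
  ultimately show ?thesis by simp
qed

lemma st_closed: "i \<in> J ==> j \<in> J ==> k \<in> J ==> st i j k |: B"
  by (simp add: st_def pt_closed pb_closed C.x_closed)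

lemma st_center: "i \<in> J ==> j \<in> J ==> k \<in> J ==> st i j k \<in> center B"
  by (simp add: st_def pt_center pb_closed C.x_closed)

text \<open>Both sides differ by a derivation of \<open>B\<close>, so it suffices to compare them on
  the image of \<open>A\<close>, where the claim is \<open>pa_lie\<close> combined with
  \<open>lo_pa\<close>.\<close>

lemma dv_comm:
  assumes i: "i \<in> J" and j: "j \<in> J" and b: "b |: B"
  shows "dv i (dv j b) = dv j (dv i b) \<oplus>\<^sub>B (\<Oplus>\<^sub>B k\<in>J. st i j k \<otimes>\<^sub>B dv k b)"
proof -
  let ?S = "\<lambda>b. \<Oplus>\<^sub>B k\<in>J. st i j k \<otimes>\<^sub>B dv k b"
  let ?\<Delta> = "\<lambda>b. (dv i (dv j b) \<ominus>\<^sub>B dv j (dv i b)) \<ominus>\<^sub>B ?S b"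
  have xij: "x i |: Z" "x j |: Z" using i j C.x_closed by auto
  have S_closed: "?S b |: B" if "b |: B" for b
    using that st_closed[OF i j] dv_closed by (intro Lo.L.finsum_closed) auto
  have "?\<Delta> b = \<zero>\<^sub>B"
  proof (rule Lo.derivation_zeroI[OF _ _ b])
    show "derivation B ?\<Delta>"
      by (intro Lo.L.derivation_diff Lo.L.derivation_commutator Lo.L.derivation_linear_combination
        dv_derivation i j st_center C.chart_fin)
    fix a assume a: "a |: A"
    have pbl: "pa (x i) (pa (x j) a) |: A" "pa (x j) (pa (x i) a) |: A"
      using a xij by (simp_all add: pa_closed)
    have "?S (lo a) = lo (pa (pb (x i) (x j)) a)"
      using lo_pa[OF a pb_closed[OF xij]] by (simp add: st_def)
    also have "\<dots> = lo (pa (x i) (pa (x j) a)) \<ominus>\<^sub>B lo (pa (x j) (pa (x i) a))"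
      unfolding pa_lie[OF xij a] using ring_hom_minus[OF Lo.lo_hom Aa.ring_axioms Lo.L.ring_axioms pbl] .
    finally show "?\<Delta> (lo a) = \<zero>\<^sub>B"
      using a xij i j pbl by (simp add: dv_lo pa_closed Lo.lo_closed a_minus_def Lo.L.r_neg)
  qed
  then have "dv i (dv j b) \<ominus>\<^sub>B dv j (dv i b) = ?S b"
    using i j b S_closed[OF b] by (simp add: dv_closed Lo.L.minus_eq_zero_iff)
  then show ?thesis
    using Lo.L.add_diff_cancel[of "dv i (dv j b)" "dv j (dv i b)"] i j b by (simp add: dv_closed)
qed

sublocale R: free_lie_rinehart B J dv st
proof (intro free_lie_rinehart.intro free_lie_rinehart_axioms.intro)
  show "ring B" by (rule Lo.L_ring)
  show "finite J" by (rule C.chart_fin)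
  show "additive B B (dv i)" if "i \<in> J" for i by (rule dv_additive[OF that])
  show "dv i (y \<otimes>\<^sub>B z) = (dv i y \<otimes>\<^sub>B z) \<oplus>\<^sub>B (y \<otimes>\<^sub>B dv i z)"
    if "i \<in> J" "y |: B" "z |: B" for i y z by (rule derivation_mult[OF dv_derivation[OF that(1)] that(2,3)])
  show "st i j k |: B" if "i \<in> J" "j \<in> J" "k \<in> J" for i j k by (rule st_closed[OF that])
  show "st i j k \<otimes>\<^sub>B y = y \<otimes>\<^sub>B st i j k" if "i \<in> J" "j \<in> J" "k \<in> J" "y |: B" for i j k y
    by (rule Lo.L.center_commute[OF st_center[OF that(1-3)] that(4)])
  note pD = KS.der_along_D(1)[OF pt_der]
  have pt0: "k \<in> J ==> pt k \<zero> = \<zero>\<^sub>B" for k by (rule additive_zero[OF pD KS.Zc.is_abelian_group Lo.L.is_abelian_group])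
  show "st i i k = \<zero>\<^sub>B" if "i \<in> J" "k \<in> J" for i k
    using that by (simp add: st_def pb_alternating C.x_closed pt0)
  show "st j i k = \<ominus>\<^sub>B st i j k" if "i \<in> J" "j \<in> J" "k \<in> J" for i j k
    using pb_skew[of "x j" "x i"] that additive_neg[OF pD[OF that(3)] KS.Zc.is_abelian_group Lo.L.is_abelian_group]
    by (simp add: st_def pb_closed C.x_closed)
  show "dv i (dv j b) = dv j (dv i b) \<oplus>\<^sub>B (\<Oplus>\<^sub>B k\<in>J. st i j k \<otimes>\<^sub>B dv k b)"
    if "i \<in> J" "j \<in> J" "b |: B" for i j b by (rule dv_comm[OF that])
  fix i j k m assume J: "i \<in> J" "j \<in> J" "k \<in> J" "m \<in> J"
  have xc: "x i |: Z" "x j |: Z" "x k |: Z" using J C.x_closed by auto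
  \<comment> \<open>By \<open>pt_pb\<close>, each of the three summands is the coefficient at
    \<open>m\<close> of an iterated Poisson bracket of coordinates, so their sum vanishes by
    \<open>pb_jacobi\<close>.\<close>
  have e: "dv k (st i j m) \<oplus>\<^sub>B (\<Oplus>\<^sub>B l\<in>J. st i j l \<otimes>\<^sub>B st k l m) = pt m (pb (x k) (pb (x i) (x j)))"
    if "i \<in> J" "j \<in> J" "k \<in> J" for i j k
    using pt_pb[OF that(3) J(4) pb_closed[OF C.x_closed[OF that(1)] C.x_closed[OF that(2)]]] by (simp add: st_def)
  note pc = pb_closed[OF xc(3) pb_closed[OF xc(1,2)]] pb_closed[OF xc(1) pb_closed[OF xc(2,3)]] pb_closed[OF xc(2) pb_closed[OF xc(3,1)]]
  have "pt m (pb (x k) (pb (x i) (x j))) \<oplus>\<^sub>B (pt m (pb (x i) (pb (x j) (x k))) \<oplus>\<^sub>B pt m (pb (x j) (pb (x k) (x i)))) =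
    pt m (pb (x k) (pb (x i) (x j)) \<oplus> pb (x i) (pb (x j) (x k)) \<oplus> pb (x j) (pb (x k) (x i)))"
    using pc J(4) by (simp add: additive_add[OF pD] pt_closed Lo.L.a_assoc)
  then show "(dv k (st i j m) \<oplus>\<^sub>B (\<Oplus>\<^sub>B l\<in>J. st i j l \<otimes>\<^sub>B st k l m)) \<oplus>\<^sub>B
      ((dv i (st j k m) \<oplus>\<^sub>B (\<Oplus>\<^sub>B l\<in>J. st j k l \<otimes>\<^sub>B st i l m)) \<oplus>\<^sub>B
       (dv j (st k i m) \<oplus>\<^sub>B (\<Oplus>\<^sub>B l\<in>J. st k i l \<otimes>\<^sub>B st j l m))) = \<zero>\<^sub>B"
    unfolding e[OF J(1-3)] e[OF J(2,3,1)] e[OF J(3,1,2)] pb_jacobi[OF xc(3,1,2)]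
    by (simp add: pt0[OF J(4)])
qed

end

text \<open>The failure to respect brackets, with one argument fixed, obeys the Leibniz rule: the
  terms \<open>q\<close> and \<open>q'\<close> from moving \<open>h\<close> past \<open>a\<close>
  and \<open>b\<close> are cancelled by those from the bracket of a product.\<close>

lemma (in ring) lie_leibniz:
  assumes c: "a |: R" "b |: R" "g |: R" "k |: R" "h |: R"
    "p |: R" "p' |: R" "q |: R" "q' |: R"
    and ha: "h \<otimes> a = q \<oplus> a \<otimes> h" and hb: "h \<otimes> b = q' \<oplus> b \<otimes> h"
  shows "((a \<otimes> k \<oplus> b \<otimes> g) \<otimes> h \<ominus> h \<otimes> (a \<otimes> k \<oplus> b \<otimes> g)) \<ominus> ((a \<otimes> p' \<oplus> (\<ominus> q') \<otimes> g) \<oplus> (b \<otimes> p \<oplus> (\<ominus> q) \<otimes> k)) =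
    a \<otimes> ((k \<otimes> h \<ominus> h \<otimes> k) \<ominus> p') \<oplus> b \<otimes> ((g \<otimes> h \<ominus> h \<otimes> g) \<ominus> p)"
proof -
  have "h \<otimes> (a \<otimes> k \<oplus> b \<otimes> g) = (h \<otimes> a) \<otimes> k \<oplus> (h \<otimes> b) \<otimes> g" using c by (simp add: r_distr m_assoc)
  also have "\<dots> = (q \<otimes> k \<oplus> a \<otimes> (h \<otimes> k)) \<oplus> (q' \<otimes> g \<oplus> b \<otimes> (h \<otimes> g))"
    unfolding ha hb using c by (simp add: l_distr m_assoc)
  finally show ?thesis using c by (simp del: r_distr add: m_assoc) algebra
qed

lemma (in ring) comm_skew:
  "p |: R ==> q |: R ==> r |: R ==> (p \<ominus> q) \<ominus> (\<ominus> r) = \<ominus> ((q \<ominus> p) \<ominus> r)"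
  by algebra

lemma (in ring) comm_cancel: "p |: R ==> r |: R ==> ((p \<oplus> r) \<ominus> p) \<ominus> r = \<zero>"
  by algebra

lemma (in ring) add_diff: "p |: R ==> r |: R ==> (r \<oplus> p) \<ominus> p = r"
  by algebra

section \<open>The representation of the enveloping algebra on polynomials over
  \<open>B\<close>\<close>

context pbw_chart
begin

abbreviation "EV \<equiv> End_ring R.V"
definition rho :: "(nat => 'a) set => (nat multiset => (nat => 'a) set) => nat multiset => (nat => 'a) set"
  where "rho b = restrict (R.sm b) (carrier R.V)"
definition DD :: "nat => (nat multiset => (nat => 'a) set) => nat multiset => (nat => 'a) set"
  where "DD j = restrict (R.D j) (carrier R.V)"
definition gg :: "'z => (nat multiset => (nat => 'a) set) => nat multiset => (nat => 'a) set"
  where "gg z = (\<Oplus>\<^bsub>EV\<^esub>j\<in>J. rho (pt j z) \<otimes>\<^bsub>EV\<^esub> DD j)"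

lemma EV_ring: "ring EV" by (rule End_ring[OF R.V.abelian_group_axioms])

sublocale EV: ring EV by (rule EV_ring)

lemma rho_closed: "b |: B ==> rho b |: EV"
  unfolding rho_def by (rule End_ringI[OF R.V.abelian_group_axioms R.sm_additive])

lemma DD_closed: "j \<in> J ==> DD j |: EV"
  unfolding DD_def by (rule End_ringI[OF R.V.abelian_group_axioms R.D_additive])

lemma rho_apply: "v |: R.V ==> rho b v = R.sm b v" by (simp add: rho_def)
lemma DD_apply: "v |: R.V ==> DD j v = R.D j v" by (simp add: DD_def)

lemmas EV_apply = End_ring_simps[of _ R.V] rho_apply DD_apply R.sm_closed R.D_closed

lemma EV_eqI: "g |: EV ==> h |: EV ==> (\<And>v. v |: R.V ==> g v = h v) ==> g = h"
  by (rule End_ring_eqI[of _ R.V])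

lemma EV_eval: "v |: R.V ==> additive EV R.V (\<lambda>h. h v)"
  by (rule additiveI) (auto simp: End_ring_simps intro: additive_closed[OF End_ring_additive])

lemma rho_hom: "rho \<in> ring_hom B EV"
proof (rule ring_hom_memI)
  fix b c assume bc: "b |: B" "c |: B"
  show "rho (b \<otimes>\<^sub>B c) = rho b \<otimes>\<^bsub>EV\<^esub> rho c" and "rho (b \<oplus>\<^sub>B c) = rho b \<oplus>\<^bsub>EV\<^esub> rho c"
    using bc by (auto intro!: EV_eqI rho_closed EV.m_closed EV.a_closed simp: EV_apply R.sm_mult R.sm_add_l)
next
  show "rho \<one>\<^sub>B = \<one>\<^bsub>EV\<^esub>"
    by (rule EV_eqI) (auto intro!: rho_closed EV.one_closed simp: EV_apply R.sm_one)
qed (rule rho_closed)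

lemma DD_rho: "j \<in> J ==> b |: B ==> DD j \<otimes>\<^bsub>EV\<^esub> rho b = rho (dv j b) \<oplus>\<^bsub>EV\<^esub> (rho b \<otimes>\<^bsub>EV\<^esub> DD j)"
  by (auto intro!: EV_eqI rho_closed DD_closed EV.m_closed EV.a_closed simp: EV_apply R.D_smult dv_closed)

lemma DD_comm:
  assumes i: "i \<in> J" and j: "j \<in> J"
  shows "DD i \<otimes>\<^bsub>EV\<^esub> DD j = (DD j \<otimes>\<^bsub>EV\<^esub> DD i) \<oplus>\<^bsub>EV\<^esub> (\<Oplus>\<^bsub>EV\<^esub>k\<in>J. rho (st i j k) \<otimes>\<^bsub>EV\<^esub> DD k)"
proof (rule EV_eqI)
  have cl: "rho (st i j k) \<otimes>\<^bsub>EV\<^esub> DD k |: EV" if "k \<in> J" for k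
    using that i j by (intro EV.m_closed rho_closed DD_closed st_closed)
  have S: "(\<Oplus>\<^bsub>EV\<^esub>k\<in>J. rho (st i j k) \<otimes>\<^bsub>EV\<^esub> DD k) |: EV" using cl by (intro EV.finsum_closed) auto
  then show "(DD j \<otimes>\<^bsub>EV\<^esub> DD i) \<oplus>\<^bsub>EV\<^esub> (\<Oplus>\<^bsub>EV\<^esub>k\<in>J. rho (st i j k) \<otimes>\<^bsub>EV\<^esub> DD k) |: EV"
    and "DD i \<otimes>\<^bsub>EV\<^esub> DD j |: EV" using i j DD_closed by auto
  fix v assume v: "v |: R.V"
  have "(\<Oplus>\<^bsub>EV\<^esub>k\<in>J. rho (st i j k) \<otimes>\<^bsub>EV\<^esub> DD k) v = (\<Oplus>\<^bsub>R.V\<^esub>k\<in>J. (rho (st i j k) \<otimes>\<^bsub>EV\<^esub> DD k) v)"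
    by (rule additive_finsum[OF EV_eval[OF v] EV.is_abelian_group R.V.abelian_group_axioms cl])
  also have "\<dots> = R.C i j v" unfolding R.C_def
    using v i j st_closed[OF i j] by (intro R.V.finsum_cong') (auto simp: EV_apply)
  finally have "(\<Oplus>\<^bsub>EV\<^esub>k\<in>J. rho (st i j k) \<otimes>\<^bsub>EV\<^esub> DD k) v = R.C i j v" .
  then show "(DD i \<otimes>\<^bsub>EV\<^esub> DD j) v = ((DD j \<otimes>\<^bsub>EV\<^esub> DD i) \<oplus>\<^bsub>EV\<^esub> (\<Oplus>\<^bsub>EV\<^esub>k\<in>J. rho (st i j k) \<otimes>\<^bsub>EV\<^esub> DD k)) v"
    using v i j R.D_comm[OF i j v] by (simp add: EV_apply)
qed

lemma rho_DD: "b |: B ==> j \<in> J ==> rho b \<otimes>\<^bsub>EV\<^esub> DD j |: EV"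
  by (intro EV.m_closed rho_closed DD_closed)

lemma rho_mult_sum:
  assumes b: "b |: B" and c: "\<And>j. j \<in> J ==> c j |: B"
  shows "(\<Oplus>\<^bsub>EV\<^esub>j\<in>J. rho (b \<otimes>\<^sub>B c j) \<otimes>\<^bsub>EV\<^esub> DD j) = rho b \<otimes>\<^bsub>EV\<^esub> (\<Oplus>\<^bsub>EV\<^esub>j\<in>J. rho (c j) \<otimes>\<^bsub>EV\<^esub> DD j)"
proof -
  have "rho b \<otimes>\<^bsub>EV\<^esub> (\<Oplus>\<^bsub>EV\<^esub>j\<in>J. rho (c j) \<otimes>\<^bsub>EV\<^esub> DD j) = (\<Oplus>\<^bsub>EV\<^esub>j\<in>J. rho b \<otimes>\<^bsub>EV\<^esub> (rho (c j) \<otimes>\<^bsub>EV\<^esub> DD j))"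
    using b c C.chart_fin rho_DD rho_closed by (intro EV.finsum_rdistr) auto
  also have "\<dots> = (\<Oplus>\<^bsub>EV\<^esub>j\<in>J. rho (b \<otimes>\<^sub>B c j) \<otimes>\<^bsub>EV\<^esub> DD j)"
    using b c by (intro EV.finsum_cong') (auto simp: ring_hom_mult[OF rho_hom] EV.m_assoc rho_closed DD_closed)
  finally show ?thesis ..
qed

text \<open>Inherited from \<open>pt j\<close>, since \<open>DD j\<close> stands to the right of the
  coefficient; left multiplication by \<open>rho (beta z)\<close> never has to pass it.\<close>

lemma gg_der: "KS.der_along EV (\<lambda>z. rho (beta z)) gg"
proof (rule KS.der_alongI)
  show add: "additive Z EV gg" unfolding gg_def
    by (intro additive_finsum_fun EV.is_abelian_group additive_comp[OF additive_comp[OF KS.der_along_D(1)[OF pt_der]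
      ring_hom_additive[OF rho_hom]] EV.additive_r_mult] DD_closed)
  show "gg (kap c) = \<zero>\<^bsub>EV\<^esub>" if c: "c |: K" for c
  proof -
    have "gg (kap c) = (\<Oplus>\<^bsub>EV\<^esub>j\<in>J. \<zero>\<^bsub>EV\<^esub>)" unfolding gg_def
      using c by (intro EV.finsum_cong')
        (auto simp: KS.der_along_D(2)[OF pt_der] ring_hom_zero[OF rho_hom Lo.L.ring_axioms EV_ring] DD_closed)
    then show ?thesis by simp
  qed
  fix y z assume yz: "y |: Z" "z |: Z"
  note cl = yz beta_closed pt_closed rho_closed DD_closed
  have "gg (y \<otimes> z) = (\<Oplus>\<^bsub>EV\<^esub>j\<in>J. (rho (beta y \<otimes>\<^sub>B pt j z) \<otimes>\<^bsub>EV\<^esub> DD j) \<oplus>\<^bsub>EV\<^esub> (rho (beta z \<otimes>\<^sub>B pt j y) \<otimes>\<^bsub>EV\<^esub> DD j))"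
    unfolding gg_def using cl by (intro EV.finsum_cong')
      (auto simp: KS.der_along_D(3)[OF pt_der] ring_hom_add[OF rho_hom] EV.l_distr)
  also have "\<dots> = (\<Oplus>\<^bsub>EV\<^esub>j\<in>J. rho (beta y \<otimes>\<^sub>B pt j z) \<otimes>\<^bsub>EV\<^esub> DD j) \<oplus>\<^bsub>EV\<^esub> (\<Oplus>\<^bsub>EV\<^esub>j\<in>J. rho (beta z \<otimes>\<^sub>B pt j y) \<otimes>\<^bsub>EV\<^esub> DD j)"
    using cl by (intro EV.finsum_addf) auto
  finally show "gg (y \<otimes> z) = (rho (beta y) \<otimes>\<^bsub>EV\<^esub> gg z) \<oplus>\<^bsub>EV\<^esub> (rho (beta z) \<otimes>\<^bsub>EV\<^esub> gg y)"
    using cl by (simp add: rho_mult_sum gg_def)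
qed

lemmas gg_additive = KS.der_along_D(1)[OF gg_der]
lemmas gg_closed = additive_closed[OF gg_additive]

lemma gg_x: assumes i: "i \<in> J" shows "gg (x i) = DD i"
proof -
  have "gg (x i) = (\<Oplus>\<^bsub>EV\<^esub>j\<in>J. if i = j then DD j else \<zero>\<^bsub>EV\<^esub>)" unfolding gg_def
    using i by (intro EV.finsum_cong')
      (auto simp: pt_x ring_hom_one[OF rho_hom] ring_hom_zero[OF rho_hom Lo.L.ring_axioms EV_ring] DD_closed)
  also have "\<dots> = DD i" using i C.chart_fin DD_closed by (intro EV.finsum_singleton) auto
  finally show ?thesis .
qed

text \<open>Moving each \<open>DD j\<close> past \<open>lo a\<close> creates the term
  \<open>dv j (lo a)\<close>; weighted with the partial derivatives of \<open>z\<close>, these terms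
  sum to \<open>lo (pa z a)\<close> by \<open>lo_pa\<close>.\<close>

lemma gg_rho:
  assumes z: "z |: Z" and a: "a |: A"
  shows "gg z \<otimes>\<^bsub>EV\<^esub> rho (lo a) = rho (lo (pa z a)) \<oplus>\<^bsub>EV\<^esub> (rho (lo a) \<otimes>\<^bsub>EV\<^esub> gg z)"
proof -
  note cl = z pt_closed rho_closed DD_closed rho_DD Lo.lo_closed[OF a] dv_closed[OF _ Lo.lo_closed[OF a]]
  have "gg z \<otimes>\<^bsub>EV\<^esub> rho (lo a) = (\<Oplus>\<^bsub>EV\<^esub>j\<in>J. (rho (pt j z) \<otimes>\<^bsub>EV\<^esub> DD j) \<otimes>\<^bsub>EV\<^esub> rho (lo a))"
    unfolding gg_def using cl C.chart_fin by (intro EV.finsum_ldistr) auto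
  also have "\<dots> = (\<Oplus>\<^bsub>EV\<^esub>j\<in>J. rho (pt j z \<otimes>\<^sub>B dv j (lo a)) \<oplus>\<^bsub>EV\<^esub> (rho (lo a \<otimes>\<^sub>B pt j z) \<otimes>\<^bsub>EV\<^esub> DD j))"
  proof (intro EV.finsum_cong')
    fix j assume j: "j \<in> J"
    have "(rho (pt j z) \<otimes>\<^bsub>EV\<^esub> DD j) \<otimes>\<^bsub>EV\<^esub> rho (lo a) =
        (rho (pt j z) \<otimes>\<^bsub>EV\<^esub> rho (dv j (lo a))) \<oplus>\<^bsub>EV\<^esub> ((rho (pt j z) \<otimes>\<^bsub>EV\<^esub> rho (lo a)) \<otimes>\<^bsub>EV\<^esub> DD j)"
      using cl j by (simp add: EV.m_assoc DD_rho EV.r_distr)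
    also have "rho (pt j z) \<otimes>\<^bsub>EV\<^esub> rho (lo a) = rho (lo a \<otimes>\<^sub>B pt j z)"
      using cl j Lo.L.center_commute[OF pt_center[OF j z] cl(6)] by (simp flip: ring_hom_mult[OF rho_hom])
    finally show "(rho (pt j z) \<otimes>\<^bsub>EV\<^esub> DD j) \<otimes>\<^bsub>EV\<^esub> rho (lo a) =
        rho (pt j z \<otimes>\<^sub>B dv j (lo a)) \<oplus>\<^bsub>EV\<^esub> (rho (lo a \<otimes>\<^sub>B pt j z) \<otimes>\<^bsub>EV\<^esub> DD j)"
      using cl j by (simp add: ring_hom_mult[OF rho_hom])
  qed (use cl in auto)
  also have "\<dots> = (\<Oplus>\<^bsub>EV\<^esub>j\<in>J. rho (pt j z \<otimes>\<^sub>B dv j (lo a))) \<oplus>\<^bsub>EV\<^esub> (\<Oplus>\<^bsub>EV\<^esub>j\<in>J. rho (lo a \<otimes>\<^sub>B pt j z) \<otimes>\<^bsub>EV\<^esub> DD j)"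
    using cl by (intro EV.finsum_addf) auto
  also have "(\<Oplus>\<^bsub>EV\<^esub>j\<in>J. rho (pt j z \<otimes>\<^sub>B dv j (lo a))) = rho (lo (pa z a))"
    unfolding lo_pa[OF a z] using cl
    by (intro additive_finsum[OF ring_hom_additive[OF rho_hom] Lo.L.is_abelian_group EV.is_abelian_group, symmetric]) auto
  also have "(\<Oplus>\<^bsub>EV\<^esub>j\<in>J. rho (lo a \<otimes>\<^sub>B pt j z) \<otimes>\<^bsub>EV\<^esub> DD j) = rho (lo a) \<otimes>\<^bsub>EV\<^esub> gg z"
    unfolding gg_def using cl by (intro rho_mult_sum) auto
  finally show ?thesis .
qed

text \<open>The failure of \<open>gg\<close> to be a Lie homomorphism is a derivation in each argument, so it vanishes if it
  does so at the coordinates.\<close>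

definition dlt :: "'z => 'z => (nat multiset => (nat => 'a) set) => nat multiset => (nat => 'a) set"
  where "dlt y z = (gg y \<otimes>\<^bsub>EV\<^esub> gg z \<ominus>\<^bsub>EV\<^esub> gg z \<otimes>\<^bsub>EV\<^esub> gg y) \<ominus>\<^bsub>EV\<^esub> gg (pb y z)"

lemma dlt_closed: "y |: Z ==> z |: Z ==> dlt y z |: EV"
  by (simp add: dlt_def gg_closed pb_closed)

lemma dlt_skew: assumes "y |: Z" "z |: Z" shows "dlt y z = \<ominus>\<^bsub>EV\<^esub> dlt z y"
proof -
  have "gg (pb y z) = \<ominus>\<^bsub>EV\<^esub> gg (pb z y)"
    using additive_neg[OF gg_additive KS.Zc.is_abelian_group EV.is_abelian_group pb_closed[OF assms(2,1)]] pb_skew[OF assms] by simp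
  then show ?thesis using EV.comm_skew[of "gg y \<otimes>\<^bsub>EV\<^esub> gg z" "gg z \<otimes>\<^bsub>EV\<^esub> gg y" "gg (pb z y)"] assms
    by (simp add: dlt_def gg_closed pb_closed)
qed

lemma pb_kap_l: assumes c: "c |: K" and z: "z |: Z" shows "pb (kap c) z = \<zero>"
proof -
  have "pb \<one> z = pb \<one> z \<oplus> pb \<one> z"
    using pb_leibniz_l[OF KS.Zc.one_closed KS.Zc.one_closed z] pb_closed[OF KS.Zc.one_closed z] by simp
  then have "pb \<one> z = \<zero>" using pb_closed[OF KS.Zc.one_closed z] KS.Zc.add.l_cancel_one by fastforce
  then have "pb z \<one> = \<zero>" using pb_skew[OF z KS.Zc.one_closed] by simp
  then have "pb z (kap c) = \<zero>" using pb_smult[OF c z KS.Zc.one_closed] c by (simp add: KS.kap_def)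
  then show ?thesis using pb_skew[OF KS.kap_closed[OF c] z] by simp
qed

lemma dlt_der: assumes z: "z |: Z" shows "KS.der_along EV (\<lambda>z. rho (beta z)) (\<lambda>y. dlt y z)"
proof (rule KS.der_alongI)
  note gD = KS.der_along_D[OF gg_der]
  have pbz: "additive Z Z (\<lambda>y. pb y z)" using z by (auto intro!: additiveI simp: pb_closed pb_add_l)
  show "additive Z EV (\<lambda>y. dlt y z)" unfolding dlt_def
    by (intro additive_diff additive_comp[OF gD(1) EV.additive_l_mult] additive_comp[OF gD(1) EV.additive_r_mult]
      additive_comp[OF pbz gD(1)] EV.is_abelian_group gg_closed z)
  show "dlt (kap c) z = \<zero>\<^bsub>EV\<^esub>" if c: "c |: K" for c
    using additive_zero[OF gD(1) KS.Zc.is_abelian_group EV.is_abelian_group] gg_closed[OF z]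
    by (simp add: dlt_def gD(2)[OF c] pb_kap_l[OF c z] a_minus_def)
  fix y y' assume y: "y |: Z" "y' |: Z"
  note cl = z y gg_closed beta_closed rho_closed pb_closed
  have nb: "rho (beta (pb y z)) = \<ominus>\<^bsub>EV\<^esub> rho (beta (pb z y))" if "y |: Z" for y
    using pb_skew[OF that z] ring_hom_neg[OF beta_hom KS.Zc.ring_axioms Lo.L.ring_axioms pb_closed[OF z that]]
      ring_hom_neg[OF rho_hom Lo.L.ring_axioms EV_ring beta_closed[OF pb_closed[OF z that]]] by simp
  have gb: "gg z \<otimes>\<^bsub>EV\<^esub> rho (beta y) = rho (beta (pb z y)) \<oplus>\<^bsub>EV\<^esub> (rho (beta y) \<otimes>\<^bsub>EV\<^esub> gg z)" if "y |: Z" for y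
    using gg_rho[OF z iota_closed[OF that]] z that by (simp add: beta_def pa_iota)
  have gp: "gg (pb (y \<otimes> y') z) =
     (rho (beta y) \<otimes>\<^bsub>EV\<^esub> gg (pb y' z) \<oplus>\<^bsub>EV\<^esub> (\<ominus>\<^bsub>EV\<^esub> rho (beta (pb z y'))) \<otimes>\<^bsub>EV\<^esub> gg y) \<oplus>\<^bsub>EV\<^esub>
     (rho (beta y') \<otimes>\<^bsub>EV\<^esub> gg (pb y z) \<oplus>\<^bsub>EV\<^esub> (\<ominus>\<^bsub>EV\<^esub> rho (beta (pb z y))) \<otimes>\<^bsub>EV\<^esub> gg y')"
    using cl by (simp add: pb_leibniz_l additive_add[OF gD(1)] gD(3) nb)
  show "dlt (y \<otimes> y') z = (rho (beta y) \<otimes>\<^bsub>EV\<^esub> dlt y' z) \<oplus>\<^bsub>EV\<^esub> (rho (beta y') \<otimes>\<^bsub>EV\<^esub> dlt y z)"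
    unfolding dlt_def gp gD(3)[OF y]
    by (rule EV.lie_leibniz[OF _ _ _ _ _ _ _ _ _ gb[OF y(1)] gb[OF y(2)]]) (use cl in auto)
qed

text \<open>The chart rule gives the claim after multiplication by \<open>rho (beta s)\<close>,
  which has the left inverse \<open>rho Lo.u\<close>.\<close>

lemma dlt_zero_step:
  assumes z: "z |: Z" and x0: "\<And>i. i \<in> J ==> dlt (x i) z = \<zero>\<^bsub>EV\<^esub>" and y: "y |: Z"
  shows "dlt y z = \<zero>\<^bsub>EV\<^esub>"
proof -
  have hom: "(\<lambda>z. rho (beta z)) \<in> ring_hom Z EV"
    using ring_hom_trans[OF beta_hom rho_hom] by (simp add: comp_def)
  have "rho (beta s) \<otimes>\<^bsub>EV\<^esub> dlt y z = (\<Oplus>\<^bsub>EV\<^esub>j\<in>J. rho (beta (w j y)) \<otimes>\<^bsub>EV\<^esub> dlt (x j) z)"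
    by (rule C.chart_rule[OF EV_ring hom dlt_der[OF z] y])
  also have "\<dots> = (\<Oplus>\<^bsub>EV\<^esub>j\<in>J. \<zero>\<^bsub>EV\<^esub>)"
    using y by (intro EV.finsum_cong') (auto simp: x0 rho_closed beta_closed C.w_closed)
  finally have "rho Lo.u \<otimes>\<^bsub>EV\<^esub> (rho (beta s) \<otimes>\<^bsub>EV\<^esub> dlt y z) = \<zero>\<^bsub>EV\<^esub>"
    by (simp add: rho_closed Lo.u_closed)
  moreover have "rho Lo.u \<otimes>\<^bsub>EV\<^esub> (rho (beta s) \<otimes>\<^bsub>EV\<^esub> dlt y z) = rho (Lo.u \<otimes>\<^sub>B beta s) \<otimes>\<^bsub>EV\<^esub> dlt y z"
    using y z sc by (simp add: ring_hom_mult[OF rho_hom] EV.m_assoc rho_closed Lo.u_closed beta_closed dlt_closed)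
  ultimately show ?thesis using y z by (simp add: beta_s_u ring_hom_one[OF rho_hom] dlt_closed)
qed

lemma dlt_zero: assumes y: "y |: Z" and z: "z |: Z" shows "dlt y z = \<zero>\<^bsub>EV\<^esub>"
proof (rule dlt_zero_step[OF z _ y])
  \<comment> \<open>At a pair of coordinates the claim is the commutation relation of the operators.
    One argument is then freed, and the other one by skew-symmetry.\<close>
  have xx: "dlt (x i) (x j) = \<zero>\<^bsub>EV\<^esub>" if ij: "i \<in> J" "j \<in> J" for i j
    using DD_comm[OF ij] EV.comm_cancel[of "DD j \<otimes>\<^bsub>EV\<^esub> DD i" "gg (pb (x i) (x j))"] DD_closed ij C.x_closed
    by (simp add: dlt_def gg_x gg_closed pb_closed) (simp add: gg_def st_def)
  fix i assume i: "i \<in> J"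
  show "dlt (x i) z = \<zero>\<^bsub>EV\<^esub>"
    using dlt_skew[OF C.x_closed[OF i] z] dlt_zero_step[OF C.x_closed[OF i] xx[OF _ i] z] by simp
qed

lemma representation:
  obtains \<Phi> where "\<Phi> \<in> ring_hom E EV" "\<And>a. a |: A ==> \<Phi> (al a) = rho (lo a)"
    "\<And>z. z |: Z ==> \<Phi> (de z) = gg z"
proof (rule E_lift[OF EV_ring, of "\<lambda>a. rho (lo a)" gg])
  have hom: "(\<lambda>z. rho (beta z)) \<in> ring_hom Z EV"
    using ring_hom_trans[OF beta_hom rho_hom] by (simp add: comp_def)
  show "(\<lambda>a. rho (lo a)) \<in> ring_hom A EV"
    using ring_hom_trans[OF Lo.lo_hom rho_hom] by (simp add: comp_def)
  show "additive Z EV gg" by (rule gg_additive)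
  show "gg (c \<odot> y) = rho (lo (iota (kap c))) \<otimes>\<^bsub>EV\<^esub> gg y" if "c |: K" "y |: Z" for c y
    using KS.der_along_scalar[OF EV_ring hom gg_der that] by (simp add: beta_def)
  show "gg (pb y z) = gg y \<otimes>\<^bsub>EV\<^esub> gg z \<ominus>\<^bsub>EV\<^esub> gg z \<otimes>\<^bsub>EV\<^esub> gg y" if "y |: Z" "z |: Z" for y z
    using dlt_zero[OF that] that EV.minus_eq_zero_iff[of "gg y \<otimes>\<^bsub>EV\<^esub> gg z \<ominus>\<^bsub>EV\<^esub> gg z \<otimes>\<^bsub>EV\<^esub> gg y" "gg (pb y z)"]
    by (simp add: dlt_def gg_closed pb_closed)
  show "rho (lo (pa y a)) = gg y \<otimes>\<^bsub>EV\<^esub> rho (lo a) \<ominus>\<^bsub>EV\<^esub> rho (lo a) \<otimes>\<^bsub>EV\<^esub> gg y"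
    if "y |: Z" "a |: A" for y a
    using gg_rho[OF that] that
    by (simp add: EV.add_diff rho_closed Lo.lo_closed pa_closed gg_closed)
  show "gg (y \<otimes> z) = rho (lo (iota y)) \<otimes>\<^bsub>EV\<^esub> gg z \<oplus>\<^bsub>EV\<^esub> rho (lo (iota z)) \<otimes>\<^bsub>EV\<^esub> gg y"
    if "y |: Z" "z |: Z" for y z
    using KS.der_along_D(3)[OF gg_der that] by (simp add: beta_def)
qed (rule that)

end

section \<open>Injectivity of the natural map\<close>

context poisson_order
begin

text \<open>The component of degree \<open>m\<close> of the source: sums of monomials with exactly
  \<open>m\<close> differentials.\<close>

definition hom_part :: "nat => ('a \<times> (('z => 'z) set multiset => 'z) set => 'z) set set"
  where "hom_part m = aspan T {tmon a zs | a zs. a |: A \<and> set zs \<subseteq> carrier Z \<and> length zs = m}"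

lemma hom_gens_closed: "{tmon a zs | a zs. a |: A \<and> set zs \<subseteq> carrier Z \<and> length zs = m} \<subseteq> carrier T"
  using tmon_closed by auto

lemmas hom_part_closed = aspan_closed[OF Tr.is_abelian_group hom_gens_closed, folded hom_part_def]

lemma natural_hom_part:
  assumes \<phi>: "natural \<phi>" and t: "t \<in> hom_part m" shows "\<exists>y\<in>Fil m. \<phi> t = cls m y"
  using t[unfolded hom_part_def]
proof induction
  case zero
  have "\<phi> \<in> ring_hom T GE" using \<phi> by (simp add: natural_iff)
  then have "\<phi> \<zero>\<^sub>T = \<zero>\<^bsub>GE\<^esub>" using Tr.ring_axioms GEr.ring_axioms by (rule ring_hom_zero)
  then show ?case using FE.cls_zero[of m] by (intro bexI[of _ "\<zero>\<^sub>E"] FE.Fil_zero) (simp add: GE_eq)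
next
  case (add t' t)
  then obtain a zs where t': "t' = tmon a zs" "a |: A" "set zs \<subseteq> carrier Z" "length zs = m" by blast
  obtain y where y: "y \<in> Fil m" "\<phi> t = cls m y" using add.IH by blast
  have hom: "\<phi> \<in> ring_hom T GE" using \<phi> by (simp add: natural_iff)
  have tc: "t |: T" using hom_part_closed add(2) by (simp add: hom_part_def)
  have F: "al a \<otimes>\<^sub>E lprod E de zs \<in> Fil m"
    using FE.Fil_mult[OF al_Fil[OF t'(2)] lprod_de_Fil[OF t'(3)]] t'(4) by simp
  have "\<phi> (t' \<oplus>\<^sub>T t) = cls m ((al a \<otimes>\<^sub>E lprod E de zs) \<oplus>\<^sub>E y)"
    using ring_hom_add[OF hom tmon_closed[OF t'(2,3)] tc] natural_tmon[OF \<phi> t'(2,3)] FE.cls_add[OF F y(1)]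
    by (simp add: t' y(2) GE_eq)
  then show ?case using FE.Fil_add[OF F y(1)] by blast
qed

lemma hom_decomposition:
  assumes "t |: T"
  shows "\<exists>S f. finite S \<and> (\<forall>m. f m \<in> hom_part m) \<and> (\<forall>m. m \<notin> S \<longrightarrow> f m = \<zero>\<^sub>T) \<and> t = (\<Oplus>\<^sub>T m\<in>S. f m)"
  using T_span[OF assms]
proof induction
  case zero
  show ?case by (rule exI[of _ "{}"], rule exI[of _ "\<lambda>_. \<zero>\<^sub>T"]) (simp add: hom_part_def aspan.zero)
next
  case (add t' t)
  then obtain a zs where t': "t' = tmon a zs" "a |: A" "set zs \<subseteq> carrier Z" by (auto simp: tmons_def)
  obtain S f where f: "finite S" "\<forall>m. f m \<in> hom_part m" "\<forall>m. m \<notin> S \<longrightarrow> f m = \<zero>\<^sub>T" "t = (\<Oplus>\<^sub>T m\<in>S. f m)"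
    using add.IH by blast
  have fc: "f m |: T" for m using f(2) hom_part_closed by blast
  let ?n = "length zs"
  have t'c: "t' |: T" unfolding t'(1) by (rule tmon_closed[OF t'(2,3)])
  define f' where "f' m = (if ?n = m then t' else \<zero>\<^sub>T) \<oplus>\<^sub>T f m" for m
  have "t' \<in> hom_part ?n" unfolding hom_part_def
    using t' by (intro aspan_base[OF Tr.is_abelian_group hom_gens_closed]) blast
  then have "f' m \<in> hom_part m" for m
    using f(2) aspan_add[OF Tr.is_abelian_group hom_gens_closed] by (auto simp: f'_def hom_part_def aspan.zero)
  moreover have "(\<Oplus>\<^sub>T m\<in>insert ?n S. f' m) = t' \<oplus>\<^sub>T t"
  proof -
    have "(\<Oplus>\<^sub>T m\<in>insert ?n S. f' m) = (\<Oplus>\<^sub>T m\<in>insert ?n S. if ?n = m then t' else \<zero>\<^sub>T) \<oplus>\<^sub>T (\<Oplus>\<^sub>T m\<in>insert ?n S. f m)"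
      unfolding f'_def using fc t'c by (intro Tr.finsum_addf) auto
    also have "(\<Oplus>\<^sub>T m\<in>insert ?n S. if ?n = m then t' else \<zero>\<^sub>T) = t'"
      using f(1) t'c by (intro Tr.finsum_singleton[where f="\<lambda>_. t'"]) auto
    also have "(\<Oplus>\<^sub>T m\<in>insert ?n S. f m) = t"
      using f fc by (cases "?n \<in> S") (auto simp: insert_absorb)
    finally show ?thesis .
  qed
  moreover have "\<forall>m. m \<notin> insert ?n S \<longrightarrow> f' m = \<zero>\<^sub>T" using f(3) by (auto simp: f'_def)
  ultimately show ?case using f(1) by (intro exI[of _ "insert ?n S"] exI[of _ f']) auto
qed

text \<open>Makes the chart rule available in the source of the natural map, where it rewrites
  arbitrary differentials in terms of coordinate differentials.\<close>

lemma theta_der: "KS.der_along T (\<lambda>z. tau (iota z)) theta"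
proof (rule KS.der_alongI)
  show "additive Z T theta" by (rule additiveI[OF theta_closed theta_add])
  have "theta \<one> = theta \<one> \<oplus>\<^sub>T theta \<one>"
    using theta_mult[OF KS.Zc.one_closed KS.Zc.one_closed] theta_closed[OF KS.Zc.one_closed]
    by (simp add: ring_hom_one[OF iota_hom] ring_hom_one[OF tau_hom])
  then have "theta \<one> = \<zero>\<^sub>T" using theta_closed[OF KS.Zc.one_closed] Tr.add.l_cancel_one by fastforce
  then show "theta (kap c) = \<zero>\<^sub>T" if "c |: K" for c
    using theta_scalar[OF that KS.Zc.one_closed] KS.kap_closed[OF that] by (simp add: KS.kap_def tau_closed)
qed (rule theta_mult)

end

section \<open>Leading coefficients, and injectivity up to elements outside of the prime\<close>

context pbw_chart
begin

text \<open>The elements \<open>de (x j)\<close> of \<open>E\<close> do not commute in general, so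
  the monomial of a multiset requires a fixed order of its factors.\<close>

abbreviation "xl \<beta> \<equiv> map x (sorted_list_of_multiset \<beta>)"
definition degree_part :: "nat => nat multiset set" where "degree_part m = {\<beta> \<in> R.mons. size \<beta> = m}"

lemma xl_closed: "\<beta> \<in> R.mons ==> set (xl \<beta>) \<subseteq> carrier Z"
  using C.x_closed by (auto simp: R.mons_def)

lemma xl_length: "length (xl \<beta>) = size \<beta>"
  using size_mset[of "sorted_list_of_multiset \<beta>"] by simp

lemma degree_part_finite: "finite (degree_part m)"
proof (rule finite_subset[of _ "mset ` {js. set js \<subseteq> J \<and> length js = m}"])
  show "degree_part m \<subseteq> mset ` {js. set js \<subseteq> J \<and> length js = m}"
  proof
    fix \<beta> assume "\<beta> \<in> degree_part m"
    then show "\<beta> \<in> mset ` {js. set js \<subseteq> J \<and> length js = m}"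
      using xl_length[of \<beta>] by (auto simp: degree_part_def R.mons_def intro!: image_eqI[of _ _ "sorted_list_of_multiset \<beta>"])
  qed
  show "finite (mset ` {js. set js \<subseteq> J \<and> length js = m})" by (intro finite_imageI finite_lists_length_eq C.chart_fin)
qed

lemma gg_Vlt:
  assumes z: "z |: Z" and v: "v \<in> carrier (R.Vlt m)" shows "gg z v \<in> carrier (R.Vlt (Suc m))"
proof -
  have vc: "v |: R.V" by (rule R.Vlt_sub[OF v])
  have "gg z v = (\<Oplus>\<^bsub>R.V\<^esub>j\<in>J. (rho (pt j z) \<otimes>\<^bsub>EV\<^esub> DD j) v)"
    unfolding gg_def using z
    by (intro additive_finsum[OF EV_eval[OF vc] EV.is_abelian_group R.V.abelian_group_axioms] rho_DD pt_closed)
  also have "\<dots> \<in> carrier (R.Vlt (Suc m))"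
    using vc by (intro R.Vlt_finsum) (auto simp: EV_apply intro!: R.sm_Vlt pt_closed R.D_Vlt v z)
  finally show ?thesis .
qed

lemma coefficients_vanish:
  assumes M: "M \<subseteq> degree_part m" and a: "\<And>\<beta>. \<beta> \<in> M ==> a \<beta> |: A"
    and y: "(\<Oplus>\<^sub>E \<beta>\<in>M. al (a \<beta>) \<otimes>\<^sub>E lprod E de (xl \<beta>)) \<in> FE.prev m" and \<gamma>: "\<gamma> \<in> M"
  shows "lo (a \<gamma>) = \<zero>\<^sub>B"
proof -
  obtain \<Phi> where \<Phi>: "\<Phi> \<in> ring_hom E EV" "\<And>a. a |: A ==> \<Phi> (al a) = rho (lo a)"
    "\<And>z. z |: Z ==> \<Phi> (de z) = gg z" by (rule representation) (rule that)
  let ?e0 = "R.e {#}"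
  have e0: "?e0 |: R.V" "?e0 \<in> carrier (R.Vlt (Suc 0))" by (simp_all add: R.e_closed R.e_Vlt)
  have \<Phi>c: "\<Phi> y |: EV" if "y |: E" for y by (rule ring_hom_closed[OF \<Phi>(1) that])
  have \<Phi>V: "\<Phi> y v |: R.V" if "y |: E" "v |: R.V" for y v
    by (rule additive_closed[OF End_ring_additive[OF \<Phi>c[OF that(1)]] that(2)])
  have gl: "lprod E gval w |: E" if "w \<in> lists X" for w
    using that gval_closed by (intro Er.lprod_closed) auto
  have al_Vlt: "\<Phi> (al a \<otimes>\<^sub>E y) ?e0 = R.sm (lo a) (\<Phi> y ?e0)" if "a |: A" "y |: E" for a y
    using that e0 \<Phi>V by (simp add: ring_hom_mult[OF \<Phi>(1)] \<Phi>(2) EV_apply)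
  have w: "\<Phi> (lprod E gval w) ?e0 \<in> carrier (R.Vlt (Suc (ndelta w)))" if "w \<in> lists X" for w
    using that
  proof (induction w)
    case Nil
    then show ?case using e0 by (simp add: ring_hom_one[OF \<Phi>(1)] EV_apply)
  next
    case (Cons g w)
    then have g: "g \<in> X" and w: "w \<in> lists X" and IH: "\<Phi> (lprod E gval w) ?e0 \<in> carrier (R.Vlt (Suc (ndelta w)))" by auto
    show ?case
    proof (cases g)
      case (Alpha b)
      then have "b |: A" using g by auto
      then show ?thesis using R.sm_Vlt[OF Lo.lo_closed IH] al_Vlt[OF _ gl[OF w]] by (simp add: Alpha gval_def[of "Alpha _"])
    next
      case (Delta z)
      then have z: "z |: Z" using g by auto
      then show ?thesis using gg_Vlt[OF z IH] gl[OF w] e0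
        by (simp add: Delta gval_def[of "Delta _"] ring_hom_mult[OF \<Phi>(1)] \<Phi>(3) EV_apply)
    qed
  qed
  \<comment> \<open>Each letter \<open>Delta\<close> raises the degree by at most one and a letter
    \<open>Alpha\<close> not at all. The index is shifted because the bound in \<open>Vlt\<close> is
    strict.\<close>
  have Fil_V: "\<Phi> y ?e0 \<in> carrier (R.Vlt (Suc i))" if "y \<in> Fil i" for y i
    using that
  proof (induction rule: Fil_induct)
    case zero
    show ?case using ring_hom_zero[OF \<Phi>(1) E_ring EV_ring] e0 by (simp add: EV_apply R.Vlt_zero)
  next
    case (add c w y)
    have kc: "iota (kap c) |: A" using add KS.kap_closed by simp
    have wX: "w \<in> lists X" and yc: "y |: E" using add FE.Fil_carrier by auto
    have "\<Phi> ((al (iota (kap c)) \<otimes>\<^sub>E lprod E gval w) \<oplus>\<^sub>E y) ?e0 =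
        R.sm (lo (iota (kap c))) (\<Phi> (lprod E gval w) ?e0) \<oplus>\<^bsub>R.V\<^esub> \<Phi> y ?e0"
      using kc gl[OF wX] yc e0 by (simp add: ring_hom_add[OF \<Phi>(1)] EV_apply flip: al_Vlt)
    moreover have "\<Phi> (lprod E gval w) ?e0 \<in> carrier (R.Vlt (Suc i))"
      using add(2) by (intro R.Vlt_mono[OF _ w[OF wX]]) auto
    ultimately show ?case using add.IH R.Vlt_add[OF R.sm_Vlt[OF Lo.lo_closed[OF kc]]] by simp
  qed
  \<comment> \<open>Since \<open>gg (x j)\<close> is \<open>DD j\<close>, a product of coordinate
    letters applied to the constant polynomial 1 has the expected monomial as leading term, whatever
    the order of the letters.\<close>
  have top: "\<exists>u\<in>carrier (R.Vlt (length js)). \<Phi> (lprod E de (map x js)) ?e0 = R.e (mset js) \<oplus>\<^bsub>R.V\<^esub> u"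
    if "set js \<subseteq> J" for js
    using that
  proof (induction js)
    case Nil
    show ?case using e0 R.Vlt_zero by (auto simp: ring_hom_one[OF \<Phi>(1)] EV_apply intro!: bexI[of _ "\<zero>\<^bsub>R.V\<^esub>"])
  next
    case (Cons j js)
    then have j: "j \<in> J" and js: "mset js \<in> R.mons" by (auto simp: R.mons_def)
    obtain u where u: "u \<in> carrier (R.Vlt (length js))" "\<Phi> (lprod E de (map x js)) ?e0 = R.e (mset js) \<oplus>\<^bsub>R.V\<^esub> u"
      using Cons by auto
    obtain u' where u': "u' \<in> carrier (R.Vlt (Suc (size (mset js))))" "R.D j (R.e (mset js)) = R.e (add_mset j (mset js)) \<oplus>\<^bsub>R.V\<^esub> u'"
      by (rule R.D_e_top[OF j js])
    have ec: "R.e (mset js) |: R.V" "R.e (add_mset j (mset js)) |: R.V" using j js by (simp_all add: R.e_closed)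
    have uc: "u |: R.V" "u' |: R.V" using u(1) u'(1) R.Vlt_sub by auto
    have lc: "lprod E de (map x js) |: E" using Cons(2) C.x_closed by (intro Er.lprod_closed) auto
    have "\<Phi> (lprod E de (map x (j # js))) ?e0 = R.D j (R.e (mset js) \<oplus>\<^bsub>R.V\<^esub> u)"
      using j lc e0 \<Phi>V[OF lc e0(1)] u(2) C.x_closed[OF j] by (simp add: ring_hom_mult[OF \<Phi>(1)] \<Phi>(3) gg_x EV_apply)
    also have "\<dots> = R.e (add_mset j (mset js)) \<oplus>\<^bsub>R.V\<^esub> (u' \<oplus>\<^bsub>R.V\<^esub> R.D j u)"
      using j ec uc u'(2) by (simp add: R.D_add R.V.a_assoc R.D_closed)
    finally show ?case using R.Vlt_add[OF u'(1)] R.D_Vlt[OF j u(1)] by auto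
  qed
  \<comment> \<open>Reading off the coefficient at \<gamma> is additive, so the given sum can be
    examined summand by summand.\<close>
  have ev: "additive E B (\<lambda>y. \<Phi> y ?e0 \<gamma>)"
    by (rule additive_comp[OF additive_comp[OF ring_hom_additive[OF \<Phi>(1)] EV_eval[OF e0(1)]]])
      (auto intro!: additiveI simp: R.V_apply R.V_add_apply)
  have size: "size \<beta> = m" "\<beta> \<in> R.mons" if "\<beta> \<in> M" for \<beta> using M that by (auto simp: degree_part_def)
  have finM: "finite M" by (rule finite_subset[OF M degree_part_finite])
  let ?y = "\<Oplus>\<^sub>E \<beta>\<in>M. al (a \<beta>) \<otimes>\<^sub>E lprod E de (xl \<beta>)"
  have lc: "lprod E de (xl \<beta>) |: E" if "\<beta> \<in> M" for \<beta>
    using xl_closed[OF size(2)[OF that]] by (intro Er.lprod_closed) auto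
  \<comment> \<open>The previous piece maps into polynomials of degree less than \<open>m\<close>,
    which have no coefficient at \<gamma>. For \<open>m = 0\<close> it consists of zero
    only.\<close>
  have "\<zero>\<^sub>B = \<Phi> ?y ?e0 \<gamma>"
  proof (cases m)
    case 0
    then have "?y = \<zero>\<^sub>E" using y by (simp add: fil_prev_def)
    then show ?thesis using additive_zero[OF ev Er.is_abelian_group Lo.L.is_abelian_group] by simp
  next
    case (Suc i)
    then have "\<Phi> ?y ?e0 \<in> carrier (R.Vlt m)" using y Fil_V by (simp add: fil_prev_Suc)
    then show ?thesis using R.Vlt_apply[of _ m \<gamma>] size[OF \<gamma>] by simp
  qed
  also have "\<dots> = (\<Oplus>\<^sub>B \<beta>\<in>M. \<Phi> (al (a \<beta>) \<otimes>\<^sub>E lprod E de (xl \<beta>)) ?e0 \<gamma>)"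
    using a lc by (intro additive_finsum[OF ev Er.is_abelian_group Lo.L.is_abelian_group]) auto
  also have "\<dots> = (\<Oplus>\<^sub>B \<beta>\<in>M. if \<gamma> = \<beta> then lo (a \<beta>) else \<zero>\<^sub>B)"
  proof (intro Lo.L.finsum_cong')
    fix \<beta> assume \<beta>: "\<beta> \<in> M"
    obtain u where u: "u \<in> carrier (R.Vlt (length (sorted_list_of_multiset \<beta>)))"
      "\<Phi> (lprod E de (xl \<beta>)) ?e0 = R.e (mset (sorted_list_of_multiset \<beta>)) \<oplus>\<^bsub>R.V\<^esub> u"
      using top[of "sorted_list_of_multiset \<beta>"] size(2)[OF \<beta>] by (auto simp: R.mons_def)
    have "u \<gamma> = \<zero>\<^sub>B" using R.Vlt_apply[OF u(1)] xl_length[of \<beta>] size[OF \<gamma>] size[OF \<beta>] by simp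
    moreover have "\<Phi> (al (a \<beta>) \<otimes>\<^sub>E lprod E de (xl \<beta>)) ?e0 = R.sm (lo (a \<beta>)) (R.e \<beta> \<oplus>\<^bsub>R.V\<^esub> u)"
      unfolding al_Vlt[OF a[OF \<beta>] lc[OF \<beta>]] u(2) by simp
    ultimately show "\<Phi> (al (a \<beta>) \<otimes>\<^sub>E lprod E de (xl \<beta>)) ?e0 \<gamma> = (if \<gamma> = \<beta> then lo (a \<beta>) else \<zero>\<^sub>B)"
      using a[OF \<beta>] lc[OF \<beta>] Lo.lo_closed[OF a[OF \<beta>]]
      by (simp add: R.sm_def R.V_add_apply R.e_def mterm_def)
  qed (use a Lo.lo_closed in auto)
  also have "\<dots> = lo (a \<gamma>)" using \<gamma> finM a Lo.lo_closed by (intro Lo.L.finsum_singleton) auto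
  finally show ?thesis ..
qed

definition chart_gens :: "nat => ('a \<times> (('z => 'z) set multiset => 'z) set => 'z) set set"
  where "chart_gens m = {tmon a (xl \<beta>) | a \<beta>. a |: A \<and> \<beta> \<in> degree_part m}"

lemma chart_gens_closed: "chart_gens m \<subseteq> carrier T"
  using tmon_closed xl_closed by (auto simp: chart_gens_def degree_part_def)

lemmas chart_aspan = Tr.is_abelian_group chart_gens_closed

lemma tau_iota_hom: "(\<lambda>z. tau (iota z)) \<in> ring_hom Z T"
  using ring_hom_trans[OF iota_hom tau_hom] by (simp add: comp_def)

lemmas ti_closed = ring_hom_closed[OF tau_iota_hom]

text \<open>The elements \<open>theta\<close> commute, so a new factor can be moved to the position
  that sorting prescribes.\<close>

lemma lprod_theta_insort:
  assumes j: "j \<in> J" and "set js \<subseteq> J"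
  shows "lprod T theta (map x (insort j js)) = theta (x j) \<otimes>\<^sub>T lprod T theta (map x js)"
  using assms(2)
proof (induction js)
  case (Cons i js)
  then have i: "i \<in> J" "set js \<subseteq> J" by auto
  have "lprod T theta (map x js) |: T" using i C.x_closed by (intro lprod_theta_closed) auto
  then show ?case using Cons theta_closed[OF C.x_closed[OF j]] theta_closed[OF C.x_closed[OF i(1)]]
      theta_comm[OF C.x_closed[OF i(1)] C.x_closed[OF j]]
    by (auto simp flip: Tr.m_assoc)
qed simp

lemma chart_gens_mult:
  assumes j: "j \<in> J" and b: "b |: A" and t: "t \<in> aspan T (chart_gens m)"
  shows "tau b \<otimes>\<^sub>T (theta (x j) \<otimes>\<^sub>T t) \<in> aspan T (chart_gens (Suc m))"
proof (rule aspan_additive_image[where h="\<lambda>t. tau b \<otimes>\<^sub>T (theta (x j) \<otimes>\<^sub>T t)",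
    OF additive_comp[OF Tr.additive_l_mult Tr.additive_l_mult] Tr.is_abelian_group chart_aspan(1) chart_gens_closed chart_gens_closed _ t])
  show "theta (x j) |: T" "tau b |: T" using j b C.x_closed theta_closed tau_closed by auto
  fix y assume "y \<in> chart_gens m"
  then obtain a \<beta> where y: "y = tmon a (xl \<beta>)" "a |: A" "\<beta> \<in> degree_part m" by (auto simp: chart_gens_def)
  have \<beta>: "\<beta> \<in> R.mons" "set (sorted_list_of_multiset \<beta>) \<subseteq> J" using y(3) by (auto simp: degree_part_def R.mons_def)
  note cl = theta_closed[OF C.x_closed[OF j]] tau_closed[OF b] tau_closed[OF y(2)] lprod_theta_closed[OF xl_closed[OF \<beta>(1)]]
  have "tau b \<otimes>\<^sub>T (theta (x j) \<otimes>\<^sub>T y) = tau b \<otimes>\<^sub>T ((theta (x j) \<otimes>\<^sub>T tau a) \<otimes>\<^sub>T lprod T theta (xl \<beta>))"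
    using cl by (simp add: y(1) tmon_def Tr.m_assoc)
  also have "\<dots> = (tau b \<otimes>\<^sub>T tau a) \<otimes>\<^sub>T (theta (x j) \<otimes>\<^sub>T lprod T theta (xl \<beta>))"
    unfolding theta_tau[OF y(2) C.x_closed[OF j], symmetric] using cl by (simp add: Tr.m_assoc)
  also have "\<dots> = tmon (b \<otimes>\<^sub>A a) (xl (add_mset j \<beta>))"
    using b y(2) by (simp add: tmon_def ring_hom_mult[OF tau_hom] lprod_theta_insort[OF j \<beta>(2)])
  finally have eq: "tau b \<otimes>\<^sub>T (theta (x j) \<otimes>\<^sub>T y) = tmon (b \<otimes>\<^sub>A a) (xl (add_mset j \<beta>))" .
  have "add_mset j \<beta> \<in> degree_part (Suc m)" "b \<otimes>\<^sub>A a |: A"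
    using b y(2,3) j by (simp_all add: degree_part_def)
  then have "tau b \<otimes>\<^sub>T (theta (x j) \<otimes>\<^sub>T y) \<in> chart_gens (Suc m)"
    unfolding chart_gens_def eq by blast
  then show "tau b \<otimes>\<^sub>T (theta (x j) \<otimes>\<^sub>T y) \<in> aspan T (chart_gens (Suc m))" by (rule aspan_base[OF chart_aspan])
qed

text \<open>Rewriting one differential in coordinates costs one factor \<open>s\<close>, which
  explains the exponent.\<close>

lemma chart_span:
  assumes a: "a |: A" and zs: "set zs \<subseteq> carrier Z"
  shows "tau (iota (s [^] length zs)) \<otimes>\<^sub>T tmon a zs \<in> aspan T (chart_gens (length zs))"
  using zs
proof (induction zs)
  case Nil
  have "tmon a (xl {#}) \<in> chart_gens 0" using a by (force simp: chart_gens_def degree_part_def)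
  from aspan_base[OF chart_aspan this] show ?case
    using tmon_closed[OF a, of "[]"] by (simp add: ring_hom_one[OF iota_hom] ring_hom_one[OF tau_hom])
next
  case (Cons z zs)
  then have z: "z |: Z" and zs: "set zs \<subseteq> carrier Z" by auto
  let ?m = "length zs" and ?t = "tau (iota (s [^] length zs)) \<otimes>\<^sub>T tmon a zs"
  have sm: "s [^] ?m |: Z" using sc by simp
  note cl = theta_closed[OF z] tau_closed[OF a] ti_closed[OF sc] ti_closed[OF sm] tmon_closed[OF a zs] lprod_theta_closed[OF zs]
  have t: "?t \<in> aspan T (chart_gens ?m)" "?t |: T" using Cons cl by auto
  have "tmon a (z # zs) = theta z \<otimes>\<^sub>T tmon a zs"
    using cl theta_tau[OF a z] by (simp add: tmon_def flip: Tr.m_assoc)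
  then have "tau (iota (s [^] Suc ?m)) \<otimes>\<^sub>T tmon a (z # zs) =
      (tau (iota (s [^] ?m)) \<otimes>\<^sub>T tau (iota s)) \<otimes>\<^sub>T (theta z \<otimes>\<^sub>T tmon a zs)"
    using ring_hom_mult[OF tau_iota_hom sm sc] by simp
  also have "tau (iota (s [^] ?m)) \<otimes>\<^sub>T tau (iota s) = tau (iota s) \<otimes>\<^sub>T tau (iota (s [^] ?m))"
    using ring_hom_mult[OF tau_iota_hom sm sc] ring_hom_mult[OF tau_iota_hom sc sm] KS.Zc.m_comm[OF sc sm] by simp
  also have "(tau (iota s) \<otimes>\<^sub>T tau (iota (s [^] ?m))) \<otimes>\<^sub>T (theta z \<otimes>\<^sub>T tmon a zs) =
      tau (iota s) \<otimes>\<^sub>T ((tau (iota (s [^] ?m)) \<otimes>\<^sub>T theta z) \<otimes>\<^sub>T tmon a zs)"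
    using cl by (simp add: Tr.m_assoc)
  also have "\<dots> = (tau (iota s) \<otimes>\<^sub>T theta z) \<otimes>\<^sub>T ?t"
    unfolding theta_tau[OF iota_closed[OF sm] z] using cl by (simp add: Tr.m_assoc)
  \<comment> \<open>One factor \<open>s\<close> has been brought next to the differential of
    \<open>z\<close>, where the chart rule replaces both by coordinate differentials.\<close>
  also have "tau (iota s) \<otimes>\<^sub>T theta z = (\<Oplus>\<^sub>T j\<in>J. tau (iota (w j z)) \<otimes>\<^sub>T theta (x j))"
    by (rule C.chart_rule[OF Tr.ring_axioms tau_iota_hom theta_der z])
  also have "\<dots> \<otimes>\<^sub>T ?t = (\<Oplus>\<^sub>T j\<in>J. (tau (iota (w j z)) \<otimes>\<^sub>T theta (x j)) \<otimes>\<^sub>T ?t)"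
    using t(2) z C.chart_fin by (intro Tr.finsum_ldistr) (auto simp: ti_closed C.w_closed theta_closed C.x_closed)
  also have "\<dots> \<in> aspan T (chart_gens (Suc ?m))"
  proof (rule aspan_finsum[OF chart_aspan])
    fix j assume j: "j \<in> J"
    have "tau (iota (w j z)) \<otimes>\<^sub>T (theta (x j) \<otimes>\<^sub>T ?t) \<in> aspan T (chart_gens (Suc ?m))"
      by (rule chart_gens_mult[OF j iota_closed[OF C.w_closed[OF j z]] t(1)])
    then show "(tau (iota (w j z)) \<otimes>\<^sub>T theta (x j)) \<otimes>\<^sub>T ?t \<in> aspan T (chart_gens (Suc ?m))"
      using Tr.m_assoc[OF ti_closed[OF C.w_closed[OF j z]] theta_closed[OF C.x_closed[OF j]] t(2)] by simp
  qed
  finally show ?case by simp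
qed

text \<open>Like terms are collected, so that each monomial occurs with a single coefficient in
  \<open>A\<close>; only then can the coefficients be recovered from the image.\<close>

lemma chart_gens_collect:
  assumes "t \<in> aspan T (chart_gens m)"
  shows "\<exists>a. (\<forall>\<beta>\<in>degree_part m. a \<beta> |: A) \<and> t = (\<Oplus>\<^sub>T \<beta>\<in>degree_part m. tmon (a \<beta>) (xl \<beta>))"
  using assms
proof induction
  case zero
  have "tmon \<zero>\<^sub>A (xl \<beta>) = \<zero>\<^sub>T" if "\<beta> \<in> degree_part m" for \<beta>
    using that xl_closed ring_hom_zero[OF tau_hom Aa.ring_axioms Tr.ring_axioms]
    by (simp add: tmon_def lprod_theta_closed degree_part_def)
  then have "(\<Oplus>\<^sub>T \<beta>\<in>degree_part m. tmon \<zero>\<^sub>A (xl \<beta>)) = (\<Oplus>\<^sub>T \<beta>\<in>degree_part m. \<zero>\<^sub>T)"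
    by (intro Tr.finsum_cong') auto
  then show ?case by (intro exI[of _ "\<lambda>_. \<zero>\<^sub>A"]) simp
next
  case (add t' t)
  then obtain b \<gamma> where t': "t' = tmon b (xl \<gamma>)" "b |: A" "\<gamma> \<in> degree_part m" by (auto simp: chart_gens_def)
  obtain a where a: "\<And>\<beta>. \<beta> \<in> degree_part m ==> a \<beta> |: A" "t = (\<Oplus>\<^sub>T \<beta>\<in>degree_part m. tmon (a \<beta>) (xl \<beta>))"
    using add.IH by blast
  let ?a = "\<lambda>\<beta>. (if \<gamma> = \<beta> then b else \<zero>\<^sub>A) \<oplus>\<^sub>A a \<beta>"
  have xc: "set (xl \<beta>) \<subseteq> carrier Z" if "\<beta> \<in> degree_part m" for \<beta> using that xl_closed by (auto simp: degree_part_def)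
  have "(\<Oplus>\<^sub>T \<beta>\<in>degree_part m. tmon (?a \<beta>) (xl \<beta>)) =
      (\<Oplus>\<^sub>T \<beta>\<in>degree_part m. (if \<gamma> = \<beta> then tmon b (xl \<beta>) else \<zero>\<^sub>T) \<oplus>\<^sub>T tmon (a \<beta>) (xl \<beta>))"
    using a(1) t'(2) tmon_closed[OF _ xc] lprod_theta_closed[OF xc] by (intro Tr.finsum_cong')
      (auto simp: tmon_def ring_hom_add[OF tau_hom] Tr.l_distr tau_closed ring_hom_zero[OF tau_hom Aa.ring_axioms Tr.ring_axioms])
  also have "\<dots> = (\<Oplus>\<^sub>T \<beta>\<in>degree_part m. if \<gamma> = \<beta> then tmon b (xl \<beta>) else \<zero>\<^sub>T) \<oplus>\<^sub>T t"
    unfolding a(2) using a(1) t'(2) tmon_closed[OF _ xc] by (intro Tr.finsum_addf) auto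
  also have "(\<Oplus>\<^sub>T \<beta>\<in>degree_part m. if \<gamma> = \<beta> then tmon b (xl \<beta>) else \<zero>\<^sub>T) = t'"
    unfolding t'(1) using t' tmon_closed[OF _ xc] degree_part_finite by (intro Tr.finsum_singleton) auto
  finally show ?case using a(1) t'(2) by (intro exI[of _ ?a]) auto
qed

text \<open>Each coefficient has its own annihilator outside of \<open>\<pp>\<close>; the product of
  finitely many of these stays outside since \<open>\<pp>\<close> is prime.\<close>

lemma common_annihilator:
  assumes M: "finite M" and a: "\<And>\<beta>. \<beta> \<in> M ==> a \<beta> |: A" and z: "\<And>\<beta>. \<beta> \<in> M ==> lo (a \<beta>) = \<zero>\<^sub>B"
  shows "\<exists>r\<in>carrier Z - \<pp>. \<forall>\<beta>\<in>M. iota r \<otimes>\<^sub>A a \<beta> = \<zero>\<^sub>A"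
  using M a z
proof (induction M)
  case empty
  then show ?case using prime_compl(1) by blast
next
  case (insert \<gamma> M)
  obtain r where r: "r \<in> carrier Z - \<pp>" "\<forall>\<beta>\<in>M. iota r \<otimes>\<^sub>A a \<beta> = \<zero>\<^sub>A" using insert by auto
  obtain q where q: "q \<in> carrier Z - \<pp>" "iota q \<otimes>\<^sub>A a \<gamma> = \<zero>\<^sub>A"
    using Lo.lo_zero[of "a \<gamma>"] insert by auto
  have "iota (r \<otimes> q) \<otimes>\<^sub>A a \<beta> = \<zero>\<^sub>A" if \<beta>: "\<beta> \<in> insert \<gamma> M" for \<beta>
  proof -
    have c: "a \<beta> |: A" "iota r |: A" "iota q |: A" using insert \<beta> r q by auto
    have 1: "iota (r \<otimes> q) \<otimes>\<^sub>A a \<beta> = iota r \<otimes>\<^sub>A (iota q \<otimes>\<^sub>A a \<beta>)"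
      using r q c by (simp add: ring_hom_mult[OF iota_hom] Aa.m_assoc)
    have 2: "iota (r \<otimes> q) \<otimes>\<^sub>A a \<beta> = iota q \<otimes>\<^sub>A (iota r \<otimes>\<^sub>A a \<beta>)"
      using r q c KS.Zc.m_comm[of r q] by (simp add: ring_hom_mult[OF iota_hom] Aa.m_assoc)
    show ?thesis
    proof (cases "\<beta> = \<gamma>")
      case True
      then show ?thesis unfolding 1 using q(2) c by simp
    next
      case False
      then show ?thesis unfolding 2 using \<beta> r(2) c by simp
    qed
  qed
  then show ?case using prime_compl(2)[OF r(1) q(1)] by blast
qed

lemma local_injectivity:
  assumes \<phi>: "natural \<phi>" and t: "t \<in> hom_part m" and zero: "\<phi> t = \<zero>\<^bsub>GE\<^esub>"
  shows "\<exists>r\<in>carrier Z - \<pp>. tau (iota r) \<otimes>\<^sub>T t = \<zero>\<^sub>T"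
proof -
  have hom: "\<phi> \<in> ring_hom T GE" using \<phi> by (simp add: natural_iff)
  have tc: "t |: T" by (rule hom_part_closed[OF t])
  have sm: "s [^] m |: Z" "s [^] m \<in> carrier Z - \<pp>"
  proof -
    show "s [^] m \<in> carrier Z - \<pp>" by (induction m) (use prime_compl C.s_carr in auto)
  qed (use sc in simp)
  let ?t = "tau (iota (s [^] m)) \<otimes>\<^sub>T t"
  have "?t \<in> aspan T (chart_gens m)"
    by (rule aspan_additive_image[OF Tr.additive_l_mult[OF ti_closed[OF sm(1)]] Tr.is_abelian_group Tr.is_abelian_group
        hom_gens_closed chart_gens_closed _ t[unfolded hom_part_def]]) (use chart_span in auto)
  then obtain a where a: "\<And>\<beta>. \<beta> \<in> degree_part m ==> a \<beta> |: A"
    and ta: "?t = (\<Oplus>\<^sub>T \<beta>\<in>degree_part m. tmon (a \<beta>) (xl \<beta>))" using chart_gens_collect by blast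
  let ?y = "\<lambda>\<beta>. al (a \<beta>) \<otimes>\<^sub>E lprod E de (xl \<beta>)"
  have xc: "set (xl \<beta>) \<subseteq> carrier Z" "length (xl \<beta>) = m" if "\<beta> \<in> degree_part m" for \<beta>
    using that xl_closed xl_length by (auto simp: degree_part_def)
  have yF: "?y \<beta> \<in> Fil m" if "\<beta> \<in> degree_part m" for \<beta>
    using FE.Fil_mult[OF al_Fil[OF a[OF that]] lprod_de_Fil[OF xc(1)[OF that]]] xc(2)[OF that] by simp
  have "\<zero>\<^bsub>GE\<^esub> = \<phi> ?t"
    using ring_hom_mult[OF hom ti_closed[OF sm(1)] tc] zero ring_hom_closed[OF hom ti_closed[OF sm(1)]] by simp
  also have "\<dots> = (\<Oplus>\<^bsub>GE\<^esub>\<beta>\<in>degree_part m. \<phi> (tmon (a \<beta>) (xl \<beta>)))"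
    unfolding ta using a xc by (intro additive_finsum[OF ring_hom_additive[OF hom] Tr.is_abelian_group GEr.is_abelian_group] tmon_closed)
  also have "\<dots> = (\<Oplus>\<^bsub>GE\<^esub>\<beta>\<in>degree_part m. cls m (?y \<beta>))"
    using natural_tmon[OF \<phi> a xc(1)] xc(2) FE.cls_closed[OF yF] by (intro GEr.finsum_cong') (auto simp: GE_eq)
  also have "\<dots> = cls m (\<Oplus>\<^sub>E \<beta>\<in>degree_part m. ?y \<beta>)"
    unfolding GE_eq by (rule FE.cls_finsum[OF yF])
  finally have "cls m (\<Oplus>\<^sub>E \<beta>\<in>degree_part m. ?y \<beta>) = \<zero>\<^bsub>FE.G\<^esub>" by (simp add: GE_eq)
  moreover have "(\<Oplus>\<^sub>E \<beta>\<in>degree_part m. ?y \<beta>) \<in> Fil m" by (rule FE.Fil_finsum[OF yF])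
  ultimately have y: "(\<Oplus>\<^sub>E \<beta>\<in>degree_part m. ?y \<beta>) \<in> FE.prev m" by (rule iffD1[OF FE.cls_zero_iff, rotated])
  have van: "lo (a \<beta>) = \<zero>\<^sub>B" if "\<beta> \<in> degree_part m" for \<beta>
    by (rule coefficients_vanish[where M = "degree_part m" and m = m and a = a, OF subset_refl a y that])
  \<comment> \<open>All coefficients vanish in \<open>B\<close>, so one factor outside of
    \<open>\<pp>\<close> kills them simultaneously in \<open>A\<close>.\<close>
  have "\<exists>r\<in>carrier Z - \<pp>. \<forall>\<beta>\<in>degree_part m. iota r \<otimes>\<^sub>A a \<beta> = \<zero>\<^sub>A"
    by (rule common_annihilator[where M = "degree_part m" and a = a, OF degree_part_finite a van])
  then obtain r where r: "r \<in> carrier Z - \<pp>" and "\<forall>\<beta>\<in>degree_part m. iota r \<otimes>\<^sub>A a \<beta> = \<zero>\<^sub>A" by (rule bexE)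
  then have ra: "iota r \<otimes>\<^sub>A a \<beta> = \<zero>\<^sub>A" if "\<beta> \<in> degree_part m" for \<beta> using that by simp
  have rc: "r |: Z" using r by simp
  have "tau (iota r) \<otimes>\<^sub>T ?t = (\<Oplus>\<^sub>T \<beta>\<in>degree_part m. tau (iota r) \<otimes>\<^sub>T tmon (a \<beta>) (xl \<beta>))"
    unfolding ta using a xc ti_closed[OF rc] tmon_closed degree_part_finite by (intro Tr.finsum_rdistr) auto
  also have "\<dots> = (\<Oplus>\<^sub>T \<beta>\<in>degree_part m. \<zero>\<^sub>T)"
  proof (intro Tr.finsum_cong')
    fix \<beta> assume \<beta>: "\<beta> \<in> degree_part m"
    note c = ti_closed[OF rc] tau_closed[OF a[OF \<beta>]] lprod_theta_closed[OF xc(1)[OF \<beta>]]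
    have "tau (iota r) \<otimes>\<^sub>T tmon (a \<beta>) (xl \<beta>) = (tau (iota r) \<otimes>\<^sub>T tau (a \<beta>)) \<otimes>\<^sub>T lprod T theta (xl \<beta>)"
      using c by (simp add: tmon_def Tr.m_assoc)
    also have "tau (iota r) \<otimes>\<^sub>T tau (a \<beta>) = \<zero>\<^sub>T"
      using ring_hom_mult[OF tau_hom iota_closed[OF rc] a[OF \<beta>]] ra[OF \<beta>] ring_hom_zero[OF tau_hom Aa.ring_axioms Tr.ring_axioms] by simp
    finally show "tau (iota r) \<otimes>\<^sub>T tmon (a \<beta>) (xl \<beta>) = \<zero>\<^sub>T" using c by simp
  qed auto
  finally have "tau (iota r) \<otimes>\<^sub>T ?t = \<zero>\<^sub>T" by simp
  then have "tau (iota (r \<otimes> s [^] m)) \<otimes>\<^sub>T t = \<zero>\<^sub>T"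
    using ring_hom_mult[OF tau_iota_hom rc sm(1)] ti_closed[OF rc] ti_closed[OF sm(1)] tc by (simp add: Tr.m_assoc)
  then show ?thesis by (rule bexI[OF _ prime_compl(2)[OF r sm(2)]])
qed

end

text \<open>Zorn's lemma for the ideals above \<open>I\<close> that avoid 1, a condition that passes
  to unions of chains; a maximal such ideal is a maximal ideal.\<close>

lemma (in cring) exists_prime_above:
  assumes I: "ideal I R" and proper: "\<one> \<notin> I" shows "\<exists>P. primeideal P R \<and> I \<subseteq> P"
proof -
  let ?A = "{P. ideal P R \<and> I \<subseteq> P \<and> \<one> \<notin> P}"
  have chain: "\<exists>U\<in>?A. \<forall>X\<in>C. X \<subseteq> U" if C: "subset.chain ?A C" for C
  proof (cases "C = {}")
    case True
    then show ?thesis using I proper by auto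
  next
    case False
    have CA: "X \<in> ?A" if "X \<in> C" for X using C that by (auto simp: subset.chain_def)
    have tot: "X \<subseteq> Y \<or> Y \<subseteq> X" if "X \<in> C" "Y \<in> C" for X Y using C that by (auto simp: subset.chain_def)
    have "ideal (\<Union>C) R"
    proof (rule idealI[OF ring_axioms])
      show "subgroup (\<Union>C) (add_monoid R)"
      proof (rule add.subgroupI)
        show "\<Union>C \<subseteq> carrier R" using CA ideal.Icarr by fastforce
        obtain X where X: "X \<in> C" using False by blast
        then have "\<zero> \<in> X" using CA[OF X] additive_subgroup.zero_closed[OF ideal.axioms(1), of X R] by simp
        then show "\<Union>C \<noteq> {}" using X by blast
        show "\<ominus> a \<in> \<Union>C" if a: "a \<in> \<Union>C" for a
        proof -
          obtain X where X: "X \<in> C" "a \<in> X" using a by blast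
          then have "\<ominus> a \<in> X" using CA[OF X(1)] additive_subgroup.a_inv_closed[OF ideal.axioms(1), of X R a] by simp
          then show ?thesis using X by blast
        qed
        fix a b assume "a \<in> \<Union>C" "b \<in> \<Union>C"
        then obtain X Y where XY: "X \<in> C" "Y \<in> C" "a \<in> X" "b \<in> Y" by blast
        have s: "a \<oplus> b \<in> X" if "X \<in> C" "a \<in> X" "b \<in> X" for X
          using CA[OF that(1)] that additive_subgroup.a_closed[OF ideal.axioms(1), of X R a b] by simp
        show "a \<oplus> b \<in> \<Union>C" using tot[OF XY(1,2)] s[OF XY(1)] s[OF XY(2)] XY by blast
      qed
      have m: "r \<otimes> a \<in> \<Union>C" "a \<otimes> r \<in> \<Union>C" if a: "a \<in> \<Union>C" and r: "r |: R" for a r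
      proof -
        obtain X where X: "X \<in> C" "a \<in> X" using a by blast
        then have "r \<otimes> a \<in> X" "a \<otimes> r \<in> X"
          using CA[OF X(1)] r ideal.I_l_closed[of X R a r] ideal.I_r_closed[of X R a r] by simp_all
        then show "r \<otimes> a \<in> \<Union>C" "a \<otimes> r \<in> \<Union>C" using X by blast+
      qed
      show "r \<otimes> a \<in> \<Union>C" if "a \<in> \<Union>C" "r |: R" for a r by (rule m(1)[OF that])
      show "a \<otimes> r \<in> \<Union>C" if "a \<in> \<Union>C" "r |: R" for a r by (rule m(2)[OF that])
    qed
    moreover have "I \<subseteq> \<Union>C" "\<one> \<notin> \<Union>C" using CA False by auto
    ultimately show ?thesis by (intro bexI[of _ "\<Union>C"]) auto
  qed
  have "\<exists>M\<in>?A. \<forall>X\<in>?A. M \<subseteq> X \<longrightarrow> X = M" by (rule subset_Zorn[OF chain])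
  then obtain M where M: "ideal M R" "I \<subseteq> M" "\<one> \<notin> M" and mx: "\<And>X. ideal X R ==> I \<subseteq> X ==> \<one> \<notin> X ==> M \<subseteq> X ==> X = M" by auto
  have "maximalideal M R"
  proof (rule maximalidealI[OF M(1)])
    show "carrier R \<noteq> M" using M(3) by auto
    fix X assume X: "ideal X R" "M \<subseteq> X" "X \<subseteq> carrier R"
    show "X = M \<or> X = carrier R"
    proof (cases "\<one> \<in> X")
      case True
      then show ?thesis using ideal.one_imp_carrier[OF X(1)] by simp
    next
      case False
      then show ?thesis using mx[OF X(1) _ _ X(2)] X M by auto
    qed
  qed
  then show ?thesis using maximalideal_prime M(2) by blast
qed

section \<open>From local to global injectivity\<close>

context poisson_order
begin

lemma natural_inj_hom_part:
  assumes reg: "regular_algebra K Z" and \<phi>: "natural \<phi>" and t: "t \<in> hom_part m" and zero: "\<phi> t = \<zero>\<^bsub>GE\<^esub>"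
  shows "t = \<zero>\<^sub>T"
proof (rule ccontr)
  assume nz: "t \<noteq> \<zero>\<^sub>T"
  have tc: "t |: T" by (rule hom_part_closed[OF t])
  have hom: "(\<lambda>z. tau (iota z)) \<in> ring_hom Z T"
    using ring_hom_trans[OF iota_hom tau_hom] by (simp add: comp_def)
  note ti = ring_hom_closed[OF hom]
  define I where "I = {r \<in> carrier Z. tau (iota r) \<otimes>\<^sub>T t = \<zero>\<^sub>T}"
  have mult: "tau (iota (a \<otimes> r)) \<otimes>\<^sub>T t = \<zero>\<^sub>T" if "a |: Z" "r \<in> I" for a r
    using that ring_hom_mult[OF hom, of a r] ti tc by (simp add: I_def Tr.m_assoc)
  have "ideal I Z"
  proof (rule idealI[OF KS.Zc.ring_axioms])
    show "subgroup I (add_monoid Z)"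
    proof (rule KS.Zc.add.subgroupI)
      have "\<zero> \<in> I" using ring_hom_zero[OF hom KS.Zc.ring_axioms Tr.ring_axioms] tc by (simp add: I_def)
      then show "I \<noteq> {}" by blast
      show "\<ominus> a \<in> I" if "a \<in> I" for a
        using mult[OF _ that, of "\<ominus> \<one>"] that by (simp add: I_def KS.Zc.l_minus)
      show "a \<oplus> b \<in> I" if "a \<in> I" "b \<in> I" for a b
        using that ring_hom_add[OF hom, of a b] ti tc by (simp add: I_def Tr.l_distr)
    qed (auto simp: I_def)
    show "a \<otimes> r \<in> I" if "r \<in> I" "a |: Z" for r a using mult that by (simp add: I_def)
    then show "r \<otimes> a \<in> I" if "r \<in> I" "a |: Z" for r a using that KS.Zc.m_comm[of r a] by (simp add: I_def)
  qed
  moreover have "\<one> \<notin> I" using nz tc ring_hom_one[OF hom] by (simp add: I_def)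
  ultimately obtain \<pp> where \<pp>: "primeideal \<pp> Z" "I \<subseteq> \<pp>" using KS.Zc.exists_prime_above by blast
  obtain J x s w where "smooth_chart K Z \<pp> J x s w" using KS.regular_chart[OF reg \<pp>(1)] by blast
  then interpret C: pbw_chart K Z pb A pa \<pp> J x s w
    by (intro pbw_chart.intro poisson_order_axioms)
  \<comment> \<open>The element outside of \<open>\<pp>\<close> that kills \<open>t\<close> belongs
    to the annihilator, which is contained in \<open>\<pp>\<close>.\<close>
  show False using C.local_injectivity[OF \<phi> t zero] \<pp>(2) by (auto simp: I_def)
qed

text \<open>The natural map respects degrees and the graded ring is the direct sum of its degrees,
  so each homogeneous component of \<open>t\<close> is killed separately.\<close>

lemma natural_inj:
  assumes reg: "regular_algebra K Z" and \<phi>: "natural \<phi>" and t: "t |: T" and zero: "\<phi> t = \<zero>\<^bsub>GE\<^esub>"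
  shows "t = \<zero>\<^sub>T"
proof -
  have hom: "\<phi> \<in> ring_hom T GE" using \<phi> by (simp add: natural_iff)
  obtain S f where f: "finite S" "\<And>m. f m \<in> hom_part m" "t = (\<Oplus>\<^sub>T m\<in>S. f m)"
    using hom_decomposition[OF t] by blast
  have "\<forall>m. \<exists>y. y \<in> Fil m \<and> \<phi> (f m) = cls m y" using natural_hom_part[OF \<phi> f(2)] by blast
  then obtain y where y: "\<And>m. y m \<in> Fil m" "\<And>m. \<phi> (f m) = cls m (y m)" by metis
  have fc: "f m |: T" for m by (rule hom_part_closed[OF f(2)])
  have "\<phi> (\<Oplus>\<^sub>T m\<in>S. f m) = (\<Oplus>\<^bsub>GE\<^esub>m\<in>S. \<phi> (f m))"
    by (rule additive_finsum[OF ring_hom_additive[OF hom] Tr.is_abelian_group GEr.is_abelian_group fc])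
  then have "(\<Oplus>\<^bsub>FE.G\<^esub>m\<in>S. cls m (y m)) = \<zero>\<^bsub>FE.G\<^esub>" using zero f(3) by (simp add: y(2) GE_eq)
  then have "y m \<in> FE.prev m" if "m \<in> S" for m using FE.gr_finsum_zero[OF f(1) y(1) _ that] by blast
  then have "\<phi> (f m) = \<zero>\<^bsub>GE\<^esub>" if "m \<in> S" for m
    using FE.cls_zero_iff[OF y(1)] that by (simp add: y(2) GE_eq)
  then have "f m = \<zero>\<^sub>T" if "m \<in> S" for m using natural_inj_hom_part[OF reg \<phi> f(2)] that by blast
  then have "t = (\<Oplus>\<^sub>T m\<in>S. \<zero>\<^sub>T)" unfolding f(3) by (intro Tr.finsum_cong') auto
  then show ?thesis by (simp only: Tr.finsum_zero)
qed

lemma natural_iso: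
  assumes reg: "regular_algebra K Z" and \<phi>: "natural \<phi>" shows "\<phi> \<in> ring_iso T GE"
proof -
  have hom: "\<phi> \<in> ring_hom T GE" using \<phi> by (simp add: natural_iff)
  have "inj_on \<phi> (carrier T)"
  proof (rule inj_onI)
    fix t u assume tu: "t |: T" "u |: T" "\<phi> t = \<phi> u"
    have "\<phi> (t \<ominus>\<^sub>T u) = \<phi> t \<ominus>\<^bsub>GE\<^esub> \<phi> u" by (rule ring_hom_minus[OF hom Tr.ring_axioms GEr.ring_axioms tu(1,2)])
    also have "\<dots> = \<zero>\<^bsub>GE\<^esub>" using tu(3) ring_hom_closed[OF hom tu(2)] by (simp add: a_minus_def GEr.r_neg)
    finally have "t \<ominus>\<^sub>T u = \<zero>\<^sub>T" using tu by (intro natural_inj[OF reg \<phi>]) auto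
    then show "t = u" using tu by (simp add: Tr.minus_eq_zero_iff)
  qed
  then show ?thesis using hom natural_surj[OF \<phi>] by (simp add: ring_iso_def bij_betw_def)
qed

end

theorem mainTheorem3:
  fixes K :: "('k, 'm) ring_scheme"
    and Z :: "('k, 'z, 'c) module_scheme" and pb :: "'z \<Rightarrow> 'z \<Rightarrow> 'z"
    and A :: "('z, 'a, 'd) module_scheme" and pa :: "'z \<Rightarrow> 'a \<Rightarrow> 'a"
  assumes "poisson_order K Z pb A pa"
    and "affine_algebra K Z"
    and "regular_algebra K Z"
  shows "(\<exists>\<phi>. natural_pbw_map K Z pb A pa \<phi>) \<and>
    (\<forall>\<phi>. natural_pbw_map K Z pb A pa \<phi> \<longrightarrow>
      \<phi> \<in> ring_iso (pbw_source K Z A) (gr_env K Z pb A pa))"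
  by (intro conjI allI impI poisson_order.natural_exists[OF assms(1)])
    (rule poisson_order.natural_iso[OF assms(1,3)])

end
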